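(* Let $\omega$ be a balanced metric on a connected compact complex manifold $X$ with $\dim_{\mathbb{C}}X=n\geq 2$. The following dichotomy holds: (a) if $\omega$ is not degenerate balanced, $H^2_{DR}(X,\mathbb{C})_{\omega\text{-}prim}$ is a complex hyperplane in $H^2_{DR}(X,\mathbb{C})$ depending only on the balanced class $\{\omega_{n-1}\}_{DR}$; (b) if $\omega$ is degenerate balanced, $H^2_{DR}(X,\mathbb{C})_{\omega\text{-}prim}=H^2_{DR}(X,\mathbb{C})$.
   Context: A Hermitian metric is identified with its smooth positive definite $(1,1)$-form $\omega$; it is balanced if $d\omega^{n-1}=0$, and degenerate balanced if $\omega^{n-1}$ is $d$-exact. Notation: $\omega_p:=\omega^p/p!$. $H^2_{DR}(X,\mathbb{C})_{\omega\text{-}prim}$ is the kernel of the well-defined linear map $H^2_{DR}(X,\mathbb{C})\to H^{2n}_{DR}(X,\mathbb{C})\simeq\mathbb{C}$, $\{\alpha\}_{DR}\mapsto\{\omega_{n-1}\wedge\alpha\}_{DR}$. *)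

theory Defs
  imports
    "HOL-Analysis.Analysis"
    "HOL-Algebra.AbelCoset"
    "HOL-Algebra.Module"
    "HOL-Library.Function_Algebras"
begin

section \<open>Smooth and holomorphic maps on open sets\<close>

text \<open>\<open>Ck_on k S f\<close>: \<open>f\<close> is of class \<open>C^k\<close> (in the real sense) on the open set \<open>S\<close>.\<close>

primrec Ck_on ::
  "nat \<Rightarrow> 'v::real_normed_vector set \<Rightarrow> ('v \<Rightarrow> 'w::real_normed_vector) \<Rightarrow> bool"
where
  "Ck_on 0 S f \<longleftrightarrow> continuous_on S f"
| "Ck_on (Suc k) S f \<longleftrightarrow>
     (\<forall>x\<in>S. f differentiable (at x)) \<and>
     (\<forall>v. Ck_on k S (\<lambda>x. frechet_derivative f (at x) v))"

definition smooth_on :: "'v::real_normed_vector set \<Rightarrow> ('v \<Rightarrow> 'w::real_normed_vector) \<Rightarrow> bool"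
  where "smooth_on S f \<longleftrightarrow> (\<forall>k. Ck_on k S f)"

text \<open>Holomorphy in several variables: the real differential exists and is complex linear at
  every point of the open set \<open>S\<close>.\<close>

definition holomorphic_map_on ::
  "(complex^'n::finite \<Rightarrow> complex^'n) \<Rightarrow> (complex^'n) set \<Rightarrow> bool"
where
  "holomorphic_map_on f S \<longleftrightarrow>
     (\<forall>x\<in>S. \<exists>f'. (f has_derivative f') (at x) \<and> (\<forall>c v. f' (c *s v) = c *s f' v))"


section \<open>Complex manifolds\<close>

text \<open>A chart is a pair of its domain and its coordinate map; the values of the coordinate map
  off the domain are irrelevant.\<close>

type_synonym ('a, 'n) chart = "'a set \<times> ('a \<Rightarrow> complex^'n)"

definition chart_img :: "('a, 'n::finite) chart \<Rightarrow> (complex^'n) set"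
  where "chart_img c = snd c ` fst c"

definition overlap :: "('a, 'n::finite) chart \<Rightarrow> ('a, 'n) chart \<Rightarrow> (complex^'n) set"
  where "overlap c d = snd c ` (fst c \<inter> fst d)"

definition transition ::
  "('a, 'n::finite) chart \<Rightarrow> ('a, 'n) chart \<Rightarrow> complex^'n \<Rightarrow> complex^'n"
  where "transition c d = snd d \<circ> inv_into (fst c) (snd c)"

text \<open>\<open>X\<close> with the atlas \<open>A\<close> is a complex manifold of complex dimension \<open>CARD('n)\<close>.\<close>

definition complex_manifold :: "'a topology \<Rightarrow> ('a, 'n::finite) chart set \<Rightarrow> bool"
where
  "complex_manifold X A \<longleftrightarrow>
     Hausdorff_space X \<and> second_countable X \<and>
     (\<Union>c\<in>A. fst c) = topspace X \<and>
     (\<forall>c\<in>A. openin X (fst c) \<and> open (chart_img c) \<and>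
        homeomorphic_map (subtopology X (fst c)) (top_of_set (chart_img c)) (snd c)) \<and>
     (\<forall>c\<in>A. \<forall>d\<in>A. holomorphic_map_on (transition c d) (overlap c d))"


section \<open>Alternating forms\<close>

text \<open>A \<open>k\<close>-form on a real vector space takes its arguments as a sequence, of which only the
  entries \<open>0, \<dots>, k - 1\<close> matter. Forms are complex valued and real multilinear.\<close>

definition alternating_form :: "nat \<Rightarrow> ((nat \<Rightarrow> 'v::real_vector) \<Rightarrow> complex) \<Rightarrow> bool"
where
  "alternating_form k \<alpha> \<longleftrightarrow>
     (\<forall>v w. (\<forall>i<k. v i = w i) \<longrightarrow> \<alpha> v = \<alpha> w) \<and>
     (\<forall>v. \<forall>i<k. linear (\<lambda>x. \<alpha> (v(i := x)))) \<and>
     (\<forall>v. \<forall>i<k. \<forall>j<k. i \<noteq> j \<and> v i = v j \<longrightarrow> \<alpha> v = 0)"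

definition wedge_alt ::
  "nat \<Rightarrow> nat \<Rightarrow> ((nat \<Rightarrow> 'v) \<Rightarrow> complex) \<Rightarrow> ((nat \<Rightarrow> 'v) \<Rightarrow> complex) \<Rightarrow> (nat \<Rightarrow> 'v) \<Rightarrow> complex"
where
  "wedge_alt p q \<alpha> \<beta> v =
     (\<Sum>s | s permutes {..<p + q}.
        of_int (sign s) * \<alpha> (\<lambda>i. v (s i)) * \<beta> (\<lambda>i. v (s (p + i)))) / (fact p * fact q)"

text \<open>\<open>i \<Sum>\<^sub>j\<^sub>k h\<^sub>j\<^sub>k dz\<^sub>j \<and> d(cnj z\<^sub>k)\<close> with \<open>h\<close> a positive definite Hermitian matrix.\<close>

definition positive_definite_11 :: "((nat \<Rightarrow> complex^'n::finite) \<Rightarrow> complex) \<Rightarrow> bool"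
where
  "positive_definite_11 \<alpha> \<longleftrightarrow>
     (\<exists>h :: complex^'n^'n.
        (\<forall>j k. h $ k $ j = cnj (h $ j $ k)) \<and>
        (\<forall>\<xi>. \<xi> \<noteq> 0 \<longrightarrow> Re (\<Sum>j\<in>UNIV. \<Sum>k\<in>UNIV. h $ j $ k * \<xi> $ j * cnj (\<xi> $ k)) > 0) \<and>
        \<alpha> = (\<lambda>v. \<i> * (\<Sum>j\<in>UNIV. \<Sum>k\<in>UNIV. h $ j $ k *
               wedge_alt 1 1 (\<lambda>u. u 0 $ j) (\<lambda>u. cnj (u 0 $ k)) v)))"


section \<open>Differential forms\<close>

text \<open>A differential form is the family of its local expressions in the charts of the atlas:
  \<open>\<omega> c x v\<close> is the value at the point with coordinates \<open>x\<close> in the chart \<open>c\<close> on the tangent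
  vectors with coordinates \<open>v 0, v 1, \<dots>\<close>. The local expressions are related by pullback along
  the transition maps, and are \<open>0\<close> at coordinates that do not belong to a chart of the atlas, so
  that equality of forms is equality of functions.\<close>

type_synonym ('a, 'n) form =
  "('a, 'n) chart \<Rightarrow> complex^'n \<Rightarrow> (nat \<Rightarrow> complex^'n) \<Rightarrow> complex"

definition smooth_forms :: "('a, 'n::finite) chart set \<Rightarrow> nat \<Rightarrow> ('a, 'n) form set"
where
  "smooth_forms A k = {\<omega>.
     (\<forall>c\<in>A. \<forall>x\<in>chart_img c. alternating_form k (\<omega> c x)) \<and>
     (\<forall>c\<in>A. \<forall>v. smooth_on (chart_img c) (\<lambda>x. \<omega> c x v)) \<and>
     (\<forall>c\<in>A. \<forall>d\<in>A. \<forall>x\<in>overlap c d. \<forall>v.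
        \<omega> c x v =
        \<omega> d (transition c d x) (\<lambda>i. frechet_derivative (transition c d) (at x) (v i))) \<and>
     (\<forall>c x. \<not> (c \<in> A \<and> x \<in> chart_img c) \<longrightarrow> \<omega> c x = 0)}"

definition form_scale :: "complex \<Rightarrow> ('a, 'n::finite) form \<Rightarrow> ('a, 'n) form"
  where "form_scale a \<alpha> = (\<lambda>c x v. a * \<alpha> c x v)"

definition wedge ::
  "nat \<Rightarrow> nat \<Rightarrow> ('a, 'n::finite) form \<Rightarrow> ('a, 'n) form \<Rightarrow> ('a, 'n) form"
  where "wedge p q \<alpha> \<beta> = (\<lambda>c x. wedge_alt p q (\<alpha> c x) (\<beta> c x))"

text \<open>The exterior derivative of a \<open>k\<close>-form in coordinates,
  \<open>(d\<omega>)\<^sub>x (v\<^sub>0, \<dots>, v\<^sub>k) = \<Sum>\<^sub>i (-1)\<^sup>i D\<omega>\<^sub>x[v\<^sub>i] (v\<^sub>0, \<dots>, v\<^sub>i omitted, \<dots>, v\<^sub>k)\<close>.\<close>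

definition omit :: "nat \<Rightarrow> (nat \<Rightarrow> 'v) \<Rightarrow> nat \<Rightarrow> 'v"
  where "omit i v = (\<lambda>j. if j < i then v j else v (Suc j))"

definition ext_deriv ::
  "('a, 'n::finite) chart set \<Rightarrow> nat \<Rightarrow> ('a, 'n) form \<Rightarrow> ('a, 'n) form"
where
  "ext_deriv A k \<omega> = (\<lambda>c x v.
     if c \<in> A \<and> x \<in> chart_img c
     then \<Sum>i\<le>k. (-1) ^ i * frechet_derivative (\<lambda>y. \<omega> c y (omit i v)) (at x) (v i)
     else 0)"

definition unit_form :: "('a, 'n::finite) chart set \<Rightarrow> ('a, 'n) form"
  where "unit_form A = (\<lambda>c x v. if c \<in> A \<and> x \<in> chart_img c then 1 else 0)"
  \<comment> \<open>the constant function \<open>1\<close>, a form of degree \<open>0\<close>\<close>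

primrec form_power ::
  "('a, 'n::finite) chart set \<Rightarrow> ('a, 'n) form \<Rightarrow> nat \<Rightarrow> ('a, 'n) form"
  \<comment> \<open>powers of a form of degree \<open>2\<close>\<close>
where
  "form_power A \<omega> 0 = unit_form A"
| "form_power A \<omega> (Suc p) = wedge 2 (2 * p) \<omega> (form_power A \<omega> p)"

definition divided_power ::
  "('a, 'n::finite) chart set \<Rightarrow> ('a, 'n) form \<Rightarrow> nat \<Rightarrow> ('a, 'n) form"
  where "divided_power A \<omega> p = form_scale (1 / fact p) (form_power A \<omega> p)"


section \<open>De Rham cohomology with complex coefficients\<close>

definition closed_forms :: "('a, 'n::finite) chart set \<Rightarrow> nat \<Rightarrow> ('a, 'n) form set"
  where "closed_forms A k = {\<alpha> \<in> smooth_forms A k. ext_deriv A k \<alpha> = 0}"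

definition exact_forms :: "('a, 'n::finite) chart set \<Rightarrow> nat \<Rightarrow> ('a, 'n) form set"
  where "exact_forms A k = (case k of 0 \<Rightarrow> {0} | Suc j \<Rightarrow> ext_deriv A j ` smooth_forms A j)"

definition derham_class ::
  "('a, 'n::finite) chart set \<Rightarrow> nat \<Rightarrow> ('a, 'n) form \<Rightarrow> ('a, 'n) form set"
  where "derham_class A k \<alpha> = {\<alpha> + \<gamma> | \<gamma>. \<gamma> \<in> exact_forms A k}"

text \<open>The complex vector space \<open>H\<^sup>k\<close> of cosets of exact forms in closed forms. The
  multiplicative fields of the record play no role for modules.\<close>

definition derham ::
  "('a, 'n::finite) chart set \<Rightarrow> nat \<Rightarrow> (complex, ('a, 'n) form set) module"
where
  "derham A k = \<lparr>
     carrier = derham_class A k ` closed_forms A k,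
     mult = undefined,
     one = undefined,
     zero = derham_class A k 0,
     add = (\<lambda>C D. {\<alpha> + \<beta> | \<alpha> \<beta>. \<alpha> \<in> C \<and> \<beta> \<in> D}),
     smult = (\<lambda>a C. \<Union>\<alpha>\<in>C. derham_class A k (form_scale a \<alpha>))\<rparr>"

definition complex_scalars :: "complex ring"
  where "complex_scalars = \<lparr>carrier = UNIV, mult = (\<lambda>a b. a * b), one = 1, zero = 0, add = (+)\<rparr>"

text \<open>Linear hyperplanes, that is, subspaces of codimension one.\<close>

definition complex_hyperplane :: "'b set \<Rightarrow> (complex, 'b) module \<Rightarrow> bool"
where
  "complex_hyperplane W V \<longleftrightarrow>
     submodule W complex_scalars V \<and>
     (\<exists>u \<in> carrier V - W. \<forall>x \<in> carrier V. \<exists>w \<in> W. \<exists>a. x = w \<oplus>\<^bsub>V\<^esub> a \<odot>\<^bsub>V\<^esub> u)"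


section \<open>Balanced metrics and primitive classes\<close>

definition hermitian_metric :: "('a, 'n::finite) chart set \<Rightarrow> ('a, 'n) form \<Rightarrow> bool"
where
  "hermitian_metric A \<omega> \<longleftrightarrow>
     \<omega> \<in> smooth_forms A 2 \<and> (\<forall>c\<in>A. \<forall>x\<in>chart_img c. positive_definite_11 (\<omega> c x))"

definition balanced :: "('a, 'n::finite) chart set \<Rightarrow> ('a, 'n) form \<Rightarrow> bool"
where
  "balanced A \<omega> \<longleftrightarrow>
     hermitian_metric A \<omega> \<and>
     ext_deriv A (2 * (CARD('n) - 1)) (form_power A \<omega> (CARD('n) - 1)) = 0"

definition degenerate_balanced :: "('a, 'n::finite) chart set \<Rightarrow> ('a, 'n) form \<Rightarrow> bool"
where
  "degenerate_balanced A \<omega> \<longleftrightarrow>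
     hermitian_metric A \<omega> \<and>
     form_power A \<omega> (CARD('n) - 1) \<in> exact_forms A (2 * (CARD('n) - 1))"

definition balanced_class :: "('a, 'n::finite) chart set \<Rightarrow> ('a, 'n) form \<Rightarrow> ('a, 'n) form set"
where
  "balanced_class A \<omega> =
     derham_class A (2 * (CARD('n) - 1)) (divided_power A \<omega> (CARD('n) - 1))"

text \<open>The map \<open>H\<^sup>2 \<rightarrow> H\<^sup>2\<^sup>n\<close> induced by \<open>\<alpha> \<mapsto> \<omega>\<^sub>n\<^sub>-\<^sub>1 \<and> \<alpha>\<close>, as a union over all representatives of
  a class; for balanced \<open>\<omega>\<close> the classes in this union coincide.\<close>

definition wedge_class_map ::
  "('a, 'n::finite) chart set \<Rightarrow> ('a, 'n) form \<Rightarrow> ('a, 'n) form set \<Rightarrow> ('a, 'n) form set"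
where
  "wedge_class_map A \<omega> C =
     (\<Union>\<alpha>\<in>C. derham_class A (2 * CARD('n))
        (wedge (2 * (CARD('n) - 1)) 2 (divided_power A \<omega> (CARD('n) - 1)) \<alpha>))"

definition primitive_classes ::
  "('a, 'n::finite) chart set \<Rightarrow> ('a, 'n) form \<Rightarrow> ('a, 'n) form set set"
where
  "primitive_classes A \<omega> =
     a_kernel (derham A 2) (derham A (2 * CARD('n))) (wedge_class_map A \<omega>)"

end

(*
Let theta = omega_(n-1), a closed form of degree 2n - 2. On a connected X a form of degree 2n is
exact if and only if its integral vanishes, so the primitive classes are the kernel of the linear
functional {alpha} |-> integral of theta \<and> alpha, which depends only on the class of theta and
vanishes when theta is exact. Hence it remains to find, for theta not exact, a closed alpha of degree 2
such that the integral of theta \<and> alpha is not 0; this is the injectivity part of Poincare duality.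

Take a finite cover by coordinate cubes Q_i with a partition of unity rho_i. The numbers
a_ijk = integral of rho_i d(rho_j) \<and> d(rho_k) \<and> theta form a chain with complex coefficients. If it is
a boundary of a chain supported on the intersections of the Q_i, then the compactly supported Poincare
lemma in somewhat larger cubes makes theta exact, by descent. Otherwise, by finite-dimensional linear
algebra, some Cech cocycle c pairs nontrivially with it, and then
alpha = sum of c_ijk rho_i d(rho_j) \<and> d(rho_k) is closed and the integral of theta \<and> alpha is the sum of the
c_ijk a_ijk. The cubes need not form a good cover, as no intersection of them is required to be acyclic.
*)
theory Submission
  imports Defs "HOL-Complex_Analysis.Complex_Analysis"
begin

section \<open>Real calculus: the classes \<open>Ck_on\<close>, parameter integrals, bump functions,
  Cauchy's formula\<close>

section \<open>Calculus of smooth maps\<close>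

text \<open>The obstacle in the descent is the support of the primitives. A form supported in an
  intersection of several \<open>Q i\<close> is solved on a cell \<open>Q1 i\<close>, so its
  primitive may spread over that cell, and the boundary of a chain of primitives mixes the cells of
  all indices whose sets meet. Each of the three steps (degrees 2n, 2n - 1, 2n - 2) therefore takes
  place in a larger cell that contains the whole star of the previous one; this is the tower
  \<open>Q\<close>, \<open>Q1\<close>, \<open>Q2\<close>, \<open>Q3\<close>. The only obstruction
  arises in the first step, in top degree, where a form on a cell has a primitive supported there
  exactly when its integral vanishes; this is why the numbers a_ijk decide everything. A boundary
  can be subtracted because every nonempty open set carries a form of integral 1. The integral is
  independent of the charts because a complex linear isomorphism has positive real determinant.
  Chains are indexed by all ordered tuples, repetitions included. The assumption n >= 2 makes 2n - 2
  positive, so that the last step also falls under the Poincare lemma.\<close>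

abbreviation fd where "fd f x v \<equiv> frechet_derivative f (at x) v"

lemma Ck_on_cong:
  assumes "open S" "\<And>x. x \<in> S \<Longrightarrow> f x = g x"
  shows "Ck_on k S f \<longleftrightarrow> Ck_on k S g"
proof -
  have "Ck_on k S f \<Longrightarrow> Ck_on k S g" if "\<And>x. x \<in> S \<Longrightarrow> f x = g x" for f g :: "'a \<Rightarrow> 'b"
    using that
  proof (induction k arbitrary: f g)
    case 0
    then show ?case by (simp cong: continuous_on_cong)
  next
    case (Suc k)
    have d: "f differentiable at x" if "x \<in> S" for x using Suc.prems(1) that by simp
    have d': "(g has_derivative frechet_derivative f (at x)) (at x)" if "x \<in> S" for x
      using has_derivative_transform_within_open[OF d[OF that, unfolded frechet_derivative_works] assms(1) that]
        Suc.prems(2) by simp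
    have e: "frechet_derivative g (at x) = frechet_derivative f (at x)" if "x \<in> S" for x
      using frechet_derivative_at[OF d'[OF that]] by simp
    have "Ck_on k S (\<lambda>x. fd g x v)" for v
      by (rule Suc.IH[of "\<lambda>x. fd f x v"]) (use Suc.prems(1) e in auto)
    then show ?case using d' unfolding Ck_on.simps differentiable_def by blast
  qed
  from this[of f g] this[of g f] assms(2) show ?thesis by auto
qed

lemma Ck_on_SucI:
  assumes "open S" "\<And>x. x \<in> S \<Longrightarrow> (f has_derivative f' x) (at x)"
    "\<And>v. Ck_on k S (\<lambda>x. f' x v)"
  shows "Ck_on (Suc k) S f"
proof -
  have "Ck_on k S (\<lambda>x. fd f x v)" for v
    using Ck_on_cong[OF assms(1), of "\<lambda>x. fd f x v" "\<lambda>x. f' x v" k] assms(3)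
      frechet_derivative_at[OF assms(2)] by simp
  then show ?thesis using assms(2) unfolding Ck_on.simps differentiable_def by blast
qed

lemma Ck_on_SucD:
  assumes "Ck_on (Suc k) S f" "x \<in> S"
  shows "(f has_derivative frechet_derivative f (at x)) (at x)"
  using assms frechet_derivative_works by auto

lemma Ck_on_Suc_lower: "Ck_on (Suc k) S f \<Longrightarrow> Ck_on k S f"
proof (induction k arbitrary: f)
  case 0
  then show ?case
    using differentiable_imp_continuous_on[of f S] by (auto simp: differentiable_on_def intro: differentiable_at_withinI)
next
  case (Suc k)
  then show ?case by (metis Ck_on.simps(2))
qed

lemma Ck_on_le: "Ck_on k S f \<Longrightarrow> j \<le> k \<Longrightarrow> Ck_on j S f"
  by (induction k) (use Ck_on_Suc_lower le_Suc_eq in \<open>auto simp del: Ck_on.simps\<close>)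

lemma Ck_on_subset: "Ck_on k S f \<Longrightarrow> T \<subseteq> S \<Longrightarrow> Ck_on k T f"
  by (induction k arbitrary: f) (auto intro: continuous_on_subset)

lemma Ck_on_Un: "open S \<Longrightarrow> open T \<Longrightarrow> Ck_on k S f \<Longrightarrow> Ck_on k T f \<Longrightarrow> Ck_on k (S \<union> T) f"
  by (induction k arbitrary: f) (auto intro: continuous_on_open_Un)


lemma Ck_on_const: "Ck_on k S (\<lambda>x. c)"
  by (induction k arbitrary: c) simp_all

lemma Ck_on_bounded_linear:
  assumes "open S" "bounded_linear h" "Ck_on k S f"
  shows "Ck_on k S (\<lambda>x. h (f x))"
  using assms(3)
proof (induction k arbitrary: f)
  case 0
  then show ?case by (simp add: bounded_linear.continuous_on[OF assms(2)])
next
  case (Suc k)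
  show ?case
  proof (rule Ck_on_SucI[OF assms(1)])
    show "((\<lambda>x. h (f x)) has_derivative (\<lambda>v. h (fd f x v))) (at x)" if "x \<in> S" for x
      by (rule bounded_linear.has_derivative[OF assms(2) Ck_on_SucD[OF Suc.prems that]])
    show "Ck_on k S (\<lambda>x. h (fd f x v))" for v
      using Suc.prems by (intro Suc.IH) simp
  qed
qed

lemma Ck_on_id: "open S \<Longrightarrow> Ck_on k S (\<lambda>x. x)"
proof (induction k)
  case (Suc k)
  show ?case
    by (rule Ck_on_SucI[OF Suc.prems, of _ "\<lambda>x v. v"]) (auto intro: Ck_on_const Suc.prems)
qed simp

lemma Ck_on_add:
  assumes "open S" "Ck_on k S f" "Ck_on k S g"
  shows "Ck_on k S (\<lambda>x. f x + g x)"
  using assms(2,3)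
proof (induction k arbitrary: f g)
  case (Suc k)
  show ?case
  proof (rule Ck_on_SucI[OF assms(1)])
    show "((\<lambda>x. f x + g x) has_derivative (\<lambda>v. fd f x v + fd g x v)) (at x)" if "x \<in> S" for x
      by (rule has_derivative_add[OF Ck_on_SucD[OF Suc.prems(1) that] Ck_on_SucD[OF Suc.prems(2) that]])
    show "Ck_on k S (\<lambda>x. fd f x v + fd g x v)" for v
      using Suc.prems by (intro Suc.IH) simp_all
  qed
qed (simp add: continuous_on_add)

lemma Ck_on_sum:
  assumes "open S" "\<And>i. i \<in> I \<Longrightarrow> Ck_on k S (f i)"
  shows "Ck_on k S (\<lambda>x. \<Sum>i\<in>I. f i x)"
  using assms(2)
  by (induction I rule: infinite_finite_induct) (auto intro: Ck_on_add Ck_on_const assms(1))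

lemma Ck_on_bilinear:
  assumes "open S" "bounded_bilinear h" "Ck_on k S f" "Ck_on k S g"
  shows "Ck_on k S (\<lambda>x. h (f x) (g x))"
  using assms(3,4)
proof (induction k arbitrary: f g)
  case 0
  then show ?case by (simp add: bounded_bilinear.continuous_on[OF assms(2)])
next
  case (Suc k)
  show ?case
  proof (rule Ck_on_SucI[OF assms(1)])
    show "((\<lambda>x. h (f x) (g x)) has_derivative (\<lambda>v. h (f x) (fd g x v) + h (fd f x v) (g x))) (at x)"
      if "x \<in> S" for x
      by (rule bounded_bilinear.FDERIV[OF assms(2) Ck_on_SucD[OF Suc.prems(1) that] Ck_on_SucD[OF Suc.prems(2) that]])
    show "Ck_on k S (\<lambda>x. h (f x) (fd g x v) + h (fd f x v) (g x))" for v
      using Suc.prems Ck_on_Suc_lower[OF Suc.prems(1)] Ck_on_Suc_lower[OF Suc.prems(2)]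
      by (intro Ck_on_add[OF assms(1)] Suc.IH) simp_all
  qed
qed

lemma linear_euclidean_expansion:
  assumes "linear h"
  shows "h v = (\<Sum>b\<in>Basis. (v \<bullet> b) *\<^sub>R h b)"
proof -
  have "h v = h (\<Sum>b\<in>Basis. (v \<bullet> b) *\<^sub>R b)" by (simp add: euclidean_representation)
  then show ?thesis by (simp add: linear_sum[OF assms] linear_cmul[OF assms])
qed

text \<open>\<open>Ck_on\<close> speaks of derivatives in fixed directions, whereas the chain rule
  evaluates the derivative of \<open>f\<close> in the moving direction \<open>fd g x v\<close>.
  Expanding that direction in \<open>Basis\<close> turns it into a sum of products with fixed
  directions, to which the induction hypothesis applies.\<close>

lemma Ck_on_compose:
  fixes g :: "'u::real_normed_vector \<Rightarrow> 'v::euclidean_space" and f :: "'v \<Rightarrow> 'w::real_normed_vector"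
  assumes "open S" "Ck_on k S g" "Ck_on k T f" "\<And>x. x \<in> S \<Longrightarrow> g x \<in> T"
  shows "Ck_on k S (\<lambda>x. f (g x))"
  using assms(2,3)
proof (induction k arbitrary: f)
  case 0
  then show ?case using assms(4) by (auto intro: continuous_on_compose2)
next
  case (Suc k)
  have df: "(f has_derivative frechet_derivative f (at (g x))) (at (g x))" if "x \<in> S" for x
    by (rule Ck_on_SucD[OF Suc.prems(2) assms(4)[OF that]])
  show ?case
  proof (rule Ck_on_SucI[OF assms(1)])
    show "((\<lambda>x. f (g x)) has_derivative (\<lambda>v. \<Sum>b\<in>Basis. (fd g x v \<bullet> b) *\<^sub>R fd f (g x) b)) (at x)"
      if "x \<in> S" for x
    proof -
      have lin: "linear (frechet_derivative f (at (g x)))"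
        using df[OF that] has_derivative_linear by blast
      have "((\<lambda>x. f (g x)) has_derivative (\<lambda>v. fd f (g x) (fd g x v))) (at x)"
        by (rule has_derivative_compose[OF Ck_on_SucD[OF Suc.prems(1) that] df[OF that]])
      then show ?thesis by (subst (asm) linear_euclidean_expansion[OF lin])
    qed
    show "Ck_on k S (\<lambda>x. \<Sum>b\<in>Basis. (fd g x v \<bullet> b) *\<^sub>R fd f (g x) b)" for v
    proof (intro Ck_on_sum[OF assms(1)] Ck_on_bilinear[OF assms(1) bounded_bilinear_scaleR])
      fix b :: 'v
      show "Ck_on k S (\<lambda>x. fd g x v \<bullet> b)"
        by (rule Ck_on_bounded_linear[OF assms(1) bounded_linear_inner_left]) (use Suc.prems(1) in simp)
      show "Ck_on k S (\<lambda>x. fd f (g x) b)"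
        by (rule Suc.IH[OF Ck_on_Suc_lower[OF Suc.prems(1)]]) (use Suc.prems(2) in simp)
    qed
  qed
qed

lemma smooth_onI: "(\<And>k. Ck_on k S f) \<Longrightarrow> smooth_on S f" by (simp add: smooth_on_def)
lemma smooth_onD: "smooth_on S f \<Longrightarrow> Ck_on k S f" by (simp add: smooth_on_def)

lemma smooth_on_cong: "open S \<Longrightarrow> (\<And>x. x \<in> S \<Longrightarrow> f x = g x) \<Longrightarrow> smooth_on S f \<longleftrightarrow> smooth_on S g"
  unfolding smooth_on_def using Ck_on_cong by blast
lemma smooth_on_subset: "smooth_on S f \<Longrightarrow> T \<subseteq> S \<Longrightarrow> smooth_on T f"
  unfolding smooth_on_def using Ck_on_subset by blast
lemma smooth_on_Un: "open S \<Longrightarrow> open T \<Longrightarrow> smooth_on S f \<Longrightarrow> smooth_on T f \<Longrightarrow> smooth_on (S \<union> T) f"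
  unfolding smooth_on_def using Ck_on_Un by blast
lemma smooth_on_const: "smooth_on S (\<lambda>x. c)"
  unfolding smooth_on_def using Ck_on_const by blast
lemma smooth_on_id: "open S \<Longrightarrow> smooth_on S (\<lambda>x. x)"
  unfolding smooth_on_def using Ck_on_id by blast
lemma smooth_on_bounded_linear: "open S \<Longrightarrow> bounded_linear h \<Longrightarrow> smooth_on S f \<Longrightarrow> smooth_on S (\<lambda>x. h (f x))"
  by (rule smooth_onI, rule Ck_on_bounded_linear) (auto intro: smooth_onD)
lemma smooth_on_linear:
  fixes h :: "'v::euclidean_space \<Rightarrow> 'w::real_normed_vector"
  shows "open S \<Longrightarrow> linear h \<Longrightarrow> smooth_on S f \<Longrightarrow> smooth_on S (\<lambda>x. h (f x))"
  using smooth_on_bounded_linear linear_conv_bounded_linear by blast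
lemma smooth_on_add: "open S \<Longrightarrow> smooth_on S f \<Longrightarrow> smooth_on S g \<Longrightarrow> smooth_on S (\<lambda>x. f x + g x)"
  by (rule smooth_onI, rule Ck_on_add) (auto intro: smooth_onD)
lemma smooth_on_sum: "open S \<Longrightarrow> (\<And>i. i \<in> I \<Longrightarrow> smooth_on S (f i)) \<Longrightarrow> smooth_on S (\<lambda>x. \<Sum>i\<in>I. f i x)"
  by (rule smooth_onI, rule Ck_on_sum) (auto intro: smooth_onD)
lemma smooth_on_bilinear:
  "open S \<Longrightarrow> bounded_bilinear h \<Longrightarrow> smooth_on S f \<Longrightarrow> smooth_on S g \<Longrightarrow> smooth_on S (\<lambda>x. h (f x) (g x))"
  by (rule smooth_onI, rule Ck_on_bilinear) (auto intro: smooth_onD)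
lemma smooth_on_mult:
  fixes f g :: "'v::real_normed_vector \<Rightarrow> 'w::real_normed_algebra"
  shows "open S \<Longrightarrow> smooth_on S f \<Longrightarrow> smooth_on S g \<Longrightarrow> smooth_on S (\<lambda>x. f x * g x)"
  by (rule smooth_on_bilinear[OF _ bounded_bilinear_mult])
lemma smooth_on_prod:
  fixes f :: "'i \<Rightarrow> 'v::real_normed_vector \<Rightarrow> 'w::real_normed_field"
  assumes "open S" "\<And>i. i \<in> I \<Longrightarrow> smooth_on S (f i)"
  shows "smooth_on S (\<lambda>x. \<Prod>i\<in>I. f i x)"
  using assms(2)
  by (induction I rule: infinite_finite_induct) (auto intro: smooth_on_mult smooth_on_const assms(1))
lemma smooth_on_compose:
  fixes g :: "'u::real_normed_vector \<Rightarrow> 'v::euclidean_space" and f :: "'v \<Rightarrow> 'w::real_normed_vector"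
  shows "open S \<Longrightarrow> smooth_on S g \<Longrightarrow> smooth_on T f \<Longrightarrow> (\<And>x. x \<in> S \<Longrightarrow> g x \<in> T) \<Longrightarrow> smooth_on S (\<lambda>x. f (g x))"
  by (rule smooth_onI, rule Ck_on_compose) (auto intro: smooth_onD)
lemma smooth_on_fd: "smooth_on S f \<Longrightarrow> smooth_on S (\<lambda>x. fd f x v)"
  unfolding smooth_on_def by (metis Ck_on.simps(2))
lemma smooth_on_differentiable: "smooth_on S f \<Longrightarrow> x \<in> S \<Longrightarrow> f differentiable at x"
  unfolding smooth_on_def by (metis Ck_on.simps(2))
lemma smooth_on_has_derivative:
  "smooth_on S f \<Longrightarrow> x \<in> S \<Longrightarrow> (f has_derivative frechet_derivative f (at x)) (at x)"
  using smooth_on_differentiable frechet_derivative_works by blast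
lemma smooth_on_continuous_on: "smooth_on S f \<Longrightarrow> continuous_on S f"
  unfolding smooth_on_def by (metis Ck_on.simps(1))
lemma smooth_on_linear_fd: "smooth_on S f \<Longrightarrow> x \<in> S \<Longrightarrow> linear (frechet_derivative f (at x))"
  using smooth_on_has_derivative has_derivative_linear by blast

text \<open>A class of functions that is closed under directional derivatives consists of smooth
  functions. Parameter integrals, flat functions and holomorphic functions are all treated as such
  classes.\<close>

lemma smooth_on_coinduct:
  assumes "open S" "P f"
    and step: "\<And>f. P f \<Longrightarrow> \<exists>f'. (\<forall>x\<in>S. (f has_derivative f' x) (at x)) \<and> (\<forall>v. P (\<lambda>x. f' x v))"
  shows "smooth_on S f"
proof (rule smooth_onI)
  have "\<forall>f. P f \<longrightarrow> Ck_on k S f" for k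
  proof (induction k)
    case 0
    have "continuous_on S f" if "P f" for f
      using step[OF that] by (metis continuous_at_imp_continuous_on has_derivative_continuous)
    then show ?case by simp
  next
    case (Suc k)
    have "Ck_on (Suc k) S f" if P: "P f" for f
    proof -
      obtain f' where f': "\<forall>x\<in>S. (f has_derivative f' x) (at x)" "\<forall>v. P (\<lambda>x. f' x v)"
        using step[OF P] by auto
      show ?thesis
      proof (rule Ck_on_SucI[OF assms(1)])
        show "(f has_derivative f' x) (at x)" if "x \<in> S" for x using f'(1) that by simp
        show "Ck_on k S (\<lambda>x. f' x v)" for v using Suc f'(2) by simp
      qed
    qed
    then show ?case by simp
  qed
  then show "Ck_on k S f" for k using assms(2) by blast
qed

lemma Ck_on_inverse:
  fixes f :: "'v::real_normed_vector \<Rightarrow> 'w::real_normed_field"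
  assumes "open S" "Ck_on k S f" "\<And>x. x \<in> S \<Longrightarrow> f x \<noteq> 0"
  shows "Ck_on k S (\<lambda>x. inverse (f x))"
  using assms(2)
proof (induction k)
  case 0
  then show ?case using assms(3) by (auto intro: continuous_on_inverse)
next
  case (Suc k)
  note mult = Ck_on_bilinear[OF assms(1) bounded_bilinear_mult]
  show ?case
  proof (rule Ck_on_SucI[OF assms(1)])
    show "((\<lambda>x. inverse (f x)) has_derivative (\<lambda>v. - (inverse (f x) * fd f x v * inverse (f x)))) (at x)"
      if "x \<in> S" for x
      by (rule Deriv.has_derivative_inverse[OF assms(3)[OF that] Ck_on_SucD[OF Suc.prems that]])
    show "Ck_on k S (\<lambda>x. - (inverse (f x) * fd f x v * inverse (f x)))" for v
      using Suc.IH[OF Ck_on_Suc_lower[OF Suc.prems]] Suc.prems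
      by (intro Ck_on_bounded_linear[OF assms(1) bounded_linear_minus[OF bounded_linear_ident]] mult) simp_all
  qed
qed

lemma smooth_on_inverse:
  fixes f :: "'v::real_normed_vector \<Rightarrow> 'w::real_normed_field"
  shows "open S \<Longrightarrow> smooth_on S f \<Longrightarrow> (\<And>x. x \<in> S \<Longrightarrow> f x \<noteq> 0) \<Longrightarrow> smooth_on S (\<lambda>x. inverse (f x))"
  by (rule smooth_onI, rule Ck_on_inverse) (auto intro: smooth_onD)

lemma fd_cong:
  assumes "open S" "x \<in> S" "\<And>y. y \<in> S \<Longrightarrow> f y = g y"
  shows "frechet_derivative f (at x) = frechet_derivative g (at x)"
proof -
  have "(f has_derivative f') (at x) \<longleftrightarrow> (g has_derivative f') (at x)" for f'
    using has_derivative_transform_within_open[OF _ assms(1,2), of f f' UNIV g]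
      has_derivative_transform_within_open[OF _ assms(1,2), of g f' UNIV f] assms(3) by auto
  then show ?thesis unfolding frechet_derivative_def by simp
qed

lemma fd_eqI: "(f has_derivative f') (at x) \<Longrightarrow> fd f x v = f' v"
  using frechet_derivative_at by metis

subsection \<open>Integrals depending on a parameter\<close>

text \<open>The weight \<open>g\<close> and the path \<open>\<gamma>\<close> cover two uses:
  integrals along a segment (\<open>g = 1\<close>) and Cauchy's formula on a circle, where
  \<open>g\<close> is the kernel. Class \<open>C^1\<close> is all that is known of \<open>f\<close>
  in the second use, since smoothness is what Cauchy's formula has to yield.\<close>

lemma integral_shift_has_derivative:
  fixes f :: "'v::euclidean_space \<Rightarrow> complex" and \<gamma> :: "real \<Rightarrow> 'v"
  assumes S: "open S" and f: "Ck_on 1 S f" and g: "continuous_on {a..b} g"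
    and \<gamma>: "continuous_on {a..b} \<gamma>"
    and U: "open U" "\<And>x t. x \<in> U \<Longrightarrow> t \<in> {a..b} \<Longrightarrow> x + \<gamma> t \<in> S" and x: "x \<in> U"
  shows "((\<lambda>x. integral {a..b} (\<lambda>t. g t * f (x + \<gamma> t))) has_derivative
    (\<lambda>v. integral {a..b} (\<lambda>t. g t * fd f (x + \<gamma> t) v))) (at x)"
proof -
  obtain r where r: "r > 0" "ball x r \<subseteq> U" using U(1) x openE by blast
  have df: "(f has_derivative frechet_derivative f (at y)) (at y)" if "y \<in> S" for y
    using Ck_on_SucD[of 0 S f y] f that by simp
  have bl: "bounded_linear (frechet_derivative f (at y))" if "y \<in> S" for y
    using df[OF that] has_derivative_bounded_linear by blast
  \<comment> \<open>\<open>leibniz_rule\<close> takes a derivative that is continuous in the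
    operator norm; in finite dimension this follows from the continuity of the directional
    derivatives.\<close>
  define D where "D y = Blinfun (frechet_derivative f (at y))" for y
  have D: "blinfun_apply (D y) v = fd f y v" if "y \<in> S" for y v
    unfolding D_def using bounded_linear_Blinfun_apply[OF bl[OF that]] by simp
  have contD: "continuous_on S (\<lambda>y. D y)"
  proof (rule continuous_on_blinfun_componentwise)
    fix i :: 'v
    have "continuous_on S (\<lambda>y. fd f y i)" using f by simp
    then show "continuous_on S (\<lambda>y. blinfun_apply (D y) i)"
      using D by (simp cong: continuous_on_cong)
  qed
  have contf: "continuous_on S f" using Ck_on_le[OF f, of 0] by simp
  have inS: "y + \<gamma> t \<in> S" if "y \<in> ball x r" "t \<in> {a..b}" for y t using U(2) r(2) that by blast
  have M: "blinfun_apply (Blinfun (\<lambda>z::complex. c * z)) z = c * z" for c z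
    using bounded_linear_Blinfun_apply[OF bounded_linear_mult_right[of c]] by simp
  have contM: "continuous_on UNIV (\<lambda>c::complex. Blinfun (\<lambda>z::complex. c * z))"
    by (rule continuous_on_blinfun_componentwise) (auto simp: M intro!: continuous_intros)
  let ?F = "\<lambda>y t. Blinfun (\<lambda>z::complex. g t * z) o\<^sub>L D (y + \<gamma> t)"
  have cF: "continuous_on (ball x r \<times> cbox a b) (\<lambda>(y, t). ?F y t)"
  proof -
    have 1: "continuous_on (ball x r \<times> cbox a b) (\<lambda>p. Blinfun (\<lambda>z::complex. g (snd p) * z))"
      by (rule continuous_on_compose2[OF contM, of _ "\<lambda>p. g (snd p)"])
        (auto intro!: continuous_on_compose2[OF g] continuous_intros)
    have 2: "continuous_on (ball x r \<times> cbox a b) (\<lambda>p. D (fst p + \<gamma> (snd p)))"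
      by (rule continuous_on_compose2[OF contD])
        (auto intro!: continuous_intros continuous_on_compose2[OF \<gamma>] inS)
    show ?thesis
      using bounded_bilinear.continuous_on[OF bounded_bilinear_blinfun_compose 1 2]
      by (simp add: case_prod_unfold)
  qed
  have intb: "(\<lambda>t. ?F x t) integrable_on cbox a b"
  proof (rule integrable_continuous)
    show "continuous_on (cbox a b) (\<lambda>t. ?F x t)"
      using continuous_on_compose2[OF cF continuous_on_Pair[OF continuous_on_const[of _ x] continuous_on_id], of "cbox a b"] r(1)
      by (simp add: image_subset_iff)
  qed
  have "((\<lambda>x. integral (cbox a b) (\<lambda>t. g t * f (x + \<gamma> t))) has_derivative
      blinfun_apply (integral (cbox a b) (?F x))) (at x within ball x r)"
  proof (rule leibniz_rule[where fx = ?F])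
    fix y t assume y: "y \<in> ball x r" "t \<in> cbox a b"
    have s: "y + \<gamma> t \<in> S" using inS y by simp
    have "((\<lambda>y. f (y + \<gamma> t)) has_derivative (\<lambda>v. fd f (y + \<gamma> t) v)) (at y)"
      by (rule has_derivative_compose[of "\<lambda>y. y + \<gamma> t" "\<lambda>v. v", OF _ df[OF s], simplified])
        (auto intro!: derivative_eq_intros)
    then have "((\<lambda>y. g t * f (y + \<gamma> t)) has_derivative (\<lambda>v. g t * fd f (y + \<gamma> t) v)) (at y)"
      by (rule has_derivative_mult_right)
    moreover have "blinfun_apply (?F y t) = (\<lambda>v. g t * fd f (y + \<gamma> t) v)"
      using D[OF s] M by (auto simp: fun_eq_iff)
    ultimately show "((\<lambda>y. g t * f (y + \<gamma> t)) has_derivative blinfun_apply (?F y t)) (at y within ball x r)"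
      by (simp add: has_derivative_at_withinI)
  next
    fix y assume y: "y \<in> ball x r"
    show "(\<lambda>t. g t * f (y + \<gamma> t)) integrable_on cbox a b"
      by (rule integrable_continuous)
        (use y inS in \<open>auto intro!: continuous_intros g \<gamma> continuous_on_compose2[OF contf]\<close>)
  qed (use r cF in auto)
  moreover have "blinfun_apply (integral (cbox a b) (?F x)) v = integral (cbox a b) (\<lambda>t. g t * fd f (x + \<gamma> t) v)" for v
  proof -
    have "integral (cbox a b) (\<lambda>t. blinfun_apply (?F x t) v) = blinfun_apply (integral (cbox a b) (?F x)) v"
      using integral_linear[OF intb, of "\<lambda>B. blinfun_apply B v"] by (simp add: o_def blinfun.bounded_linear_left)
    moreover have "integral (cbox a b) (\<lambda>t. blinfun_apply (?F x t) v) = integral (cbox a b) (\<lambda>t. g t * fd f (x + \<gamma> t) v)"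
      by (rule integral_cong) (use D M inS r(1) in auto)
    ultimately show ?thesis by simp
  qed
  ultimately have "((\<lambda>x. integral {a..b} (\<lambda>t. g t * f (x + \<gamma> t))) has_derivative
    (\<lambda>v. integral {a..b} (\<lambda>t. g t * fd f (x + \<gamma> t) v))) (at x within ball x r)"
    by (metis (no_types, lifting) ext cbox_interval)
  then show ?thesis using at_within_open[of x "ball x r"] r(1) by simp
qed

text \<open>A derivative of such an integral is the same integral with a derivative of
  \<open>f\<close>, so these integrals form a class closed under differentiation.\<close>

lemma integral_shift_Ck_on:
  fixes f :: "'v::euclidean_space \<Rightarrow> complex" and \<gamma> :: "real \<Rightarrow> 'v"
  assumes S: "open S" and f: "smooth_on S f" and \<gamma>: "continuous_on {a..b} \<gamma>"
    and U: "open U" "\<And>x t. x \<in> U \<Longrightarrow> t \<in> {a..b} \<Longrightarrow> x + \<gamma> t \<in> S"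
  shows "smooth_on U (\<lambda>x. integral {a..b} (\<lambda>t. f (x + \<gamma> t)))"
proof -
  let ?P = "\<lambda>h. \<exists>f :: 'v \<Rightarrow> complex. smooth_on S f \<and> h = (\<lambda>x. integral {a..b} (\<lambda>t. f (x + \<gamma> t)))"
  show ?thesis
  proof (rule smooth_on_coinduct[OF U(1), where P = ?P])
    show "?P (\<lambda>x. integral {a..b} (\<lambda>t. f (x + \<gamma> t)))" using f by blast
  next
    fix h :: "'v \<Rightarrow> complex" assume "?P h"
    then obtain f where f: "smooth_on S f" and h: "h = (\<lambda>x. integral {a..b} (\<lambda>t. f (x + \<gamma> t)))" by blast
    let ?h' = "\<lambda>x v. integral {a..b} (\<lambda>t. fd f (x + \<gamma> t) v)"
    have "(h has_derivative ?h' x) (at x)" if "x \<in> U" for x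
    proof -
      have "((\<lambda>x. integral {a..b} (\<lambda>t. 1 * f (x + \<gamma> t))) has_derivative
        (\<lambda>v. integral {a..b} (\<lambda>t. 1 * fd f (x + \<gamma> t) v))) (at x)"
        by (rule integral_shift_has_derivative[OF S smooth_onD[OF f] continuous_on_const \<gamma> U that])
      then show ?thesis by (simp add: h)
    qed
    moreover have "?P (\<lambda>x. ?h' x v)" for v
      by (rule exI[of _ "\<lambda>x. fd f x v"]) (simp add: smooth_on_fd[OF f])
    ultimately show "\<exists>f'. (\<forall>x\<in>U. (h has_derivative f' x) (at x)) \<and> (\<forall>v. ?P (\<lambda>x. f' x v))"
      by (intro exI[of _ ?h']) simp
  qed
qed

lemma integral_shift_fd:
  fixes f :: "'v::euclidean_space \<Rightarrow> complex" and \<gamma> :: "real \<Rightarrow> 'v"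
  assumes S: "open S" and f: "smooth_on S f" and \<gamma>: "continuous_on {a..b} \<gamma>"
    and U: "open U" "\<And>x t. x \<in> U \<Longrightarrow> t \<in> {a..b} \<Longrightarrow> x + \<gamma> t \<in> S" and x: "x \<in> U"
  shows "fd (\<lambda>x. integral {a..b} (\<lambda>t. f (x + \<gamma> t))) x v = integral {a..b} (\<lambda>t. fd f (x + \<gamma> t) v)"
proof (rule fd_eqI)
  have "((\<lambda>x. integral {a..b} (\<lambda>t. 1 * f (x + \<gamma> t))) has_derivative
    (\<lambda>v. integral {a..b} (\<lambda>t. 1 * fd f (x + \<gamma> t) v))) (at x)"
    by (rule integral_shift_has_derivative[OF S smooth_onD[OF f] continuous_on_const \<gamma> U x])
  then show "((\<lambda>x. integral {a..b} (\<lambda>t. f (x + \<gamma> t))) has_derivative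
    (\<lambda>v. integral {a..b} (\<lambda>t. fd f (x + \<gamma> t) v))) (at x)" by simp
qed

lemma has_vector_derivative_line:
  assumes "(f has_derivative f') (at (x + t *\<^sub>R v))"
  shows "((\<lambda>t. f (x + t *\<^sub>R v)) has_vector_derivative f' v) (at t within T)"
proof -
  have "((\<lambda>t. x + t *\<^sub>R v) has_vector_derivative v) (at t within T)"
    by (auto intro!: derivative_eq_intros simp: has_vector_derivative_def)
  then show ?thesis
    using vector_derivative_diff_chain_within[of "\<lambda>t. x + t *\<^sub>R v" v t T f f'] assms
    by (auto simp: o_def intro: has_derivative_at_withinI)
qed

lemma integral_fd_line:
  fixes f :: "'v::euclidean_space \<Rightarrow> complex"
  assumes "\<And>t. t \<in> {a..b} \<Longrightarrow> (f has_derivative frechet_derivative f (at (x + t *\<^sub>R v))) (at (x + t *\<^sub>R v))" "a \<le> b"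
  shows "integral {a..b} (\<lambda>t. fd f (x + t *\<^sub>R v) v) = f (x + b *\<^sub>R v) - f (x + a *\<^sub>R v)"
  by (rule integral_unique, rule fundamental_theorem_of_calculus[OF assms(2)])
    (rule has_vector_derivative_line[OF assms(1)])

text \<open>Differentiate \<open>f (x + t v) - f x = \<integral>\<^sub>0\<^sup>t D\<^sub>v f (x + s v) ds\<close> in the direction \<open>u\<close> under the integral
  sign, and then in \<open>t\<close>.\<close>

lemma fd_commute:
  fixes f :: "'v::euclidean_space \<Rightarrow> complex"
  assumes "open S" "smooth_on S f" "x \<in> S"
  shows "fd (\<lambda>y. fd f y u) x v = fd (\<lambda>y. fd f y v) x u"
proof -
  obtain r where r: "r > 0" "ball x r \<subseteq> S" using assms(1,3) openE by blast
  \<comment> \<open>Steps of length at most \<open>e\<close> along \<open>v\<close> move a point by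
    at most r / 2; the summand 1 covers \<open>v = 0\<close>.\<close>
  define e where "e = r / (2 * (norm v + 1))"
  have e: "e > 0" using r(1) by (simp add: e_def add_nonneg_pos)
  have small: "y + t *\<^sub>R v \<in> S" if "y \<in> ball x (r/2)" "t \<in> {0..e}" for y t
  proof -
    have "norm (t *\<^sub>R v) \<le> e * norm v" using that(2) e by (simp add: mult_right_mono)
    also have "\<dots> \<le> e * (norm v + 1)" using e by simp
    also have "\<dots> = r / 2" unfolding e_def using norm_ge_zero[of v] by (simp add: field_simps add_nonneg_eq_0_iff)
    finally have "norm (t *\<^sub>R v) \<le> r / 2" .
    moreover have "dist x (y + t *\<^sub>R v) \<le> dist x y + norm (t *\<^sub>R v)"
      using dist_triangle[of x "y + t *\<^sub>R v" y] by (simp add: dist_norm)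
    ultimately have "y + t *\<^sub>R v \<in> ball x r" using that(1) by simp
    then show ?thesis using r(2) by blast
  qed
  have xb: "x \<in> ball x (r/2)" using r(1) by simp
  define D where "D = (\<lambda>y. fd f y v)"
  define H where "H t = fd f (x + t *\<^sub>R v) u" for t
  have sD: "smooth_on S D" unfolding D_def by (rule smooth_on_fd[OF assms(2)])
  have H: "H t = H 0 + integral {0..t} (\<lambda>s. fd D (x + s *\<^sub>R v) u)" if t: "t \<in> {0..e}" for t
  proof -
    have sm: "y + s *\<^sub>R v \<in> S" if "y \<in> ball x (r/2)" "s \<in> {0..t}" for y s
      using small that t by auto
    have sm0: "y \<in> S" if "y \<in> ball x (r/2)" for y using small[OF that, of 0] e by simp
    have "fd (\<lambda>y. integral {0..t} (\<lambda>s. D (y + s *\<^sub>R v))) x u = integral {0..t} (\<lambda>s. fd D (x + s *\<^sub>R v) u)"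
      by (rule integral_shift_fd[OF assms(1) sD _ _ sm xb]) (auto intro!: continuous_intros)
    moreover have "fd (\<lambda>y. integral {0..t} (\<lambda>s. D (y + s *\<^sub>R v))) x = fd (\<lambda>y. f (y + t *\<^sub>R v) - f y) x"
    proof (rule fd_cong[OF open_ball xb])
      fix y assume y: "y \<in> ball x (r/2)"
      show "integral {0..t} (\<lambda>s. D (y + s *\<^sub>R v)) = f (y + t *\<^sub>R v) - f y"
        using integral_fd_line[of 0 t f y v] t sm[OF y] smooth_on_has_derivative[OF assms(2)]
        by (auto simp: D_def)
    qed
    moreover have "fd (\<lambda>y. f (y + t *\<^sub>R v) - f y) x u = H t - H 0"
    proof -
      have a: "((\<lambda>y. f (y + t *\<^sub>R v)) has_derivative (\<lambda>w. fd f (x + t *\<^sub>R v) w)) (at x)"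
        by (rule has_derivative_compose[of "\<lambda>y. y + t *\<^sub>R v" "\<lambda>v. v", OF _
              smooth_on_has_derivative[OF assms(2) small[OF xb t]], simplified])
          (auto intro!: derivative_eq_intros)
      show ?thesis
        unfolding H_def by (rule fd_eqI)
          (use has_derivative_diff[OF a smooth_on_has_derivative[OF assms(2,3)]] in simp)
    qed
    ultimately show ?thesis by (simp add: algebra_simps)
  qed
  have xS: "x + t *\<^sub>R v \<in> S" if "t \<in> {0..e}" for t using small[OF xb that] .
  have c: "continuous_on {0..e} (\<lambda>s. fd D (x + s *\<^sub>R v) u)"
    by (rule continuous_on_compose2[OF smooth_on_continuous_on[OF smooth_on_fd[OF sD]]])
      (use xS in \<open>auto intro!: continuous_intros\<close>)
  \<comment> \<open>The right derivative of \<open>H\<close> at 0 is computed twice: from the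
    integral formula by the fundamental theorem, and directly as a derivative along the line.
    Uniqueness of the derivative gives the symmetry.\<close>
  have "((\<lambda>t. integral {0..t} (\<lambda>s. fd D (x + s *\<^sub>R v) u)) has_vector_derivative fd D (x + 0 *\<^sub>R v) u) (at 0 within {0..e})"
    by (rule integral_has_vector_derivative[OF c]) (use e in simp)
  then have "((\<lambda>t. H 0 + integral {0..t} (\<lambda>s. fd D (x + s *\<^sub>R v) u)) has_vector_derivative fd D x u) (at 0 within {0..e})"
    using has_vector_derivative_add[OF has_vector_derivative_const[of "H 0"]] by fastforce
  then have h1: "(H has_vector_derivative fd D x u) (at 0 within {0..e})"
    by (rule has_vector_derivative_transform[rotated 2]) (use e in \<open>auto simp: H[symmetric]\<close>)
  have h2: "(H has_vector_derivative fd (\<lambda>y. fd f y u) x v) (at 0 within {0..e})"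
    unfolding H_def
    by (rule has_vector_derivative_line)
      (use smooth_on_has_derivative[OF smooth_on_fd[OF assms(2)] assms(3)] in simp)
  show ?thesis
    using vector_derivative_unique_within[OF _ h2 h1] e unfolding D_def
    by (auto simp: trivial_limit_within)
qed


subsection \<open>Flat functions\<close>

text \<open>For \<open>p = 1\<close> this is exp (- 1 / x) extended by 0. The polynomial factor in 1
  / x makes the family closed under differentiation.\<close>

definition flat :: "real poly \<Rightarrow> real \<Rightarrow> real"
  where "flat p x = (if x > 0 then poly p (1 / x) * exp (- (1 / x)) else 0)"

lemma poly_exp_tendsto_0: "((\<lambda>u::real. poly p u * exp (- u)) \<longlongrightarrow> 0) at_top"
proof -
  have "((\<lambda>u. \<Sum>i\<le>degree p. coeff p i * (u ^ i / exp u)) \<longlongrightarrow> (\<Sum>i\<le>degree p. coeff p i * 0)) at_top"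
    by (intro tendsto_sum tendsto_mult tendsto_const tendsto_power_div_exp_0)
  moreover have "(\<Sum>i\<le>degree p. coeff p i * (u ^ i / exp u)) = poly p u * exp (- u)" for u
    by (simp add: poly_altdef sum_distrib_right exp_minus divide_inverse mult.assoc)
  ultimately show ?thesis by simp
qed

text \<open>With u = 1 / x, differentiation in x is - u^2 d/du, which sends p(u) exp (- u) to u^2
  (p(u) - p'(u)) exp (- u); the polynomial \<open>[:0, 0, 1:]\<close> is u^2.\<close>

lemma flat_has_real_derivative:
  "(flat p has_real_derivative flat ([:0, 0, 1:] * (p - pderiv p)) x) (at x)"
proof -
  consider "x > 0" | "x < 0" | "x = 0" by linarith
  then show ?thesis
  proof cases
    case 1
    have "((\<lambda>x. poly p (1 / x) * exp (- (1 / x))) has_real_derivative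
        flat ([:0, 0, 1:] * (p - pderiv p)) x) (at x)"
      using 1 by (auto intro!: derivative_eq_intros DERIV_chain2[OF poly_DERIV] simp: flat_def field_simps power2_eq_square)
    then show ?thesis
      by (rule has_field_derivative_transform_within_open[of _ _ _ "{0<..}"]) (use 1 in \<open>auto simp: flat_def\<close>)
  next
    case 2
    have "((\<lambda>x. 0) has_real_derivative flat ([:0, 0, 1:] * (p - pderiv p)) x) (at x)"
      using 2 by (auto simp: flat_def)
    then show ?thesis
      by (rule has_field_derivative_transform_within_open[of _ _ _ "{..<0}"]) (use 2 in \<open>auto simp: flat_def\<close>)
  next
    case 3
    \<comment> \<open>From the right the difference quotient at 0 is u p(u) exp (- u) with u = 1 /
      x; \<open>pCons 0 p\<close> is the product of p with u.\<close>
    have "((\<lambda>x. poly (pCons 0 p) (inverse x) * exp (- inverse x)) \<longlongrightarrow> 0) (at_right 0)"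
      by (rule filterlim_compose[OF poly_exp_tendsto_0 filterlim_inverse_at_top_right])
    then have "((\<lambda>x. (flat p x - flat p 0) / (x - 0)) \<longlongrightarrow> 0) (at_right 0)"
      by (rule Lim_transform_eventually)
        (auto simp: eventually_at_right_field flat_def field_simps intro!: exI[of _ 1])
    moreover have "((\<lambda>x. (flat p x - flat p 0) / (x - 0)) \<longlongrightarrow> 0) (at_left 0)"
      by (rule Lim_transform_eventually[OF tendsto_const])
        (auto simp: eventually_at_left_field flat_def field_simps intro!: exI[of _ "-1"])
    ultimately have "((\<lambda>x. (flat p x - flat p 0) / (x - 0)) \<longlongrightarrow> 0) (at 0)"
      using filterlim_at_split by blast
    then show ?thesis using 3 by (simp add: has_field_derivative_iff flat_def)
  qed
qed

lemma smooth_on_flat: "smooth_on UNIV (flat p)"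
proof (rule smooth_on_coinduct[where P = "\<lambda>h. \<exists>p. h = flat p"])
  fix h assume "\<exists>p. h = flat p"
  then obtain p where h: "h = flat p" ..
  let ?q = "[:0, 0, 1:] * (p - pderiv p)"
  have "(h has_derivative (\<lambda>v. flat (Polynomial.smult v ?q) x)) (at x)" for x
  proof -
    have "(\<lambda>v. flat (Polynomial.smult v ?q) x) = (*) (flat ?q x)" by (auto simp: flat_def)
    then show ?thesis using flat_has_real_derivative[of p x] by (simp add: h has_field_derivative_def)
  qed
  then show "\<exists>f'. (\<forall>x\<in>UNIV. (h has_derivative f' x) (at x)) \<and> (\<forall>v. \<exists>p. (\<lambda>x. f' x v) = flat p)"
    by (intro exI[of _ "\<lambda>x v. flat (Polynomial.smult v ?q) x"]) auto
qed auto

definition smooth_step :: "real \<Rightarrow> real"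
  where "smooth_step x = flat 1 x / (flat 1 x + flat 1 (1 - x))"

lemma smooth_on_reflect: "smooth_on UNIV f \<Longrightarrow> smooth_on UNIV (\<lambda>x. f (a + b * x))" for f :: "real \<Rightarrow> real"
proof (rule smooth_on_compose[of UNIV "\<lambda>x. a + b * x" UNIV f])
  show "smooth_on UNIV (\<lambda>x. a + b * x)"
    by (intro smooth_on_add smooth_on_mult smooth_on_const smooth_on_id) auto
qed auto

lemma smooth_on_smooth_step: "smooth_on UNIV smooth_step"
proof -
  have 1: "smooth_on UNIV (\<lambda>x. flat 1 (1 + (-1) * x))" by (rule smooth_on_reflect[OF smooth_on_flat])
  have "smooth_on UNIV (\<lambda>x. flat 1 x * inverse (flat 1 x + flat 1 (1 + (-1) * x)))"
  proof (intro smooth_on_mult smooth_on_inverse smooth_on_add smooth_on_flat 1)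
    show "flat 1 x + flat 1 (1 + (-1) * x) \<noteq> 0" for x :: real
      by (auto simp: flat_def add_pos_pos less_imp_neq[symmetric])
  qed auto
  then show ?thesis by (simp add: smooth_step_def[abs_def] divide_inverse)
qed

lemma smooth_step_eq_0: "x \<le> 0 \<Longrightarrow> smooth_step x = 0"
  and smooth_step_eq_1: "x \<ge> 1 \<Longrightarrow> smooth_step x = 1"
  by (auto simp: smooth_step_def flat_def)

definition bump1 :: "real \<Rightarrow> real \<Rightarrow> real"
  where "bump1 \<rho> s = flat 1 (\<rho> + s) * flat 1 (\<rho> - s)"

lemma smooth_on_bump1: "smooth_on UNIV (bump1 \<rho>)"
  using smooth_on_mult[OF open_UNIV smooth_on_reflect[OF smooth_on_flat[of 1], of \<rho> 1]
      smooth_on_reflect[OF smooth_on_flat[of 1], of \<rho> "-1"]]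
  by (simp add: bump1_def[abs_def])

lemma bump1_pos: "\<bar>s\<bar> < \<rho> \<Longrightarrow> bump1 \<rho> s > 0"
  and bump1_eq_0: "\<rho> \<le> \<bar>s\<bar> \<Longrightarrow> bump1 \<rho> s = 0"
  and bump1_nonneg: "bump1 \<rho> s \<ge> 0"
  by (auto simp: bump1_def flat_def)

subsection \<open>Holomorphic maps are smooth\<close>

text \<open>By Cauchy's formula on a small circle, \<open>D\<^sub>v g (y) = (1 / 2 \<pi> i) \<integral> g (y + z v) / z\<^sup>2 dz\<close>; hence
  \<open>D\<^sub>v g\<close> is again holomorphic.\<close>

definition complex_diff_on :: "(complex^'n::finite) set \<Rightarrow> (complex^'n \<Rightarrow> complex) \<Rightarrow> bool"
  where "complex_diff_on S g \<longleftrightarrow>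
    (\<forall>x\<in>S. g differentiable (at x) \<and> (\<forall>c v. fd g x (c *s v) = c * fd g x v))"

lemma complex_diff_on_cauchy:
  assumes g: "complex_diff_on S g" and "open S" and d: "d > 0"
    and inS: "\<And>z. norm z \<le> d \<Longrightarrow> y + z *s v \<in> S"
  shows "fd g y v = integral {0..1} (\<lambda>t. inverse (circlepath 0 d t) * g (y + circlepath 0 d t *s v))"
proof -
  define h where "h z = g (y + z *s v)" for z
  have dg: "(g has_derivative frechet_derivative g (at x)) (at x)" if "x \<in> S" for x
    using g that frechet_derivative_works unfolding complex_diff_on_def by blast
  \<comment> \<open>On the complex line through \<open>y\<close> in direction \<open>v\<close> the
    complex linear derivative of \<open>g\<close> becomes an ordinary complex derivative, so the
    one-variable theory applies to \<open>h\<close>.\<close>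
  have dh: "(h has_field_derivative fd g (y + z *s v) v) (at z)" if "norm z \<le> d" for z
  proof -
    have 1: "((\<lambda>z. y + z *s v) has_derivative (\<lambda>z. z *s v)) (at z)"
    proof -
      have "bounded_linear (\<lambda>z. z *s v)"
        by (rule linear_conv_bounded_linear[THEN iffD1], rule linearI)
          (simp_all add: vec_eq_iff scaleR_conv_of_real[where 'a = complex] distrib_right)
      then have "((\<lambda>z. z *s v) has_derivative (\<lambda>z. z *s v)) (at z)"
        by (rule bounded_linear_imp_has_derivative)
      then show ?thesis using has_derivative_add[OF has_derivative_const[of y]] by fastforce
    qed
    have "(h has_derivative (\<lambda>w. fd g (y + z *s v) (w *s v))) (at z)"
      unfolding h_def by (rule has_derivative_compose[OF 1 dg[OF inS[OF that]]])
    moreover have "fd g (y + z *s v) (w *s v) = fd g (y + z *s v) v * w" for w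
      using g inS[OF that] by (simp add: complex_diff_on_def)
    ultimately show ?thesis by (simp add: has_field_derivative_def mult_commute_abs)
  qed
  have c: "continuous_on (cball 0 d) h"
    by (rule continuous_at_imp_continuous_on, rule ballI, rule DERIV_isCont[OF dh]) simp
  have hol: "h holomorphic_on ball 0 d"
    unfolding holomorphic_on_def field_differentiable_def
    by (intro ballI exI, rule has_field_derivative_at_within, rule dh) simp
  have "(h has_field_derivative 1 / (2 * of_real pi * \<i>) * contour_integral (circlepath 0 d) (\<lambda>u. h u / (u - 0)\<^sup>2)) (at 0)"
    by (rule Cauchy_derivative_integral_circlepath(2)[OF c hol]) (use d in simp)
  then have "fd g y v = 1 / (2 * of_real pi * \<i>) * contour_integral (circlepath 0 d) (\<lambda>u. h u / (u - 0)\<^sup>2)"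
    using dh[of 0] d DERIV_unique by fastforce
  also have "\<dots> = integral {0..1} (\<lambda>t. 1 / (2 * of_real pi * \<i>) *
      (h (circlepath 0 d t) / (circlepath 0 d t)\<^sup>2 * vector_derivative (circlepath 0 d) (at t)))"
    by (simp only: contour_integral_integral Henstock_Kurzweil_Integration.integral_mult_right diff_0_right)
  also have "\<dots> = integral {0..1} (\<lambda>t. inverse (circlepath 0 d t) * h (circlepath 0 d t))"
  proof (rule integral_cong)
    fix t
    \<comment> \<open>On the circle dz = 2 pi i z dt, which cancels the prefactor and one of the two
      powers of z in the kernel.\<close>
    have "vector_derivative (circlepath 0 d) (at t) = 2 * of_real pi * \<i> * circlepath 0 d t"
      unfolding vector_derivative_circlepath by (simp add: circlepath)
    moreover have "circlepath 0 d t \<noteq> 0" using d by (simp add: circlepath)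
    ultimately show "1 / (2 * of_real pi * \<i>) *
      (h (circlepath 0 d t) / (circlepath 0 d t)\<^sup>2 * vector_derivative (circlepath 0 d) (at t)) =
      inverse (circlepath 0 d t) * h (circlepath 0 d t)"
      by (simp add: power2_eq_square field_simps)
  qed
  finally show ?thesis by (simp add: h_def)
qed

lemma scaleC_neighbourhood:
  fixes v :: "complex^'n::finite"
  assumes "open S" "x \<in> S"
  obtains r d where "r > 0" "d > 0" "\<And>y z. y \<in> ball x r \<Longrightarrow> norm z \<le> d \<Longrightarrow> y + z *s v \<in> S"
proof -
  have nz: "norm (z *s v) = norm z * norm v" for z
    by (simp add: norm_vec_def norm_mult L2_set_right_distrib)
  obtain r where r: "r > 0" "ball x r \<subseteq> S" using assms openE by blast
  define d where "d = r / (2 * (norm v + 1))"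
  have d: "d > 0" using r(1) by (simp add: d_def add_nonneg_pos)
  have "y + z *s v \<in> S" if "y \<in> ball x (r/2)" "norm z \<le> d" for y z
  proof -
    have "norm z * norm v \<le> d * norm v" using that(2) by (simp add: mult_right_mono)
    also have "\<dots> \<le> d * (norm v + 1)" using d by simp
    also have "\<dots> = r / 2" unfolding d_def using norm_ge_zero[of v] by (simp add: field_simps add_nonneg_eq_0_iff)
    finally have "norm (z *s v) \<le> r / 2" by (simp add: nz)
    moreover have "dist x (y + z *s v) \<le> dist x y + norm (z *s v)"
      using dist_triangle[of x "y + z *s v" y] by (simp add: dist_norm)
    ultimately have "y + z *s v \<in> ball x r" using that(1) by simp
    then show ?thesis using r(2) by blast
  qed
  then show thesis using that[of "r/2" d] r d by simp
qed

text \<open>Holomorphy as defined only asks for a derivative at each point. Cauchy's formula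
  expresses the derivative as the integral of a continuous function of \<open>y\<close> and
  \<open>t\<close>, hence it is continuous; this is the \<open>C^1\<close> condition for
  differentiating under the integral.\<close>

lemma complex_diff_on_continuous_fd:
  fixes g :: "complex^'n::finite \<Rightarrow> complex"
  assumes g: "complex_diff_on S g" and "open S"
  shows "continuous_on S (\<lambda>x. fd g x v)"
proof (rule continuous_at_imp_continuous_on, rule ballI)
  fix x assume "x \<in> S"
  then obtain r d where rd: "r > 0" "d > 0" "\<And>y z. y \<in> ball x r \<Longrightarrow> norm z \<le> d \<Longrightarrow> y + z *s v \<in> S"
    using scaleC_neighbourhood[OF assms(2)] by metis
  have cg: "continuous_on S g"
    by (rule continuous_at_imp_continuous_on)
      (use g in \<open>auto simp: complex_diff_on_def intro: differentiable_imp_continuous_within\<close>)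
  have cc: "continuous_on UNIV (\<lambda>t. circlepath 0 d t)"
    unfolding circlepath by (intro continuous_intros)
  have nz: "circlepath 0 d t \<noteq> 0" "norm (circlepath 0 d t) = d" for t
    using rd(2) by (auto simp: circlepath norm_mult)
  have "continuous_on (ball x r) (\<lambda>y. integral (cbox 0 1)
      (\<lambda>t. inverse (circlepath 0 d t) * g (y + circlepath 0 d t *s v)))"
  proof (rule integral_continuous_on_param)
    have "continuous_on (ball x r \<times> cbox 0 1) (\<lambda>p. inverse (circlepath 0 d (snd p)) * g (fst p + circlepath 0 d (snd p) *s v))"
    proof (intro continuous_on_mult continuous_on_inverse)
      show 1: "continuous_on (ball x r \<times> cbox 0 1) (\<lambda>p. circlepath 0 d (snd p))"
        by (rule continuous_on_compose2[OF cc]) (auto intro: continuous_intros)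
      show "continuous_on (ball x r \<times> cbox 0 1) (\<lambda>p. g (fst p + circlepath 0 d (snd p) *s v))"
      proof (rule continuous_on_compose2[OF cg])
        show "continuous_on (ball x r \<times> cbox 0 1) (\<lambda>p. fst p + circlepath 0 d (snd p) *s v)"
          unfolding vector_scalar_mult_def
          by (intro continuous_on_add continuous_on_fst continuous_on_id continuous_on_vec_lambda
              continuous_on_mult 1 continuous_on_const)
        show "(\<lambda>p. fst p + circlepath 0 d (snd p) *s v) ` (ball x r \<times> cbox 0 1) \<subseteq> S"
          using rd(3) nz(2) by auto
      qed
    qed (use nz in auto)
    then show "continuous_on (ball x r \<times> cbox 0 1)
      (\<lambda>(y, t). inverse (circlepath 0 d t) * g (y + circlepath 0 d t *s v))"
      by (simp add: case_prod_unfold)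
  qed
  then have "continuous_on (ball x r) (\<lambda>y. fd g y v)"
    by (rule continuous_on_eq) (simp add: complex_diff_on_cauchy[OF g assms(2) rd(2) rd(3)])
  then show "isCont (\<lambda>x. fd g x v) x"
    using rd(1) by (simp add: continuous_on_eq_continuous_at)
qed

text \<open>Cauchy's formula is differentiated under the integral sign. The result is complex linear
  in its direction because every integrand is.\<close>

lemma complex_diff_on_fd:
  fixes g :: "complex^'n::finite \<Rightarrow> complex"
  assumes g: "complex_diff_on S g" and "open S"
  shows "complex_diff_on S (\<lambda>x. fd g x v)"
  unfolding complex_diff_on_def
proof (intro ballI conjI)
  fix x assume "x \<in> S"
  then obtain r d where rd: "r > 0" "d > 0" "\<And>y z. y \<in> ball x r \<Longrightarrow> norm z \<le> d \<Longrightarrow> y + z *s v \<in> S"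
    using scaleC_neighbourhood[OF assms(2)] by metis
  have nz: "circlepath 0 d t \<noteq> 0" "norm (circlepath 0 d t) = d" for t
    using rd(2) by (auto simp: circlepath norm_mult)
  have cc: "continuous_on T (\<lambda>t. circlepath 0 d t)" for T
    unfolding circlepath by (intro continuous_intros)
  have C1: "Ck_on 1 S g"
    using complex_diff_on_continuous_fd[OF assms] g by (simp add: complex_diff_on_def)
  let ?D = "\<lambda>w. integral {0..1} (\<lambda>t. inverse (circlepath 0 d t) * fd g (x + circlepath 0 d t *s v) w)"
  have "((\<lambda>y. integral {0..1} (\<lambda>t. inverse (circlepath 0 d t) * g (y + circlepath 0 d t *s v))) has_derivative ?D) (at x)"
  proof (rule integral_shift_has_derivative[OF assms(2) C1])
    show "continuous_on {0..1} (\<lambda>t. inverse (circlepath 0 d t))"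
      by (intro continuous_on_inverse cc) (use nz in auto)
    show "continuous_on {0..1} (\<lambda>t. circlepath 0 d t *s v)"
      unfolding vector_scalar_mult_def
      by (intro continuous_on_vec_lambda continuous_on_mult cc continuous_on_const)
    show "open (ball x r)" "x \<in> ball x r" using rd(1) by auto
    show "y + circlepath 0 d t *s v \<in> S" if "y \<in> ball x r" "t \<in> {0..1}" for y t
      using rd(3)[OF that(1)] nz(2) by simp
  qed
  then have D: "((\<lambda>y. fd g y v) has_derivative ?D) (at x)"
  proof (rule has_derivative_transform_within_open[OF _ open_ball])
    show "x \<in> ball x r" using rd(1) by simp
  qed (simp add: complex_diff_on_cauchy[OF g assms(2) rd(2) rd(3)])
  then show "(\<lambda>x. fd g x v) differentiable at x" using differentiable_def by blast
  show "\<forall>c w. fd (\<lambda>x. fd g x v) x (c *s w) = c * fd (\<lambda>x. fd g x v) x w"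
  proof (intro allI)
    fix c w
    have "fd g (x + circlepath 0 d t *s v) (c *s w) = c * fd g (x + circlepath 0 d t *s v) w" for t
      using rd nz g by (simp add: complex_diff_on_def)
    then have "?D (c *s w) = integral {0..1} (\<lambda>t. c * (inverse (circlepath 0 d t) * fd g (x + circlepath 0 d t *s v) w))"
      by (simp add: mult_ac)
    also have "\<dots> = c * ?D w" by simp
    finally show "fd (\<lambda>x. fd g x v) x (c *s w) = c * fd (\<lambda>x. fd g x v) x w"
      unfolding fd_eqI[OF D] .
  qed
qed

lemma complex_diff_on_smooth:
  fixes g :: "complex^'n::finite \<Rightarrow> complex"
  assumes "complex_diff_on S g" and "open S"
  shows "smooth_on S g"
proof (rule smooth_on_coinduct[OF assms(2), where P = "complex_diff_on S"])
  fix g :: "complex^'n::finite \<Rightarrow> complex" assume g: "complex_diff_on S g"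
  show "\<exists>f'. (\<forall>x\<in>S. (g has_derivative f' x) (at x)) \<and> (\<forall>v. complex_diff_on S (\<lambda>x. f' x v))"
  proof (intro exI conjI ballI allI)
    show "(g has_derivative frechet_derivative g (at x)) (at x)" if "x \<in> S" for x
      using g that frechet_derivative_works unfolding complex_diff_on_def by blast
  qed (rule complex_diff_on_fd[OF g assms(2)])
qed (rule assms)

lemma smooth_on_vec:
  fixes f :: "'v::real_normed_vector \<Rightarrow> complex^'n::finite"
  assumes "open S" "\<And>i. smooth_on S (\<lambda>x. f x $ i)"
  shows "smooth_on S f"
proof -
  have lin: "bounded_linear (\<lambda>z. axis i (z :: complex) :: complex^'n)" for i
    by (rule linear_conv_bounded_linear[THEN iffD1], rule linearI) (auto simp: vec_eq_iff axis_def)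
  have "smooth_on S (\<lambda>x. \<Sum>i\<in>UNIV. axis i (f x $ i))"
    by (intro smooth_on_sum[OF assms(1)] smooth_on_bounded_linear[OF assms(1) lin] assms(2))
  moreover have "(\<Sum>i\<in>UNIV. axis i (f x $ i)) = f x" for x
    by (simp add: vec_eq_iff axis_def sum.delta' if_distrib cong: if_cong)
  ultimately show ?thesis by simp
qed

lemma holomorphic_map_on_smooth:
  assumes "holomorphic_map_on f S" "open S"
  shows "smooth_on S f"
proof (rule smooth_on_vec[OF assms(2)], rule complex_diff_on_smooth[OF _ assms(2)])
  fix i
  show "complex_diff_on S (\<lambda>x. f x $ i)"
    unfolding complex_diff_on_def
  proof (intro ballI conjI allI)
    fix x assume "x \<in> S"
    then obtain f' where f': "(f has_derivative f') (at x)" "\<And>c v. f' (c *s v) = c *s f' v"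
      using assms(1) unfolding holomorphic_map_on_def by metis
    have d: "((\<lambda>x. f x $ i) has_derivative (\<lambda>v. f' v $ i)) (at x)"
      by (rule bounded_linear.has_derivative[OF bounded_linear_vec_nth f'(1)])
    then show "(\<lambda>x. f x $ i) differentiable at x" using differentiable_def by blast
    show "fd (\<lambda>x. f x $ i) x (c *s v) = c * fd (\<lambda>x. f x $ i) x v" for c v
      using fd_eqI[OF d] f'(2) by simp
  qed
qed

lemma holomorphic_map_on_fd:
  assumes "holomorphic_map_on f S" "x \<in> S"
  shows "fd f x (c *s v) = c *s fd f x v"
  using assms fd_eqI unfolding holomorphic_map_on_def by metis


section \<open>Multilinear algebra of antisymmetrisation and of the wedge product\<close>

section \<open>Alternating forms\<close>

text \<open>Antisymmetrisation without a normalising factor. Both \<open>wedge_alt\<close> and the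
  exterior derivative are multiples of it, which reduces their identities to manipulations of one
  kind of sum.\<close>

definition alt_sum :: "nat \<Rightarrow> ((nat \<Rightarrow> 'v) \<Rightarrow> complex) \<Rightarrow> (nat \<Rightarrow> 'v) \<Rightarrow> complex"
  where "alt_sum N f v = (\<Sum>s | s permutes {..<N}. of_int (sign s) * f (\<lambda>i. v (s i)))"

definition mlinear :: "nat \<Rightarrow> ((nat \<Rightarrow> 'v::real_vector) \<Rightarrow> complex) \<Rightarrow> bool"
  where "mlinear k \<alpha> \<longleftrightarrow> (\<forall>v w. (\<forall>i<k. v i = w i) \<longrightarrow> \<alpha> v = \<alpha> w) \<and>
     (\<forall>v. \<forall>i<k. linear (\<lambda>x. \<alpha> (v(i := x))))"

lemma mlinearD1: "mlinear k \<alpha> \<Longrightarrow> (\<And>i. i < k \<Longrightarrow> v i = w i) \<Longrightarrow> \<alpha> v = \<alpha> w"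
  unfolding mlinear_def by blast

lemma mlinearD2: "mlinear k \<alpha> \<Longrightarrow> i < k \<Longrightarrow> linear (\<lambda>x. \<alpha> (v(i := x)))"
  unfolding mlinear_def by blast

lemma alternating_form_iff:
  "alternating_form k \<alpha> \<longleftrightarrow> mlinear k \<alpha> \<and> (\<forall>v. \<forall>i<k. \<forall>j<k. i \<noteq> j \<and> v i = v j \<longrightarrow> \<alpha> v = 0)"
  by (auto simp: alternating_form_def mlinear_def)

lemma alternating_mlinear: "alternating_form k \<alpha> \<Longrightarrow> mlinear k \<alpha>"
  by (simp add: alternating_form_iff)

lemma alternating_repeat: "alternating_form k \<alpha> \<Longrightarrow> i < k \<Longrightarrow> j < k \<Longrightarrow> i \<noteq> j \<Longrightarrow> v i = v j \<Longrightarrow> \<alpha> v = 0"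
  unfolding alternating_form_def by blast

lemma mlinear_add: "mlinear k \<alpha> \<Longrightarrow> i < k \<Longrightarrow> \<alpha> (v(i := x + y)) = \<alpha> (v(i := x)) + \<alpha> (v(i := y))"
  using linear_add[OF mlinearD2] by blast

lemma mlinear_scaleR: "mlinear k \<alpha> \<Longrightarrow> i < k \<Longrightarrow> \<alpha> (v(i := c *\<^sub>R x)) = c *\<^sub>R \<alpha> (v(i := x))"
  using linear_cmul[OF mlinearD2] by blast

lemma mlinear_sum:
  assumes "mlinear k \<alpha>" "i < k"
  shows "\<alpha> (v(i := (\<Sum>b\<in>B. c b *\<^sub>R x b))) = (\<Sum>b\<in>B. c b *\<^sub>R \<alpha> (v(i := x b)))"
  using linear_sum[OF mlinearD2[OF assms], of v "\<lambda>b. c b *\<^sub>R x b" B] by (simp add: mlinear_scaleR[OF assms])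

text \<open>Polarisation: expand the value 0 obtained by putting \<open>v i + v j\<close> in both
  places.\<close>

lemma alternating_transpose:
  assumes \<alpha>: "alternating_form k \<alpha>" and ij: "i < k" "j < k" "i \<noteq> j"
  shows "\<alpha> (\<lambda>l. v (Transposition.transpose i j l)) = - \<alpha> v"
proof -
  note m = alternating_mlinear[OF \<alpha>]
  define w where "w x y = v(i := x, j := y)" for x y
  have r: "\<alpha> (w x x) = 0" for x
    by (rule alternating_repeat[OF \<alpha> ij]) (use ij in \<open>simp add: w_def\<close>)
  have a1: "\<alpha> (w (x + x') y) = \<alpha> (w x y) + \<alpha> (w x' y)" for x x' y
    using mlinear_add[OF m ij(1), of "v(j := y)"] ij by (simp add: w_def fun_upd_twist)
  have a2: "\<alpha> (w x (y + y')) = \<alpha> (w x y) + \<alpha> (w x y')" for x y y'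
    using mlinear_add[OF m ij(2), of "v(i := x)"] by (simp add: w_def)
  have "\<alpha> (w (v i) (v j)) + \<alpha> (w (v j) (v i)) = 0"
    using r[of "v i + v j"] r[of "v i"] r[of "v j"] unfolding a1 a2 by (simp add: add.commute)
  moreover have "w (v i) (v j) = v" by (auto simp: w_def)
  moreover have "w (v j) (v i) = (\<lambda>l. v (Transposition.transpose i j l))"
    using ij by (auto simp: w_def Transposition.transpose_def)
  ultimately show ?thesis by (simp add: eq_neg_iff_add_eq_0 add.commute)
qed

lemma sign_compose_permutes:
  "p permutes {..<N::nat} \<Longrightarrow> q permutes {..<M::nat} \<Longrightarrow> sign (p \<circ> q) = sign p * sign q"
  using permutation_permutes finite_lessThan by (intro sign_compose) blast+

lemma alternating_permute:
  assumes \<alpha>: "alternating_form k \<alpha>" and s: "s permutes {..<k}"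
  shows "\<alpha> (\<lambda>i. v (s i)) = of_int (sign s) * \<alpha> v"
  using finite_lessThan s
proof (induction arbitrary: v rule: permutes_rev_induct)
  case id
  then show ?case by simp
next
  case (swap a b p)
  have A: "\<alpha> (\<lambda>i. v ((p \<circ> Transposition.transpose a b) i)) = - (of_int (sign p) * \<alpha> v)"
    using alternating_transpose[OF \<alpha>, of a b "\<lambda>i. v (p i)"] swap by simp
  have B: "sign (p \<circ> Transposition.transpose a b) = - sign p"
    using sign_compose_permutes[OF swap(4), of "Transposition.transpose a b" k] swap(1-3)
    by (simp add: permutes_swap_id sign_swap_id)
  show ?case by (simp only: A B of_int_minus mult_minus_left)
qed

lemma sum_over_permutations_card: "card {s. s permutes {..<N::nat}} = fact N"
  by (simp add: card_permutations)

lemma alt_sum_alternating: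
  assumes "alternating_form k \<alpha>"
  shows "alt_sum k \<alpha> v = fact k * \<alpha> v"
proof -
  have "of_int (sign s) * \<alpha> (\<lambda>i. v (s i)) = \<alpha> v" if "s permutes {..<k}" for s
    using alternating_permute[OF assms that, of v] by (simp add: sign_def)
  then have "alt_sum k \<alpha> v = (\<Sum>s | s permutes {..<k}. \<alpha> v)"
    unfolding alt_sum_def by (intro sum.cong) auto
  then show ?thesis by (simp add: sum_over_permutations_card)
qed

lemma alt_sum_permute_inner:
  assumes "\<kappa> permutes {..<N}"
  shows "alt_sum N (\<lambda>v. f (\<lambda>i. v (\<kappa> i))) v = of_int (sign \<kappa>) * alt_sum N f v"
proof -
  have "alt_sum N f v = (\<Sum>s | s permutes {..<N}. of_int (sign (s \<circ> \<kappa>)) * f (\<lambda>i. v ((s \<circ> \<kappa>) i)))"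
    unfolding alt_sum_def by (rule sum_permutations_compose_right[OF assms])
  also have "\<dots> = (\<Sum>s | s permutes {..<N}. of_int (sign \<kappa>) * (of_int (sign s) * f (\<lambda>i. v (s (\<kappa> i)))))"
    using assms by (intro sum.cong) (auto simp: sign_compose_permutes)
  finally show ?thesis
    unfolding alt_sum_def by (simp add: sum_distrib_left mult.assoc[symmetric]) (simp add: sign_def)
qed

lemma alt_sum_permute_outer:
  assumes "\<kappa> permutes {..<N}"
  shows "alt_sum N f (\<lambda>i. v (\<kappa> i)) = of_int (sign \<kappa>) * alt_sum N f v"
proof -
  have "alt_sum N f v = (\<Sum>s | s permutes {..<N}. of_int (sign (\<kappa> \<circ> s)) * f (\<lambda>i. v ((\<kappa> \<circ> s) i)))"
    unfolding alt_sum_def by (rule setum_permutations_compose_left[OF assms])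
  also have "\<dots> = (\<Sum>s | s permutes {..<N}. of_int (sign \<kappa>) * (of_int (sign s) * f (\<lambda>i. v (\<kappa> (s i)))))"
    using assms by (intro sum.cong) (auto simp: sign_compose_permutes)
  finally show ?thesis
    unfolding alt_sum_def by (simp add: sum_distrib_left mult.assoc[symmetric]) (simp add: sign_def)
qed

text \<open>A transposition is odd, so symmetry in two arguments makes the sum its own negative.
  This is how the symmetric second derivatives disappear in d d = 0 and in the naturality of
  d.\<close>

lemma alt_sum_symmetric_0:
  assumes "i < N" "j < N" "i \<noteq> j" "\<And>v. f (\<lambda>l. v (Transposition.transpose i j l)) = f v"
  shows "alt_sum N f v = 0"
proof -
  have t: "Transposition.transpose i j permutes {..<N}" by (rule permutes_swap_id) (use assms in auto)
  have "alt_sum N f v = - alt_sum N f v"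
    using alt_sum_permute_inner[OF t, of f v] assms(3,4) by (simp add: sign_swap_id)
  then show ?thesis by simp
qed

lemma alt_sum_cong: "(\<And>v. f v = g v) \<Longrightarrow> alt_sum N f v = alt_sum N g v"
  by (simp add: alt_sum_def)

lemma alt_sum_add: "alt_sum N (\<lambda>v. f v + g v) v = alt_sum N f v + alt_sum N g v"
  by (simp add: alt_sum_def sum.distrib algebra_simps)

lemma alt_sum_cmult: "alt_sum N (\<lambda>v. c * f v) v = c * alt_sum N f v"
  by (simp add: alt_sum_def sum_distrib_left algebra_simps)

lemma alt_sum_sum: "alt_sum N (\<lambda>v. \<Sum>i\<in>I. f i v) v = (\<Sum>i\<in>I. alt_sum N (f i) v)"
  by (simp add: alt_sum_def sum_distrib_left sum.swap[of _ I])

lemma alt_sum_mlinear: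
  assumes f: "mlinear N f"
  shows "alternating_form N (alt_sum N f)"
  unfolding alternating_form_iff mlinear_def
proof (intro conjI allI impI)
  fix v w :: "nat \<Rightarrow> 'a" assume vw: "\<forall>i<N. v i = w i"
  show "alt_sum N f v = alt_sum N f w"
    unfolding alt_sum_def
  proof (intro sum.cong refl arg_cong2[of _ _ _ _ "(*)"] mlinearD1[OF f])
    fix s i assume "s \<in> {s. s permutes {..<N}}" "i < N"
    then show "v (s i) = w (s i)" using vw permutes_in_image[of s "{..<N}" i] by simp
  qed
next
  fix v :: "nat \<Rightarrow> 'a" and i assume i: "i < N"
  have "linear (\<lambda>x. of_int (sign s) * f (\<lambda>l. (v(i := x)) (s l)))" if s: "s permutes {..<N}" for s
  proof -
    obtain j where j: "s j = i" "j < N"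
      using s i permutes_in_image[of s "{..<N}"] permutes_surj[OF s] by (metis lessThan_iff surjD)
    have "(\<lambda>l. (v(i := x)) (s l)) = (\<lambda>l. v (s l))(j := x)" for x
      using j permutes_inj[OF s] by (auto simp: inj_def)
    then show ?thesis using mlinearD2[OF f j(2), of "\<lambda>l. v (s l)"]
      by (auto simp: linear_iff algebra_simps)
  qed
  then show "linear (\<lambda>x. alt_sum N f (v(i := x)))"
    unfolding alt_sum_def by (intro linear_compose_sum) auto
next
  fix v :: "nat \<Rightarrow> 'a" and i j assume ij: "i < N" "j < N" "i \<noteq> j \<and> v i = v j"
  have t: "Transposition.transpose i j permutes {..<N}" by (rule permutes_swap_id) (use ij in auto)
  have "(\<lambda>l. v (Transposition.transpose i j l)) = v" using ij by (auto simp: Transposition.transpose_def)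
  then have "alt_sum N f v = - alt_sum N f v"
    using alt_sum_permute_outer[OF t, of f v] ij(3) by (simp add: sign_swap_id)
  then show "alt_sum N f v = 0" by simp
qed

subsection \<open>Expansion along the first argument\<close>

definition skip :: "nat \<Rightarrow> nat \<Rightarrow> nat" where "skip i j = (if j < i then j else Suc j)"

text \<open>The permutation that has value \<open>i\<close> at 0 and runs through the remaining
  values in the order prescribed by \<open>q\<close>; \<open>skip i\<close> enumerates the numbers
  other than \<open>i\<close>.\<close>

definition ins :: "nat \<Rightarrow> (nat \<Rightarrow> nat) \<Rightarrow> nat \<Rightarrow> nat"
  where "ins i q = case_nat i (\<lambda>j. skip i (q j))"

lemma omit_skip: "omit i v = (\<lambda>j. v (skip i j))"
  by (auto simp: omit_def skip_def)

lemma ins_compose: "ins i q = ins i id \<circ> ins 0 q"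
  by (auto simp: ins_def skip_def fun_eq_iff split: nat.split)

lemma permutes_ins_0:
  assumes "q permutes {..<N}"
  shows "ins 0 q permutes {..<Suc N}"
proof (rule bij_imp_permutes)
  show "bij_betw (ins 0 q) {..<Suc N} {..<Suc N}"
  proof (rule bij_betwI[of _ _ _ "ins 0 (inv_into UNIV q)"])
    have "inv_into UNIV q permutes {..<N}" by (rule permutes_inv[OF assms])
    then show "ins 0 q \<in> {..<Suc N} \<rightarrow> {..<Suc N}" "ins 0 (inv_into UNIV q) \<in> {..<Suc N} \<rightarrow> {..<Suc N}"
      using permutes_in_image[OF assms] permutes_in_image[of "inv_into UNIV q" "{..<N}"]
      by (auto simp: ins_def skip_def split: nat.splits)
  qed (auto simp: ins_def skip_def permutes_inverses[OF assms] split: nat.split)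
  show "ins 0 q x = x" if "x \<notin> {..<Suc N}" for x
    using that permutes_not_in[OF assms] by (cases x) (auto simp: ins_def skip_def)
qed

lemma sign_ins_0:
  assumes "q permutes {..<N}"
  shows "sign (ins 0 q) = sign q"
  using assms finite_lessThan
proof (induction rule: permutes_induct)
  case id
  have "ins 0 id = id" by (auto simp: ins_def skip_def fun_eq_iff split: nat.split)
  then show ?case unfolding id_def by simp
next
  case (swap a b p)
  have "ins 0 (Transposition.transpose a b \<circ> p) = Transposition.transpose (Suc a) (Suc b) \<circ> ins 0 p"
    by (auto simp: ins_def skip_def fun_eq_iff Transposition.transpose_def split: nat.split)
  moreover have "permutation p" "permutation (ins 0 p)"
    using swap permutation_permutes permutes_ins_0 by blast+
  moreover have "sign (Transposition.transpose a b \<circ> p) = - sign p"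
    using swap \<open>permutation p\<close> by (simp only: sign_compose permutation_swap_id sign_swap_id) simp
  ultimately show ?case using swap by (simp only: sign_compose permutation_swap_id sign_swap_id) simp
qed

text \<open>The cycle that brings \<open>i\<close> to the front is a product of \<open>i\<close>
  adjacent transpositions.\<close>

lemma ins_id:
  assumes "i < N"
  shows "ins i id permutes {..<N}" "sign (ins i id) = (- 1) ^ i"
proof -
  have "ins i id permutes {..<N} \<and> sign (ins i id) = (- 1) ^ i"
    using assms
  proof (induction i)
    case 0
    have "ins 0 id = id" by (auto simp: ins_def skip_def fun_eq_iff split: nat.split)
    then show ?case unfolding id_def using permutes_id[unfolded id_def] by simp
  next
    case (Suc i)
    have e: "ins (Suc i) id = Transposition.transpose i (Suc i) \<circ> ins i id"
      by (auto simp: ins_def skip_def fun_eq_iff Transposition.transpose_def split: nat.split)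
    have t: "Transposition.transpose i (Suc i) permutes {..<N}" by (rule permutes_swap_id) (use Suc in auto)
    have IH: "ins i id permutes {..<N}" "sign (ins i id) = (- 1) ^ i"
      by (rule Suc.IH[THEN conjunct1], use Suc.prems in simp, rule Suc.IH[THEN conjunct2], use Suc.prems in simp)
    have "permutation (ins i id)" using IH(1) permutation_permutes by blast
    then show ?case
      unfolding e using permutes_compose[OF IH(1) t] IH(2)
      by (simp only: sign_compose permutation_swap_id sign_swap_id) simp
  qed
  then show "ins i id permutes {..<N}" "sign (ins i id) = (- 1) ^ i" by auto
qed

lemma sign_ins:
  assumes "q permutes {..<N}" "i \<le> N"
  shows "ins i q permutes {..<Suc N}" "sign (ins i q) = (- 1) ^ i * sign q"
proof -
  note a = permutes_ins_0[OF assms(1)] and b = ins_id[of i "Suc N"]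
  show "ins i q permutes {..<Suc N}"
    unfolding ins_compose[of i q] using permutes_compose[OF a] b assms(2) by simp
  have "permutation (ins 0 q)" "permutation (ins i id)"
    using a b(1) assms(2) permutation_permutes by (blast, metis finite_lessThan le_imp_less_Suc)
  then show "sign (ins i q) = (- 1) ^ i * sign q"
    unfolding ins_compose[of i q] using b(2) assms(2) sign_ins_0[OF assms(1)] by (simp add: sign_compose)
qed

text \<open>A permutation of N + 1 elements is recovered from its value at 0 and the order of the
  others, which gives injectivity; surjectivity follows by counting, since (N + 1) N! = (N +
  1)!.\<close>

lemma bij_betw_ins:
  "bij_betw (\<lambda>(i, q). ins i q) ({..N} \<times> {q. q permutes {..<N}}) {s. s permutes {..<Suc N}}"
proof -
  let ?A = "{..N} \<times> {q. q permutes {..<N}}"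
  have inj: "inj_on (\<lambda>(i, q). ins i q) ?A"
  proof (rule inj_onI, clarsimp)
    fix i q j r assume e: "ins i q = ins j r"
    have "i = j" using fun_cong[OF e, of 0] by (simp add: ins_def)
    moreover have "q l = r l" for l
      using fun_cong[OF e, of "Suc l"] \<open>i = j\<close> by (auto simp: ins_def skip_def split: if_splits)
    ultimately show "i = j \<and> q = r" by auto
  qed
  have sub: "(\<lambda>(i, q). ins i q) ` ?A \<subseteq> {s. s permutes {..<Suc N}}"
    using sign_ins(1) by auto
  have "card ((\<lambda>(i, q). ins i q) ` ?A) = card {s. s permutes {..<Suc N}}"
    unfolding card_image[OF inj] card_cartesian_product sum_over_permutations_card by simp
  then have "(\<lambda>(i, q). ins i q) ` ?A = {s. s permutes {..<Suc N}}"
    using card_subset_eq[OF finite_permutations sub] by simp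
  then show ?thesis using inj by (simp add: bij_betw_def)
qed

text \<open>Laplace expansion: the permutations are sorted by their value \<open>i\<close> at 0. It
  links the formula for d, a sum over the omitted argument, with the sum over all
  permutations.\<close>

lemma alt_sum_Suc:
  "alt_sum (Suc N) f v = (\<Sum>i\<le>N. (- 1) ^ i * alt_sum N (\<lambda>w. f (case_nat (v i) w)) (omit i v))"
proof -
  have "alt_sum (Suc N) f v = (\<Sum>(i, q)\<in>{..N} \<times> {q. q permutes {..<N}}.
      of_int (sign (ins i q)) * f (\<lambda>l. v (ins i q l)))"
    unfolding alt_sum_def
    by (subst sum.reindex_bij_betw[OF bij_betw_ins, symmetric]) (simp add: case_prod_unfold)
  also have "\<dots> = (\<Sum>(i, q)\<in>{..N} \<times> {q. q permutes {..<N}}.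
      (- 1) ^ i * (of_int (sign q) * f (case_nat (v i) (\<lambda>l. omit i v (q l)))))"
  proof (rule sum.cong[OF refl], clarify)
    fix i q assume iq: "i \<le> N" "q permutes {..<N}"
    have "(\<lambda>l. v (ins i q l)) = case_nat (v i) (\<lambda>l. omit i v (q l))"
      by (auto simp: ins_def omit_skip fun_eq_iff split: nat.split)
    then show "of_int (sign (ins i q)) * f (\<lambda>l. v (ins i q l)) =
        (- 1) ^ i * (of_int (sign q) * f (case_nat (v i) (\<lambda>l. omit i v (q l))))"
      using sign_ins(2)[OF iq(2,1)] by simp
  qed
  also have "\<dots> = (\<Sum>i\<le>N. (- 1) ^ i * alt_sum N (\<lambda>w. f (case_nat (v i) w)) (omit i v))"
    unfolding alt_sum_def by (simp add: sum.cartesian_product[symmetric] sum_distrib_left)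
  finally show ?thesis .
qed

text \<open>Moving the argument in position \<open>i\<close> to the front is the cycle \<open>ins i id\<close>, of sign \<open>(-1)\<^sup>i\<close>.\<close>

lemma alt_sum_front:
  assumes "i < N" "\<And>v. g v = f (case_nat (v i) (omit i v))"
  shows "alt_sum N g v = (- 1) ^ i * alt_sum N f v"
proof -
  have "(\<lambda>l. v (ins i id l)) = case_nat (v i) (omit i v)" for v :: "nat \<Rightarrow> 'a"
    by (auto simp: ins_def omit_skip fun_eq_iff split: nat.split)
  then have "alt_sum N g v = alt_sum N (\<lambda>v. f (\<lambda>l. v (ins i id l))) v"
    using assms(2) by (intro alt_sum_cong) simp
  also have "\<dots> = of_int (sign (ins i id)) * alt_sum N f v"
    by (rule alt_sum_permute_inner[OF ins_id(1)[OF assms(1)]])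
  finally show ?thesis using ins_id(2)[OF assms(1)] by simp
qed

subsection \<open>The wedge product\<close>

lemma wedge_alt_alt_sum:
  "wedge_alt p q \<alpha> \<beta> v = alt_sum (p + q) (\<lambda>v. \<alpha> v * \<beta> (\<lambda>i. v (p + i))) v / (fact p * fact q)"
  by (simp add: wedge_alt_def alt_sum_def mult.assoc)

lemma mlinear_tensor:
  assumes "mlinear p \<alpha>" "mlinear q \<beta>"
  shows "mlinear (p + q) (\<lambda>v. \<alpha> v * \<beta> (\<lambda>i. v (p + i)))"
  unfolding mlinear_def
proof (intro conjI allI impI)
  fix v w :: "nat \<Rightarrow> 'a" assume "\<forall>i<p + q. v i = w i"
  then show "\<alpha> v * \<beta> (\<lambda>i. v (p + i)) = \<alpha> w * \<beta> (\<lambda>i. w (p + i))"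
    using mlinearD1[OF assms(1), of v w] mlinearD1[OF assms(2), of "\<lambda>i. v (p + i)" "\<lambda>i. w (p + i)"] by simp
next
  fix v :: "nat \<Rightarrow> 'a" and i assume i: "i < p + q"
  show "linear (\<lambda>x. \<alpha> (v(i := x)) * \<beta> (\<lambda>j. (v(i := x)) (p + j)))"
  proof (cases "i < p")
    case True
    have "(\<lambda>j. (v(i := x)) (p + j)) = (\<lambda>j. v (p + j))" for x using True by auto
    then show ?thesis using mlinearD2[OF assms(1) True, of v] by (auto simp: linear_iff algebra_simps)
  next
    case False
    have 1: "(\<lambda>j. (v(i := x)) (p + j)) = (\<lambda>j. v (p + j))(i - p := x)" for x
      using False by (auto simp: fun_eq_iff)
    have 2: "\<alpha> (v(i := x)) = \<alpha> v" for x using False by (intro mlinearD1[OF assms(1)]) auto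
    have l: "linear (\<lambda>x. \<beta> ((\<lambda>j. v (p + j))(i - p := x)))" using i False by (intro mlinearD2[OF assms(2)]) simp
    show ?thesis
      unfolding 1 2 using linear_compose[OF l bounded_linear.linear[OF bounded_linear_mult_right]] by (simp only: o_def)
  qed
qed

lemma alternating_cmult:
  assumes "alternating_form k f"
  shows "alternating_form k (\<lambda>v. c * f v)"
  unfolding alternating_form_iff mlinear_def
proof (intro conjI allI impI)
  note m = alternating_mlinear[OF assms]
  show "c * f v = c * f w" if "\<forall>i<k. v i = w i" for v w using mlinearD1[OF m, of v w] that by simp
  show "linear (\<lambda>x. c * f (v(i := x)))" if "i < k" for v i
    using linear_compose[OF mlinearD2[OF m that] bounded_linear.linear[OF bounded_linear_mult_right]] by (simp add: o_def)
  show "c * f v = 0" if "i < k" "j < k" "i \<noteq> j \<and> v i = v j" for v i j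
    using alternating_repeat[OF assms, of i j v] that by simp
qed

lemma alternating_add:
  assumes "alternating_form k f" "alternating_form k g"
  shows "alternating_form k (\<lambda>v. f v + g v)"
  unfolding alternating_form_iff mlinear_def
proof (intro conjI allI impI)
  note m = assms[THEN alternating_mlinear]
  show "f v + g v = f w + g w" if "\<forall>i<k. v i = w i" for v w
    using mlinearD1[OF m(1), of v w] mlinearD1[OF m(2), of v w] that by simp
  show "linear (\<lambda>x. f (v(i := x)) + g (v(i := x)))" if "i < k" for v i
    by (rule linear_compose_add[OF mlinearD2[OF m(1) that] mlinearD2[OF m(2) that]])
  show "f v + g v = 0" if "i < k" "j < k" "i \<noteq> j \<and> v i = v j" for v i j
    using alternating_repeat[OF assms(1), of i j v] alternating_repeat[OF assms(2), of i j v] that by simp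
qed

lemma alternating_0: "alternating_form k (\<lambda>v. 0)"
  unfolding alternating_form_def by (simp add: linear_iff)

lemma wedge_alt_alternating:
  assumes "alternating_form p \<alpha>" "alternating_form q \<beta>"
  shows "alternating_form (p + q) (wedge_alt p q \<alpha> \<beta>)"
  using alternating_cmult[OF alt_sum_mlinear[OF mlinear_tensor[OF assms[THEN alternating_mlinear]]],
      of "1 / (fact p * fact q)"]
  by (simp add: wedge_alt_alt_sum[abs_def])

lemma wedge_alt_0:
  assumes "alternating_form p \<alpha>" "alternating_form 0 \<beta>"
  shows "wedge_alt p 0 \<alpha> \<beta> v = \<alpha> v * \<beta> v"
proof -
  have "\<beta> (\<lambda>i. w (p + i)) = \<beta> v" for w by (rule mlinearD1[OF alternating_mlinear[OF assms(2)]]) simp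
  then have "alt_sum (p + 0) (\<lambda>v. \<alpha> v * \<beta> (\<lambda>i. v (p + i))) v = alt_sum p (\<lambda>w. \<beta> v * \<alpha> w) v"
    by (simp add: mult.commute)
  also have "\<dots> = \<beta> v * (fact p * \<alpha> v)" by (simp add: alt_sum_cmult alt_sum_alternating[OF assms(1)])
  finally show ?thesis by (simp add: wedge_alt_alt_sum)
qed

lemma alternating_eq_0:
  assumes \<alpha>: "alternating_form k \<alpha>" and B: "finite B" "\<And>i. i < k \<Longrightarrow> v i \<in> span B"
    and z: "\<And>w. (\<And>i. i < k \<Longrightarrow> w i \<in> B) \<Longrightarrow> inj_on w {..<k} \<Longrightarrow> \<alpha> w = 0"
  shows "\<alpha> v = 0"
proof -
  note m = alternating_mlinear[OF \<alpha>]
  \<comment> \<open>Induction on \<open>j\<close>: the arguments from position \<open>j\<close> on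
    already lie in \<open>B\<close>. The step expands argument \<open>j\<close>; at
    \<open>j = 0\<close> a tuple with a repetition vanishes because the form alternates.\<close>
  have "\<alpha> w = 0" if "\<And>i. i < k \<Longrightarrow> w i \<in> span B" "\<And>i. j \<le> i \<Longrightarrow> i < k \<Longrightarrow> w i \<in> B" "j \<le> k" for w j
    using that
  proof (induction j arbitrary: w)
    case 0
    show ?case
    proof (cases "inj_on w {..<k}")
      case True
      then show ?thesis using z 0 by simp
    next
      case False
      then show ?thesis using alternating_repeat[OF \<alpha>, of _ _ w] by (auto simp: inj_on_def)
    qed
  next
    case (Suc j)
    have "w j \<in> span B" using Suc.prems(1,3) by simp
    then obtain c where c: "w j = (\<Sum>b\<in>B. c b *\<^sub>R b)" unfolding span_finite[OF B(1)] by auto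
    have "\<alpha> w = \<alpha> (w(j := (\<Sum>b\<in>B. c b *\<^sub>R b)))" by (simp add: c[symmetric])
    also have "\<dots> = (\<Sum>b\<in>B. c b *\<^sub>R \<alpha> (w(j := b)))" by (rule mlinear_sum[OF m]) (use Suc.prems(3) in simp)
    also have "\<dots> = 0"
    proof (intro sum.neutral ballI)
      fix b assume b: "b \<in> B"
      have "\<alpha> (w(j := b)) = 0"
        using Suc.prems b span_base[OF b] by (intro Suc.IH) (auto simp: le_Suc_eq Suc_le_eq)
      then show "c b *\<^sub>R \<alpha> (w(j := b)) = 0" by simp
    qed
    finally show ?case .
  qed
  from this[of v k] show ?thesis using B(2) by simp
qed

lemma alternating_linear_compose:
  assumes "alternating_form k \<alpha>" "linear L"
  shows "alternating_form k (\<lambda>v. \<alpha> (\<lambda>i. L (v i)))"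
  unfolding alternating_form_iff mlinear_def
proof (intro conjI allI impI)
  note m = alternating_mlinear[OF assms(1)]
  fix v w :: "nat \<Rightarrow> 'b" assume "\<forall>i<k. v i = w i"
  then show "\<alpha> (\<lambda>i. L (v i)) = \<alpha> (\<lambda>i. L (w i))" by (intro mlinearD1[OF m]) simp
next
  note m = alternating_mlinear[OF assms(1)]
  fix v :: "nat \<Rightarrow> 'b" and i assume i: "i < k"
  have "(\<lambda>j. L ((v(i := x)) j)) = (\<lambda>j. L (v j))(i := L x)" for x by auto
  then show "linear (\<lambda>x. \<alpha> (\<lambda>j. L ((v(i := x)) j)))"
    using linear_compose[OF assms(2) mlinearD2[OF m i]] by (simp add: o_def)
next
  fix v :: "nat \<Rightarrow> 'b" and i j assume "i < k" "j < k" "i \<noteq> j \<and> v i = v j"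
  then show "\<alpha> (\<lambda>i. L (v i)) = 0" by (intro alternating_repeat[OF assms(1), of i j]) auto
qed


section \<open>Exterior derivative, pullback and Leibniz rule in coordinates\<close>

section \<open>Differential forms on open sets\<close>

definition local_form :: "'v::real_normed_vector set \<Rightarrow> nat \<Rightarrow> ('v \<Rightarrow> (nat \<Rightarrow> 'v) \<Rightarrow> complex) \<Rightarrow> bool"
  where "local_form S k w \<longleftrightarrow> (\<forall>x\<in>S. alternating_form k (w x)) \<and> (\<forall>v. smooth_on S (\<lambda>x. w x v))"

definition ld :: "nat \<Rightarrow> ('v::real_normed_vector \<Rightarrow> (nat \<Rightarrow> 'v) \<Rightarrow> complex) \<Rightarrow> 'v \<Rightarrow> (nat \<Rightarrow> 'v) \<Rightarrow> complex"
  where "ld k w x v = (\<Sum>i\<le>k. (- 1) ^ i * fd (\<lambda>y. w y (omit i v)) x (v i))"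

lemma local_formD1: "local_form S k w \<Longrightarrow> x \<in> S \<Longrightarrow> alternating_form k (w x)"
  by (simp add: local_form_def)
lemma local_formD2: "local_form S k w \<Longrightarrow> smooth_on S (\<lambda>x. w x v)"
  by (simp add: local_form_def)
lemma local_formD3:
  "local_form S k w \<Longrightarrow> x \<in> S \<Longrightarrow> ((\<lambda>x. w x v) has_derivative frechet_derivative (\<lambda>x. w x v) (at x)) (at x)"
  by (rule smooth_on_has_derivative[OF local_formD2])
lemma local_form_subset: "local_form S k w \<Longrightarrow> T \<subseteq> S \<Longrightarrow> local_form T k w"
  unfolding local_form_def using smooth_on_subset by blast

lemma local_form_cong:
  assumes "open S" "\<And>x. x \<in> S \<Longrightarrow> w x = w' x"
  shows "local_form S k w \<longleftrightarrow> local_form S k w'"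
proof -
  have "smooth_on S (\<lambda>x. w x v) \<longleftrightarrow> smooth_on S (\<lambda>x. w' x v)" for v
    by (rule smooth_on_cong[OF assms(1)]) (simp add: assms(2))
  then show ?thesis unfolding local_form_def using assms(2) by simp
qed

lemma local_form_Un:
  "open S \<Longrightarrow> open T \<Longrightarrow> local_form S k w \<Longrightarrow> local_form T k w \<Longrightarrow> local_form (S \<union> T) k w"
  unfolding local_form_def using smooth_on_Un by blast

lemma local_form_0: "local_form S k (\<lambda>x v. 0)"
  by (simp add: local_form_def alternating_0 smooth_on_const)

lemma local_form_add: "open S \<Longrightarrow> local_form S k w \<Longrightarrow> local_form S k w' \<Longrightarrow> local_form S k (\<lambda>x v. w x v + w' x v)"
  by (simp add: local_form_def alternating_add smooth_on_add)

lemma local_form_fmult: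
  "open S \<Longrightarrow> smooth_on S f \<Longrightarrow> local_form S k w \<Longrightarrow> local_form S k (\<lambda>x v. f x * w x v)"
  by (simp add: local_form_def alternating_cmult smooth_on_mult)

lemma local_form_cmult: "open S \<Longrightarrow> local_form S k w \<Longrightarrow> local_form S k (\<lambda>x v. c * w x v)"
  by (rule local_form_fmult[OF _ smooth_on_const])

text \<open>The multilinear and alternating identities of \<open>w\<close> hold at all points of an
  open set and may therefore be differentiated there.\<close>

lemma alternating_fd:
  assumes w: "local_form S k w" and S: "open S" "x \<in> S"
  shows "alternating_form k (\<lambda>v. fd (\<lambda>y. w y v) x u)"
  unfolding alternating_form_iff mlinear_def
proof (intro conjI allI impI)
  note m = alternating_mlinear[OF local_formD1[OF w]]
  show "fd (\<lambda>y. w y v) x u = fd (\<lambda>y. w y v') x u" if "\<forall>i<k. v i = v' i" for v v'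
    using fd_cong[OF S, of "\<lambda>y. w y v" "\<lambda>y. w y v'"] mlinearD1[OF m, of _ v v'] that by simp
  show "fd (\<lambda>y. w y v) x u = 0" if "i < k" "j < k" "i \<noteq> j \<and> v i = v j" for v i j
    using fd_cong[OF S, of "\<lambda>y. w y v" "\<lambda>y. 0"] alternating_repeat[OF local_formD1[OF w], of _ i j v] that by simp
  show "linear (\<lambda>z. fd (\<lambda>y. w y (v(i := z))) x u)" if i: "i < k" for v i
  proof (rule linearI)
    fix a b :: 'a and c :: real
    have e1: "frechet_derivative (\<lambda>y. w y (v(i := a + b))) (at x) =
        frechet_derivative (\<lambda>y. w y (v(i := a)) + w y (v(i := b))) (at x)"
      by (rule fd_cong[OF S]) (rule mlinear_add[OF m i])
    show "fd (\<lambda>y. w y (v(i := a + b))) x u = fd (\<lambda>y. w y (v(i := a))) x u + fd (\<lambda>y. w y (v(i := b))) x u"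
      unfolding e1 by (rule fd_eqI[OF has_derivative_add[OF local_formD3[OF w S(2)] local_formD3[OF w S(2)]]])
    have e2: "frechet_derivative (\<lambda>y. w y (v(i := c *\<^sub>R a))) (at x) =
        frechet_derivative (\<lambda>y. c *\<^sub>R w y (v(i := a))) (at x)"
      by (rule fd_cong[OF S]) (rule mlinear_scaleR[OF m i])
    show "fd (\<lambda>y. w y (v(i := c *\<^sub>R a))) x u = c *\<^sub>R fd (\<lambda>y. w y (v(i := a))) x u"
      unfolding e2 by (rule fd_eqI[OF has_derivative_scaleR_right[OF local_formD3[OF w S(2)]]])
  qed
qed

abbreviation (input) tail :: "(nat \<Rightarrow> 'v) \<Rightarrow> nat \<Rightarrow> 'v" where "tail v \<equiv> (\<lambda>i. v (Suc i))"

lemma mlinear_fd: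
  assumes w: "local_form S k w" and S: "open S" "x \<in> S"
  shows "mlinear (Suc k) (\<lambda>v. fd (\<lambda>y. w y (tail v)) x (v 0))"
  unfolding mlinear_def
proof (intro conjI allI impI)
  note m = alternating_mlinear[OF alternating_fd[OF assms]]
  show "fd (\<lambda>y. w y (tail v)) x (v 0) = fd (\<lambda>y. w y (tail v')) x (v' 0)" if "\<forall>i<Suc k. v i = v' i" for v v'
    using mlinearD1[OF m, of "tail v" "tail v'"] that by auto
  show "linear (\<lambda>z. fd (\<lambda>y. w y (tail (v(i := z)))) x ((v(i := z)) 0))" if i: "i < Suc k" for v i
  proof (cases i)
    case 0
    then show ?thesis using has_derivative_linear[OF local_formD3[OF w S(2)]] by (simp add: fun_upd_def)
  next
    case (Suc j)
    have "tail (v(i := z)) = (tail v)(j := z)" for z using Suc by auto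
    then show ?thesis using mlinearD2[OF m, of j] i Suc by simp
  qed
qed

lemma tail_case_nat: "tail (case_nat a v) = v" "case_nat a v 0 = a" "case_nat (v 0) (tail v) = v"
  by (auto simp: fun_eq_iff split: nat.split)

text \<open>The derivative of \<open>w\<close> already alternates in its last \<open>k\<close>
  arguments, so antisymmetrising over all \<open>k + 1\<close> repeats each term of
  \<open>ld\<close> k! times.\<close>

lemma ld_alt_sum:
  assumes w: "local_form S k w" and S: "open S" "x \<in> S"
  shows "ld k w x v = alt_sum (Suc k) (\<lambda>v. fd (\<lambda>y. w y (tail v)) x (v 0)) v / fact k"
  by (simp add: alt_sum_Suc tail_case_nat alt_sum_alternating[OF alternating_fd[OF assms]] ld_def
      sum_divide_distrib)

lemma local_form_ld:
  assumes w: "local_form S k w" and S: "open S"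
  shows "local_form S (Suc k) (ld k w)"
  unfolding local_form_def
proof (intro conjI ballI allI)
  fix x assume x: "x \<in> S"
  have "alternating_form (Suc k) (\<lambda>v. (1 / fact k) * alt_sum (Suc k) (\<lambda>v. fd (\<lambda>y. w y (tail v)) x (v 0)) v)"
    by (rule alternating_cmult[OF alt_sum_mlinear[OF mlinear_fd[OF w S x]]])
  then show "alternating_form (Suc k) (ld k w x)"
    by (simp add: ld_alt_sum[OF w S x, abs_def])
next
  fix v show "smooth_on S (\<lambda>x. ld k w x v)"
    unfolding ld_def
    by (intro smooth_on_sum[OF S] smooth_on_mult[OF S] smooth_on_const smooth_on_fd local_formD2[OF w])
qed

lemma ld_cong:
  assumes "open S" "x \<in> S" "\<And>y. y \<in> S \<Longrightarrow> w y = w' y"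
  shows "ld k w x v = ld k w' x v"
proof -
  have "frechet_derivative (\<lambda>y. w y u) (at x) = frechet_derivative (\<lambda>y. w' y u) (at x)" for u
    by (rule fd_cong[OF assms(1,2)]) (simp add: assms(3))
  then show ?thesis by (simp add: ld_def)
qed

lemma ld_zero [simp]: "ld k (\<lambda>x v. 0) x v = 0"
  by (simp add: ld_def)

lemma ld_add:
  assumes "local_form S k w" "local_form S k w'" "x \<in> S"
  shows "ld k (\<lambda>x v. w x v + w' x v) x v = ld k w x v + ld k w' x v"
  unfolding ld_def sum.distrib[symmetric]
  by (intro sum.cong refl)
    (simp add: fd_eqI[OF has_derivative_add[OF local_formD3[OF assms(1,3)] local_formD3[OF assms(2,3)]]] distrib_left)

lemma ld_fmult:
  assumes "smooth_on S f" "local_form S k w" "x \<in> S"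
  shows "ld k (\<lambda>x v. f x * w x v) x v = (\<Sum>i\<le>k. (- 1) ^ i * (fd f x (v i) * w x (omit i v))) + f x * ld k w x v"
  unfolding ld_def sum_distrib_left sum.distrib[symmetric]
  by (intro sum.cong refl)
    (simp add: fd_eqI[OF has_derivative_mult[OF smooth_on_has_derivative[OF assms(1,3)] local_formD3[OF assms(2,3)]]] algebra_simps)

lemma ld_cmult:
  assumes "local_form S k w" "x \<in> S"
  shows "ld k (\<lambda>x v. c * w x v) x v = c * ld k w x v"
  using ld_fmult[OF smooth_on_const assms, of c] by simp

text \<open>Each term of d d is the antisymmetrisation of a second derivative, which by
  \<open>fd_commute\<close> is symmetric in its two directions; these are the arguments 0 and
  \<open>Suc i\<close>.\<close>

lemma ld_ld:
  fixes w :: "'v::euclidean_space \<Rightarrow> (nat \<Rightarrow> 'v) \<Rightarrow> complex"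
  assumes w: "local_form S k w" and S: "open S" "x \<in> S"
  shows "ld (Suc k) (ld k w) x v = 0"
proof -
  define F where "F v = fd (\<lambda>y. fd (\<lambda>z. w z (tail (tail v))) y (v (Suc 0))) x (v 0)" for v :: "nat \<Rightarrow> 'v"
  have "fd (\<lambda>y. ld k w y (tail v)) x (v 0) = (\<Sum>i\<le>k. (- 1) ^ i * F (case_nat (v 0) (case_nat (v (Suc i)) (omit i (tail v)))))" for v
  proof -
    have "((\<lambda>y. ld k w y (tail v)) has_derivative
        (\<lambda>u. \<Sum>i\<le>k. (- 1) ^ i * fd (\<lambda>y. fd (\<lambda>z. w z (omit i (tail v))) y (v (Suc i))) x u)) (at x)"
      unfolding ld_def
      by (intro has_derivative_sum has_derivative_mult_right
          smooth_on_has_derivative[OF smooth_on_fd[OF local_formD2[OF w]] S(2)])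
    from fd_eqI[OF this] show ?thesis by (simp add: F_def tail_case_nat)
  qed
  then have "alt_sum (Suc (Suc k)) (\<lambda>v. fd (\<lambda>y. ld k w y (tail v)) x (v 0)) v =
     (\<Sum>i\<le>k. (- 1) ^ i * alt_sum (Suc (Suc k)) (\<lambda>v. F (case_nat (v 0) (case_nat (v (Suc i)) (omit i (tail v))))) v)"
    by (simp add: alt_sum_sum alt_sum_cmult)
  also have "\<dots> = 0"
  proof (intro sum.neutral ballI)
    fix i assume i: "i \<in> {..k}"
    let ?G = "\<lambda>v. F (case_nat (v 0) (case_nat (v (Suc i)) (omit i (tail v))))"
    have "?G (\<lambda>l. v (Transposition.transpose 0 (Suc i) l)) = ?G v" for v
    proof -
      have "omit i (tail (\<lambda>l. v (Transposition.transpose 0 (Suc i) l))) = omit i (tail v)"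
        by (auto simp: omit_def Transposition.transpose_def)
      then show ?thesis
        using fd_commute[OF S(1) local_formD2[OF w] S(2)] by (simp add: F_def tail_case_nat)
    qed
    then have "alt_sum (Suc (Suc k)) ?G v = 0"
      using i by (intro alt_sum_symmetric_0[of 0 _ "Suc i"]) auto
    then show "(- 1) ^ i * alt_sum (Suc (Suc k)) ?G v = 0" by simp
  qed
  finally show ?thesis by (simp add: ld_alt_sum[OF local_form_ld[OF w S(1)] S])
qed

subsection \<open>Pullbacks\<close>

text \<open>The vector fields are inserted one argument at a time: expanding the new field in
  \<open>Basis\<close> leaves constant vectors with smooth coefficients, which the induction
  hypothesis handles.\<close>

lemma smooth_on_mlinear_vector_fields:
  fixes u :: "nat \<Rightarrow> 'w::real_normed_vector \<Rightarrow> 'v::euclidean_space"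
  assumes S: "open S" and f: "\<And>v. smooth_on S (\<lambda>x. f x v)" "\<And>x. x \<in> S \<Longrightarrow> mlinear k (f x)"
    and u: "\<And>i. i < k \<Longrightarrow> smooth_on S (u i)"
  shows "smooth_on S (\<lambda>x. f x (\<lambda>i. u i x))"
proof -
  have "smooth_on S (\<lambda>x. f x (\<lambda>i. if i < j then u i x else v i))" if "j \<le> k" for j v
    using that
  proof (induction j arbitrary: v)
    case 0
    then show ?case using f(1) by simp
  next
    case (Suc j)
    have "f x (\<lambda>i. if i < Suc j then u i x else v i) =
        (\<Sum>b\<in>Basis. of_real (u j x \<bullet> b) * f x (\<lambda>i. if i < j then u i x else (v(j := b)) i))" if "x \<in> S" for x
    proof -
      define v' where "v' = (\<lambda>i. if i < j then u i x else v i)"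
      have "(\<lambda>i. if i < Suc j then u i x else v i) = v'(j := (\<Sum>b\<in>Basis. (u j x \<bullet> b) *\<^sub>R b))"
        by (auto simp: v'_def euclidean_representation)
      moreover have "(\<lambda>i. if i < j then u i x else (v(j := b)) i) = v'(j := b)" for b
        by (auto simp: v'_def)
      ultimately show ?thesis
        using mlinear_sum[OF f(2)[OF that], of j v'] Suc.prems by (simp add: scaleR_conv_of_real)
    qed
    moreover have "smooth_on S (\<lambda>x. \<Sum>b\<in>Basis. of_real (u j x \<bullet> b) * f x (\<lambda>i. if i < j then u i x else (v(j := b)) i))"
    proof (intro smooth_on_sum[OF S] smooth_on_mult[OF S])
      fix b :: 'v
      show "smooth_on S (\<lambda>x. f x (\<lambda>i. if i < j then u i x else (v(j := b)) i))"
        by (rule Suc.IH) (use Suc.prems in simp)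
      show "smooth_on S (\<lambda>x. complex_of_real (u j x \<bullet> b))"
        by (rule smooth_on_bounded_linear[OF S bounded_linear_of_real])
          (rule smooth_on_bounded_linear[OF S bounded_linear_inner_left], use u Suc.prems in simp)
    qed
    ultimately show ?case by (subst smooth_on_cong[OF S]) auto
  qed
  from this[of k "\<lambda>i. 0"] have "smooth_on S (\<lambda>x. f x (\<lambda>i. if i < k then u i x else 0))" by simp
  moreover have "f x (\<lambda>i. if i < k then u i x else 0) = f x (\<lambda>i. u i x)" if "x \<in> S" for x
    by (rule mlinearD1[OF f(2)[OF that]]) simp
  ultimately show ?thesis by (subst smooth_on_cong[OF S, symmetric]) auto
qed

lemma has_derivative_mlinear_vector_fields:
  fixes g :: "'w::real_normed_vector \<Rightarrow> 'v::euclidean_space" and u :: "nat \<Rightarrow> 'w \<Rightarrow> 'v"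
  assumes g: "(g has_derivative g') (at x)" and gS: "g x \<in> T" and T: "open T" "local_form T k f"
    and u: "\<And>i. i < k \<Longrightarrow> (u i has_derivative u' i) (at x)"
  shows "((\<lambda>y. f (g y) (\<lambda>i. u i y)) has_derivative
    (\<lambda>h. fd (\<lambda>z. f z (\<lambda>i. u i x)) (g x) (g' h) + (\<Sum>j<k. f (g x) ((\<lambda>i. u i x)(j := u' j h))))) (at x)"
proof -
  note m = alternating_mlinear[OF local_formD1[OF T(2)]]
  obtain U where U: "open U" "x \<in> U" "\<And>y. y \<in> U \<Longrightarrow> g y \<in> T"
  proof -
    have "isCont g x" using g has_derivative_continuous by blast
    then obtain U where "open U" "x \<in> U" "\<And>y. y \<in> U \<Longrightarrow> g y \<in> T"
      using T(1) gS unfolding continuous_at_open by metis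
    then show ?thesis using that by blast
  qed
  \<comment> \<open>Induction on the number \<open>n\<close> of moving arguments, the others being
    frozen at \<open>v\<close>. The next argument is expanded in \<open>Basis\<close>, so that the
    product rule differentiates its coordinates separately from the rest.\<close>
  have main: "((\<lambda>y. f (g y) (\<lambda>i. if i < n then u i y else v i)) has_derivative
      (\<lambda>h. fd (\<lambda>z. f z (\<lambda>i. if i < n then u i x else v i)) (g x) (g' h) +
        (\<Sum>j<n. f (g x) ((\<lambda>i. if i < n then u i x else v i)(j := u' j h))))) (at x)" if "n \<le> k" for n v
    using that
  proof (induction n arbitrary: v)
    case 0
    show ?case
      using has_derivative_compose[OF g local_formD3[OF T(2) gS]] by simp
  next
    case (Suc n)
    define W where "W y b = (\<lambda>i. if i < n then u i y else (v(n := b)) i)" for y b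
    have n: "n < k" using Suc.prems by simp
    have e: "f z (\<lambda>i. if i < Suc n then u i y else v i) = (\<Sum>b\<in>Basis. (u n y \<bullet> b) *\<^sub>R f z (W y b))" if "z \<in> T" for z y
    proof -
      have "(\<lambda>i. if i < Suc n then u i y else v i) = (W y 0)(n := (\<Sum>b\<in>Basis. (u n y \<bullet> b) *\<^sub>R b))"
        by (auto simp: W_def euclidean_representation)
      moreover have "(W y 0)(n := b) = W y b" for b by (auto simp: W_def)
      ultimately show ?thesis
        using mlinear_sum[OF m[OF that] n, of "W y 0" "\<lambda>b. u n y \<bullet> b" "\<lambda>b. b" Basis] by simp
    qed
    let ?D = "\<lambda>b h. fd (\<lambda>z. f z (W x b)) (g x) (g' h) + (\<Sum>j<n. f (g x) ((W x b)(j := u' j h)))"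
    have D: "((\<lambda>y. f (g y) (W y b)) has_derivative ?D b) (at x)" for b
      unfolding W_def by (rule Suc.IH) (use n in simp)
    have "((\<lambda>y. \<Sum>b\<in>Basis. (u n y \<bullet> b) *\<^sub>R f (g y) (W y b)) has_derivative
        (\<lambda>h. \<Sum>b\<in>Basis. (u n x \<bullet> b) *\<^sub>R ?D b h + (u' n h \<bullet> b) *\<^sub>R f (g x) (W x b))) (at x)"
      by (intro has_derivative_sum has_derivative_scaleR D
          bounded_linear.has_derivative[OF bounded_linear_inner_left] u n)
    then have 1: "((\<lambda>y. f (g y) (\<lambda>i. if i < Suc n then u i y else v i)) has_derivative
        (\<lambda>h. \<Sum>b\<in>Basis. (u n x \<bullet> b) *\<^sub>R ?D b h + (u' n h \<bullet> b) *\<^sub>R f (g x) (W x b))) (at x)"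
      by (rule has_derivative_transform_within_open[OF _ U(1,2)]) (simp add: e U(3))
    have 2: "(\<Sum>b\<in>Basis. (u n x \<bullet> b) *\<^sub>R ?D b h + (u' n h \<bullet> b) *\<^sub>R f (g x) (W x b)) =
      fd (\<lambda>z. f z (\<lambda>i. if i < Suc n then u i x else v i)) (g x) (g' h) +
        (\<Sum>j<Suc n. f (g x) ((\<lambda>i. if i < Suc n then u i x else v i)(j := u' j h)))" for h
    proof -
      have a: "fd (\<lambda>z. f z (\<lambda>i. if i < Suc n then u i x else v i)) (g x) (g' h) =
          (\<Sum>b\<in>Basis. (u n x \<bullet> b) *\<^sub>R fd (\<lambda>z. f z (W x b)) (g x) (g' h))"
      proof -
        have e1: "frechet_derivative (\<lambda>z. f z (\<lambda>i. if i < Suc n then u i x else v i)) (at (g x)) =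
          frechet_derivative (\<lambda>z. \<Sum>b\<in>Basis. (u n x \<bullet> b) *\<^sub>R f z (W x b)) (at (g x))"
          by (rule fd_cong[OF T(1) gS e])
        have d: "((\<lambda>z. \<Sum>b\<in>Basis. (u n x \<bullet> b) *\<^sub>R f z (W x b)) has_derivative
            (\<lambda>h. \<Sum>b\<in>Basis. (u n x \<bullet> b) *\<^sub>R fd (\<lambda>z. f z (W x b)) (g x) h)) (at (g x))"
          by (intro has_derivative_sum has_derivative_scaleR_right local_formD3[OF T(2) gS])
        show ?thesis unfolding e1 by (rule fd_eqI[OF d])
      qed
      have b: "(\<Sum>b\<in>Basis. (u n x \<bullet> b) *\<^sub>R f (g x) ((W x b)(j := u' j h))) =
          f (g x) ((\<lambda>i. if i < Suc n then u i x else v i)(j := u' j h))" if "j < n" for j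
      proof -
        have "(\<lambda>i. if i < Suc n then u i x else v i)(j := u' j h) =
            ((W x 0)(j := u' j h))(n := (\<Sum>b\<in>Basis. (u n x \<bullet> b) *\<^sub>R b))"
          using that by (auto simp: W_def euclidean_representation)
        moreover have "((W x 0)(j := u' j h))(n := b) = (W x b)(j := u' j h)" for b
          using that by (auto simp: W_def)
        ultimately show ?thesis
          using mlinear_sum[OF m[OF gS] n, of "(W x 0)(j := u' j h)" "\<lambda>b. u n x \<bullet> b" "\<lambda>b. b" Basis] by simp
      qed
      have c: "(\<Sum>b\<in>Basis. (u' n h \<bullet> b) *\<^sub>R f (g x) (W x b)) =
          f (g x) ((\<lambda>i. if i < Suc n then u i x else v i)(n := u' n h))"
      proof -
        have "(\<lambda>i. if i < Suc n then u i x else v i)(n := u' n h) =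
            (W x 0)(n := (\<Sum>b\<in>Basis. (u' n h \<bullet> b) *\<^sub>R b))"
          by (auto simp: W_def euclidean_representation)
        moreover have "(W x 0)(n := b) = W x b" for b by (auto simp: W_def)
        ultimately show ?thesis
          using mlinear_sum[OF m[OF gS] n, of "W x 0" "\<lambda>b. u' n h \<bullet> b" "\<lambda>b. b" Basis] by simp
      qed
      have "(\<Sum>b\<in>Basis. (u n x \<bullet> b) *\<^sub>R ?D b h + (u' n h \<bullet> b) *\<^sub>R f (g x) (W x b)) =
        (\<Sum>b\<in>Basis. (u n x \<bullet> b) *\<^sub>R fd (\<lambda>z. f z (W x b)) (g x) (g' h)) +
        (\<Sum>j<n. \<Sum>b\<in>Basis. (u n x \<bullet> b) *\<^sub>R f (g x) ((W x b)(j := u' j h))) +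
        (\<Sum>b\<in>Basis. (u' n h \<bullet> b) *\<^sub>R f (g x) (W x b))"
        by (simp add: sum.distrib scaleR_add_right scaleR_sum_right sum.swap[of _ Basis "{..<n}"])
      also have "\<dots> = fd (\<lambda>z. f z (\<lambda>i. if i < Suc n then u i x else v i)) (g x) (g' h) +
        (\<Sum>j<Suc n. f (g x) ((\<lambda>i. if i < Suc n then u i x else v i)(j := u' j h)))"
        unfolding a c sum.lessThan_Suc add.assoc[symmetric] by (simp add: b del: fun_upd_apply cong: sum.cong_simp)
      finally show ?thesis .
    qed
    show ?case using 1 unfolding 2 .
  qed
  have *: "f z (\<lambda>i. if i < k then u i y else 0) = f z (\<lambda>i. u i y)" if "z \<in> T" for z y
    by (rule mlinearD1[OF m[OF that]]) simp
  have "((\<lambda>y. f (g y) (\<lambda>i. u i y)) has_derivative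
      (\<lambda>h. fd (\<lambda>z. f z (\<lambda>i. if i < k then u i x else 0)) (g x) (g' h) +
        (\<Sum>j<k. f (g x) ((\<lambda>i. if i < k then u i x else 0)(j := u' j h))))) (at x)"
    by (rule has_derivative_transform_within_open[OF main[OF order_refl, of "\<lambda>_. 0"] U(1,2)]) (simp add: * U(3))
  moreover have "frechet_derivative (\<lambda>z. f z (\<lambda>i. if i < k then u i x else 0)) (at (g x)) =
      frechet_derivative (\<lambda>z. f z (\<lambda>i. u i x)) (at (g x))"
    by (rule fd_cong[OF T(1) gS *])
  moreover have "f (g x) ((\<lambda>i. if i < k then u i x else 0)(j := b)) = f (g x) ((\<lambda>i. u i x)(j := b))" for j b
    by (rule mlinearD1[OF m[OF gS]]) simp
  ultimately show ?thesis by simp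
qed

definition pullback ::
  "('v::real_normed_vector \<Rightarrow> 'w::real_normed_vector) \<Rightarrow> ('w \<Rightarrow> (nat \<Rightarrow> 'w) \<Rightarrow> complex) \<Rightarrow> 'v \<Rightarrow> (nat \<Rightarrow> 'v) \<Rightarrow> complex"
  where "pullback \<phi> w x v = w (\<phi> x) (\<lambda>i. fd \<phi> x (v i))"

lemma local_form_pullback:
  fixes \<phi> :: "'v::euclidean_space \<Rightarrow> 'w::euclidean_space"
  assumes S: "open S" and \<phi>: "smooth_on S \<phi>" "\<And>x. x \<in> S \<Longrightarrow> \<phi> x \<in> T" and w: "local_form T k w"
  shows "local_form S k (pullback \<phi> w)"
  unfolding local_form_def
proof (intro conjI ballI allI)
  show "alternating_form k (pullback \<phi> w x)" if "x \<in> S" for x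
    using alternating_linear_compose[OF local_formD1[OF w \<phi>(2)[OF that]] smooth_on_linear_fd[OF \<phi>(1) that]]
    by (simp add: pullback_def[abs_def])
  fix v
  show "smooth_on S (\<lambda>x. pullback \<phi> w x v)"
    unfolding pullback_def
  proof (rule smooth_on_mlinear_vector_fields[OF S, where k = k and f = "\<lambda>x. w (\<phi> x)" and u = "\<lambda>i x. fd \<phi> x (v i)"])
    show "smooth_on S (\<lambda>x. w (\<phi> x) v)" for v
      by (rule smooth_on_compose[OF S \<phi>(1) local_formD2[OF w] \<phi>(2)])
    show "mlinear k (w (\<phi> x))" if "x \<in> S" for x
      by (rule alternating_mlinear[OF local_formD1[OF w \<phi>(2)[OF that]]])
    show "smooth_on S (\<lambda>x. fd \<phi> x (v i))" for i
      by (rule smooth_on_fd[OF \<phi>(1)])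
  qed
qed

lemma smooth_on_fd_commute_vec:
  fixes \<phi> :: "'v::euclidean_space \<Rightarrow> complex^'n::finite"
  assumes S: "open S" "x \<in> S" and \<phi>: "smooth_on S \<phi>"
  shows "fd (\<lambda>y. fd \<phi> y u) x v = fd (\<lambda>y. fd \<phi> y v) x u"
proof -
  have c: "fd (\<lambda>y. h y $ i) x u = fd h x u $ i" if "smooth_on S h" "x \<in> S" for h :: "'v \<Rightarrow> complex^'n" and i x u
    by (rule fd_eqI, rule bounded_linear.has_derivative[OF bounded_linear_vec_nth])
      (rule smooth_on_has_derivative[OF that])
  have "fd (\<lambda>y. fd \<phi> y u) x v $ i = fd (\<lambda>y. fd (\<lambda>z. \<phi> z $ i) y u) x v" for u v i
  proof -
    have "fd (\<lambda>y. fd \<phi> y u) x v $ i = fd (\<lambda>y. fd \<phi> y u $ i) x v"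
      using c[OF smooth_on_fd[OF \<phi>] S(2)] by simp
    also have "\<dots> = fd (\<lambda>y. fd (\<lambda>z. \<phi> z $ i) y u) x v"
      using fd_cong[OF S, of "\<lambda>y. fd \<phi> y u $ i" "\<lambda>y. fd (\<lambda>z. \<phi> z $ i) y u"] c[OF \<phi>] by simp
    finally show ?thesis .
  qed
  moreover have "fd (\<lambda>y. fd (\<lambda>z. \<phi> z $ i) y u) x v = fd (\<lambda>y. fd (\<lambda>z. \<phi> z $ i) y v) x u" for i
    by (rule fd_commute[OF S(1) smooth_on_bounded_linear[OF S(1) bounded_linear_vec_nth \<phi>] S(2)])
  ultimately show ?thesis by (simp add: vec_eq_iff)
qed

text \<open>In the derivative of the pulled back form, \<open>A\<close> is the term of d w and
  \<open>B j\<close> contains the second derivative of \<open>\<phi>\<close> in the directions of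
  the arguments 0 and \<open>Suc j\<close>. The latter is symmetric, so its alternating sum
  vanishes.\<close>

lemma ld_pullback:
  fixes \<phi> :: "'v::euclidean_space \<Rightarrow> complex^'n::finite"
  assumes S: "open S" "x \<in> S" and \<phi>: "smooth_on S \<phi>" "\<And>x. x \<in> S \<Longrightarrow> \<phi> x \<in> T"
    and T: "open T" and w: "local_form T k w"
  shows "ld k (pullback \<phi> w) x v = pullback \<phi> (ld k w) x v"
proof -
  define A where "A v = fd (\<lambda>y. w y (\<lambda>i. fd \<phi> x (tail v i))) (\<phi> x) (fd \<phi> x (v 0))" for v
  define B where "B j v = w (\<phi> x) ((\<lambda>i. fd \<phi> x (tail v i))(j := fd (\<lambda>y. fd \<phi> y (v (Suc j))) x (v 0)))" for j v
  have "fd (\<lambda>y. pullback \<phi> w y (tail v)) x (v 0) = A v + (\<Sum>j<k. B j v)" for v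
    unfolding pullback_def A_def B_def
    by (rule fd_eqI, rule has_derivative_mlinear_vector_fields[OF
          smooth_on_has_derivative[OF \<phi>(1) S(2)] \<phi>(2)[OF S(2)] T w])
      (rule smooth_on_has_derivative[OF smooth_on_fd[OF \<phi>(1)] S(2)])
  then have "alt_sum (Suc k) (\<lambda>v. fd (\<lambda>y. pullback \<phi> w y (tail v)) x (v 0)) v =
      alt_sum (Suc k) A v + (\<Sum>j<k. alt_sum (Suc k) (B j) v)"
    by (simp add: alt_sum_add alt_sum_sum)
  moreover have "alt_sum (Suc k) (B j) v = 0" if j: "j < k" for j
  proof (rule alt_sum_symmetric_0[of 0 _ "Suc j"])
    fix v
    have "(\<lambda>i. fd \<phi> x (tail (\<lambda>l. v (Transposition.transpose 0 (Suc j) l)) i))(j := z) =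
        (\<lambda>i. fd \<phi> x (tail v i))(j := z)" for z
      by (auto simp: Transposition.transpose_def)
    then show "B j (\<lambda>l. v (Transposition.transpose 0 (Suc j) l)) = B j v"
      using smooth_on_fd_commute_vec[OF S \<phi>(1)] unfolding B_def by simp
  qed (use j in auto)
  moreover have "alt_sum (Suc k) A v =
      alt_sum (Suc k) (\<lambda>u. fd (\<lambda>y. w y (tail u)) (\<phi> x) (u 0)) (\<lambda>i. fd \<phi> x (v i))"
    by (simp add: alt_sum_def A_def)
  ultimately show ?thesis
    by (simp add: ld_alt_sum[OF local_form_pullback[OF S(1) \<phi> w] S] pullback_def
        ld_alt_sum[OF w T \<phi>(2)[OF S(2)]])
qed

subsection \<open>The Leibniz rule\<close>

lemma local_form_wedge:
  assumes S: "open S" and a: "local_form S p a" and b: "local_form S q b"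
  shows "local_form S (p + q) (\<lambda>x. wedge_alt p q (a x) (b x))"
  unfolding local_form_def
proof (intro conjI ballI allI)
  show "alternating_form (p + q) (wedge_alt p q (a x) (b x))" if "x \<in> S" for x
    by (rule wedge_alt_alternating[OF local_formD1[OF a that] local_formD1[OF b that]])
  show "smooth_on S (\<lambda>x. wedge_alt p q (a x) (b x) v)" for v
    unfolding wedge_alt_def divide_inverse
    by (intro smooth_on_mult[OF S] smooth_on_sum[OF S] smooth_on_const local_formD2[OF a] local_formD2[OF b])
qed

lemma fact_ratio: "of_nat (Suc p) * z / (fact (Suc p) * y) = z / (fact p * (y :: complex))"
  by (simp add: mult.assoc del: of_nat_Suc)

text \<open>Under the alternating sum the product rule gives \<open>A\<close>, where the derivative
  falls on \<open>a\<close>, and \<open>B\<close>, where it falls on \<open>b\<close>. Both have the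
  direction of differentiation in front; moving it past the \<open>p\<close> arguments of
  \<open>a\<close> produces the sign.\<close>

lemma ld_wedge:
  fixes a b :: "'v::real_normed_vector \<Rightarrow> (nat \<Rightarrow> 'v) \<Rightarrow> complex"
  assumes S: "open S" "x \<in> S" and a: "local_form S p a" and b: "local_form S q b"
  shows "ld (p + q) (\<lambda>x. wedge_alt p q (a x) (b x)) x v =
    wedge_alt (Suc p) q (ld p a x) (b x) v + (- 1) ^ p * wedge_alt p (Suc q) (a x) (ld q b x) v"
proof -
  let ?N = "p + q"
  define A where "A v = fd (\<lambda>y. a y (tail v)) x (v 0) * b x (\<lambda>i. v (Suc p + i))" for v
  define B where "B v = a x (tail v) * fd (\<lambda>y. b y (\<lambda>i. v (Suc p + i))) x (v 0)" for v
  have D: "fd (\<lambda>y. wedge_alt p q (a y) (b y) v) x u =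
      alt_sum ?N (\<lambda>v. A (case_nat u v) + B (case_nat u v)) v / (fact p * fact q)" for v u
  proof -
    have "((\<lambda>y. wedge_alt p q (a y) (b y) v) has_derivative (\<lambda>u.
      (\<Sum>s | s permutes {..<?N}. of_int (sign s) * (a x (\<lambda>i. v (s i)) * fd (\<lambda>y. b y (\<lambda>i. v (s (p + i)))) x u +
        fd (\<lambda>y. a y (\<lambda>i. v (s i))) x u * b x (\<lambda>i. v (s (p + i))))) / (fact p * fact q))) (at x)"
      unfolding wedge_alt_def mult.assoc divide_inverse
      by (intro has_derivative_mult_left has_derivative_sum has_derivative_mult_right has_derivative_mult
          local_formD3[OF a S(2)] local_formD3[OF b S(2)])
    from fd_eqI[OF this] show ?thesis
      by (simp add: alt_sum_def A_def B_def add.commute)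
  qed
  have "ld ?N (\<lambda>x. wedge_alt p q (a x) (b x)) x v = alt_sum (Suc ?N) (\<lambda>v. A v + B v) v / (fact p * fact q)"
    by (simp add: ld_def D alt_sum_Suc sum_divide_distrib)
  also have "\<dots> = alt_sum (Suc ?N) A v / (fact p * fact q) + alt_sum (Suc ?N) B v / (fact p * fact q)"
    by (simp add: alt_sum_add add_divide_distrib)
  also have "alt_sum (Suc ?N) A v / (fact p * fact q) = wedge_alt (Suc p) q (ld p a x) (b x) v"
  proof -
    have "alt_sum (Suc ?N) (\<lambda>v. ld p a x v * b x (\<lambda>i. v (Suc p + i))) v =
        (\<Sum>i\<le>p. (- 1) ^ i * alt_sum (Suc ?N) (\<lambda>v. fd (\<lambda>y. a y (omit i v)) x (v i) * b x (\<lambda>i. v (Suc p + i))) v)"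
      by (simp add: ld_def sum_distrib_right alt_sum_sum mult.assoc alt_sum_cmult)
    also have "\<dots> = (\<Sum>i\<le>p. (- 1) ^ i * ((- 1) ^ i * alt_sum (Suc ?N) A v))"
    proof (intro sum.cong refl arg_cong2[of _ _ _ _ "(*)"] alt_sum_front)
      fix i and v :: "nat \<Rightarrow> 'v" assume i: "i \<in> {..p}"
      show "i < Suc ?N" using i by simp
      have "(\<lambda>j. case_nat (v i) (omit i v) (Suc p + j)) = (\<lambda>j. v (Suc p + j))"
        using i by (auto simp: omit_def)
      then show "fd (\<lambda>y. a y (omit i v)) x (v i) * b x (\<lambda>j. v (Suc p + j)) = A (case_nat (v i) (omit i v))"
        by (simp add: A_def)
    qed
    \<comment> \<open>The p + 1 terms coincide, and (p + 1) / (p + 1)! = 1 / p! restores the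
      normalisation of the wedge product.\<close>
    also have "\<dots> = of_nat (Suc p) * alt_sum (Suc ?N) A v"
      by (simp add: mult.assoc[symmetric] power_mult_distrib[symmetric])
    finally show ?thesis by (simp only: wedge_alt_alt_sum add_Suc fact_ratio)
  qed
  also have "alt_sum (Suc ?N) B v / (fact p * fact q) = (- 1) ^ p * wedge_alt p (Suc q) (a x) (ld q b x) v"
  proof -
    have "alt_sum (Suc ?N) (\<lambda>v. a x v * ld q b x (\<lambda>i. v (p + i))) v =
        (\<Sum>i\<le>q. (- 1) ^ i * alt_sum (Suc ?N) (\<lambda>v. a x v * fd (\<lambda>y. b y (omit i (\<lambda>i. v (p + i)))) x (v (p + i))) v)"
      by (simp only: ld_def sum_distrib_left alt_sum_sum mult.left_commute[of "a x _" "(- 1) ^ _"] alt_sum_cmult)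
    also have "\<dots> = (\<Sum>i\<le>q. (- 1) ^ i * ((- 1) ^ (p + i) * alt_sum (Suc ?N) B v))"
    proof (intro sum.cong refl arg_cong2[of _ _ _ _ "(*)"] alt_sum_front)
      fix i and v :: "nat \<Rightarrow> 'v" assume i: "i \<in> {..q}"
      show "p + i < Suc ?N" using i by simp
      have "a x v = a x (omit (p + i) v)"
        by (rule mlinearD1[OF alternating_mlinear[OF local_formD1[OF a S(2)]]]) (simp add: omit_def)
      moreover have "omit i (\<lambda>j. v (p + j)) = (\<lambda>j. omit (p + i) v (p + j))"
        by (auto simp: omit_def)
      ultimately show "a x v * fd (\<lambda>y. b y (omit i (\<lambda>j. v (p + j)))) x (v (p + i)) =
          B (case_nat (v (p + i)) (omit (p + i) v))"
        by (simp add: B_def)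
    qed
    also have "\<dots> = of_nat (Suc q) * ((- 1) ^ p * alt_sum (Suc ?N) B v)"
      by (simp add: mult.assoc[symmetric] power_mult_distrib[symmetric] power_add mult.commute[of "(- 1) ^ p"])
    finally have e: "alt_sum (Suc ?N) (\<lambda>v. a x v * ld q b x (\<lambda>i. v (p + i))) v =
        of_nat (Suc q) * ((- 1) ^ p * alt_sum (Suc ?N) B v)" .
    have "(- 1) ^ p * wedge_alt p (Suc q) (a x) (ld q b x) v =
        ((- 1) ^ p * (- 1) ^ p) * alt_sum (Suc ?N) B v / (fact p * fact q)"
      by (simp only: wedge_alt_alt_sum add_Suc_right e mult.commute[of "fact p"] fact_ratio)
        (simp add: mult.assoc)
    then show ?thesis by (simp add: power_mult_distrib[symmetric])
  qed
  finally show ?thesis .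
qed


section \<open>Global forms as compatible families, supports and extension by zero\<close>

section \<open>Differential forms on a complex manifold\<close>

abbreviation (input) pt where "pt c \<equiv> inv_into (fst c) (snd c)"

lemma overlap_iff:
  assumes "inj_on (snd c) (fst c)"
  shows "x \<in> overlap c d \<longleftrightarrow> x \<in> chart_img c \<and> pt c x \<in> fst d"
  using assms unfolding overlap_def chart_img_def
  by (auto simp: inv_into_f_f)

locale complex_atlas =
  fixes X :: "'a topology" and A :: "('a, 'n::finite) chart set"
  assumes manifold: "complex_manifold X A"
begin

lemma Hausdorff: "Hausdorff_space X" and covers: "(\<Union>c\<in>A. fst c) = topspace X"
  using manifold by (auto simp: complex_manifold_def)

lemma chart:
  assumes "c \<in> A"
  shows "openin X (fst c)" "open (chart_img c)"
    "homeomorphic_map (subtopology X (fst c)) (top_of_set (chart_img c)) (snd c)"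
  using manifold assms by (auto simp: complex_manifold_def)

lemma chart_subset: "c \<in> A \<Longrightarrow> fst c \<subseteq> topspace X"
  using chart(1) openin_subset by blast

lemma chart_inj: "c \<in> A \<Longrightarrow> inj_on (snd c) (fst c)"
  using homeomorphic_imp_injective_map[OF chart(3)] chart_subset
  by (metis topspace_subtopology_subset)

lemma pt_chart [simp]: "c \<in> A \<Longrightarrow> p \<in> fst c \<Longrightarrow> pt c (snd c p) = p"
  using chart_inj by (rule inv_into_f_f)

lemma chart_pt [simp]: "x \<in> chart_img c \<Longrightarrow> snd c (pt c x) = x"
  unfolding chart_img_def by (rule f_inv_into_f)

lemma pt_in [simp]: "x \<in> chart_img c \<Longrightarrow> pt c x \<in> fst c"
  unfolding chart_img_def by (rule inv_into_into)

lemma in_chart_img [simp]: "p \<in> fst c \<Longrightarrow> snd c p \<in> chart_img c"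
  unfolding chart_img_def by blast

lemma overlapD:
  assumes "c \<in> A" shows "x \<in> overlap c d \<longleftrightarrow> x \<in> chart_img c \<and> pt c x \<in> fst d"
  by (rule overlap_iff[OF chart_inj[OF assms]])

lemma open_chart_part:
  assumes c: "c \<in> A" and U: "openin X U"
  shows "open {x \<in> chart_img c. pt c x \<in> U}"
proof -
  have "openin (top_of_set (chart_img c)) (snd c ` (fst c \<inter> U))"
    using homeomorphic_imp_open_map[OF chart(3)[OF c]] U
    unfolding open_map_def by (metis inf_commute openin_subtopology_Int)
  then have "open (snd c ` (fst c \<inter> U))" using chart(2)[OF c] openin_open_trans by blast
  moreover have "snd c ` (fst c \<inter> U) = {x \<in> chart_img c. pt c x \<in> U}"
  proof (rule Set.set_eqI, rule iffI)
    fix x assume x: "x \<in> {x \<in> chart_img c. pt c x \<in> U}"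
    then have "x = snd c (pt c x)" "pt c x \<in> fst c \<inter> U" by auto
    then show "x \<in> snd c ` (fst c \<inter> U)" by blast
  qed (use c in auto)
  ultimately show ?thesis by simp
qed

lemma openin_chart_preimage:
  assumes c: "c \<in> A" and S: "open S"
  shows "openin X {p \<in> fst c. snd c p \<in> S}"
proof -
  have cm: "continuous_map (subtopology X (fst c)) (top_of_set (chart_img c)) (snd c)"
    by (rule homeomorphic_imp_continuous_map[OF chart(3)[OF c]])
  have "openin (top_of_set (chart_img c)) (chart_img c \<inter> S)" using S openin_open by blast
  from openin_continuous_map_preimage[OF cm this]
  have "openin (subtopology X (fst c)) {p \<in> fst c. snd c p \<in> S}"
    using chart_subset[OF c]
    by (smt (verit) Collect_cong IntD2 IntI in_chart_img topspace_subtopology_subset)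
  then show ?thesis using chart(1)[OF c] openin_trans_full by blast
qed

text \<open>The image is compact, and compact sets are closed because \<open>X\<close> is Hausdorff.
  Closedness in all of \<open>X\<close>, not only in the chart, is what makes extension by zero
  smooth.\<close>

lemma compactin_pt_image:
  assumes c: "c \<in> A" and C: "compact C" "C \<subseteq> chart_img c"
  shows "closedin X (pt c ` C)"
proof -
  obtain g where g: "homeomorphic_maps (subtopology X (fst c)) (top_of_set (chart_img c)) (snd c) g"
    using chart(3)[OF c] homeomorphic_map_maps by blast
  have "continuous_map (top_of_set (chart_img c)) (subtopology X (fst c)) g"
    using g homeomorphic_maps_def by blast
  moreover have "compactin (top_of_set (chart_img c)) C"
    using C by (simp add: compactin_subtopology)
  ultimately have "compactin (subtopology X (fst c)) (g ` C)" by (rule image_compactin[rotated])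
  then have "compactin X (g ` C)" by (simp add: compactin_subtopology)
  moreover have "g x = pt c x" if "x \<in> C" for x
  proof -
    have x: "x \<in> chart_img c" using that C(2) by blast
    have "g (snd c (pt c x)) = pt c x"
      using g pt_in[OF x] chart_subset[OF c] unfolding homeomorphic_maps_def by auto
    then show ?thesis using x by simp
  qed
  then have "g ` C = pt c ` C" by (rule image_cong[OF refl])
  ultimately show ?thesis using compactin_imp_closedin[OF Hausdorff] by simp
qed

lemma open_overlap:
  assumes "c \<in> A" "d \<in> A" shows "open (overlap c d)"
proof -
  have "overlap c d = {x \<in> chart_img c. pt c x \<in> fst d}" using overlapD[OF assms(1)] by blast
  then show ?thesis using open_chart_part[OF assms(1) chart(1)[OF assms(2)]] by simp
qed

lemma transition_eq: "transition c d x = snd d (pt c x)"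
  by (simp add: transition_def)

lemma transition_in: "c \<in> A \<Longrightarrow> d \<in> A \<Longrightarrow> x \<in> overlap c d \<Longrightarrow> transition c d x \<in> overlap d c"
  by (auto simp: transition_eq overlapD)

lemma pt_transition: "c \<in> A \<Longrightarrow> d \<in> A \<Longrightarrow> x \<in> overlap c d \<Longrightarrow> pt d (transition c d x) = pt c x"
  by (auto simp: transition_eq overlapD)

lemma transition_holomorphic: "c \<in> A \<Longrightarrow> d \<in> A \<Longrightarrow> holomorphic_map_on (transition c d) (overlap c d)"
  using manifold by (auto simp: complex_manifold_def)

lemma transition_smooth: "c \<in> A \<Longrightarrow> d \<in> A \<Longrightarrow> smooth_on (overlap c d) (transition c d)"
  by (rule holomorphic_map_on_smooth[OF transition_holomorphic open_overlap])

lemma transition_derivative: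
  "c \<in> A \<Longrightarrow> d \<in> A \<Longrightarrow> x \<in> overlap c d \<Longrightarrow>
    (transition c d has_derivative frechet_derivative (transition c d) (at x)) (at x)"
  by (rule smooth_on_has_derivative[OF transition_smooth])

lemma fd_transition_self:
  assumes "c \<in> A" "x \<in> chart_img c" shows "fd (transition c c) x v = v"
proof -
  have "((\<lambda>y. y) has_derivative (\<lambda>v. v)) (at x)" by simp
  then have "(transition c c has_derivative (\<lambda>v. v)) (at x)"
    by (rule has_derivative_transform_within_open[OF _ chart(2)[OF assms(1)] assms(2)])
      (simp add: transition_eq)
  then show ?thesis by (rule fd_eqI)
qed

lemma fd_transition_trans:
  assumes "c \<in> A" "d \<in> A" "e \<in> A" "x \<in> overlap c d" "x \<in> overlap c e"
  shows "fd (transition d e) (transition c d x) (fd (transition c d) x v) = fd (transition c e) x v"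
proof -
  have de: "transition c d x \<in> overlap d e"
    using assms by (auto simp: overlapD transition_eq)
  have "((\<lambda>y. transition d e (transition c d y)) has_derivative
      (\<lambda>v. fd (transition d e) (transition c d x) (fd (transition c d) x v))) (at x)"
    by (rule has_derivative_compose[OF transition_derivative[OF assms(1,2,4)] transition_derivative[OF assms(2,3) de]])
  then have "(transition c e has_derivative
      (\<lambda>v. fd (transition d e) (transition c d x) (fd (transition c d) x v))) (at x)"
    by (rule has_derivative_transform_within_open[OF _ open_overlap[OF assms(1,2)] assms(4)])
      (use assms in \<open>auto simp: transition_eq overlapD\<close>)
  then show ?thesis by (simp add: fd_eqI)
qed

subsection \<open>Smooth forms\<close>

lemma smooth_forms_iff:
  "\<omega> \<in> smooth_forms A k \<longleftrightarrow>
    (\<forall>c\<in>A. local_form (chart_img c) k (\<omega> c)) \<and>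
    (\<forall>c\<in>A. \<forall>d\<in>A. \<forall>x\<in>overlap c d. \<omega> c x = pullback (transition c d) (\<omega> d) x) \<and>
    (\<forall>c x. \<not> (c \<in> A \<and> x \<in> chart_img c) \<longrightarrow> \<omega> c x = 0)"
  unfolding smooth_forms_def local_form_def pullback_def fun_eq_iff by blast

lemma smooth_formsI:
  assumes "\<And>c. c \<in> A \<Longrightarrow> local_form (chart_img c) k (\<omega> c)"
    "\<And>c d x. c \<in> A \<Longrightarrow> d \<in> A \<Longrightarrow> x \<in> overlap c d \<Longrightarrow> \<omega> c x = pullback (transition c d) (\<omega> d) x"
    "\<And>c x. \<not> (c \<in> A \<and> x \<in> chart_img c) \<Longrightarrow> \<omega> c x = 0"
  shows "\<omega> \<in> smooth_forms A k"
  using assms by (simp add: smooth_forms_iff)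

lemma smooth_formsD:
  assumes "\<omega> \<in> smooth_forms A k"
  shows "c \<in> A \<Longrightarrow> local_form (chart_img c) k (\<omega> c)"
    "c \<in> A \<Longrightarrow> d \<in> A \<Longrightarrow> x \<in> overlap c d \<Longrightarrow> \<omega> c x = pullback (transition c d) (\<omega> d) x"
    "\<not> (c \<in> A \<and> x \<in> chart_img c) \<Longrightarrow> \<omega> c x = 0"
  using assms unfolding smooth_forms_iff by blast+

text \<open>The transition rule carries the values in one chart around a point to every other chart
  around it, so one chart for each point suffices.\<close>

lemma form_eqI:
  assumes "\<omega> \<in> smooth_forms A k" "\<omega>' \<in> smooth_forms A k"
    and eq: "\<And>p. p \<in> topspace X \<Longrightarrow> \<exists>c\<in>A. p \<in> fst c \<and> \<omega> c (snd c p) = \<omega>' c (snd c p)"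
  shows "\<omega> = \<omega>'"
proof (rule ext, rule ext)
  fix d x
  show "\<omega> d x = \<omega>' d x"
  proof (cases "d \<in> A \<and> x \<in> chart_img d")
    case True
    then have "pt d x \<in> topspace X" using chart_subset[of d] pt_in[of x d] by auto
    then obtain c where c: "c \<in> A" "pt d x \<in> fst c" "\<omega> c (snd c (pt d x)) = \<omega>' c (snd c (pt d x))"
      using eq by blast
    then have "x \<in> overlap d c" using True by (simp add: overlapD)
    then show ?thesis
      using smooth_formsD(2)[OF assms(1), of d c x] smooth_formsD(2)[OF assms(2), of d c x] True c
      by (simp add: pullback_def transition_eq fun_eq_iff)
  qed (simp add: smooth_formsD(3)[OF assms(1)] smooth_formsD(3)[OF assms(2)])
qed

lemma ext_deriv_eq: "ext_deriv A k \<omega> c x = (if c \<in> A \<and> x \<in> chart_img c then ld k (\<omega> c) x else 0)"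
  by (auto simp: ext_deriv_def ld_def fun_eq_iff)

lemma zero_smooth: "0 \<in> smooth_forms A k"
  by (rule smooth_formsI) (simp_all add: pullback_def fun_eq_iff local_form_def alternating_0[unfolded zero_fun_def[symmetric]] smooth_on_const zero_fun_def alternating_0)

lemma add_smooth:
  assumes "\<alpha> \<in> smooth_forms A k" "\<beta> \<in> smooth_forms A k"
  shows "\<alpha> + \<beta> \<in> smooth_forms A k"
proof (rule smooth_formsI)
  fix c assume c: "c \<in> A"
  show "local_form (chart_img c) k ((\<alpha> + \<beta>) c)"
    using local_form_add[OF chart(2)[OF c] smooth_formsD(1)[OF assms(1) c] smooth_formsD(1)[OF assms(2) c]]
    by (simp add: plus_fun_def)
next
  fix c d x assume "c \<in> A" "d \<in> A" "x \<in> overlap c d"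
  then show "(\<alpha> + \<beta>) c x = pullback (transition c d) ((\<alpha> + \<beta>) d) x"
    using smooth_formsD(2)[OF assms(1)] smooth_formsD(2)[OF assms(2)]
    by (simp add: pullback_def fun_eq_iff plus_fun_def)
qed (simp add: smooth_formsD(3)[OF assms(1)] smooth_formsD(3)[OF assms(2)])

definition smooth_fun :: "('a \<Rightarrow> complex) \<Rightarrow> bool"
  where "smooth_fun f \<longleftrightarrow> (\<forall>c\<in>A. smooth_on (chart_img c) (\<lambda>x. f (pt c x)))"

definition fmult :: "('a \<Rightarrow> complex) \<Rightarrow> ('a, 'n) form \<Rightarrow> ('a, 'n) form"
  where "fmult f \<omega> = (\<lambda>c x v. f (pt c x) * \<omega> c x v)"

lemma smooth_funD: "smooth_fun f \<Longrightarrow> c \<in> A \<Longrightarrow> smooth_on (chart_img c) (\<lambda>x. f (pt c x))"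
  by (simp add: smooth_fun_def)

lemma smooth_fun_const: "smooth_fun (\<lambda>p. a)"
  by (simp add: smooth_fun_def smooth_on_const)

lemma smooth_fun_mult: "smooth_fun f \<Longrightarrow> smooth_fun g \<Longrightarrow> smooth_fun (\<lambda>p. f p * g p)"
  by (simp add: smooth_fun_def smooth_on_mult[OF chart(2)])

lemma smooth_fun_sum: "(\<And>i. i \<in> I \<Longrightarrow> smooth_fun (f i)) \<Longrightarrow> smooth_fun (\<lambda>p. \<Sum>i\<in>I. f i p)"
  by (simp add: smooth_fun_def smooth_on_sum[OF chart(2)])

lemma fmult_smooth:
  assumes "smooth_fun f" "\<omega> \<in> smooth_forms A k"
  shows "fmult f \<omega> \<in> smooth_forms A k"
proof (rule smooth_formsI)
  fix c assume c: "c \<in> A"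
  show "local_form (chart_img c) k (fmult f \<omega> c)"
    using local_form_fmult[OF chart(2)[OF c] smooth_funD[OF assms(1) c] smooth_formsD(1)[OF assms(2) c]]
    by (simp add: fmult_def)
next
  fix c d x assume "c \<in> A" "d \<in> A" "x \<in> overlap c d"
  then show "fmult f \<omega> c x = pullback (transition c d) (fmult f \<omega> d) x"
    using smooth_formsD(2)[OF assms(2)] by (simp add: pullback_def fun_eq_iff fmult_def pt_transition)
qed (simp add: smooth_formsD(3)[OF assms(2)] fmult_def fun_eq_iff)

lemma form_scale_fmult: "form_scale a \<omega> = fmult (\<lambda>p. a) \<omega>"
  by (simp add: form_scale_def fmult_def)

lemma form_scale_smooth: "\<omega> \<in> smooth_forms A k \<Longrightarrow> form_scale a \<omega> \<in> smooth_forms A k"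
  unfolding form_scale_fmult by (rule fmult_smooth[OF smooth_fun_const])

lemma form_scale_simps:
  "form_scale 1 \<omega> = \<omega>" "form_scale 0 \<omega> = 0" "form_scale a (form_scale b \<omega>) = form_scale (a * b) \<omega>"
  "form_scale a (\<alpha> + \<beta>) = form_scale a \<alpha> + form_scale a \<beta>" "form_scale a 0 = 0"
  "form_scale (a + b) \<omega> = form_scale a \<omega> + form_scale b \<omega>" "form_scale (- 1) \<omega> = - \<omega>"
  "form_scale a (\<alpha> - \<beta>) = form_scale a \<alpha> - form_scale a \<beta>"
  by (simp_all add: form_scale_def fun_eq_iff algebra_simps)

lemma uminus_smooth: "\<omega> \<in> smooth_forms A k \<Longrightarrow> - \<omega> \<in> smooth_forms A k"
  using form_scale_smooth[of \<omega> k "- 1"] by (simp add: form_scale_simps)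

lemma diff_smooth: "\<alpha> \<in> smooth_forms A k \<Longrightarrow> \<beta> \<in> smooth_forms A k \<Longrightarrow> \<alpha> - \<beta> \<in> smooth_forms A k"
  using add_smooth[OF _ uminus_smooth] by (metis diff_conv_add_uminus)

lemma sum_smooth: "(\<And>i. i \<in> I \<Longrightarrow> \<omega> i \<in> smooth_forms A k) \<Longrightarrow> (\<Sum>i\<in>I. \<omega> i) \<in> smooth_forms A k"
  by (induction I rule: infinite_finite_induct) (auto intro: add_smooth zero_smooth)

text \<open>The transition rule for the exterior derivative is its naturality under pullback by the
  transition map, applied on the open overlap.\<close>

lemma ext_deriv_smooth:
  assumes w: "\<omega> \<in> smooth_forms A k"
  shows "ext_deriv A k \<omega> \<in> smooth_forms A (Suc k)"
proof (rule smooth_formsI)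
  fix c assume c: "c \<in> A"
  have "local_form (chart_img c) (Suc k) (ext_deriv A k \<omega> c) \<longleftrightarrow> local_form (chart_img c) (Suc k) (ld k (\<omega> c))"
    by (rule local_form_cong[OF chart(2)[OF c]]) (simp add: ext_deriv_eq c)
  then show "local_form (chart_img c) (Suc k) (ext_deriv A k \<omega> c)"
    using local_form_ld[OF smooth_formsD(1)[OF w c] chart(2)[OF c]] by simp
next
  fix c d x assume cd: "c \<in> A" "d \<in> A" "x \<in> overlap c d"
  have im: "\<And>x. x \<in> overlap c d \<Longrightarrow> x \<in> chart_img c \<and> transition c d x \<in> chart_img d"
    using cd by (auto simp: overlapD transition_eq)
  have "ld k (\<omega> c) x v = ld k (pullback (transition c d) (\<omega> d)) x v" for v
    by (rule ld_cong[OF open_overlap[OF cd(1,2)] cd(3)]) (rule smooth_formsD(2)[OF w cd(1,2)])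
  also have "\<dots>v = pullback (transition c d) (ld k (\<omega> d)) x v" for v
    by (rule ld_pullback[OF open_overlap[OF cd(1,2)] cd(3) transition_smooth[OF cd(1,2)] _ chart(2)[OF cd(2)]
          smooth_formsD(1)[OF w cd(2)]]) (use im in blast)
  finally show "ext_deriv A k \<omega> c x = pullback (transition c d) (ext_deriv A k \<omega> d) x"
    using cd im by (simp add: ext_deriv_eq pullback_def fun_eq_iff)
qed (auto simp: ext_deriv_eq)

lemma ext_deriv_add:
  assumes "\<alpha> \<in> smooth_forms A k" "\<beta> \<in> smooth_forms A k"
  shows "ext_deriv A k (\<alpha> + \<beta>) = ext_deriv A k \<alpha> + ext_deriv A k \<beta>"
  using ld_add[OF smooth_formsD(1)[OF assms(1)] smooth_formsD(1)[OF assms(2)]]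
  by (simp add: fun_eq_iff ext_deriv_eq plus_fun_def)

lemma ext_deriv_scale:
  assumes "\<alpha> \<in> smooth_forms A k"
  shows "ext_deriv A k (form_scale a \<alpha>) = form_scale a (ext_deriv A k \<alpha>)"
  using ld_cmult[OF smooth_formsD(1)[OF assms]]
  by (simp add: fun_eq_iff ext_deriv_eq form_scale_def)

lemma ext_deriv_0: "ext_deriv A k 0 = 0"
  by (auto simp: fun_eq_iff ext_deriv_eq ld_def)

lemma ext_deriv_uminus: "\<alpha> \<in> smooth_forms A k \<Longrightarrow> ext_deriv A k (- \<alpha>) = - ext_deriv A k \<alpha>"
  using ext_deriv_scale[of \<alpha> k "- 1"] by (simp add: form_scale_simps)

lemma ext_deriv_diff:
  "\<alpha> \<in> smooth_forms A k \<Longrightarrow> \<beta> \<in> smooth_forms A k \<Longrightarrow> ext_deriv A k (\<alpha> - \<beta>) = ext_deriv A k \<alpha> - ext_deriv A k \<beta>"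
  using ext_deriv_add[of \<alpha> k "- \<beta>"] by (simp add: uminus_smooth ext_deriv_uminus)

lemma ext_deriv_sum:
  "(\<And>i. i \<in> I \<Longrightarrow> \<omega> i \<in> smooth_forms A k) \<Longrightarrow> ext_deriv A k (\<Sum>i\<in>I. \<omega> i) = (\<Sum>i\<in>I. ext_deriv A k (\<omega> i))"
proof (induction I rule: infinite_finite_induct)
  case (insert i I)
  have "ext_deriv A k (\<omega> i + (\<Sum>i\<in>I. \<omega> i)) = ext_deriv A k (\<omega> i) + ext_deriv A k (\<Sum>i\<in>I. \<omega> i)"
    by (intro ext_deriv_add sum_smooth insert.prems) auto
  then show ?case unfolding sum.insert[OF insert(1,2)] using insert by (metis insertCI)
qed (simp_all add: ext_deriv_0)

lemma ext_deriv_ext_deriv: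
  assumes w: "\<omega> \<in> smooth_forms A k"
  shows "ext_deriv A (Suc k) (ext_deriv A k \<omega>) = 0"
proof (rule ext, rule ext, rule ext)
  fix c x v
  show "ext_deriv A (Suc k) (ext_deriv A k \<omega>) c x v = 0 c x v"
  proof (cases "c \<in> A \<and> x \<in> chart_img c")
    case True
    have "ld (Suc k) (ext_deriv A k \<omega> c) x v = ld (Suc k) (ld k (\<omega> c)) x v"
      by (rule ld_cong[OF chart(2)]) (use True in \<open>auto simp: ext_deriv_eq\<close>)
    then show ?thesis
      using ld_ld[OF smooth_formsD(1)[OF w] chart(2), of c x v] True by (simp add: ext_deriv_eq)
  qed (auto simp: ext_deriv_eq)
qed

text \<open>The form \<open>df \<and> \<omega>\<close>, for a function \<open>f\<close>.\<close>

definition dwedge :: "nat \<Rightarrow> ('a \<Rightarrow> complex) \<Rightarrow> ('a, 'n) form \<Rightarrow> ('a, 'n) form"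
  where "dwedge k f \<omega> = ext_deriv A k (fmult f \<omega>) - fmult f (ext_deriv A k \<omega>)"

lemma dwedge_smooth: "smooth_fun f \<Longrightarrow> \<omega> \<in> smooth_forms A k \<Longrightarrow> dwedge k f \<omega> \<in> smooth_forms A (Suc k)"
  unfolding dwedge_def by (intro diff_smooth ext_deriv_smooth fmult_smooth)

lemma ext_deriv_fmult: "ext_deriv A k (fmult f \<omega>) = dwedge k f \<omega> + fmult f (ext_deriv A k \<omega>)"
  by (simp add: dwedge_def)


lemma dwedge_sum:
  assumes "\<And>i. i \<in> I \<Longrightarrow> smooth_fun (f i)" "\<omega> \<in> smooth_forms A k"
  shows "(\<Sum>i\<in>I. dwedge k (f i) \<omega>) = dwedge k (\<lambda>p. \<Sum>i\<in>I. f i p) \<omega>"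
proof -
  have 1: "(\<Sum>i\<in>I. fmult (f i) \<eta>) = fmult (\<lambda>p. \<Sum>i\<in>I. f i p) \<eta>" for \<eta>
    by (induction I rule: infinite_finite_induct) (auto simp: fmult_def fun_eq_iff algebra_simps)
  show ?thesis
    using ext_deriv_sum[of I "\<lambda>i. fmult (f i) \<omega>" k] assms
    by (simp add: dwedge_def sum_subtractf 1 fmult_smooth)
qed

lemma fmult_sum_fun: "(\<Sum>i\<in>I. fmult (f i) \<eta>) = fmult (\<lambda>p. \<Sum>i\<in>I. f i p) \<eta>"
  by (induction I rule: infinite_finite_induct) (auto simp: fmult_def fun_eq_iff algebra_simps)

lemma fmult_add: "fmult f (\<alpha> + \<beta>) = fmult f \<alpha> + fmult f \<beta>"
  and fmult_0: "fmult f 0 = 0"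
  and fmult_commute: "fmult f (fmult g \<omega>) = fmult g (fmult f \<omega>)"
  by (auto simp: fmult_def fun_eq_iff algebra_simps)

text \<open>Serves partitions of unity, whose sum is 1 only on \<open>topspace X\<close>: off the
  chart image \<open>pt c x\<close> is an arbitrary point, but there the form is 0.\<close>

lemma form_vanishes_off_topspace:
  "\<omega> \<in> smooth_forms A k \<Longrightarrow> (\<And>p. p \<in> topspace X \<Longrightarrow> f p = g p) \<Longrightarrow> fmult f \<omega> = fmult g \<omega>"
  unfolding fmult_def fun_eq_iff
proof (intro allI)
  fix c x v assume w: "\<omega> \<in> smooth_forms A k" and fg: "\<And>p. p \<in> topspace X \<Longrightarrow> f p = g p"
  show "f (pt c x) * \<omega> c x v = g (pt c x) * \<omega> c x v"
  proof (cases "c \<in> A \<and> x \<in> chart_img c")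
    case True
    then have "pt c x \<in> topspace X" using subsetD[OF chart_subset pt_in] by blast
    then show ?thesis using fg by simp
  qed (simp add: smooth_formsD(3)[OF w])
qed

lemma dwedge_cong:
  assumes "\<omega> \<in> smooth_forms A k" "\<And>p. p \<in> topspace X \<Longrightarrow> f p = g p"
  shows "dwedge k f \<omega> = dwedge k g \<omega>"
  unfolding dwedge_def
  using form_vanishes_off_topspace[OF assms(1), of f g] form_vanishes_off_topspace[OF ext_deriv_smooth[OF assms(1)], of f g]
    assms(2) by simp

lemma dwedge_const: "\<omega> \<in> smooth_forms A k \<Longrightarrow> dwedge k (\<lambda>p. a) \<omega> = 0"
  by (simp add: dwedge_def form_scale_fmult[symmetric] ext_deriv_scale)

lemma ext_deriv_dwedge:
  assumes "smooth_fun f" "\<omega> \<in> smooth_forms A k" "ext_deriv A k \<omega> = 0"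
  shows "ext_deriv A (Suc k) (dwedge k f \<omega>) = 0"
  by (simp add: dwedge_def assms(3) fmult_0 ext_deriv_ext_deriv[OF fmult_smooth[OF assms(1,2)]])

subsection \<open>Wedge products\<close>

lemma wedge_smooth:
  assumes a: "\<alpha> \<in> smooth_forms A p" and b: "\<beta> \<in> smooth_forms A q"
  shows "wedge p q \<alpha> \<beta> \<in> smooth_forms A (p + q)"
proof (rule smooth_formsI)
  fix c assume c: "c \<in> A"
  show "local_form (chart_img c) (p + q) (wedge p q \<alpha> \<beta> c)"
    using local_form_wedge[OF chart(2)[OF c] smooth_formsD(1)[OF a c] smooth_formsD(1)[OF b c]]
    by (simp add: wedge_def)
next
  fix c d x assume "c \<in> A" "d \<in> A" "x \<in> overlap c d"
  then show "wedge p q \<alpha> \<beta> c x = pullback (transition c d) (wedge p q \<alpha> \<beta> d) x"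
    using smooth_formsD(2)[OF a] smooth_formsD(2)[OF b]
    by (simp add: wedge_def pullback_def fun_eq_iff wedge_alt_def)
next
  fix c x assume "\<not> (c \<in> A \<and> x \<in> chart_img c)"
  then have "\<alpha> c x = 0" by (rule smooth_formsD(3)[OF a])
  then show "wedge p q \<alpha> \<beta> c x = 0" by (simp add: wedge_def wedge_alt_def fun_eq_iff)
qed

lemma ext_deriv_wedge:
  assumes a: "\<alpha> \<in> smooth_forms A p" and b: "\<beta> \<in> smooth_forms A q"
  shows "ext_deriv A (p + q) (wedge p q \<alpha> \<beta>) =
    wedge (Suc p) q (ext_deriv A p \<alpha>) \<beta> + form_scale ((- 1) ^ p) (wedge p (Suc q) \<alpha> (ext_deriv A q \<beta>))"
proof (rule ext, rule ext, rule ext)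
  fix c x v
  show "ext_deriv A (p + q) (wedge p q \<alpha> \<beta>) c x v =
    (wedge (Suc p) q (ext_deriv A p \<alpha>) \<beta> + form_scale ((- 1) ^ p) (wedge p (Suc q) \<alpha> (ext_deriv A q \<beta>))) c x v"
  proof (cases "c \<in> A \<and> x \<in> chart_img c")
    case True
    then show ?thesis
      using ld_wedge[OF chart(2) _ smooth_formsD(1)[OF a] smooth_formsD(1)[OF b], of c x v]
      by (simp add: ext_deriv_eq wedge_def form_scale_def)
  next
    case False
    then have "\<alpha> c x = 0" "ext_deriv A p \<alpha> c x = 0" "ext_deriv A (p + q) (wedge p q \<alpha> \<beta>) c x = 0"
      using smooth_formsD(3)[OF a] by (auto simp: ext_deriv_eq)
    then show ?thesis
      by (simp add: wedge_def form_scale_def wedge_alt_def)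
  qed
qed

lemma wedge_linear:
  "wedge p q \<alpha> (\<beta> + \<gamma>) = wedge p q \<alpha> \<beta> + wedge p q \<alpha> \<gamma>"
  "wedge p q (\<alpha> + \<delta>) \<beta> = wedge p q \<alpha> \<beta> + wedge p q \<delta> \<beta>"
  "wedge p q \<alpha> (form_scale a \<beta>) = form_scale a (wedge p q \<alpha> \<beta>)"
  "wedge p q (form_scale a \<alpha>) \<beta> = form_scale a (wedge p q \<alpha> \<beta>)"
  "wedge p q \<alpha> (fmult f \<beta>) = fmult f (wedge p q \<alpha> \<beta>)"
  "wedge p q 0 \<beta> = 0" "wedge p q \<alpha> 0 = 0"
  by (simp_all add: fun_eq_iff wedge_def wedge_alt_def form_scale_def fmult_def algebra_simps
      sum.distrib sum_distrib_left sum_divide_distrib add_divide_distrib)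

lemma wedge_sum:
  fixes \<alpha> :: "('a, 'n) form"
  shows "wedge p q \<alpha> (\<Sum>i\<in>I. \<beta> i) = (\<Sum>i\<in>I. wedge p q \<alpha> (\<beta> i))"
  by (induction I rule: infinite_finite_induct) (simp_all only: sum.infinite sum.empty sum.insert wedge_linear not_False_eq_True)

lemma closed_even_wedge:
  assumes t: "\<theta> \<in> smooth_forms A p" "ext_deriv A p \<theta> = 0" "even p" and b: "\<beta> \<in> smooth_forms A q"
  shows "ext_deriv A (p + q) (wedge p q \<theta> \<beta>) = wedge p (Suc q) \<theta> (ext_deriv A q \<beta>)"
  using ext_deriv_wedge[OF t(1) b] t(2,3) by (simp add: wedge_linear form_scale_simps)

text \<open>Since \<open>dwedge\<close> is defined through d, the identity is the difference of two
  instances of \<open>closed_even_wedge\<close>, for \<open>fmult f \<beta>\<close> and for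
  \<open>\<beta>\<close>. The even degree of \<open>\<theta>\<close> removes the sign that df would
  pick up in passing it.\<close>

lemma wedge_dwedge:
  assumes t: "\<theta> \<in> smooth_forms A p" "ext_deriv A p \<theta> = 0" "even p"
    and b: "\<beta> \<in> smooth_forms A q" and f: "smooth_fun f"
  shows "wedge p (Suc q) \<theta> (dwedge q f \<beta>) = dwedge (p + q) f (wedge p q \<theta> \<beta>)"
proof -
  have "dwedge (p + q) f (wedge p q \<theta> \<beta>) = wedge p (Suc q) \<theta> (ext_deriv A q (fmult f \<beta>)) -
      wedge p (Suc q) \<theta> (fmult f (ext_deriv A q \<beta>))"
    unfolding dwedge_def
    using closed_even_wedge[OF t b] closed_even_wedge[OF t fmult_smooth[OF f b]] by (simp add: wedge_linear)
  also have "\<dots> = wedge p (Suc q) \<theta> (dwedge q f \<beta>)"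
    unfolding ext_deriv_fmult[of q f \<beta>] wedge_linear(1) by simp
  finally show ?thesis ..
qed

lemma unit_smooth: "unit_form A \<in> smooth_forms A 0"
proof (rule smooth_formsI)
  fix c assume c: "c \<in> A"
  have "local_form (chart_img c) 0 (\<lambda>x v. 1)"
    by (simp add: local_form_def smooth_on_const alternating_form_def)
  then show "local_form (chart_img c) 0 (unit_form A c)"
    using local_form_cong[OF chart(2)[OF c], of "unit_form A c" "\<lambda>x v. 1"] c
    by (simp add: unit_form_def)
next
  fix c d x assume "c \<in> A" "d \<in> A" "x \<in> overlap c d"
  then show "unit_form A c x = pullback (transition c d) (unit_form A d) x"
    by (auto simp: unit_form_def pullback_def overlapD transition_eq)
qed (auto simp: unit_form_def fun_eq_iff)

lemma ext_deriv_unit: "ext_deriv A 0 (unit_form A) = 0"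
proof (rule ext, rule ext, rule ext)
  fix c x v
  show "ext_deriv A 0 (unit_form A) c x v = 0 c x v"
  proof (cases "c \<in> A \<and> x \<in> chart_img c")
    case True
    have "ld 0 (unit_form A c) x v = ld 0 (\<lambda>x v. 1) x v"
      by (rule ld_cong[OF chart(2)]) (use True in \<open>auto simp: unit_form_def\<close>)
    then show ?thesis using True by (simp add: ext_deriv_eq ld_def)
  qed (auto simp: ext_deriv_eq)
qed

lemma wedge_unit: "\<theta> \<in> smooth_forms A p \<Longrightarrow> wedge p 0 \<theta> (unit_form A) = \<theta>"
proof (rule ext, rule ext, rule ext)
  fix c x v assume t: "\<theta> \<in> smooth_forms A p"
  show "wedge p 0 \<theta> (unit_form A) c x v = \<theta> c x v"
  proof (cases "c \<in> A \<and> x \<in> chart_img c")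
    case True
    have "alternating_form 0 (unit_form A c x)"
      using local_formD1[OF smooth_formsD(1)[OF unit_smooth]] True by blast
    then show ?thesis
      using wedge_alt_0[OF local_formD1[OF smooth_formsD(1)[OF t]], of c x "unit_form A c x" v] True
      by (simp add: wedge_def unit_form_def)
  next
    case False
    then show ?thesis using smooth_formsD(3)[OF t False] by (simp add: wedge_def wedge_alt_def)
  qed
qed

lemma form_power_smooth: "\<omega> \<in> smooth_forms A 2 \<Longrightarrow> form_power A \<omega> k \<in> smooth_forms A (2 * k)"
proof (induction k)
  case (Suc k)
  then show ?case using wedge_smooth[of \<omega> 2 "form_power A \<omega> k" "2 * k"] by simp
qed (simp add: unit_smooth)

subsection \<open>Supports\<close>

definition vanishes_off :: "'a set \<Rightarrow> ('a, 'n) form \<Rightarrow> bool"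
  where "vanishes_off K \<omega> \<longleftrightarrow> (\<forall>c\<in>A. \<forall>x\<in>chart_img c. pt c x \<notin> K \<longrightarrow> \<omega> c x = 0)"

text \<open>Support contained in \<open>U\<close> is witnessed by some closed set inside
  \<open>U\<close>. On a compact \<open>X\<close> that set is compact, so this is the notion of
  compact support in \<open>U\<close>.\<close>

definition supp_in :: "'a set \<Rightarrow> ('a, 'n) form \<Rightarrow> bool"
  where "supp_in U \<omega> \<longleftrightarrow> (\<exists>K\<subseteq>U. closedin X K \<and> vanishes_off K \<omega>)"

definition fun_supp_in :: "'a set \<Rightarrow> ('a \<Rightarrow> complex) \<Rightarrow> bool"
  where "fun_supp_in U f \<longleftrightarrow> (\<exists>K\<subseteq>U. closedin X K \<and> (\<forall>p\<in>topspace X - K. f p = 0))"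

lemma supp_in_mono: "supp_in U \<omega> \<Longrightarrow> U \<subseteq> V \<Longrightarrow> supp_in V \<omega>"
  unfolding supp_in_def by blast

lemma supp_in_0: "supp_in U 0"
  unfolding supp_in_def vanishes_off_def by (rule exI[of _ "{}"]) simp

lemma supp_in_add: "supp_in U \<alpha> \<Longrightarrow> supp_in U \<beta> \<Longrightarrow> supp_in U (\<alpha> + \<beta>)"
  unfolding supp_in_def
proof (elim exE conjE)
  fix K L assume "K \<subseteq> U" "L \<subseteq> U" "closedin X K" "closedin X L" "vanishes_off K \<alpha>" "vanishes_off L \<beta>"
  then show "\<exists>K\<subseteq>U. closedin X K \<and> vanishes_off K (\<alpha> + \<beta>)"
    by (intro exI[of _ "K \<union> L"]) (auto simp: vanishes_off_def)
qed

lemma supp_in_fmult: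
  assumes "supp_in U \<omega>" shows "supp_in U (fmult f \<omega>)"
proof -
  obtain K where K: "K \<subseteq> U" "closedin X K" "vanishes_off K \<omega>" using assms unfolding supp_in_def by blast
  from K(3) have "vanishes_off K (fmult f \<omega>)" by (simp add: vanishes_off_def fmult_def fun_eq_iff)
  with K(1,2) show ?thesis unfolding supp_in_def by blast
qed

lemma supp_in_fmult_fun:
  assumes "fun_supp_in U f" shows "supp_in U (fmult f \<omega>)"
proof -
  obtain K where K: "K \<subseteq> U" "closedin X K" "\<forall>p\<in>topspace X - K. f p = 0"
    using assms unfolding fun_supp_in_def by blast
  have "vanishes_off K (fmult f \<omega>)"
    unfolding vanishes_off_def
  proof (intro ballI impI)
    fix c x assume "c \<in> A" "x \<in> chart_img c" "pt c x \<notin> K"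
    then have "f (pt c x) = 0" using K(3) chart_subset[of c] pt_in[of x c] by blast
    then show "fmult f \<omega> c x = 0" by (simp add: fmult_def fun_eq_iff)
  qed
  then show ?thesis using K unfolding supp_in_def by blast
qed

lemma supp_in_Int: "supp_in U \<omega> \<Longrightarrow> supp_in V \<omega> \<Longrightarrow> supp_in (U \<inter> V) \<omega>"
  unfolding supp_in_def
proof (elim exE conjE)
  fix K L assume "K \<subseteq> U" "L \<subseteq> V" "closedin X K" "closedin X L" "vanishes_off K \<omega>" "vanishes_off L \<omega>"
  then show "\<exists>K\<subseteq>U \<inter> V. closedin X K \<and> vanishes_off K \<omega>"
    by (intro exI[of _ "K \<inter> L"]) (auto simp: vanishes_off_def)
qed

lemma supp_in_scale: "supp_in U \<omega> \<Longrightarrow> supp_in U (form_scale a \<omega>)"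
  unfolding form_scale_fmult by (rule supp_in_fmult)

lemma supp_in_diff: "supp_in U \<alpha> \<Longrightarrow> supp_in U \<beta> \<Longrightarrow> supp_in U (\<alpha> - \<beta>)"
  using supp_in_add[of U \<alpha> "form_scale (- 1) \<beta>"] supp_in_scale[of U \<beta> "- 1"] by (simp add: form_scale_simps)

lemma supp_in_sum: "(\<And>i. i \<in> I \<Longrightarrow> supp_in U (\<omega> i)) \<Longrightarrow> supp_in U (\<Sum>i\<in>I. \<omega> i)"
  by (induction I rule: infinite_finite_induct) (auto intro: supp_in_add supp_in_0)

lemma vanishes_off_ext_deriv:
  assumes "closedin X K" "vanishes_off K \<omega>"
  shows "vanishes_off K (ext_deriv A k \<omega>)"
  unfolding vanishes_off_def
proof (intro ballI impI)
  fix c x assume c: "c \<in> A" "x \<in> chart_img c" "pt c x \<notin> K"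
  let ?U = "{x \<in> chart_img c. pt c x \<in> topspace X - K}"
  have U: "open ?U" by (rule open_chart_part[OF c(1)]) (use assms(1) in blast)
  have "x \<in> ?U" using c chart_subset[OF c(1)] by auto
  then have "ld k (\<omega> c) x v = ld k (\<lambda>x v. 0) x v" for v
    by (rule ld_cong[OF U]) (use assms(2) c in \<open>auto simp: vanishes_off_def fun_eq_iff\<close>)
  then show "ext_deriv A k \<omega> c x = 0" by (simp add: ext_deriv_eq fun_eq_iff)
qed

lemma supp_in_ext_deriv: "supp_in U \<omega> \<Longrightarrow> supp_in U (ext_deriv A k \<omega>)"
  unfolding supp_in_def using vanishes_off_ext_deriv by blast

lemma supp_in_dwedge: "supp_in U \<omega> \<Longrightarrow> supp_in U (dwedge k f \<omega>)"
  unfolding dwedge_def by (intro supp_in_diff supp_in_ext_deriv supp_in_fmult)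

lemma supp_in_dwedge_fun: "fun_supp_in U f \<Longrightarrow> supp_in U (dwedge k f \<omega>)"
  unfolding dwedge_def by (intro supp_in_diff supp_in_ext_deriv supp_in_fmult_fun)

lemma supp_in_empty:
  assumes "\<omega> \<in> smooth_forms A k" "supp_in {} \<omega>" shows "\<omega> = 0"
proof (rule form_eqI[OF assms(1) zero_smooth])
  fix p assume "p \<in> topspace X"
  then obtain c where "c \<in> A" "p \<in> fst c" using covers by blast
  then show "\<exists>c\<in>A. p \<in> fst c \<and> \<omega> c (snd c p) = 0 c (snd c p)"
    using assms(2) by (intro bexI[of _ c]) (auto simp: supp_in_def vanishes_off_def)
qed

subsection \<open>Extension by zero\<close>

lemma smooth_on_extend:
  assumes c: "c \<in> A" and d: "d \<in> A" and C: "compact C" "C \<subseteq> chart_img c"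
    and sm: "smooth_on (overlap d c) h" and z: "\<And>x. x \<in> chart_img d \<Longrightarrow> pt d x \<notin> pt c ` C \<Longrightarrow> h x = 0"
  shows "smooth_on (chart_img d) h"
proof -
  let ?V = "{x \<in> chart_img d. pt d x \<in> topspace X - pt c ` C}"
  have V: "open ?V" by (rule open_chart_part[OF d]) (use compactin_pt_image[OF c C] in blast)
  have "smooth_on ?V (\<lambda>x. 0 :: 'b)" by (rule smooth_on_const)
  then have 1: "smooth_on ?V h" by (subst smooth_on_cong[OF V, of h "\<lambda>x. 0"]) (use z in auto)
  have "smooth_on (overlap d c \<union> ?V) h"
    by (rule smooth_on_Un[OF open_overlap[OF d c] V sm 1])
  moreover have "chart_img d \<subseteq> overlap d c \<union> ?V"
    using C(2) chart_subset[OF d] by (auto simp: overlapD[OF d])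
  ultimately show ?thesis by (rule smooth_on_subset)
qed

definition extend :: "('a, 'n) chart \<Rightarrow> (complex^'n \<Rightarrow> (nat \<Rightarrow> complex^'n) \<Rightarrow> complex) \<Rightarrow> ('a, 'n) form"
  where "extend c w = (\<lambda>d x. if d \<in> A \<and> x \<in> overlap d c then pullback (transition d c) w x else 0)"

lemma extend_self: "c \<in> A \<Longrightarrow> x \<in> chart_img c \<Longrightarrow> extend c w c x = w x"
  by (auto simp: extend_def overlapD pullback_def fd_transition_self transition_eq fun_eq_iff)

lemma extend_vanishes:
  assumes c: "c \<in> A" and C: "C \<subseteq> chart_img c" "\<And>x. x \<in> chart_img c \<Longrightarrow> x \<notin> C \<Longrightarrow> w x = 0"
  shows "vanishes_off (pt c ` C) (extend c w)"
  unfolding vanishes_off_def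
proof (intro ballI impI)
  fix d x assume d: "d \<in> A" "x \<in> chart_img d" "pt d x \<notin> pt c ` C"
  show "extend c w d x = 0"
  proof (cases "x \<in> overlap d c")
    case True
    then have p: "pt d x \<in> fst c" using d by (simp add: overlapD)
    have "snd c (pt d x) \<notin> C"
    proof
      assume "snd c (pt d x) \<in> C"
      then have "pt c (snd c (pt d x)) \<in> pt c ` C" by blast
      then show False using d(3) p c by simp
    qed
    then have "w (transition d c x) = 0" using C(2) p by (simp add: transition_eq)
    then show ?thesis by (simp add: extend_def pullback_def fun_eq_iff)
  qed (simp add: extend_def)
qed

lemma extend_smooth:
  assumes c: "c \<in> A" and C: "compact C" "C \<subseteq> chart_img c" "\<And>x. x \<in> chart_img c \<Longrightarrow> x \<notin> C \<Longrightarrow> w x = 0"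
    and w: "local_form (chart_img c) k w"
  shows "extend c w \<in> smooth_forms A k"
proof (rule smooth_formsI)
  fix d assume d: "d \<in> A"
  have ov: "\<And>x. x \<in> overlap d c \<Longrightarrow> transition d c x \<in> chart_img c"
    using c d by (auto simp: overlapD transition_eq)
  have pb: "local_form (overlap d c) k (pullback (transition d c) w)"
    by (rule local_form_pullback[OF open_overlap[OF d c] transition_smooth[OF d c] ov w])
  have "local_form (overlap d c) k (extend c w d)"
    using local_form_cong[OF open_overlap[OF d c], of "extend c w d" "pullback (transition d c) w" k] pb d
    by (simp add: extend_def)
  then have sm: "smooth_on (overlap d c) (\<lambda>x. extend c w d x v)" for v by (rule local_formD2)
  show "local_form (chart_img d) k (extend c w d)"
    unfolding local_form_def
  proof (intro conjI ballI allI)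
    show "alternating_form k (extend c w d x)" for x
      using local_formD1[OF pb] alternating_0[of k] by (auto simp: extend_def zero_fun_def)
    show "smooth_on (chart_img d) (\<lambda>x. extend c w d x v)" for v
      by (rule smooth_on_extend[OF c d C(1,2) sm])
        (use extend_vanishes[OF c C(2,3)] d in \<open>auto simp: vanishes_off_def\<close>)
  qed
next
  fix d e x assume de: "d \<in> A" "e \<in> A" "x \<in> overlap d e"
  then have iff: "transition d e x \<in> overlap e c \<longleftrightarrow> x \<in> overlap d c"
    by (auto simp: overlapD transition_eq)
  show "extend c w d x = pullback (transition d e) (extend c w e) x"
  proof (cases "x \<in> overlap d c")
    case True
    have "transition e c (transition d e x) = transition d c x"
      using de True by (auto simp: overlapD transition_eq)
    then show ?thesis
      using de True iff fd_transition_trans[OF de(1,2) c de(3) True]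
      by (simp add: extend_def pullback_def fun_eq_iff)
  next
    case False
    then show ?thesis using iff by (simp add: extend_def pullback_def fun_eq_iff)
  qed
qed (auto simp: extend_def overlapD)

lemma smooth_fun_extend:
  assumes c: "c \<in> A" and C: "compact C" "C \<subseteq> chart_img c" "\<And>x. x \<in> chart_img c \<Longrightarrow> x \<notin> C \<Longrightarrow> h x = 0"
    and h: "smooth_on (chart_img c) h"
  shows "smooth_fun (\<lambda>p. if p \<in> fst c then h (snd c p) else 0)"
    and "p \<notin> pt c ` C \<Longrightarrow> (if p \<in> fst c then h (snd c p) else 0) = 0"
proof -
  let ?f = "\<lambda>p. if p \<in> fst c then h (snd c p) else 0"
  have z: "?f p = 0" if "p \<notin> pt c ` C" for p
  proof -
    have "snd c p \<notin> C" if "p \<in> fst c"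
      using \<open>p \<notin> pt c ` C\<close> pt_chart[OF c that] by (metis image_eqI)
    then show ?thesis using C(3) by auto
  qed
  then show "p \<notin> pt c ` C \<Longrightarrow> ?f p = 0" .
  show "smooth_fun ?f"
    unfolding smooth_fun_def
  proof
    fix d assume d: "d \<in> A"
    show "smooth_on (chart_img d) (\<lambda>x. ?f (pt d x))"
    proof (rule smooth_on_extend[OF c d C(1,2)])
      have "smooth_on (overlap d c) (\<lambda>x. h (transition d c x))"
        by (rule smooth_on_compose[OF open_overlap[OF d c] transition_smooth[OF d c] h])
          (use c d in \<open>auto simp: overlapD transition_eq\<close>)
      then show "smooth_on (overlap d c) (\<lambda>x. ?f (pt d x))"
        by (subst smooth_on_cong[OF open_overlap[OF d c], of _ "\<lambda>x. h (transition d c x)"])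
          (auto simp: overlapD[OF d] transition_eq)
    qed (use z in blast)
  qed
qed

end


section \<open>Compactly supported primitives on a cube, one coordinate direction at a time\<close>

section \<open>The Poincare lemma with compact supports on a cube\<close>

text \<open>An injective choice of \<open>m\<close> vectors from a set of \<open>m\<close>
  generators is a permutation of the frame, so the value on the frame determines all others up to
  sign.\<close>

lemma alternating_eq_0_frame:
  fixes \<alpha> :: "(nat \<Rightarrow> 'v::real_vector) \<Rightarrow> complex"
  assumes \<alpha>: "alternating_form m \<alpha>" and fr: "bij_betw fr {..<m} B" "span B = UNIV" and z: "\<alpha> fr = 0"
  shows "\<alpha> v = 0"
proof (rule alternating_eq_0[OF \<alpha>])
  show "finite B" using bij_betw_finite[OF fr(1)] by simp
  show "v i \<in> span B" for i by (simp add: fr(2))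
  fix w :: "nat \<Rightarrow> 'v" assume w: "\<And>i. i < m \<Longrightarrow> w i \<in> B" "inj_on w {..<m}"
  define s where "s i = (if i < m then inv_into {..<m} fr (w i) else i)" for i
  have s: "s i < m" "fr (s i) = w i" if "i < m" for i
    using bij_betw_inv_into_right[OF fr(1) w(1)[OF that]] bij_betw_apply[OF bij_betw_inv_into[OF fr(1)] w(1)[OF that]]
    by (auto simp: s_def that)
  have "inj_on s {..<m}"
    by (rule inj_onI) (metis inj_onD lessThan_iff s(2) w(2))
  moreover have "s ` {..<m} \<subseteq> {..<m}" using s by auto
  ultimately have "bij_betw s {..<m} {..<m}"
    by (simp add: bij_betw_def endo_inj_surj)
  then have "s permutes {..<m}" by (rule bij_imp_permutes) (simp add: s_def)
  from alternating_permute[OF \<alpha> this, of fr] have "\<alpha> (\<lambda>i. fr (s i)) = 0" by (simp add: z)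
  moreover have "\<alpha> w = \<alpha> (\<lambda>i. fr (s i))"
    by (rule mlinearD1[OF alternating_mlinear[OF \<alpha>]]) (simp add: s)
  ultimately show "\<alpha> w = 0" by simp
qed

lemma alternating_top_eq_0:
  fixes \<alpha> :: "(nat \<Rightarrow> 'v::euclidean_space) \<Rightarrow> complex"
  assumes \<alpha>: "alternating_form DIM('v) \<alpha>" and fr: "bij_betw fr {..<DIM('v)} Basis" and z: "\<alpha> fr = 0"
  shows "\<alpha> v = 0"
  by (rule alternating_eq_0_frame[OF \<alpha> fr _ z]) simp

lemma omit_case_nat: "omit 0 (case_nat e v) = v" "omit (Suc i) (case_nat e v) = case_nat e (omit i v)"
  by (auto simp: omit_def fun_eq_iff split: nat.split)

lemma alternating_contract:
  assumes "alternating_form (Suc k) \<alpha>"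
  shows "alternating_form k (\<lambda>v. \<alpha> (case_nat e v))"
  unfolding alternating_form_iff mlinear_def
proof (intro conjI allI impI)
  note m = alternating_mlinear[OF assms]
  show "\<alpha> (case_nat e v) = \<alpha> (case_nat e w)" if "\<forall>i<k. v i = w i" for v w
    by (rule mlinearD1[OF m]) (use that in \<open>auto split: nat.split\<close>)
  show "linear (\<lambda>x. \<alpha> (case_nat e (v(i := x))))" if "i < k" for v i
  proof -
    have "case_nat e (v(i := x)) = (case_nat e v)(Suc i := x)" for x
      by (auto simp: fun_eq_iff split: nat.split)
    then show ?thesis using mlinearD2[OF m, of "Suc i"] that by simp
  qed
  show "\<alpha> (case_nat e v) = 0" if "i < k" "j < k" "i \<noteq> j \<and> v i = v j" for v i j
    by (rule alternating_repeat[OF assms, of "Suc i" "Suc j"]) (use that in auto)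
qed

lemma local_form_line_continuous:
  assumes "local_form UNIV k w"
  shows "continuous_on T (\<lambda>t. w (x + t *\<^sub>R e) v)"
  by (rule continuous_on_compose2[OF smooth_on_continuous_on[OF local_formD2[OF assms]]])
    (auto intro!: continuous_intros)

lemma local_form_line_integral:
  fixes w :: "'v::euclidean_space \<Rightarrow> (nat \<Rightarrow> 'v) \<Rightarrow> complex"
  assumes w: "local_form UNIV (Suc k) w"
  shows "local_form UNIV k (\<lambda>x v. integral {a..b} (\<lambda>t. w (x + t *\<^sub>R e) (case_nat e v)))"
  unfolding local_form_def
proof (intro conjI ballI allI)
  fix v
  show "smooth_on UNIV (\<lambda>x. integral {a..b} (\<lambda>t. w (x + t *\<^sub>R e) (case_nat e v)))"
    by (rule integral_shift_Ck_on[OF open_UNIV local_formD2[OF w]]) (auto intro!: continuous_intros)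
next
  fix x
  have alt: "alternating_form k (\<lambda>v. w y (case_nat e v))" for y
    by (rule alternating_contract[OF local_formD1[OF w]]) simp
  note m = alternating_mlinear[OF alt]
  have int: "(\<lambda>t. w (x + t *\<^sub>R e) u) integrable_on {a..b}" for u
    by (rule integrable_continuous_real[OF local_form_line_continuous[OF w]])
  show "alternating_form k (\<lambda>v. integral {a..b} (\<lambda>t. w (x + t *\<^sub>R e) (case_nat e v)))"
    unfolding alternating_form_iff mlinear_def
  proof (intro conjI allI impI)
    show "integral {a..b} (\<lambda>t. w (x + t *\<^sub>R e) (case_nat e v)) = integral {a..b} (\<lambda>t. w (x + t *\<^sub>R e) (case_nat e v'))"
      if "\<forall>i<k. v i = v' i" for v v'
      using mlinearD1[OF m, of v v'] that by simp
    show "integral {a..b} (\<lambda>t. w (x + t *\<^sub>R e) (case_nat e v)) = 0" if "i < k" "j < k" "i \<noteq> j \<and> v i = v j" for v i j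
      using alternating_repeat[OF alt, of i j v] that by simp
    show "linear (\<lambda>z. integral {a..b} (\<lambda>t. w (x + t *\<^sub>R e) (case_nat e (v(i := z)))))" if i: "i < k" for v i
      by (rule linearI) (simp_all only: mlinear_add[OF m i] mlinear_scaleR[OF m i] integral_add[OF int int] integral_cmul)
  qed
qed

text \<open>Closedness evaluated on \<open>e\<close> followed by \<open>v\<close> says that the
  alternating sum of derivatives of the contraction with \<open>e\<close> is the derivative of
  \<open>w\<close> along \<open>e\<close> (Cartan's formula for a constant field). The fundamental
  theorem then integrates it along the line.\<close>

lemma ld_line_integral:
  fixes w :: "'v::euclidean_space \<Rightarrow> (nat \<Rightarrow> 'v) \<Rightarrow> complex"
  assumes w: "local_form UNIV (Suc k) w" and closed: "\<And>x v. ld (Suc k) w x v = 0" and ab: "a \<le> b"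
  shows "ld k (\<lambda>x v. integral {a..b} (\<lambda>t. w (x + t *\<^sub>R e) (case_nat e v))) x v =
    w (x + b *\<^sub>R e) v - w (x + a *\<^sub>R e) v"
proof -
  let ?D = "\<lambda>i y. fd (\<lambda>y. w y (case_nat e (omit i v))) y (v i)"
  have D: "(\<Sum>i\<le>k. (- 1) ^ i * ?D i y) = fd (\<lambda>y. w y v) y e" for y
  proof -
    have "fd (\<lambda>y. w y v) y e + (\<Sum>i\<le>k. - ((- 1) ^ i * ?D i y)) = 0"
      using closed[of y "case_nat e v"]
      by (simp add: ld_def sum.atMost_Suc_shift omit_case_nat del: sum.atMost_Suc)
    then show ?thesis by (simp add: sum_negf)
  qed
  have c: "continuous_on {a..b} (\<lambda>t. ?D i (x + t *\<^sub>R e))" for i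
    by (rule continuous_on_compose2[OF smooth_on_continuous_on[OF smooth_on_fd[OF local_formD2[OF w]]]])
      (auto intro!: continuous_intros)
  have "ld k (\<lambda>x v. integral {a..b} (\<lambda>t. w (x + t *\<^sub>R e) (case_nat e v))) x v =
      (\<Sum>i\<le>k. (- 1) ^ i * integral {a..b} (\<lambda>t. ?D i (x + t *\<^sub>R e)))"
    unfolding ld_def
    by (intro sum.cong refl arg_cong2[of _ _ _ _ "(*)"] integral_shift_fd[OF open_UNIV local_formD2[OF w] _ open_UNIV])
      (auto intro!: continuous_intros)
  also have "\<dots> = integral {a..b} (\<lambda>t. \<Sum>i\<le>k. (- 1) ^ i * ?D i (x + t *\<^sub>R e))"
    by (subst integral_sum) (auto intro!: integrable_continuous_real continuous_intros c)
  also have "\<dots> = integral {a..b} (\<lambda>t. fd (\<lambda>y. w y v) (x + t *\<^sub>R e) e)" by (simp only: D)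
  also have "\<dots> = w (x + b *\<^sub>R e) v - w (x + a *\<^sub>R e) v"
    by (rule integral_fd_line[OF local_formD3[OF w] ab]) simp
  finally show ?thesis .
qed

lemma integral_shift_support:
  fixes f :: "real \<Rightarrow> complex"
  assumes c: "continuous_on UNIV f" and z: "\<And>t. f t \<noteq> 0 \<Longrightarrow> t \<in> {a..b} \<inter> {a + s..b + s}"
  shows "integral {a..b} (\<lambda>t. f (t + s)) = integral {a..b} f"
proof -
  have U: "integral {u..v} f = integral UNIV f" if "\<And>t. f t \<noteq> 0 \<Longrightarrow> t \<in> {u..v}" for u v
  proof -
    have "(f has_integral integral {u..v} f) {u..v}"
      using integrable_continuous_real[OF continuous_on_subset[OF c]] by (simp add: integrable_integral)
    then have "(f has_integral integral {u..v} f) UNIV"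
      by (rule has_integral_on_superset) (use that in auto)
    then show ?thesis by (rule integral_unique[symmetric])
  qed
  have "integral {a..b} (\<lambda>t. f (t + s)) = integral {a + s..b + s} f"
    using integral_shift[of a s b f] continuous_on_subset[OF c] by (simp add: o_def)
  then show ?thesis using U[of a b] U[of "a + s" "b + s"] z by auto
qed

text \<open>All forms are supported in the closed cube \<open>Cx\<close> of half side
  \<open>\<rho>\<close>; the larger open cube \<open>Bx\<close> leaves a margin in which primitives
  can be cut off. The function \<open>st\<close> rises from 0 to 1 across the inner cube, so its
  derivative \<open>bp\<close> is a profile supported there.\<close>

locale cube =
  fixes p :: "'v::euclidean_space" and r \<rho> :: real
  assumes rho: "0 < \<rho>" "\<rho> < r"
begin

definition co where "co x e = (x - p) \<bullet> e"
definition Bx where "Bx = {x. \<forall>b\<in>Basis. \<bar>co x b\<bar> < r}"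
definition Cx where "Cx = {x. \<forall>b\<in>Basis. \<bar>co x b\<bar> \<le> \<rho>}"
definition st where "st s = smooth_step ((s + \<rho>) / (2 * \<rho>))"
definition bp where "bp s = fd st s 1"

lemma co_add: "co (x + t *\<^sub>R e) b = co x b + t * (e \<bullet> b)"
  by (simp add: co_def inner_add_left inner_diff_left)

lemma co_line: "e \<in> Basis \<Longrightarrow> b \<in> Basis \<Longrightarrow> co (x + t *\<^sub>R e) b = (if b = e then co x b + t else co x b)"
  by (simp add: co_add inner_Basis)

lemma continuous_co: "continuous_on UNIV (\<lambda>x. co x b)"
  unfolding co_def by (intro continuous_intros)

lemma open_Bx: "open Bx"
proof -
  have "Bx = (\<Inter>b\<in>Basis. {x. \<bar>co x b\<bar> < r})" by (auto simp: Bx_def)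
  moreover have "open {x. \<bar>co x b\<bar> < r}" for b
    by (intro open_Collect_less continuous_on_rabs continuous_co continuous_on_const)
  ultimately show ?thesis by (simp add: open_INT)
qed

lemma closed_Cx: "closed Cx"
proof -
  have "Cx = (\<Inter>b\<in>Basis. {x. \<bar>co x b\<bar> \<le> \<rho>})" by (auto simp: Cx_def)
  moreover have "closed {x. \<bar>co x b\<bar> \<le> \<rho>}" for b
    by (intro closed_Collect_le continuous_on_rabs continuous_co continuous_on_const)
  ultimately show ?thesis by auto
qed

lemma compact_Cx: "compact Cx"
proof (rule compact_eq_bounded_closed[THEN iffD2, OF conjI])
  have "norm (x - p) \<le> (\<Sum>b\<in>(Basis :: 'v set). \<rho>)" if "x \<in> Cx" for x
    using norm_le_l1[of "x - p"] sum_mono[of Basis "\<lambda>b. \<bar>(x - p) \<bullet> b\<bar>" "\<lambda>b. \<rho>"] that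
    by (auto simp: Cx_def co_def)
  then show "bounded Cx" by (intro boundedI[of _ "norm p + (\<Sum>b\<in>(Basis :: 'v set). \<rho>)"]) (metis add.commute add_left_mono norm_triangle_sub order_trans)
qed (rule closed_Cx)

lemma Cx_subset: "Cx \<subseteq> Bx"
  using rho by (fastforce simp: Bx_def Cx_def)

lemma smooth_st: "smooth_on UNIV st"
proof -
  have "smooth_on UNIV (\<lambda>s. smooth_step (1 / 2 + (1 / (2 * \<rho>)) * s))"
    by (rule smooth_on_reflect[OF smooth_on_smooth_step])
  moreover have "1 / 2 + (1 / (2 * \<rho>)) * s = (s + \<rho>) / (2 * \<rho>)" for s
    using rho by (simp add: field_simps)
  ultimately show ?thesis by (simp add: st_def[abs_def])
qed

lemma st_0: "s \<le> - \<rho> \<Longrightarrow> st s = 0" and st_1: "\<rho> \<le> s \<Longrightarrow> st s = 1"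
  using rho by (auto simp: st_def field_simps intro!: smooth_step_eq_0 smooth_step_eq_1)

lemma st_derivative: "(st has_derivative (\<lambda>v. v * bp s)) (at s)"
proof -
  have "fd st s v = v * bp s" for v
    using linear_cmul[OF smooth_on_linear_fd[OF smooth_st], of s v 1] by (simp add: bp_def)
  then have "frechet_derivative st (at s) = (\<lambda>v. v * bp s)" by (rule ext)
  then show ?thesis using smooth_on_has_derivative[OF smooth_st, of s] by simp
qed

lemma bp_0: assumes "\<rho> < \<bar>s\<bar>" shows "bp s = 0"
proof -
  define S where "S = (if s < 0 then {..<-\<rho>} else {\<rho><..})"
  have "frechet_derivative st (at s) = frechet_derivative (\<lambda>x. if s < 0 then 0 else 1) (at s)"
    by (rule fd_cong[of S]) (use assms in \<open>auto simp: S_def st_0 st_1\<close>)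
  then show ?thesis by (simp add: bp_def)
qed

lemma bp_nonzero: obtains s where "bp s \<noteq> 0"
proof (rule ccontr)
  assume "\<not> thesis"
  then have "bp s = 0" for s using that by blast
  then have "(st has_derivative (\<lambda>v. 0)) (at s within UNIV)" for s using st_derivative[of s] by simp
  then obtain c where "\<And>s. s \<in> UNIV \<Longrightarrow> st s = c"
    using has_derivative_zero_constant[of UNIV st] by auto
  then show False using st_0[of "- \<rho>"] st_1[of \<rho>] by simp
qed

definition cube_supp where "cube_supp w \<longleftrightarrow> (\<forall>x v. x \<notin> Cx \<longrightarrow> w x v = (0 :: complex))"

definition cube_form where "cube_form k w \<longleftrightarrow> local_form UNIV k w \<and> cube_supp w \<and> (\<forall>x v. ld k w x v = 0)"

definition line_int where "line_int a b e w = (\<lambda>x v. integral {a..b} (\<lambda>t. w (x + t *\<^sub>R e) (case_nat e v)) :: complex)"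

text \<open>One step of the Poincare lemma: \<open>htpy e w\<close> is the primitive of \<open>w\<close> along \<open>e\<close> that starts from \<open>0\<close>, minus
  \<open>st\<close> times its final value, so that its support stays in the cube. What remains of \<open>w\<close> is \<open>red e w\<close>,
  the product of \<open>d (st (x\<^sub>e))\<close> with the fibre integral of \<open>w\<close> along \<open>e\<close>.\<close>

definition htpy where "htpy e w = (\<lambda>x v. if x \<in> Bx
    then line_int (- 2 * r) 0 e w x v - of_real (st (co x e)) * line_int (- 2 * r) (2 * r) e w x v else 0)"

definition red where "red k e w = (\<lambda>x v. of_real (bp (co x e)) *
    (\<Sum>i\<le>k. (- 1) ^ i * (of_real (v i \<bullet> e) * line_int (- 2 * r) (2 * r) e w x (omit i v))))"

lemma line_int_supp:
  assumes "cube_supp w" "\<And>t. t \<in> {a..b} \<Longrightarrow> x + t *\<^sub>R e \<notin> Cx"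
  shows "line_int a b e w x v = 0"
proof -
  have "line_int a b e w x v = integral {a..b} (\<lambda>t. 0)"
    unfolding line_int_def by (rule integral_cong) (use assms in \<open>auto simp: cube_supp_def\<close>)
  then show ?thesis by simp
qed

lemma smooth_co_comp:
  assumes "smooth_on UNIV h"
  shows "smooth_on UNIV (\<lambda>x. complex_of_real (h (co x e)))"
proof (intro smooth_on_bounded_linear[OF open_UNIV bounded_linear_of_real] smooth_on_compose[OF open_UNIV _ assms])
  have "smooth_on UNIV (\<lambda>x. (\<lambda>y. y \<bullet> e) (x + - p))"
    by (intro smooth_on_bounded_linear[OF open_UNIV bounded_linear_inner_left] smooth_on_add smooth_on_id smooth_on_const) auto
  then show "smooth_on UNIV (\<lambda>x. co x e)" by (simp add: co_def)
qed auto

lemma fd_st_co: "fd (\<lambda>x. complex_of_real (st (co x e))) x v = of_real (bp (co x e)) * of_real (v \<bullet> e)"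
proof -
  have "((\<lambda>x. co x e) has_derivative (\<lambda>v. v \<bullet> e)) (at x)"
    unfolding co_def by (auto intro!: derivative_eq_intros)
  from has_derivative_compose[OF this st_derivative]
  have "((\<lambda>x. complex_of_real (st (co x e))) has_derivative (\<lambda>v. of_real ((v \<bullet> e) * bp (co x e)))) (at x)"
    by (rule has_derivative_of_real)
  from fd_eqI[OF this] show ?thesis by (simp add: mult.commute)
qed

lemma outside_cube:
  assumes "e \<in> Basis" "b \<in> Basis" "\<rho> < \<bar>co x b\<bar>" "b \<noteq> e"
  shows "x + t *\<^sub>R e \<notin> Cx"
  using assms co_line[OF assms(1,2), of x t] by (auto simp: Cx_def intro!: bexI[of _ b])

text \<open>From a point of \<open>Bx\<close> a step of length \<open>2 * r\<close> along
  \<open>e\<close>, in either direction, leaves \<open>Cx\<close>. Hence the outer limits of the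
  line integrals contribute nothing to d, and the limit 0 contributes \<open>w\<close>.\<close>

lemma homotopy_formula:
  assumes w: "cube_form (Suc k) w" and e: "e \<in> Basis"
  shows "local_form UNIV k (htpy e w)" "cube_supp (htpy e w)"
    "w x v = ld k (htpy e w) x v + red k e w x v"
proof -
  have lf: "local_form UNIV (Suc k) w" and su: "cube_supp w" and cl: "\<And>x v. ld (Suc k) w x v = 0"
    using w by (auto simp: cube_form_def)
  define I where "I a b = line_int a b e w" for a b
  have lfI: "local_form UNIV k (I a b)" for a b
    unfolding I_def line_int_def by (rule local_form_line_integral[OF lf])
  have ldI: "ld k (I a b) x v = w (x + b *\<^sub>R e) v - w (x + a *\<^sub>R e) v" if "a \<le> b" for a b x v
    unfolding I_def line_int_def by (rule ld_line_integral[OF lf cl that])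
  \<comment> \<open>\<open>G\<close> is \<open>htpy\<close> before the restriction to
    \<open>Bx\<close>. Far from the cube the window of integration may cover the support only in
    part, so \<open>G\<close> need not vanish there; it does vanish on \<open>Bx\<close> outside
    \<open>Cx\<close>, which makes the restriction smooth.\<close>
  define G where "G = (\<lambda>x v. I (- 2 * r) 0 x v + (- 1) * (of_real (st (co x e)) * I (- 2 * r) (2 * r) x v))"
  have lfS: "local_form UNIV k (\<lambda>x v. of_real (st (co x e)) * I (- 2 * r) (2 * r) x v)"
    by (rule local_form_fmult[OF open_UNIV smooth_co_comp[OF smooth_st] lfI])
  have lfG: "local_form UNIV k G"
    unfolding G_def by (intro local_form_add local_form_cmult open_UNIV lfI lfS)
  have r0: "r > 0" using rho by simp
  have ldG: "ld k G x v = w x v - w (x + (- 2 * r) *\<^sub>R e) v -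
      of_real (st (co x e)) * (w (x + (2 * r) *\<^sub>R e) v - w (x + (- 2 * r) *\<^sub>R e) v) - red k e w x v" for x v
  proof -
    have "ld k G x v = ld k (I (- 2 * r) 0) x v + ld k (\<lambda>x v. (- 1) * (of_real (st (co x e)) * I (- 2 * r) (2 * r) x v)) x v"
      unfolding G_def by (rule ld_add[OF lfI local_form_cmult[OF open_UNIV lfS]]) simp
    also have "ld k (\<lambda>x v. (- 1) * (of_real (st (co x e)) * I (- 2 * r) (2 * r) x v)) x v =
        - ld k (\<lambda>x v. of_real (st (co x e)) * I (- 2 * r) (2 * r) x v) x v"
      using ld_cmult[OF lfS, of x "- 1" v] by simp
    also have "ld k (\<lambda>x v. of_real (st (co x e)) * I (- 2 * r) (2 * r) x v) x v =
        red k e w x v + of_real (st (co x e)) * ld k (I (- 2 * r) (2 * r)) x v"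
      using ld_fmult[OF smooth_co_comp[OF smooth_st, of e] lfI[of "- 2 * r" "2 * r"], of x v]
      by (simp add: fd_st_co red_def I_def sum_distrib_left mult_ac)
    finally show ?thesis using ldI[of "- 2 * r" 0 x v] ldI[of "- 2 * r" "2 * r" x v] r0 by simp
  qed
  \<comment> \<open>Outside \<open>Cx\<close> in another coordinate, the whole line misses the
    support. Beyond the far face along \<open>e\<close> the half integral equals the full one and
    \<open>st\<close> is 1, so the two terms cancel; before the near face the half integral and
    \<open>st\<close> are both 0.\<close>
  have G0: "G x v = 0" if x: "x \<in> Bx" "x \<notin> Cx" for x v
  proof -
    obtain b where b: "b \<in> Basis" "\<rho> < \<bar>co x b\<bar>" using x(2) by (auto simp: Cx_def not_le)
    show ?thesis
    proof (cases "b = e")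
      case False
      then have "I a b' x v = 0" for a b'
        unfolding I_def using outside_cube[OF e b] by (intro line_int_supp[OF su]) auto
      then show ?thesis by (simp add: G_def)
    next
      case True
      have out: "x + t *\<^sub>R e \<notin> Cx" if "\<rho> < \<bar>co x e + t\<bar>" for t
        using that e co_line[OF e e, of x t] by (auto simp: Cx_def intro!: bexI[of _ e])
      show ?thesis
      proof (cases "co x e > 0")
        case True
        then have "\<rho> < co x e" using b \<open>b = e\<close> by simp
        then have 1: "I 0 (2 * r) x v = 0" unfolding I_def by (intro line_int_supp[OF su] out) auto
        have "I (- 2 * r) (2 * r) x v = I (- 2 * r) 0 x v + I 0 (2 * r) x v"
          unfolding I_def line_int_def
          by (rule Henstock_Kurzweil_Integration.integral_combine[symmetric])
            (use r0 in \<open>auto intro!: integrable_continuous_real local_form_line_continuous[OF lf]\<close>)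
        then show ?thesis using 1 st_1[of "co x e"] \<open>\<rho> < co x e\<close> by (simp add: G_def)
      next
        case False
        then have "co x e < - \<rho>" using b \<open>b = e\<close> by simp
        then have "I (- 2 * r) 0 x v = 0" unfolding I_def using rho by (intro line_int_supp[OF su] out) auto
        then show ?thesis using st_0[of "co x e"] \<open>co x e < - \<rho>\<close> by (simp add: G_def)
      qed
    qed
  qed
  have hG: "htpy e w x = G x" if "x \<in> Bx" for x
    using that by (simp add: htpy_def G_def I_def fun_eq_iff)
  have h0: "htpy e w x = (\<lambda>v. 0)" if "x \<notin> Cx" for x
    using that hG[of x] G0[of x] by (cases "x \<in> Bx") (auto simp: htpy_def fun_eq_iff)
  have oC: "open (- Cx)" using closed_Cx by (simp add: open_Compl)
  have "local_form Bx k (htpy e w)"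
    using local_form_cong[OF open_Bx hG] local_form_subset[OF lfG] by simp
  moreover have "local_form (- Cx) k (htpy e w)"
    using local_form_cong[OF oC, of "htpy e w" "\<lambda>x v. 0" k] h0 local_form_0 by auto
  ultimately have "local_form (Bx \<union> - Cx) k (htpy e w)" by (rule local_form_Un[OF open_Bx oC])
  moreover have "Bx \<union> - Cx = UNIV" using Cx_subset by blast
  ultimately show "local_form UNIV k (htpy e w)" by simp
  show "cube_supp (htpy e w)" using h0 by (simp add: cube_supp_def)
  show "w x v = ld k (htpy e w) x v + red k e w x v"
  proof (cases "x \<in> Bx")
    case True
    have a: "\<bar>co x e\<bar> < r" using True e by (simp add: Bx_def)
    have "x + (2 * r) *\<^sub>R e \<notin> Cx" "x + (- 2 * r) *\<^sub>R e \<notin> Cx"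
      using co_line[OF e e, of x "2 * r"] co_line[OF e e, of x "- 2 * r"] a rho e
      by (auto simp: Cx_def intro!: bexI[of _ e])
    then have "w (x + (2 * r) *\<^sub>R e) v = 0" "w (x + (- 2 * r) *\<^sub>R e) v = 0"
      using su by (auto simp: cube_supp_def)
    moreover have "ld k (htpy e w) x v = ld k G x v" by (rule ld_cong[OF open_Bx True hG])
    ultimately show ?thesis using ldG[of x v] by simp
  next
    case False
    then have x: "x \<notin> Cx" using Cx_subset by blast
    have "ld k (htpy e w) x v = ld k (\<lambda>x v. 0) x v" by (rule ld_cong[OF oC]) (use x h0 in auto)
    moreover have "red k e w x v = 0"
    proof -
      obtain b where b: "b \<in> Basis" "\<rho> < \<bar>co x b\<bar>" using x by (auto simp: Cx_def not_le)
      show ?thesis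
      proof (cases "b = e")
        case False
        then have "line_int a b' e w x u = 0" for a b' u
          using outside_cube[OF e b] by (intro line_int_supp[OF su]) auto
        then show ?thesis by (simp add: red_def)
      qed (use b bp_0 in \<open>simp add: red_def\<close>)
    qed
    moreover have "w x v = 0" using su x by (simp add: cube_supp_def)
    ultimately show ?thesis by simp
  qed
qed

text \<open>The first clause says that along \<open>e\<close> the coefficients are proportional to
  the profile \<open>bp\<close>, written as a cross product so that no division occurs. The second
  says that \<open>w\<close> contains the factor dx_e, as it vanishes when all arguments are
  orthogonal to \<open>e\<close>.\<close>

definition reduced where "reduced k e w \<longleftrightarrow>
  (\<forall>x s v. of_real (bp (co x e + s)) * w x v = of_real (bp (co x e)) * (w (x + s *\<^sub>R e) v :: complex)) \<and>
  (\<forall>x v. (\<forall>i<k. v i \<bullet> e = 0) \<longrightarrow> w x v = 0)"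

lemma reduced_red:
  assumes w: "cube_form (Suc k) w" and e: "e \<in> Basis"
  shows "reduced (Suc k) e (red k e w)"
  unfolding reduced_def
proof (intro conjI allI impI)
  have lf: "local_form UNIV (Suc k) w" and su: "cube_supp w"
    using w by (auto simp: cube_form_def)
  fix x s v
  let ?J = "line_int (- 2 * r) (2 * r) e w"
  have J: "?J (x + s *\<^sub>R e) u = ?J x u" if "\<bar>co x e\<bar> \<le> \<rho>" "\<bar>co x e + s\<bar> \<le> \<rho>" for u
  proof -
    have "integral {- 2 * r..2 * r} (\<lambda>t. w (x + (t + s) *\<^sub>R e) (case_nat e u)) =
        integral {- 2 * r..2 * r} (\<lambda>t. w (x + t *\<^sub>R e) (case_nat e u))"
    \<comment> \<open>Both base points have \<open>e\<close>-coordinate at most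
      \<open>\<rho>\<close> in absolute value, so the support lies within distance
      \<open>2 * \<rho> < 2 * r\<close> of either and is seen by both windows.\<close>
    proof (rule integral_shift_support[OF local_form_line_continuous[OF lf]])
      fix t assume "w (x + t *\<^sub>R e) (case_nat e u) \<noteq> 0"
      then have "x + t *\<^sub>R e \<in> Cx" using su by (auto simp: cube_supp_def)
      then have "\<bar>co x e + t\<bar> \<le> \<rho>" using co_line[OF e e, of x t] e by (auto simp: Cx_def)
      then show "t \<in> {- 2 * r..2 * r} \<inter> {- 2 * r + s..2 * r + s}" using that rho by auto
    qed
    moreover have "x + s *\<^sub>R e + t *\<^sub>R e = x + (t + s) *\<^sub>R e" for t by (simp add: algebra_simps)
    ultimately show ?thesis by (simp only: line_int_def)
  qed
  show "of_real (bp (co x e + s)) * red k e w x v = of_real (bp (co x e)) * red k e w (x + s *\<^sub>R e) v"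
  proof (cases "bp (co x e) = 0 \<or> bp (co x e + s) = 0")
    case True
    then show ?thesis by (auto simp: red_def co_line e)
  next
    case False
    then have "\<bar>co x e\<bar> \<le> \<rho>" "\<bar>co x e + s\<bar> \<le> \<rho>" using bp_0 by (meson not_le)+
    then show ?thesis
      unfolding red_def by (simp only: J co_line[OF e e] simp_thms if_True mult.left_commute)
  qed
next
  fix x v assume "\<forall>i<Suc k. v i \<bullet> e = 0"
  then show "red k e w x v = 0" by (simp add: red_def less_Suc_eq_le)
qed

text \<open>Integration along \<open>e\<close> commutes with translation along the orthogonal
  direction \<open>e'\<close>, so a later reduction preserves the earlier ones.\<close>

lemma reduced_red_other:
  assumes w: "reduced (Suc k) e' w" "local_form UNIV (Suc k) w" and e: "e \<in> Basis" "e' \<in> Basis" "e \<noteq> e'"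
  shows "reduced (Suc k) e' (red k e w)"
  unfolding reduced_def
proof (intro conjI allI impI)
  let ?J = "line_int (- 2 * r) (2 * r) e w"
  fix x s v
  have J: "of_real (bp (co x e' + s)) * ?J x u = of_real (bp (co x e')) * ?J (x + s *\<^sub>R e') u" for u
  proof -
    have "of_real (bp (co x e' + s)) * w (x + t *\<^sub>R e) u' = of_real (bp (co x e')) * w (x + s *\<^sub>R e' + t *\<^sub>R e) u'" for t u'
    proof -
      have "of_real (bp (co (x + t *\<^sub>R e) e' + s)) * w (x + t *\<^sub>R e) u' =
          of_real (bp (co (x + t *\<^sub>R e) e')) * w ((x + t *\<^sub>R e) + s *\<^sub>R e') u'"
        using w(1) unfolding reduced_def by blast
      moreover have "co (x + t *\<^sub>R e) e' = co x e'" using co_line[OF e(1,2)] e(3) by simp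
      moreover have "(x + t *\<^sub>R e) + s *\<^sub>R e' = x + s *\<^sub>R e' + t *\<^sub>R e" by simp
      ultimately show ?thesis by simp
    qed
    then show ?thesis unfolding line_int_def by (simp flip: Henstock_Kurzweil_Integration.integral_mult_right)
  qed
  have "co (x + s *\<^sub>R e') e = co x e" using co_line[OF e(2,1)] e(3) by simp
  then show "of_real (bp (co x e' + s)) * red k e w x v = of_real (bp (co x e')) * red k e w (x + s *\<^sub>R e') v"
    unfolding red_def sum_distrib_left
    by (intro sum.cong refl) (metis (no_types, opaque_lifting) J mult.left_commute)
next
  fix x v assume v: "\<forall>i<Suc k. v i \<bullet> e' = 0"
  have "line_int (- 2 * r) (2 * r) e w x (omit i v) = 0" if "i \<le> k" for i
  proof -
    have "w y (case_nat e (omit i v)) = 0" for y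
      using w(1) v e unfolding reduced_def
      by (elim conjE allE[of _ y] allE[of _ "case_nat e (omit i v)"])
        (auto simp: inner_Basis omit_def split: nat.split)
    then show ?thesis by (simp add: line_int_def)
  qed
  then show "red k e w x v = 0" by (simp add: red_def)
qed

lemma cube_form_minus_ld:
  assumes w: "cube_form (Suc k) w" and h: "local_form UNIV k \<eta>" "cube_supp \<eta>"
  shows "cube_form (Suc k) (\<lambda>x v. w x v - ld k \<eta> x v)"
proof -
  have lf: "local_form UNIV (Suc k) w" and su: "cube_supp w" and cl: "\<And>x v. ld (Suc k) w x v = 0"
    using w by (auto simp: cube_form_def)
  have lh: "local_form UNIV (Suc k) (\<lambda>x v. (- 1) * ld k \<eta> x v)"
    by (intro local_form_cmult open_UNIV local_form_ld h(1))
  have eq: "(\<lambda>x v. w x v - ld k \<eta> x v) = (\<lambda>x v. w x v + (- 1) * ld k \<eta> x v)" by simp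
  have "ld (Suc k) (\<lambda>x v. w x v - ld k \<eta> x v) x v = 0" for x v
    unfolding eq using ld_add[OF lf lh, of x v] ld_cmult[OF local_form_ld[OF h(1) open_UNIV], of x "- 1" v]
      ld_ld[OF h(1) open_UNIV, of x v] cl by simp
  moreover have "ld k \<eta> x v = 0" if "x \<notin> Cx" for x v
  proof -
    have "ld k \<eta> x v = ld k (\<lambda>x v. 0) x v"
      by (rule ld_cong[of "- Cx"]) (use that h(2) closed_Cx in \<open>auto simp: open_Compl cube_supp_def fun_eq_iff\<close>)
    then show ?thesis by simp
  qed
  ultimately show ?thesis
    unfolding cube_form_def eq using local_form_add[OF open_UNIV lf lh] su by (auto simp: cube_supp_def)
qed

text \<open>The directions are reduced one after another; the primitives add up in
  \<open>\<eta>\<close>, and the form that remains is the last \<open>red\<close>.\<close>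

lemma reduce_all:
  assumes w: "cube_form (Suc k) w" and E: "finite E" "E \<subseteq> Basis"
  shows "\<exists>\<eta>. local_form UNIV k \<eta> \<and> cube_supp \<eta> \<and> cube_form (Suc k) (\<lambda>x v. w x v - ld k \<eta> x v) \<and>
    (\<forall>e\<in>E. reduced (Suc k) e (\<lambda>x v. w x v - ld k \<eta> x v))"
  using E
proof (induction rule: finite_induct)
  case empty
  show ?case using w by (intro exI[of _ "\<lambda>x v. 0"]) (simp add: local_form_0 cube_supp_def)
next
  case (insert e E)
  then obtain \<eta> where h: "local_form UNIV k \<eta>" "cube_supp \<eta>" "cube_form (Suc k) (\<lambda>x v. w x v - ld k \<eta> x v)"
    and r: "\<forall>e\<in>E. reduced (Suc k) e (\<lambda>x v. w x v - ld k \<eta> x v)" by blast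
  define w' where "w' = (\<lambda>x v. w x v - ld k \<eta> x v)"
  have e: "e \<in> Basis" using insert by simp
  note hf = homotopy_formula[OF h(3)[folded w'_def] e]
  define \<zeta> where "\<zeta> = (\<lambda>x v. \<eta> x v + htpy e w' x v)"
  have 1: "local_form UNIV k \<zeta>" unfolding \<zeta>_def by (rule local_form_add[OF open_UNIV h(1) hf(1)])
  have 2: "cube_supp \<zeta>" using h(2) hf(2) by (simp add: \<zeta>_def cube_supp_def)
  have "w x v - ld k \<zeta> x v = red k e w' x v" for x v
    using hf(3)[of x v] ld_add[OF h(1) hf(1), of x v] by (simp add: \<zeta>_def w'_def algebra_simps)
  then have eq: "(\<lambda>x v. w x v - ld k \<zeta> x v) = red k e w'" by auto
  have 4: "reduced (Suc k) e' (red k e w')" if "e' \<in> insert e E" for e'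
  proof (cases "e' = e")
    case True
    then show ?thesis using reduced_red[OF h(3)[folded w'_def] e] by simp
  next
    case False
    then show ?thesis using that r insert.prems h(3) e
      by (intro reduced_red_other) (auto simp: w'_def cube_form_def)
  qed
  show ?case
  proof (intro exI[of _ \<zeta>] conjI ballI)
    fix e' assume "e' \<in> insert e E"
    then show "reduced (Suc k) e' (\<lambda>x v. w x v - ld k \<zeta> x v)" unfolding eq by (rule 4)
  qed (rule 1, rule 2, rule cube_form_minus_ld[OF w 1 2])
qed

text \<open>Fewer basis vectors than the dimension miss some direction \<open>e\<close>. A form
  reduced along every direction contains the factor dx_e and so vanishes on them.\<close>

lemma compact_poincare:
  assumes w: "cube_form (Suc k) w" and k: "Suc k < DIM('v)"
  obtains \<eta> where "local_form UNIV k \<eta>" "cube_supp \<eta>" "\<And>x v. w x v = ld k \<eta> x v"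
proof -
  obtain \<eta> where h: "local_form UNIV k \<eta>" "cube_supp \<eta>" "cube_form (Suc k) (\<lambda>x v. w x v - ld k \<eta> x v)"
    and r: "\<forall>e\<in>Basis. reduced (Suc k) e (\<lambda>x v. w x v - ld k \<eta> x v)"
    using reduce_all[OF w finite_Basis order_refl] by blast
  have "w x v - ld k \<eta> x v = 0" for x v
  proof (rule alternating_eq_0[where \<alpha> = "\<lambda>v. w x v - ld k \<eta> x v", OF _ finite_Basis])
    show "alternating_form (Suc k) (\<lambda>v. w x v - ld k \<eta> x v)"
      using h(3) local_formD1 unfolding cube_form_def by blast
    show "v i \<in> span Basis" for i by simp
    fix u :: "nat \<Rightarrow> 'v" assume u: "\<And>i. i < Suc k \<Longrightarrow> u i \<in> Basis"
    have "card (u ` {..<Suc k}) \<le> Suc k" using card_image_le[of "{..<Suc k}" u] by simp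
    then have "\<not> Basis \<subseteq> u ` {..<Suc k}" using k card_mono[of "u ` {..<Suc k}" Basis] by auto
    then obtain e where e: "e \<in> Basis" "e \<notin> u ` {..<Suc k}" by blast
    have "u i \<bullet> e = 0" if "i < Suc k" for i using u[OF that] e that by (auto simp: inner_Basis)
    then show "w x u - ld k \<eta> x u = 0" using r e(1) unfolding reduced_def by blast
  qed
  then show thesis using that h by simp
qed

text \<open>From \<open>x0\<close> every point is reached by moving along one coordinate axis at a
  time. Each move multiplies by a ratio of values of \<open>bp\<close> whose denominator, taken at
  \<open>x0\<close>, is not 0.\<close>

lemma reduced_eq_0:
  assumes r: "\<forall>e\<in>Basis. reduced k e w" and x0: "\<And>e. e \<in> Basis \<Longrightarrow> bp (co x0 e) \<noteq> 0" "\<And>v. w x0 v = 0"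
  shows "w x v = 0"
proof -
  have "w (x0 + (\<Sum>e\<in>E. (co x e - co x0 e) *\<^sub>R e)) v = 0" if "finite E" "E \<subseteq> Basis" for E
    using that
  proof (induction rule: finite_induct)
    case empty
    then show ?case using x0(2) by simp
  next
    case (insert e E)
    let ?y = "x0 + (\<Sum>e\<in>E. (co x e - co x0 e) *\<^sub>R e)"
    have e: "e \<in> Basis" using insert by simp
    have "(\<Sum>e'\<in>E. (co x e' - co x0 e') *\<^sub>R e') \<bullet> e = 0"
      unfolding inner_sum_left
    proof (intro sum.neutral ballI)
      fix b assume "b \<in> E"
      then have "b \<in> Basis" "b \<noteq> e" using insert by auto
      then show "(co x b - co x0 b) *\<^sub>R b \<bullet> e = 0" using e by (simp add: inner_Basis)
    qed
    then have "co ?y e = co x0 e" by (simp add: co_def inner_add_left inner_diff_left)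
    moreover have "of_real (bp (co ?y e + (co x e - co x0 e))) * w ?y v =
        of_real (bp (co ?y e)) * w (?y + (co x e - co x0 e) *\<^sub>R e) v"
      using r e unfolding reduced_def by blast
    ultimately have "w (?y + (co x e - co x0 e) *\<^sub>R e) v = 0" using insert x0(1)[OF e] by simp
    then show ?case using insert by (simp add: add_ac)
  qed
  from this[OF finite_Basis order_refl]
  have "w (x0 + (\<Sum>e\<in>Basis. (co x e - co x0 e) *\<^sub>R e)) v = 0" .
  moreover have "(\<Sum>e\<in>Basis. (co x e - co x0 e) *\<^sub>R e) = x - x0"
    by (simp add: co_def inner_diff_left[symmetric] euclidean_representation)
  ultimately show ?thesis by simp
qed

text \<open>In top degree a reduced form is determined by its value at one point on one frame, so
  \<open>w\<close> and \<open>\<mu>\<close> are proportional after reduction; \<open>a\<close> and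
  \<open>b\<close> are these values. Thus the compactly supported cohomology of the cube has
  dimension at most one. The last clause covers \<open>b = 0\<close>, where \<open>\<mu>\<close>
  itself is exact; a nonzero integral of \<open>\<mu>\<close> will exclude it.\<close>

lemma compact_poincare_top:
  assumes w: "cube_form (Suc k) w" and m: "cube_form (Suc k) \<mu>" and k: "Suc k = DIM('v)"
  obtains a b \<eta> where "local_form UNIV k \<eta>" "cube_supp \<eta>" "\<And>x v. b * w x v - a * \<mu> x v = ld k \<eta> x v"
    "b = 0 \<Longrightarrow> \<exists>\<zeta>. local_form UNIV k \<zeta> \<and> cube_supp \<zeta> \<and> (\<forall>x v. \<mu> x v = ld k \<zeta> x v)"
proof -
  obtain \<eta> where h: "local_form UNIV k \<eta>" "cube_supp \<eta>" "cube_form (Suc k) (\<lambda>x v. w x v - ld k \<eta> x v)"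
    and r: "\<forall>e\<in>Basis. reduced (Suc k) e (\<lambda>x v. w x v - ld k \<eta> x v)"
    using reduce_all[OF w finite_Basis order_refl] by blast
  obtain \<zeta> where z: "local_form UNIV k \<zeta>" "cube_supp \<zeta>" "cube_form (Suc k) (\<lambda>x v. \<mu> x v - ld k \<zeta> x v)"
    and s: "\<forall>e\<in>Basis. reduced (Suc k) e (\<lambda>x v. \<mu> x v - ld k \<zeta> x v)"
    using reduce_all[OF m finite_Basis order_refl] by blast
  define w' where "w' = (\<lambda>x v. w x v - ld k \<eta> x v)"
  define \<mu>' where "\<mu>' = (\<lambda>x v. \<mu> x v - ld k \<zeta> x v)"
  obtain s0 where s0: "bp s0 \<noteq> 0" by (rule bp_nonzero)
  define x0 where "x0 = p + (\<Sum>b\<in>Basis. s0 *\<^sub>R b)"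
  have x0: "bp (co x0 e) \<noteq> 0" if "e \<in> Basis" for e
    using s0 that by (simp add: x0_def co_def)
  obtain fr :: "nat \<Rightarrow> 'v" where fr: "bij_betw fr {..<DIM('v)} Basis"
    using ex_bij_betw_nat_finite[OF finite_Basis] by (metis atLeast0LessThan)
  define a where "a = w' x0 fr"
  define b where "b = \<mu>' x0 fr"
  have "(\<lambda>x v. b * w' x v - a * \<mu>' x v) x v = 0" for x v
  proof (rule reduced_eq_0)
    show "\<forall>e\<in>Basis. reduced (Suc k) e (\<lambda>x v. b * w' x v - a * \<mu>' x v)"
      using r s unfolding reduced_def w'_def[symmetric] \<mu>'_def[symmetric]
      by (auto simp: right_diff_distrib mult.left_commute)
    have "alternating_form (Suc k) (\<lambda>v. b * w' x0 v + (- a) * \<mu>' x0 v)"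
      using h(3) z(3) unfolding cube_form_def w'_def[symmetric] \<mu>'_def[symmetric]
      by (intro alternating_add alternating_cmult) (auto intro: local_formD1)
    from alternating_top_eq_0[OF this[unfolded k] fr] show "b * w' x0 v - a * \<mu>' x0 v = 0" for v
      by (simp add: a_def b_def)
  qed (rule x0)
  then have 1: "b * w' x v = a * \<mu>' x v" for x v by simp
  let ?h = "\<lambda>x v. b * \<eta> x v + (- a) * \<zeta> x v"
  note lb = local_form_cmult[OF open_UNIV h(1), of b] local_form_cmult[OF open_UNIV z(1), of "- a"]
  show thesis
  proof (rule that[of ?h b a])
    show "local_form UNIV k ?h" by (rule local_form_add[OF open_UNIV lb])
    show "cube_supp ?h" using h(2) z(2) by (simp add: cube_supp_def)
    show "b * w x v - a * \<mu> x v = ld k ?h x v" for x v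
    proof -
      have "ld k ?h x v = b * ld k \<eta> x v - a * ld k \<zeta> x v"
        using ld_add[OF lb, of x v] ld_cmult[OF h(1), of x b v] ld_cmult[OF z(1), of x "- a" v] by simp
      then show ?thesis using 1[of x v] by (simp only: w'_def \<mu>'_def) (simp add: algebra_simps)
    qed
  next
    assume "b = 0"
    have "\<mu>' x v = 0" for x v
    proof (rule reduced_eq_0[OF s[folded \<mu>'_def]])
      have "alternating_form (Suc k) (\<mu>' x0)"
        using z(3) local_formD1 unfolding cube_form_def \<mu>'_def[symmetric] by blast
      from alternating_top_eq_0[OF this[unfolded k] fr] \<open>b = 0\<close> show "\<mu>' x0 v = 0" for v
        by (simp add: b_def)
    qed (rule x0)
    then show "\<exists>\<zeta>. local_form UNIV k \<zeta> \<and> cube_supp \<zeta> \<and> (\<forall>x v. \<mu> x v = ld k \<zeta> x v)"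
      using z by (intro exI[of _ \<zeta>]) (simp add: \<mu>'_def)
  qed
qed

end


section \<open>Integration in real coordinates and the orientation given by a complex
  structure\<close>

section \<open>Integration of compactly supported functions\<close>

definition compact_supp :: "('v::euclidean_space \<Rightarrow> complex) \<Rightarrow> bool"
  where "compact_supp f \<longleftrightarrow> (\<exists>C. compact C \<and> (\<forall>x. x \<notin> C \<longrightarrow> f x = 0))"

lemma integral_eq_UNIV:
  fixes f :: "'v::euclidean_space \<Rightarrow> 'w::banach"
  assumes "\<And>x. x \<notin> S \<Longrightarrow> f x = 0"
  shows "integral S f = integral UNIV f"
proof -
  have "(\<lambda>x. if x \<in> S then f x else 0) = f" using assms by auto
  then show ?thesis using Henstock_Kurzweil_Integration.integral_restrict_UNIV[of S f] by simp
qed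

lemma compact_supp_absolutely_integrable:
  fixes f :: "'v::euclidean_space \<Rightarrow> complex"
  assumes "continuous_on UNIV f" "compact_supp f"
  shows "f absolutely_integrable_on UNIV"
proof -
  obtain C where C: "compact C" "\<And>x. x \<notin> C \<Longrightarrow> f x = 0" using assms(2) unfolding compact_supp_def by blast
  obtain a where a: "C \<subseteq> cbox (- a) a" using bounded_subset_cbox_symmetric compact_imp_bounded[OF C(1)] by blast
  have "f absolutely_integrable_on cbox (- a) a"
    by (rule absolutely_integrable_continuous[OF continuous_on_subset[OF assms(1)]]) simp
  moreover have "(\<lambda>x. if x \<in> cbox (- a) a then f x else 0) = f"
    by (rule ext) (use a C(2) in auto)
  ultimately show ?thesis using absolutely_integrable_restrict_UNIV[of "cbox (- a) a" f] by simp
qed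

text \<open>The integral of the translate of \<open>f\<close> by \<open>t *\<^sub>R u\<close> does
  not depend on \<open>t\<close>; its derivative at \<open>t = 0\<close>, taken under the integral
  sign, is the integral in question. The box is large enough to contain the supports of all
  translates with \<open>t\<close> between - 1 and 1.\<close>

lemma integral_fd_eq_0:
  fixes f :: "'v::euclidean_space \<Rightarrow> complex"
  assumes f: "smooth_on UNIV f" "compact_supp f"
  shows "integral UNIV (\<lambda>x. fd f x u) = 0"
proof -
  obtain C where C: "compact C" "\<And>x. x \<notin> C \<Longrightarrow> f x = 0" using f(2) unfolding compact_supp_def by blast
  obtain R where R: "\<And>x. x \<in> C \<Longrightarrow> norm x \<le> R" using compact_imp_bounded[OF C(1)] bounded_iff by blast
  obtain a :: 'v where a: "cball 0 (R + norm u) \<subseteq> cbox (- a) a" using bounded_subset_cbox_symmetric bounded_cball by blast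
  have inb: "x \<in> cbox (- a) a" if "x + t *\<^sub>R u \<in> C" "\<bar>t\<bar> \<le> 1" for x t
  proof -
    have "norm x \<le> norm (x + t *\<^sub>R u) + norm (t *\<^sub>R u)" by (metis add_diff_cancel norm_triangle_ineq4)
    also have "\<dots> \<le> R + norm u" using R[OF that(1)] that(2) by (intro add_mono) (auto simp: mult_left_le_one_le)
    finally show ?thesis using a by auto
  qed
  define g where "g t = integral (cbox (- a) a) (\<lambda>x. f (x + t *\<^sub>R u))" for t
  have gc: "g t = g 0" if t: "\<bar>t\<bar> \<le> 1" for t
  proof -
    have "g t = integral UNIV (\<lambda>x. f (x + t *\<^sub>R u))"
      unfolding g_def by (rule integral_eq_UNIV) (use inb[OF _ t] C(2) in blast)
    also have "\<dots> = integral (cbox (- a - t *\<^sub>R u) (a - t *\<^sub>R u)) (\<lambda>x. f (x + t *\<^sub>R u))"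
    proof (rule integral_eq_UNIV[symmetric])
      fix x assume x: "x \<notin> cbox (- a - t *\<^sub>R u) (a - t *\<^sub>R u)"
      have "x + t *\<^sub>R u \<notin> C"
      proof
        assume "x + t *\<^sub>R u \<in> C"
        then have "x + t *\<^sub>R u \<in> cbox (- a) a" using inb[of "x + t *\<^sub>R u" 0] by simp
        then show False using x by (auto simp: mem_box algebra_simps)
      qed
      then show "f (x + t *\<^sub>R u) = 0" by (rule C(2))
    qed
    also have "\<dots> = integral (cbox (- a) a) f" by (rule integral_shift_cbox)
    finally show ?thesis by (simp add: g_def)
  qed
  have cf: "continuous_on UNIV f" by (rule smooth_on_continuous_on[OF f(1)])
  have "(g has_vector_derivative integral (cbox (- a) a) (\<lambda>x. fd f (x + 0 *\<^sub>R u) u)) (at 0 within {- 1..1})"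
    unfolding g_def
  proof (rule leibniz_rule_vector_derivative[where fx = "\<lambda>t x. fd f (x + t *\<^sub>R u) u"])
    show "((\<lambda>t. f (x + t *\<^sub>R u)) has_vector_derivative fd f (x + t *\<^sub>R u) u) (at t within {- 1..1})" for x t
      by (rule has_vector_derivative_line, rule smooth_on_has_derivative[OF f(1)]) simp
    show "(\<lambda>x. f (x + t *\<^sub>R u)) integrable_on cbox (- a) a" for t
      by (intro integrable_continuous continuous_on_compose2[OF cf]) (auto intro!: continuous_intros)
    have "continuous_on ({- 1..1} \<times> cbox (- a) a) (\<lambda>p. fd f (snd p + fst p *\<^sub>R u) u)"
      by (rule continuous_on_compose2[OF smooth_on_continuous_on[OF smooth_on_fd[OF f(1)]]])
        (auto intro!: continuous_intros)
    then show "continuous_on ({- 1..1} \<times> cbox (- a) a) (\<lambda>(t, x). fd f (x + t *\<^sub>R u) u)"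
      by (simp add: case_prod_unfold)
  qed auto
  moreover have "(g has_vector_derivative 0) (at 0 within {- 1..1})"
  proof (rule has_vector_derivative_transform[where f = "\<lambda>t. g 0"])
    show "g t = g 0" if "t \<in> {- 1..1}" for t using gc[of t] that by auto
  qed auto
  ultimately have "integral (cbox (- a) a) (\<lambda>x. fd f (x + 0 *\<^sub>R u) u) = 0"
    using vector_derivative_unique_within[of 0 "{- 1..1}" g] by (auto simp: trivial_limit_within islimpt_Icc)
  then have "integral (cbox (- a) a) (\<lambda>x. fd f x u) = 0" by simp
  moreover have "fd f x u = 0" if "x \<notin> cbox (- a) a" for x
  proof -
    have "C \<subseteq> cbox (- a) a" using inb[of _ 0] by auto
    then have "frechet_derivative f (at x) = frechet_derivative (\<lambda>x. 0) (at x)"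
      using that C by (intro fd_cong[of "- C"]) (auto simp: open_Compl compact_imp_closed)
    then show ?thesis by simp
  qed
  ultimately show ?thesis using integral_eq_UNIV[of "cbox (- a) a" "\<lambda>x. fd f x u"] by simp
qed

lemma integral_nonneg_pos:
  fixes f :: "'v::euclidean_space \<Rightarrow> real"
  assumes f: "continuous_on UNIV f" "\<And>x. f x \<ge> 0" and C: "compact C" "\<And>x. x \<notin> C \<Longrightarrow> f x = 0"
    and x: "f x \<noteq> 0"
  shows "integral UNIV f \<noteq> 0"
proof
  obtain a :: 'v where a: "C \<subseteq> box (- a) a" using bounded_subset_box_symmetric compact_imp_bounded[OF C(1)] by blast
  have xa: "x \<in> box (- a) a" using x C(2) a by blast
  assume "integral UNIV f = 0"
  then have "integral (cbox (- a) a) f = 0"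
    using integral_eq_UNIV[of "cbox (- a) a" f] a C(2) box_subset_cbox by (metis subsetD)
  moreover have cf: "continuous_on (cbox (- a) a) f" by (rule continuous_on_subset[OF f(1)]) simp
  ultimately have "(f has_integral 0) (cbox (- a) a)" using integrable_integral[OF integrable_continuous[OF cf]] by simp
  from has_integral_0_cbox_imp_0[OF cf _ this] xa f(2) x show False
    using box_subset_cbox by blast
qed

subsection \<open>Complex space as a real coordinate space\<close>

text \<open>The index type \<open>'n bit0\<close> has \<open>2 * CARD('n)\<close> elements and is well-ordered, as the change of
  variables theorem of the library requires.\<close>

definition to_cplx :: "real^('n::finite bit0) \<Rightarrow> complex^'n"
  where "to_cplx = (SOME L. linear L \<and> (\<exists>M. linear M \<and> (\<forall>x. M (L x) = x) \<and> (\<forall>y. L (M y) = y)))"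

definition of_cplx :: "complex^'n \<Rightarrow> real^('n::finite bit0)"
  where "of_cplx = inv_into UNIV to_cplx"

lemma to_cplx_exists:
  "linear (to_cplx :: real^('n::finite bit0) \<Rightarrow> complex^'n) \<and>
    (\<exists>M. linear M \<and> (\<forall>x. M (to_cplx x :: complex^'n) = x) \<and> (\<forall>y. to_cplx (M y) = y))"
proof -
  have "DIM(real^('n bit0)) = DIM(complex^'n)" by simp
  then obtain f :: "real^('n bit0) \<Rightarrow> complex^'n" and g where "linear f" "linear g" "\<And>x. g (f x) = x" "\<And>y. f (g y) = y"
    by (rule isomorphisms_UNIV_UNIV) (rule that)
  then show ?thesis unfolding to_cplx_def by (intro someI_ex[of "\<lambda>L. linear L \<and> (\<exists>M. linear M \<and> (\<forall>x. M (L x) = x) \<and> (\<forall>y. L (M y) = y))"]) blast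
qed

lemma linear_to_cplx: "linear to_cplx" using to_cplx_exists by blast

lemma bij_to_cplx: "bij to_cplx"
  using to_cplx_exists by (metis bijI')

lemma of_to_cplx [simp]: "of_cplx (to_cplx x) = x"
  unfolding of_cplx_def using bij_to_cplx bij_is_inj inv_f_f by metis

lemma to_of_cplx [simp]: "to_cplx (of_cplx y) = y"
  unfolding of_cplx_def using bij_to_cplx bij_is_surj surj_f_inv_f by metis

lemma linear_of_cplx: "linear of_cplx"
proof -
  obtain M :: "complex^'a \<Rightarrow> real^('a bit0)" where "linear M" "\<And>x. M (to_cplx x) = x" using to_cplx_exists by blast
  then have "M = of_cplx" by (metis ext to_of_cplx)
  then show ?thesis using \<open>linear M\<close> by simp
qed

definition index_enum :: "nat \<Rightarrow> 'n::finite bit0"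
  where "index_enum = (SOME e. bij_betw e {..<2 * CARD('n)} UNIV)"

lemma index_enum: "bij_betw (index_enum :: nat \<Rightarrow> 'n::finite bit0) {..<2 * CARD('n)} UNIV"
proof -
  have "\<exists>e. bij_betw e {..<2 * CARD('n)} (UNIV :: 'n bit0 set)"
    using ex_bij_betw_nat_finite[of "UNIV :: 'n bit0 set"] by (simp add: atLeast0LessThan)
  then show ?thesis unfolding index_enum_def by (rule someI_ex)
qed

definition index_num :: "'n::finite bit0 \<Rightarrow> nat"
  where "index_num = inv_into {..<2 * CARD('n)} index_enum"

lemma index_num: "index_num (j :: 'n::finite bit0) < 2 * CARD('n)" "index_enum (index_num j) = j"
  using bij_betw_inv_into_right[OF index_enum, of j] bij_betw_apply[OF bij_betw_inv_into[OF index_enum], of j]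
  by (auto simp: index_num_def)

lemma index_num_enum: "i < 2 * CARD('n) \<Longrightarrow> index_num (index_enum i :: 'n::finite bit0) = i"
  unfolding index_num_def by (rule bij_betw_inv_into_left[OF index_enum]) simp

text \<open>The real frame on which a top-degree form is evaluated to obtain a density. Another
  choice of \<open>to_cplx\<close> would multiply all integrals by one nonzero constant.\<close>

definition frame :: "nat \<Rightarrow> complex^'n::finite"
  where "frame i = to_cplx (axis (index_enum i) 1)"

lemma frame_bij: "bij_betw (frame :: nat \<Rightarrow> complex^'n::finite) {..<2 * CARD('n)} (range (\<lambda>j. to_cplx (axis j 1)))"
proof -
  have "inj (\<lambda>j :: 'n bit0. to_cplx (axis j 1) :: complex^'n)"
  proof (rule injI)
    fix i j :: "'n bit0" assume "(to_cplx (axis i 1) :: complex^'n) = to_cplx (axis j 1)"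
    then have "axis i (1 :: real) = axis j 1" by (metis of_to_cplx)
    then show "i = j" by (simp add: axis_eq_axis)
  qed
  then have "bij_betw (\<lambda>j :: 'n bit0. to_cplx (axis j 1)) UNIV (range (\<lambda>j. to_cplx (axis j 1) :: complex^'n))"
    by (simp add: bij_betw_def)
  from bij_betw_trans[OF index_enum this] show ?thesis by (simp add: frame_def[abs_def] o_def)
qed

lemma frame_span: "span (range (\<lambda>j. to_cplx (axis j 1))) = (UNIV :: (complex^'n::finite) set)"
proof -
  have "(Basis :: (real^('n bit0)) set) = range (\<lambda>j. axis j 1)" by (auto simp: Basis_vec_def)
  moreover have "range (\<lambda>j :: 'n bit0. to_cplx (axis j 1) :: complex^'n) =
      to_cplx ` range (\<lambda>j :: 'n bit0. axis j 1)"
    by (simp only: image_image)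
  ultimately have "range (\<lambda>j :: 'n bit0. to_cplx (axis j 1) :: complex^'n) = to_cplx ` Basis"
    by (simp only:)
  then have "span (range (\<lambda>j :: 'n bit0. to_cplx (axis j 1) :: complex^'n)) = to_cplx ` UNIV"
    by (simp add: linear_span_image[OF linear_to_cplx])
  then show ?thesis using bij_to_cplx bij_is_surj by metis
qed

lemma alternating_frame_eq_0:
  fixes \<alpha> :: "(nat \<Rightarrow> complex^'n::finite) \<Rightarrow> complex"
  assumes "alternating_form (2 * CARD('n)) \<alpha>" "\<alpha> frame = 0" shows "\<alpha> v = 0"
  by (rule alternating_eq_0_frame[OF assms(1) frame_bij frame_span assms(2)])

definition real_det :: "(complex^'n::finite \<Rightarrow> complex^'n) \<Rightarrow> real"
  where "real_det T = det (matrix (of_cplx \<circ> T \<circ> to_cplx))"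

definition det_form :: "(nat \<Rightarrow> complex^'n::finite) \<Rightarrow> complex"
  where "det_form v = of_real (det (\<chi> j. of_cplx (v (index_num j))))"

lemma alternating_det_form: "alternating_form (2 * CARD('n)) (det_form :: (nat \<Rightarrow> complex^'n::finite) \<Rightarrow> complex)"
  unfolding alternating_form_iff mlinear_def
proof (intro conjI allI impI)
  fix v w :: "nat \<Rightarrow> complex^'n" assume "\<forall>i<2 * CARD('n). v i = w i"
  then show "det_form v = det_form w" by (simp add: det_form_def index_num(1))
next
  fix v :: "nat \<Rightarrow> complex^'n" and i assume i: "i < 2 * CARD('n)"
  have e: "index_num j = i \<longleftrightarrow> j = index_enum i" for j :: "'n bit0"
    using index_num(2)[of j] index_num_enum[OF i] by auto
  have "(\<chi> j :: 'n bit0. of_cplx ((v(i := x)) (index_num j))) =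
      (\<chi> j. if j = index_enum i then of_cplx x else of_cplx (v (index_num j)))" for x
    by (simp add: vec_eq_iff e)
  then show "linear (\<lambda>x. det_form (v(i := x)))"
    unfolding det_form_def
    by (intro linearI) (simp_all only: linear_add[OF linear_of_cplx] linear_cmul[OF linear_of_cplx]
        det_row_add scalar_mult_eq_scaleR[symmetric] det_row_mul of_real_add of_real_mult
        scaleR_conv_of_real[where 'a = complex])
next
  fix v :: "nat \<Rightarrow> complex^'n" and i j assume ij: "i < 2 * CARD('n)" "j < 2 * CARD('n)" "i \<noteq> j \<and> v i = v j"
  have "det (\<chi> l :: 'n bit0. of_cplx (v (index_num l))) = 0"
  proof (rule det_identical_rows)
    show "index_enum i \<noteq> (index_enum j :: 'n bit0)" using index_num_enum ij by metis
    show "row (index_enum i) (\<chi> l :: 'n bit0. of_cplx (v (index_num l))) = row (index_enum j) (\<chi> l :: 'n bit0. of_cplx (v (index_num l)))"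
      using ij by (simp add: row_def index_num_enum)
  qed
  then show "det_form v = 0" by (simp add: det_form_def)
qed

lemma det_form_transform:
  fixes T :: "complex^'n::finite \<Rightarrow> complex^'n"
  shows "det_form (\<lambda>i. T (frame i)) = of_real (real_det T)"
proof -
  have "(\<chi> j :: 'n bit0. of_cplx (T (frame (index_num j)))) = transpose (matrix (of_cplx \<circ> T \<circ> to_cplx))"
    by (simp add: vec_eq_iff transpose_def matrix_def frame_def index_num(2))
  then show ?thesis by (simp add: det_form_def real_det_def)
qed

lemma real_det_id: "real_det (\<lambda>x :: complex^'n::finite. x) = 1"
proof -
  have "of_cplx \<circ> (\<lambda>x :: complex^'n. x) \<circ> to_cplx = id" by auto
  then show ?thesis by (simp only: real_det_def matrix_id_mat_1 det_I)
qed

text \<open>Top-degree forms are multiples of \<open>det_form\<close>: subtracting the multiple with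
  the same value on \<open>frame\<close> leaves a form that vanishes on \<open>frame\<close>, hence
  everywhere.\<close>

lemma alternating_transform:
  fixes \<alpha> :: "(nat \<Rightarrow> complex^'n::finite) \<Rightarrow> complex"
  assumes \<alpha>: "alternating_form (2 * CARD('n)) \<alpha>"
  shows "\<alpha> (\<lambda>i. T (frame i)) = of_real (real_det T) * \<alpha> frame"
proof -
  have 1: "alternating_form (2 * CARD('n)) (\<lambda>v. \<alpha> v + (- \<alpha> frame) * det_form v)"
    by (intro alternating_add alternating_cmult \<alpha> alternating_det_form)
  have "det_form (frame :: nat \<Rightarrow> complex^'n) = 1" using det_form_transform[of "\<lambda>x. x"] by (simp add: real_det_id)
  then have "\<alpha> (\<lambda>i. T (frame i)) + (- \<alpha> frame) * det_form (\<lambda>i. T (frame i)) = 0"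
    using alternating_frame_eq_0[OF 1, of "\<lambda>i. T (frame i)"] by simp
  then show ?thesis by (simp add: det_form_transform)
qed

text \<open>The set of \<open>z\<close> for which \<open>(1 - z) + z T\<close> is invertible is the complement of a finite set, hence
  connected; the real determinant does not vanish there and equals \<open>1\<close> at \<open>z = 0\<close>.\<close>

lemma real_det_pos:
  fixes T :: "complex^'n::finite \<Rightarrow> complex^'n"
  assumes T: "linear T" "\<And>c v. T (c *s v) = c *s T v" "inj T"
  shows "real_det T > 0"
proof -
  have linT: "Vector_Spaces.linear (*s) (*s) T"
    by unfold_locales (auto simp: T(2) linear_add[OF T(1)])
  define B where "B = matrix T"
  \<comment> \<open>The complex determinant of (1 - z) + z T as a polynomial in z. It is not 0 at z
    = 0, so it has finitely many roots, and injectivity of \<open>T\<close> keeps z = 1 from being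
    one of them.\<close>
  define P where "P = (\<Sum>p | p permutes (UNIV :: 'n set). of_int (sign p) *
      (\<Prod>i\<in>UNIV. [: mat 1 $ i $ p i, B $ i $ p i - mat 1 $ i $ p i :]))"
  define Az where "Az z = (\<chi> i j. mat 1 $ i $ j + z * (B $ i $ j - mat 1 $ i $ j))" for z
  have P: "poly P z = det (Az z)" for z
    by (simp add: P_def det_def Az_def poly_sum poly_prod)
  define F where "F z v = v + z *s (T v - v)" for z v
  have F: "F z = (*v) (Az z)" for z
  proof
    fix v
    have "(Az z *v v) = (mat 1 *v v) + z *s (B *v v - mat 1 *v v)"
      by (simp add: vec_eq_iff matrix_vector_mult_def Az_def algebra_simps sum.distrib sum_distrib_left sum_subtractf)
    then show "F z v = Az z *v v" by (simp add: F_def B_def matrix_works[OF linT])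
  qed
  have "Az 0 = mat 1" "Az 1 = B" by (simp_all add: Az_def vec_eq_iff)
  then have P01: "poly P 0 \<noteq> 0" "poly P 1 \<noteq> 0"
    using det_nz_iff_inj_gen[OF linT] T(3) by (auto simp: P B_def)
  define Z where "Z = UNIV - {z. poly P z = 0}"
  have "finite {z. poly P z = 0}" using P01(1) by (intro poly_roots_finite) auto
  then have conn: "connected Z"
    unfolding Z_def by (intro connected_open_delete_finite) auto
  have nz: "real_det (F z) \<noteq> 0" if "z \<in> Z" for z
  proof -
    have "inj (F z)"
      using det_nz_iff_inj_gen[OF matrix_vector_mul_linear_gen[of "Az z"]] that P
      unfolding F Z_def by simp
    then have "inj (of_cplx \<circ> F z \<circ> to_cplx)"
      by (metis bij_is_inj bij_to_cplx inj_compose inj_on_inverseI to_of_cplx)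
    moreover have "linear (F z)" unfolding F by simp
    then have "linear (of_cplx \<circ> F z \<circ> to_cplx)"
      by (intro linear_compose linear_to_cplx linear_of_cplx)
    ultimately show ?thesis unfolding real_det_def by (simp add: det_nz_iff_inj)
  qed
  have bl: "bounded_linear of_cplx" using linear_of_cplx linear_conv_bounded_linear by blast
  have cz: "continuous_on UNIV (\<lambda>z. F z v)" for v
    unfolding F_def vector_scalar_mult_def
    by (intro continuous_on_add continuous_on_const continuous_on_vec_lambda continuous_on_mult continuous_on_id)
  have "continuous_on UNIV (\<lambda>z. real_det (F z))"
    unfolding real_det_def det_def matrix_def
    by (simp, intro continuous_on_sum continuous_on_mult continuous_on_const continuous_on_prod
        bounded_linear.continuous_on[OF bounded_linear_vec_nth] bounded_linear.continuous_on[OF bl] cz)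
  then have c: "continuous_on Z (\<lambda>z. real_det (F z))" by (rule continuous_on_subset) simp
  have "connected ((\<lambda>z. real_det (F z)) ` Z)" by (rule connected_continuous_image[OF c conn])
  then have iv: "is_interval ((\<lambda>z. real_det (F z)) ` Z)" by (simp add: is_interval_connected_1)
  have Z01: "0 \<in> Z" "1 \<in> Z" using P01 by (auto simp: Z_def)
  have F01: "F 0 = (\<lambda>x. x)" "F 1 = T" by (auto simp: F_def fun_eq_iff vec_eq_iff)
  from imageI[OF Z01(1), of "\<lambda>z. real_det (F z)"] imageI[OF Z01(2), of "\<lambda>z. real_det (F z)"] have "1 \<in> (\<lambda>z. real_det (F z)) ` Z" "real_det T \<in> (\<lambda>z. real_det (F z)) ` Z"
    by (simp_all only: F01 real_det_id)
  moreover have "0 \<notin> (\<lambda>z. real_det (F z)) ` Z" using nz by auto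
  ultimately show ?thesis
    using iv[unfolded is_interval_1] by (metis linorder_not_less zero_less_one_class.zero_le_one)
qed

definition vol_integral :: "(complex^'n::finite \<Rightarrow> complex) \<Rightarrow> complex"
  where "vol_integral h = integral UNIV (\<lambda>y. h (to_cplx y))"

lemma continuous_to_cplx: "continuous_on S to_cplx" and continuous_of_cplx: "continuous_on T of_cplx"
  using linear_to_cplx linear_of_cplx linear_continuous_on linear_conv_bounded_linear by blast+

lemma compact_supp_to_cplx:
  assumes "compact_supp h" shows "compact_supp (\<lambda>y. h (to_cplx y))"
proof -
  obtain C where C: "compact C" "\<And>x. x \<notin> C \<Longrightarrow> h x = 0" using assms unfolding compact_supp_def by blast
  have "compact (of_cplx ` C)" by (rule compact_continuous_image[OF continuous_of_cplx C(1)])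
  moreover have "h (to_cplx y) = 0" if "y \<notin> of_cplx ` C" for y
    using that by (intro C(2)) (metis image_eqI of_to_cplx)
  ultimately show ?thesis unfolding compact_supp_def by blast
qed

lemma vol_integrable:
  assumes "continuous_on UNIV h" "compact_supp h"
  shows "(\<lambda>y. h (to_cplx y)) absolutely_integrable_on UNIV"
  by (rule compact_supp_absolutely_integrable[OF _ compact_supp_to_cplx[OF assms(2)]])
    (rule continuous_on_compose2[OF assms(1) continuous_to_cplx], simp)

lemma vol_integral_add:
  assumes "continuous_on UNIV h" "compact_supp h" "continuous_on UNIV k" "compact_supp k"
  shows "vol_integral (\<lambda>x. h x + k x) = vol_integral h + vol_integral k"
  unfolding vol_integral_def
  using vol_integrable[OF assms(1,2)] vol_integrable[OF assms(3,4)]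
  by (intro integral_add) (auto simp: absolutely_integrable_on_def)

lemma vol_integral_cmult: "vol_integral (\<lambda>x. c * h x) = c * vol_integral h"
  unfolding vol_integral_def by simp

lemma vol_integral_fd:
  assumes "smooth_on UNIV h" "compact_supp h"
  shows "vol_integral (\<lambda>x. fd h x u) = 0"
proof -
  have sm: "smooth_on UNIV (\<lambda>y. h (to_cplx y))"
    by (rule smooth_on_compose[OF open_UNIV smooth_on_linear[OF open_UNIV linear_to_cplx smooth_on_id] assms(1)]) auto
  have "fd (\<lambda>y. h (to_cplx y)) y (of_cplx u) = fd h (to_cplx y) u" for y
  proof -
    have "((\<lambda>y. h (to_cplx y)) has_derivative (\<lambda>v. fd h (to_cplx y) (to_cplx v))) (at y)"
      by (rule has_derivative_compose[OF linear_imp_has_derivative[OF linear_to_cplx] smooth_on_has_derivative[OF assms(1)]]) simp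
    from fd_eqI[OF this] show ?thesis by simp
  qed
  then show ?thesis
    using integral_fd_eq_0[OF sm compact_supp_to_cplx[OF assms(2)], of "of_cplx u"] by (simp add: vol_integral_def)
qed

lemma vol_integral_change_of_variables:
  fixes \<phi> :: "complex^'n::finite \<Rightarrow> complex^'n"
  assumes S: "open S" "open (\<phi> ` S)" and \<phi>: "\<And>x. x \<in> S \<Longrightarrow> (\<phi> has_derivative \<phi>' x) (at x)" "inj_on \<phi> S"
    and pos: "\<And>x. x \<in> S \<Longrightarrow> real_det (\<phi>' x) > 0"
    and h: "continuous_on UNIV h" "compact_supp h" "\<And>y. y \<notin> \<phi> ` S \<Longrightarrow> h y = 0"
    and k: "continuous_on UNIV k" "compact_supp k" "\<And>x. x \<notin> S \<Longrightarrow> k x = 0"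
    and hk: "\<And>x. x \<in> S \<Longrightarrow> k x = of_real (real_det (\<phi>' x)) * h (\<phi> x)"
  shows "vol_integral k = vol_integral h"
proof -
  \<comment> \<open>The change of variables theorem speaks of functions with values in a real
    coordinate space, so the complex values are read in \<open>real^2\<close>.\<close>
  obtain \<psi> :: "complex \<Rightarrow> real^2" and \<psi>' where psi: "linear \<psi>" "\<And>z. \<psi>' (\<psi> z) = z"
    by (rule isomorphisms_UNIV_UNIV[where 'M = complex and 'N = "real^2"]) auto
  have bl: "bounded_linear \<psi>" using psi(1) linear_conv_bounded_linear by blast
  define g where "g = of_cplx \<circ> \<phi> \<circ> to_cplx"
  define g' where "g' y = of_cplx \<circ> \<phi>' (to_cplx y) \<circ> to_cplx" for y :: "real^('n bit0)"
  define S0 where "S0 = to_cplx -` S"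
  have oS0: "open S0" unfolding S0_def by (rule open_vimage[OF S(1) continuous_to_cplx])
  have im: "g ` S0 = to_cplx -` (\<phi> ` S)"
  proof (rule Set.set_eqI, rule iffI)
    fix y assume "y \<in> to_cplx -` (\<phi> ` S)"
    then obtain x where x: "x \<in> S" "to_cplx y = \<phi> x" by auto
    then have "y = g (of_cplx x)" "of_cplx x \<in> S0" by (auto simp: g_def S0_def) (metis of_to_cplx)
    then show "y \<in> g ` S0" by blast
  qed (auto simp: g_def S0_def)
  have oT0: "open (g ` S0)" unfolding im by (rule open_vimage[OF S(2) continuous_to_cplx])
  define f where "f y = \<psi> (h (to_cplx y))" for y
  have lin: "(\<lambda>y. \<psi> (F (to_cplx y))) absolutely_integrable_on UNIV \<and>
      integral UNIV (\<lambda>y. \<psi> (F (to_cplx y))) = \<psi> (vol_integral F)" if F: "continuous_on UNIV F" "compact_supp F" for F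
  proof -
    have 1: "(\<lambda>y. F (to_cplx y)) absolutely_integrable_on UNIV" by (rule vol_integrable[OF F])
    then have "integral UNIV (\<psi> \<circ> (\<lambda>y. F (to_cplx y))) = \<psi> (vol_integral F)"
      unfolding vol_integral_def by (intro integral_linear[OF _ bl]) (simp add: absolutely_integrable_on_def)
    then show ?thesis using absolutely_integrable_linear[OF 1 bl] by (simp add: o_def)
  qed
  have 1: "f absolutely_integrable_on (g ` S0)"
    unfolding f_def by (rule set_integrable_subset[OF lin[OF h(1,2), THEN conjunct1]])
      (use oT0 in \<open>auto intro: lebesgue_openin\<close>)
  have "integral S0 (\<lambda>y. \<bar>det (matrix (g' y))\<bar> *\<^sub>R f (g y)) = integral (g ` S0) f"
  proof (rule has_absolute_integral_change_of_variables[THEN iffD2, THEN conjunct2])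
    show "S0 \<in> sets lebesgue" using oS0 by (auto intro: lebesgue_openin)
    show "(g has_derivative g' y) (at y within S0)" if "y \<in> S0" for y
    proof -
      have y: "to_cplx y \<in> S" using that by (simp add: S0_def)
      have "((\<lambda>y. \<phi> (to_cplx y)) has_derivative (\<lambda>v. \<phi>' (to_cplx y) (to_cplx v))) (at y)"
        by (rule has_derivative_compose[OF linear_imp_has_derivative[OF linear_to_cplx] \<phi>(1)[OF y]])
      from has_derivative_compose[OF this linear_imp_has_derivative[OF linear_of_cplx]]
      have "(g has_derivative g' y) (at y)" by (simp add: g_def g'_def o_def)
      then show ?thesis by (rule has_derivative_at_withinI)
    qed
    show "inj_on g S0"
      using \<phi>(2) unfolding g_def S0_def inj_on_def by (metis comp_apply of_to_cplx to_of_cplx vimageE)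
    show "f absolutely_integrable_on (g ` S0) \<and> integral (g ` S0) f = integral (g ` S0) f" using 1 by simp
  qed
  moreover have "integral S0 (\<lambda>y. \<bar>det (matrix (g' y))\<bar> *\<^sub>R f (g y)) = integral S0 (\<lambda>y. \<psi> (k (to_cplx y)))"
  proof (rule integral_cong)
    fix y assume "y \<in> S0"
    then have y: "to_cplx y \<in> S" by (simp add: S0_def)
    have "\<bar>det (matrix (g' y))\<bar> = real_det (\<phi>' (to_cplx y))"
      using pos[OF y] by (simp add: g'_def real_det_def)
    moreover have "f (g y) = \<psi> (h (\<phi> (to_cplx y)))" by (simp add: f_def g_def)
    ultimately show "\<bar>det (matrix (g' y))\<bar> *\<^sub>R f (g y) = \<psi> (k (to_cplx y))"
      using hk[OF y] linear_cmul[OF psi(1)] by (simp add: scaleR_conv_of_real)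
  qed
  moreover have "integral S0 (\<lambda>y. \<psi> (k (to_cplx y))) = integral UNIV (\<lambda>y. \<psi> (k (to_cplx y)))"
    by (rule integral_eq_UNIV) (simp add: S0_def k(3) linear_0[OF psi(1)])
  moreover have "integral (g ` S0) f = integral UNIV f"
    by (rule integral_eq_UNIV) (simp add: im f_def h(3) linear_0[OF psi(1)])
  ultimately have "\<psi> (vol_integral k) = \<psi> (vol_integral h)"
    using lin[OF h(1,2)] lin[OF k(1,2)] by (simp add: f_def[abs_def])
  then show ?thesis using psi(2) by metis
qed


section \<open>Local integrals, Stokes' theorem and exactness on coordinate cells\<close>

section \<open>Cells and integration on a compact complex manifold\<close>

lemma alternating_above_dim:
  fixes \<alpha> :: "(nat \<Rightarrow> 'v::euclidean_space) \<Rightarrow> complex"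
  assumes "alternating_form k \<alpha>" "DIM('v) < k" shows "\<alpha> v = 0"
proof (rule alternating_eq_0[OF assms(1) finite_Basis])
  show "v i \<in> span Basis" for i by simp
  fix w :: "nat \<Rightarrow> 'v" assume w: "\<And>i. i < k \<Longrightarrow> w i \<in> Basis" "inj_on w {..<k}"
  have "card (w ` {..<k}) \<le> DIM('v)" by (rule card_mono) (use w(1) in auto)
  then show "\<alpha> w = 0" using card_image[OF w(2)] assms(2) by simp
qed

lemma smooth_compact_supp_fd:
  assumes "smooth_on UNIV h" "compact_supp h"
  shows "continuous_on UNIV (\<lambda>x. fd h x u)" "compact_supp (\<lambda>x. fd h x u)"
proof -
  show "continuous_on UNIV (\<lambda>x. fd h x u)" by (rule smooth_on_continuous_on[OF smooth_on_fd[OF assms(1)]])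
  obtain C where C: "compact C" "\<And>x. x \<notin> C \<Longrightarrow> h x = 0" using assms(2) unfolding compact_supp_def by blast
  have "fd h x u = 0" if "x \<notin> C" for x
  proof -
    have "frechet_derivative h (at x) = frechet_derivative (\<lambda>x. 0) (at x)"
      using that C by (intro fd_cong[of "- C"]) (auto simp: open_Compl compact_imp_closed)
    then show ?thesis by simp
  qed
  then show "compact_supp (\<lambda>x. fd h x u)" using C(1) unfolding compact_supp_def by blast
qed

lemma compact_supp_add: "compact_supp h \<Longrightarrow> compact_supp k \<Longrightarrow> compact_supp (\<lambda>x. h x + k x)"
  unfolding compact_supp_def
proof (elim exE conjE)
  fix C D assume "compact C" "compact D" "\<forall>x. x \<notin> C \<longrightarrow> h x = 0" "\<forall>x. x \<notin> D \<longrightarrow> k x = 0"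
  then show "\<exists>C. compact C \<and> (\<forall>x. x \<notin> C \<longrightarrow> h x + k x = 0)"
    by (intro exI[of _ "C \<union> D"]) auto
qed

lemma compact_supp_cmult: "compact_supp h \<Longrightarrow> compact_supp (\<lambda>x. c * h x)"
  unfolding compact_supp_def by auto

lemma vol_integral_sum_fd:
  assumes "finite I" "\<And>i. i \<in> I \<Longrightarrow> smooth_on UNIV (h i)" "\<And>i. i \<in> I \<Longrightarrow> compact_supp (h i)"
  shows "vol_integral (\<lambda>x. \<Sum>i\<in>I. a i * fd (h i) x (u i)) = 0"
proof -
  have "vol_integral (\<lambda>x. \<Sum>i\<in>I. a i * fd (h i) x (u i)) = 0 \<and>
    continuous_on UNIV (\<lambda>x. \<Sum>i\<in>I. a i * fd (h i) x (u i)) \<and> compact_supp (\<lambda>x. \<Sum>i\<in>I. a i * fd (h i) x (u i))"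
    using assms
  proof (induction rule: finite_induct)
    case empty
    show ?case by (simp add: vol_integral_def compact_supp_def) (rule exI[of _ "{}"], simp)
  next
    case (insert i I)
    have sm: "smooth_on UNIV (h i)" "compact_supp (h i)" using insert by auto
    note s = smooth_compact_supp_fd[OF sm, of "u i"]
    have s': "continuous_on UNIV (\<lambda>x. a i * fd (h i) x (u i))" "compact_supp (\<lambda>x. a i * fd (h i) x (u i))"
      using s by (auto intro: continuous_intros compact_supp_cmult)
    have IH: "vol_integral (\<lambda>x. \<Sum>i\<in>I. a i * fd (h i) x (u i)) = 0"
      "continuous_on UNIV (\<lambda>x. \<Sum>i\<in>I. a i * fd (h i) x (u i))" "compact_supp (\<lambda>x. \<Sum>i\<in>I. a i * fd (h i) x (u i))"
      using insert by auto
    have "vol_integral (\<lambda>x. a i * fd (h i) x (u i) + (\<Sum>i\<in>I. a i * fd (h i) x (u i))) = 0"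
      using vol_integral_add[OF s' IH(2,3)] IH(1) vol_integral_fd[OF sm] by (simp add: vol_integral_cmult)
    then show ?case
      using insert(1,2) continuous_on_add[OF s'(1) IH(2)] compact_supp_add[OF s'(2) IH(3)] by simp
  qed
  then show ?thesis by simp
qed

definition open_cube :: "'v::euclidean_space \<Rightarrow> real \<Rightarrow> 'v set"
  where "open_cube p r = {x. \<forall>b\<in>Basis. \<bar>(x - p) \<bullet> b\<bar> < r}"

lemma open_cube_shrink:
  fixes p :: "'v::euclidean_space"
  assumes "compact C" "C \<subseteq> open_cube p r" "r > 0"
  obtains \<rho> where "0 < \<rho>" "\<rho> < r" "\<And>x b. x \<in> C \<Longrightarrow> b \<in> Basis \<Longrightarrow> \<bar>(x - p) \<bullet> b\<bar> \<le> \<rho>"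
proof (cases "C = {}")
  case True
  then show ?thesis using that[of "r / 2"] assms(3) by auto
next
  case False
  have "continuous_on C (\<lambda>x. infnorm (x - p))" by (intro continuous_intros)
  then obtain x0 where x0: "x0 \<in> C" "\<And>x. x \<in> C \<Longrightarrow> infnorm (x - p) \<le> infnorm (x0 - p)"
    using continuous_attains_sup[OF assms(1) False] by blast
  have "infnorm (x0 - p) < r"
    using x0(1) assms(2) by (auto simp: infnorm_Max open_cube_def)
  show ?thesis
  proof (rule that[of "max (r / 2) (infnorm (x0 - p))"])
    \<comment> \<open>The maximum with \<open>r / 2\<close> keeps the radius positive when
      \<open>C\<close> is just the centre of the cube.\<close>
    show "\<bar>(x - p) \<bullet> b\<bar> \<le> max (r / 2) (infnorm (x0 - p))" if "x \<in> C" "b \<in> Basis" for x b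
      using Basis_le_infnorm[OF that(2), of "x - p"] x0(2)[OF that(1)] by linarith
  qed (use assms(3) \<open>infnorm (x0 - p) < r\<close> in auto)
qed

context complex_atlas
begin

definition cell_in :: "('a, 'n) chart \<Rightarrow> 'a set \<Rightarrow> bool"
  where "cell_in c U \<longleftrightarrow> c \<in> A \<and> (\<exists>p r. r > 0 \<and> open_cube p r \<subseteq> chart_img c \<and>
    U = {q \<in> fst c. snd c q \<in> open_cube p r})"

text \<open>The integral read in the chart \<open>c\<close>. Local expressions vanish off the chart
  image, so integrating over the whole coordinate space is the right encoding when the form is
  supported in the chart.\<close>

definition cint :: "('a, 'n) chart \<Rightarrow> ('a, 'n) form \<Rightarrow> complex"
  where "cint c \<omega> = vol_integral (\<lambda>x. \<omega> c x frame)"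

lemma cint_scale: "cint c (form_scale a \<omega>) = a * cint c \<omega>"
  by (simp add: cint_def form_scale_def vol_integral_cmult)

lemma form_eq_in_chart:
  assumes "\<alpha> \<in> smooth_forms A k" "\<beta> \<in> smooth_forms A k" "c \<in> A" "supp_in (fst c) \<alpha>" "supp_in (fst c) \<beta>"
    and eq: "\<And>x. x \<in> chart_img c \<Longrightarrow> \<alpha> c x = \<beta> c x"
  shows "\<alpha> = \<beta>"
proof (rule form_eqI[OF assms(1,2)])
  fix p assume p: "p \<in> topspace X"
  show "\<exists>c\<in>A. p \<in> fst c \<and> \<alpha> c (snd c p) = \<beta> c (snd c p)"
  proof (cases "p \<in> fst c")
    case True
    then show ?thesis using assms(3) eq by (intro bexI[of _ c]) auto
  next
    case False
    obtain d where d: "d \<in> A" "p \<in> fst d" using p covers by blast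
    have *: "\<gamma> d (snd d p) = 0" if "supp_in (fst c) \<gamma>" for \<gamma>
    proof -
      obtain K where K: "K \<subseteq> fst c" "vanishes_off K \<gamma>" using \<open>supp_in (fst c) \<gamma>\<close> unfolding supp_in_def by blast
      have "snd d p \<in> chart_img d" "pt d (snd d p) \<notin> K" using d False K(1) by auto
      then show ?thesis using K(2) d(1) unfolding vanishes_off_def by blast
    qed
    have "\<alpha> d (snd d p) = 0" "\<beta> d (snd d p) = 0"
      using *[OF assms(4)] *[OF assms(5)] by auto
    then show ?thesis using d by (intro bexI[of _ d]) auto
  qed
qed

lemma extend_cube:
  assumes U: "c \<in> A" "open_cube p r \<subseteq> chart_img c" "U = {q \<in> fst c. snd c q \<in> open_cube p r}"
    and cube: "cube r \<rho>" and w: "local_form UNIV k w" "cube.cube_supp p \<rho> w"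
  shows "extend c w \<in> smooth_forms A k" "supp_in U (extend c w)"
    "\<And>x. x \<in> chart_img c \<Longrightarrow> extend c w c x = w x"
    "\<And>x. x \<in> chart_img c \<Longrightarrow> ext_deriv A k (extend c w) c x = ld k w x"
proof -
  interpret cube p r \<rho> by (rule cube)
  have B: "Bx = open_cube p r" by (simp add: Bx_def open_cube_def co_def)
  have C: "Cx \<subseteq> chart_img c" using Cx_subset U(2) B by blast
  have z: "w x = 0" if "x \<notin> Cx" for x using w(2) that by (simp add: cube_supp_def fun_eq_iff)
  show "extend c w \<in> smooth_forms A k"
    by (rule extend_smooth[OF U(1) compact_Cx C z local_form_subset[OF w(1)]]) auto
  have "pt c ` Cx \<subseteq> U"
  proof (rule image_subsetI)
    fix x assume "x \<in> Cx"
    then have "x \<in> chart_img c" "x \<in> open_cube p r" using C Cx_subset B by auto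
    then show "pt c x \<in> U" by (simp add: U(3))
  qed
  moreover have "vanishes_off (pt c ` Cx) (extend c w)" by (rule extend_vanishes[OF U(1) C z])
  ultimately show "supp_in U (extend c w)"
    unfolding supp_in_def using compactin_pt_image[OF U(1) compact_Cx C] by (intro exI[of _ "pt c ` Cx"] conjI)
  show s: "extend c w c x = w x" if "x \<in> chart_img c" for x by (rule extend_self[OF U(1) that])
  show "ext_deriv A k (extend c w) c x = ld k w x" if "x \<in> chart_img c" for x
  proof -
    have "ld k (extend c w c) x v = ld k w x v" for v by (rule ld_cong[OF chart(2)[OF U(1)] that s])
    then show ?thesis using U(1) that by (simp add: ext_deriv_eq fun_eq_iff)
  qed
qed

end

locale compact_atlas = complex_atlas X A for X :: "'a topology" and A :: "('a, 'n::finite) chart set" +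
  assumes compact: "compact_space X"
begin

text \<open>Local expressions are 0 off the chart image, so \<open>\<omega> c\<close> is its own
  extension by zero. It is smooth because the chart image and the complement of the compact image of
  the support are open, and they cover the whole space.\<close>

lemma chart_form_UNIV:
  assumes w: "\<omega> \<in> smooth_forms A k" and c: "c \<in> A" and U: "supp_in U \<omega>" "U \<subseteq> fst c"
  obtains C where "compact C" "C \<subseteq> snd c ` U" "\<And>x. x \<notin> C \<Longrightarrow> \<omega> c x = 0" "local_form UNIV k (\<omega> c)"
    "\<And>x. ext_deriv A k \<omega> c x = ld k (\<omega> c) x"
proof -
  obtain K where K: "K \<subseteq> U" "closedin X K" "vanishes_off K \<omega>" using U(1) unfolding supp_in_def by blast
  have "compactin X K" using closedin_compact_space[OF compact K(2)] .
  then have "compactin (subtopology X (fst c)) K" using K(1) U(2) by (simp add: compactin_subtopology)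
  then have "compactin (top_of_set (chart_img c)) (snd c ` K)"
    by (rule image_compactin[OF _ homeomorphic_imp_continuous_map[OF chart(3)[OF c]]])
  then have cK: "compact (snd c ` K)" by (simp add: compactin_subtopology)
  have z: "\<omega> c x = 0" if "x \<notin> snd c ` K" for x
  proof (cases "x \<in> chart_img c")
    case True
    then have "pt c x \<notin> K" using \<open>x \<notin> snd c ` K\<close> chart_pt[OF True] by (metis image_eqI)
    then show ?thesis using K(3) c True by (auto simp: vanishes_off_def)
  qed (simp add: smooth_formsD(3)[OF w])
  let ?V = "- (snd c ` K)"
  have V: "open ?V" using cK by (simp add: open_Compl compact_imp_closed)
  have "local_form ?V k (\<omega> c)"
    using local_form_cong[OF V, of "\<omega> c" "\<lambda>x v. 0" k] z local_form_0 by (simp add: fun_eq_iff)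
  then have "local_form (chart_img c \<union> ?V) k (\<omega> c)"
    by (intro local_form_Un chart(2)[OF c] V smooth_formsD(1)[OF w c])
  moreover have "chart_img c \<union> ?V = UNIV" using K(1) U(2) by (auto simp: chart_img_def)
  ultimately have l: "local_form UNIV k (\<omega> c)" by simp
  have "ext_deriv A k \<omega> c x = ld k (\<omega> c) x" for x
  proof (cases "x \<in> chart_img c")
    case False
    then have "x \<in> ?V" using K(1) U(2) by (auto simp: chart_img_def)
    then have "ld k (\<omega> c) x v = ld k (\<lambda>x v. 0) x v" for v
      by (rule ld_cong[OF V]) (use z in \<open>auto simp: fun_eq_iff\<close>)
    then show ?thesis using False by (simp add: ext_deriv_eq fun_eq_iff)
  qed (simp add: ext_deriv_eq c)
  then show thesis using that[of "snd c ` K"] cK K(1) z l by blast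
qed

lemma chart_function_UNIV:
  assumes w: "\<omega> \<in> smooth_forms A k" and c: "c \<in> A" and U: "supp_in (fst c) \<omega>"
  shows "smooth_on UNIV (\<lambda>x. \<omega> c x v)" "continuous_on UNIV (\<lambda>x. \<omega> c x v)" "compact_supp (\<lambda>x. \<omega> c x v)"
proof -
  obtain C where C: "compact C" "\<And>x. x \<notin> C \<Longrightarrow> \<omega> c x = 0" "local_form UNIV k (\<omega> c)"
    using chart_form_UNIV[OF w c U order_refl] by metis
  show s: "smooth_on UNIV (\<lambda>x. \<omega> c x v)" by (rule local_formD2[OF C(3)])
  then show "continuous_on UNIV (\<lambda>x. \<omega> c x v)" by (rule smooth_on_continuous_on)
  show "compact_supp (\<lambda>x. \<omega> c x v)" unfolding compact_supp_def using C(1,2) by (metis zero_fun_apply)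
qed

lemma cint_add:
  assumes "\<alpha> \<in> smooth_forms A k" "\<beta> \<in> smooth_forms A k" "c \<in> A" "supp_in (fst c) \<alpha>" "supp_in (fst c) \<beta>"
  shows "cint c (\<alpha> + \<beta>) = cint c \<alpha> + cint c \<beta>"
  unfolding cint_def plus_fun_apply
  by (intro vol_integral_add chart_function_UNIV[OF assms(1,3,4)] chart_function_UNIV[OF assms(2,3,5)])

lemma cint_diff:
  assumes "\<alpha> \<in> smooth_forms A k" "\<beta> \<in> smooth_forms A k" "c \<in> A" "supp_in (fst c) \<alpha>" "supp_in (fst c) \<beta>"
  shows "cint c (\<alpha> - \<beta>) = cint c \<alpha> - cint c \<beta>"
  using cint_add[OF assms(1) form_scale_smooth[OF assms(2), of "- 1"] assms(3,4) supp_in_scale[OF assms(5)]]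
  by (simp add: cint_scale) (simp add: form_scale_simps)

text \<open>Stokes' theorem for one chart: every term of d is a directional derivative of a
  compactly supported function and integrates to 0.\<close>

lemma cint_ext_deriv:
  assumes w: "\<omega> \<in> smooth_forms A k" and c: "c \<in> A" "supp_in (fst c) \<omega>"
  shows "cint c (ext_deriv A k \<omega>) = 0"
proof -
  have "\<And>x. ext_deriv A k \<omega> c x = ld k (\<omega> c) x" using chart_form_UNIV[OF w c order_refl] by metis
  then have "cint c (ext_deriv A k \<omega>) = vol_integral (\<lambda>x. \<Sum>i\<le>k. (- 1) ^ i * fd (\<lambda>y. \<omega> c y (omit i frame)) x (frame i))"
    by (simp add: cint_def ld_def)
  also have "\<dots> = 0" by (intro vol_integral_sum_fd chart_function_UNIV[OF w c]) simp
  finally show ?thesis .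
qed

text \<open>The change of variables formula contains the absolute value of the Jacobian, whereas a
  form picks up the Jacobian itself. They agree because transition maps are holomorphic, so that
  \<open>real_det_pos\<close> applies.\<close>

lemma cint_change_chart:
  assumes w: "\<omega> \<in> smooth_forms A (2 * CARD('n))" and cd: "c \<in> A" "d \<in> A" and s: "supp_in (fst c \<inter> fst d) \<omega>"
  shows "cint c \<omega> = cint d \<omega>"
proof -
  let ?\<phi> = "transition c d" and ?S = "overlap c d"
  have sc: "supp_in (fst c) \<omega>" and sd: "supp_in (fst d) \<omega>" using supp_in_mono[OF s] by auto
  have im: "?\<phi> ` ?S = overlap d c"
  proof (rule Set.set_eqI, rule iffI)
    fix y assume y: "y \<in> overlap d c"
    then have "y = ?\<phi> (transition d c y)" using cd by (auto simp: overlapD transition_eq)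
    then show "y \<in> ?\<phi> ` ?S" using transition_in[OF cd(2,1) y] by blast
  qed (use transition_in[OF cd] in auto)
  have inv: "transition d c (?\<phi> x) = x" if "x \<in> ?S" for x
    using that cd by (auto simp: overlapD transition_eq)
  have z: "\<omega> e x frame = 0" if e: "e \<in> A" "e' \<in> A" "supp_in (fst e \<inter> fst e') \<omega>" "x \<notin> overlap e e'" for e e' x
  proof -
    obtain C where C: "C \<subseteq> snd e ` (fst e \<inter> fst e')" "\<And>x. x \<notin> C \<Longrightarrow> \<omega> e x = 0"
      using chart_form_UNIV[OF w e(1,3)] by (metis inf_le1)
    then have "x \<notin> C" using e(4) by (auto simp: overlap_def)
    then show ?thesis using C(2) by simp
  qed
  show ?thesis
    unfolding cint_def
  proof (rule vol_integral_change_of_variables[where \<phi> = ?\<phi> and S = ?S and \<phi>' = "\<lambda>x. frechet_derivative ?\<phi> (at x)"])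
    show "open ?S" "open (?\<phi> ` ?S)" unfolding im by (intro open_overlap cd)+
    show "(?\<phi> has_derivative frechet_derivative ?\<phi> (at x)) (at x)" if "x \<in> ?S" for x
      by (rule transition_derivative[OF cd that])
    show "inj_on ?\<phi> ?S" using inv by (metis inj_onI)
    show "continuous_on UNIV (\<lambda>x. \<omega> d x frame)" "compact_supp (\<lambda>x. \<omega> d x frame)"
      by (rule chart_function_UNIV[OF w cd(2) sd])+
    show "continuous_on UNIV (\<lambda>x. \<omega> c x frame)" "compact_supp (\<lambda>x. \<omega> c x frame)"
      by (rule chart_function_UNIV[OF w cd(1) sc])+
    show "\<omega> d y frame = 0" if "y \<notin> ?\<phi> ` ?S" for y
      using z[OF cd(2,1)] s that unfolding im by (simp add: Int_commute)
    show "\<omega> c x frame = 0" if "x \<notin> ?S" for x using z[OF cd s that] .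
  next
    fix x assume x: "x \<in> ?S"
    have lin: "linear (frechet_derivative ?\<phi> (at x))" by (rule smooth_on_linear_fd[OF transition_smooth[OF cd] x])
    have "inj (frechet_derivative ?\<phi> (at x))"
    proof (rule injI)
      fix u v assume e: "fd ?\<phi> x u = fd ?\<phi> x v"
      have xc: "x \<in> chart_img c" "x \<in> overlap c c" using x cd by (auto simp: overlapD)
      have inv': "fd (transition d c) (?\<phi> x) (fd ?\<phi> x u) = u" for u
        using fd_transition_trans[OF cd cd(1) x xc(2), of u] fd_transition_self[OF cd(1) xc(1), of u] by (rule trans)
      have "u = fd (transition d c) (?\<phi> x) (fd ?\<phi> x u)" by (rule inv'[symmetric])
      also have "\<dots> = fd (transition d c) (?\<phi> x) (fd ?\<phi> x v)" by (simp only: e)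
      also have "\<dots> = v" by (rule inv')
      finally show "u = v" .
    qed
    then show "real_det (frechet_derivative ?\<phi> (at x)) > 0"
      using holomorphic_map_on_fd[OF transition_holomorphic[OF cd] x] by (intro real_det_pos lin)
    have "?\<phi> x \<in> chart_img d" using transition_in[OF cd x] cd by (simp add: overlapD)
    then have "alternating_form (2 * CARD('n)) (\<omega> d (?\<phi> x))"
      by (rule local_formD1[OF smooth_formsD(1)[OF w cd(2)]])
    from alternating_transform[OF this, of "frechet_derivative ?\<phi> (at x)"]
    show "\<omega> c x frame = of_real (real_det (frechet_derivative ?\<phi> (at x))) * \<omega> d (?\<phi> x) frame"
      using smooth_formsD(2)[OF w cd x] by (simp add: pullback_def)
  qed
qed

subsection \<open>Bumps and exactness on cells\<close>

lemma cell_subset: "cell_in c U \<Longrightarrow> U \<subseteq> fst c" and cell_chart: "cell_in c U \<Longrightarrow> c \<in> A"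
  by (auto simp: cell_in_def)

lemma cell_open: "cell_in c U \<Longrightarrow> openin X U"
proof -
  assume "cell_in c U"
  then obtain p r where c: "c \<in> A" and U: "U = {q \<in> fst c. snd c q \<in> open_cube p r}" and r: "r > 0"
    unfolding cell_in_def by blast
  interpret cube p r "r / 2" by unfold_locales (use r in auto)
  have "open (open_cube p r)" using open_Bx by (simp add: Bx_def open_cube_def co_def)
  then show ?thesis unfolding U by (rule openin_chart_preimage[OF c])
qed

lemma cell_exists:
  assumes "openin X W" "q \<in> W"
  obtains c U p r where "c \<in> A" "r > 0" "open_cube p r \<subseteq> chart_img c" "U = {q \<in> fst c. snd c q \<in> open_cube p r}"
    "p = snd c q" "q \<in> U" "U \<subseteq> W"
proof -
  obtain c where c: "c \<in> A" "q \<in> fst c" using covers assms openin_subset by blast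
  have "open {x \<in> chart_img c. pt c x \<in> W}" by (rule open_chart_part[OF c(1) assms(1)])
  moreover have "snd c q \<in> {x \<in> chart_img c. pt c x \<in> W}" using c assms(2) by simp
  ultimately obtain e where e: "e > 0" "ball (snd c q) e \<subseteq> {x \<in> chart_img c. pt c x \<in> W}"
    using openE by blast
  \<comment> \<open>The Euclidean norm is at most the sum of the absolute coordinates, so this cube
    stays within distance e / 2 of its centre.\<close>
  define r where "r = e / (2 * DIM(complex^'n))"
  have r: "r > 0" using e(1) by (simp add: r_def)
  have sub: "open_cube (snd c q) r \<subseteq> ball (snd c q) e"
  proof
    fix x assume x: "x \<in> open_cube (snd c q) r"
    have "norm (x - snd c q) \<le> (\<Sum>b\<in>Basis. \<bar>(x - snd c q) \<bullet> b\<bar>)" by (rule norm_le_l1)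
    also have "\<dots> \<le> (\<Sum>b\<in>(Basis :: (complex^'n) set). r)"
      by (rule sum_mono) (use x in \<open>auto simp: open_cube_def less_imp_le\<close>)
    also have "\<dots> = e / 2" by (simp add: r_def)
    also have "\<dots> < e" using e(1) by simp
    finally show "x \<in> ball (snd c q) e" by (simp add: dist_norm norm_minus_commute)
  qed
  show thesis
  proof (rule that[OF c(1) r _ refl refl])
    show "open_cube (snd c q) r \<subseteq> chart_img c" using sub e(2) by blast
    show "q \<in> {q' \<in> fst c. snd c q' \<in> open_cube (snd c q) r}" using c(2) r by (simp add: open_cube_def)
    show "{q' \<in> fst c. snd c q' \<in> open_cube (snd c q) r} \<subseteq> W"
      using sub e(2) c(1) by force
  qed
qed

definition cube_bump :: "complex^'n \<Rightarrow> real \<Rightarrow> complex^'n \<Rightarrow> real"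
  where "cube_bump p \<rho> x = (\<Prod>b\<in>Basis. bump1 \<rho> ((x - p) \<bullet> b))"

lemma cube_bump_smooth: "smooth_on UNIV (\<lambda>x. complex_of_real (cube_bump p \<rho> x))"
  unfolding cube_bump_def
proof (intro smooth_on_bounded_linear[OF open_UNIV bounded_linear_of_real] smooth_on_prod[OF open_UNIV])
  fix b :: "complex^'n"
  have "smooth_on UNIV (\<lambda>x. (\<lambda>y. y \<bullet> b) (x + - p))"
    by (intro smooth_on_bounded_linear[OF open_UNIV bounded_linear_inner_left] smooth_on_add smooth_on_id smooth_on_const) auto
  then show "smooth_on UNIV (\<lambda>x. bump1 \<rho> ((x - p) \<bullet> b))"
    using smooth_on_compose[OF open_UNIV _ smooth_on_bump1] by auto
qed

lemma cube_bump_nonneg: "cube_bump p \<rho> x \<ge> 0"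
  unfolding cube_bump_def by (intro prod_nonneg bump1_nonneg)

lemma cube_bump_pos: "x \<in> open_cube p \<rho> \<Longrightarrow> cube_bump p \<rho> x > 0"
  unfolding cube_bump_def open_cube_def by (intro prod_pos bump1_pos) auto

lemma cube_bump_0: "b \<in> Basis \<Longrightarrow> \<rho> \<le> \<bar>(x - p) \<bullet> b\<bar> \<Longrightarrow> cube_bump p \<rho> x = 0"
  unfolding cube_bump_def using bump1_eq_0 by (metis finite_Basis prod_zero)

lemma bump_function:
  assumes "openin X W" "q \<in> W"
  obtains c U V g where "cell_in c U" "U \<subseteq> W" "openin X V" "q \<in> V" "smooth_fun g" "fun_supp_in U g"
    "\<And>p. \<exists>t\<ge>0. g p = complex_of_real t" "\<And>p. p \<in> V \<Longrightarrow> g p \<noteq> 0"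
proof -
  obtain c U p r where c: "c \<in> A" "r > 0" "open_cube p r \<subseteq> chart_img c" "U = {q \<in> fst c. snd c q \<in> open_cube p r}"
    "p = snd c q" "q \<in> U" "U \<subseteq> W" by (rule cell_exists[OF assms]) (rule that)
  interpret cube p r "r / 2" by unfold_locales (use c in auto)
  have B: "Bx = open_cube p r" by (simp add: Bx_def open_cube_def co_def)
  have C: "Cx \<subseteq> chart_img c" using Cx_subset c(3) B by blast
  let ?h = "\<lambda>x. complex_of_real (cube_bump p (r / 2) x)"
  let ?g = "\<lambda>q. if q \<in> fst c then ?h (snd c q) else 0"
  have z: "?h x = 0" if "x \<notin> Cx" for x
    using that cube_bump_0[of _ "r / 2" x p] by (auto simp: Cx_def co_def not_le less_imp_le)
  note s = smooth_fun_extend[OF c(1) compact_Cx C z smooth_on_subset[OF cube_bump_smooth subset_UNIV]]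
  let ?V = "{q \<in> fst c. snd c q \<in> open_cube p (r / 2)}"
  show thesis
  proof (rule that[of c U ?V ?g])
    show "cell_in c U" using c unfolding cell_in_def by blast
    show "U \<subseteq> W" by (rule c)
    interpret h: cube p "r / 2" "r / 4" by unfold_locales (use c in auto)
    have "open (open_cube p (r / 2))" using h.open_Bx by (simp add: h.Bx_def open_cube_def h.co_def)
    then show "openin X ?V" by (rule openin_chart_preimage[OF c(1)])
    show "q \<in> ?V" using c by (simp add: open_cube_def)
    show "smooth_fun ?g" by (rule s(1))
    have "pt c ` Cx \<subseteq> U"
    proof (rule image_subsetI)
      fix x assume "x \<in> Cx"
      then have "x \<in> chart_img c" "x \<in> open_cube p r" using C Cx_subset B by auto
      then show "pt c x \<in> U" by (simp add: c(4))
    qed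
    then show "fun_supp_in U ?g"
      unfolding fun_supp_in_def using compactin_pt_image[OF c(1) compact_Cx C] s(2) by blast
    show "\<exists>t\<ge>0. ?g p' = complex_of_real t" for p'
      using cube_bump_nonneg by (cases "p' \<in> fst c") auto
    show "?g p' \<noteq> 0" if "p' \<in> ?V" for p'
      using that cube_bump_pos[of "snd c p'" p "r / 2"] by auto
  qed
qed

lemma bump_form:
  assumes "openin X W" "q \<in> W"
  obtains \<mu> c where "c \<in> A" "\<mu> \<in> smooth_forms A (2 * CARD('n))" "supp_in W \<mu>" "supp_in (fst c) \<mu>" "cint c \<mu> = 1"
proof -
  obtain c U p r where c: "c \<in> A" "r > 0" "open_cube p r \<subseteq> chart_img c" "U = {q \<in> fst c. snd c q \<in> open_cube p r}"
    "p = snd c q" "q \<in> U" "U \<subseteq> W" by (rule cell_exists[OF assms]) (rule that)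
  have cu: "cube r (r / 2)" by unfold_locales (use c in auto)
  interpret cube p r "r / 2" by (rule cu)
  define h where "h = (\<lambda>x. complex_of_real (cube_bump p (r / 2) x))"
  have z: "h x = 0" if "x \<notin> Cx" for x
    using that cube_bump_0[of _ "r / 2" x p] by (auto simp: h_def Cx_def co_def not_le less_imp_le)
  define w :: "complex^'n \<Rightarrow> (nat \<Rightarrow> complex^'n) \<Rightarrow> complex" where "w = (\<lambda>x v. h x * det_form v)"
  have "local_form UNIV (2 * CARD('n)) (\<lambda>x :: complex^'n. det_form)"
    by (simp add: local_form_def alternating_det_form smooth_on_const)
  then have w: "local_form UNIV (2 * CARD('n)) w"
    unfolding w_def h_def by (intro local_form_fmult open_UNIV cube_bump_smooth)
  have ws: "cube_supp w" unfolding cube_supp_def using z by (simp add: w_def)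
  note e = extend_cube[OF c(1,3,4) cu w ws]
  have "det_form (frame :: nat \<Rightarrow> complex^'n) = 1"
    using det_form_transform[of "\<lambda>x :: complex^'n. x"] by (simp add: real_det_id)
  then have "extend c w c x frame = h x" for x
    using e(3)[of x] z[of x] smooth_formsD(3)[OF e(1), of c x] c(3) Cx_subset
    by (cases "x \<in> chart_img c") (auto simp: w_def Bx_def open_cube_def co_def)
  then have "cint c (extend c w) = integral UNIV (\<lambda>y. complex_of_real (cube_bump p (r / 2) (to_cplx y)))"
    by (simp add: cint_def vol_integral_def h_def)
  also have "\<dots> = of_real (integral UNIV (\<lambda>y. cube_bump p (r / 2) (to_cplx y)))"
  proof -
    have "(\<lambda>y. h (to_cplx y)) absolutely_integrable_on UNIV"
      using smooth_on_continuous_on[OF cube_bump_smooth] z compact_Cx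
      by (intro vol_integrable) (auto simp: h_def compact_supp_def)
    then have "(\<lambda>y. h (to_cplx y)) integrable_on UNIV" by (simp add: absolutely_integrable_on_def)
    from integrable_linear[OF this bounded_linear_Re]
    have "(\<lambda>y. cube_bump p (r / 2) (to_cplx y)) integrable_on UNIV" by (simp add: o_def h_def)
    moreover have "bounded_linear complex_of_real" by (rule bounded_linear_of_real)
    ultimately show ?thesis using integral_linear[of _ UNIV complex_of_real] by (simp add: o_def)
  qed
  finally have ci: "cint c (extend c w) = of_real (integral UNIV (\<lambda>y. cube_bump p (r / 2) (to_cplx y)))" .
  have "integral UNIV (\<lambda>y. cube_bump p (r / 2) (to_cplx y)) \<noteq> 0"
  proof (rule integral_nonneg_pos)
    have "continuous_on UNIV (\<lambda>x. Re (complex_of_real (cube_bump p (r / 2) x)))"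
      by (intro continuous_on_Re smooth_on_continuous_on[OF cube_bump_smooth])
    then show "continuous_on UNIV (\<lambda>y. cube_bump p (r / 2) (to_cplx y))"
      using continuous_on_compose2[OF _ continuous_to_cplx] by fastforce
    show "compact (of_cplx ` Cx)" by (rule compact_continuous_image[OF continuous_of_cplx compact_Cx])
    show "cube_bump p (r / 2) (to_cplx y) = 0" if "y \<notin> of_cplx ` Cx" for y
    proof -
      have "to_cplx y \<notin> Cx" using that by (metis image_eqI of_to_cplx)
      then show ?thesis using z[of "to_cplx y"] by (simp add: h_def)
    qed
    show "cube_bump p (r / 2) (to_cplx (of_cplx p)) \<noteq> 0"
      using cube_bump_pos[of p p "r / 2"] c(2) by (simp add: open_cube_def)
  qed (rule cube_bump_nonneg)
  then have nz: "cint c (extend c w) \<noteq> 0" by (simp add: ci)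
  have "U \<subseteq> fst c" by (auto simp: c(4))
  then show thesis
    using that[OF c(1) form_scale_smooth[OF e(1), of "inverse (cint c (extend c w))"]] nz
      supp_in_scale[OF supp_in_mono[OF e(2)]] c(7) by (auto simp: cint_scale)
qed

text \<open>One inner radius \<open>\<rho>\<close> serves both forms, so that they can be compared
  within a single instance of \<open>cube\<close>.\<close>

lemma cell_cube_form:
  assumes U: "cell_in c U" and w: "\<omega> \<in> smooth_forms A (Suc k)" "supp_in U \<omega>" "ext_deriv A (Suc k) \<omega> = 0"
    and m: "\<mu> \<in> smooth_forms A (Suc k)" "supp_in U \<mu>" "ext_deriv A (Suc k) \<mu> = 0"
  obtains p r \<rho> where "open_cube p r \<subseteq> chart_img c" "U = {q \<in> fst c. snd c q \<in> open_cube p r}" "cube r \<rho>"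
    "cube.cube_form p \<rho> (Suc k) (\<omega> c)" "cube.cube_form p \<rho> (Suc k) (\<mu> c)"
proof -
  obtain p r where c: "c \<in> A" and r: "r > 0" and B: "open_cube p r \<subseteq> chart_img c" and
    Ue: "U = {q \<in> fst c. snd c q \<in> open_cube p r}"
    using U unfolding cell_in_def by blast
  have Uc: "U \<subseteq> fst c" by (rule cell_subset[OF U])
  obtain C where C: "compact C" "C \<subseteq> snd c ` U" "\<And>x. x \<notin> C \<Longrightarrow> \<omega> c x = 0" "local_form UNIV (Suc k) (\<omega> c)"
    "\<And>x. ext_deriv A (Suc k) \<omega> c x = ld (Suc k) (\<omega> c) x"
    by (rule chart_form_UNIV[OF w(1) c w(2) Uc]) (rule that)
  obtain D where D: "compact D" "D \<subseteq> snd c ` U" "\<And>x. x \<notin> D \<Longrightarrow> \<mu> c x = 0" "local_form UNIV (Suc k) (\<mu> c)"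
    "\<And>x. ext_deriv A (Suc k) \<mu> c x = ld (Suc k) (\<mu> c) x"
    by (rule chart_form_UNIV[OF m(1) c m(2) Uc]) (rule that)
  have "C \<union> D \<subseteq> open_cube p r" using C(2) D(2) by (auto simp: Ue)
  then obtain \<rho> where rh: "0 < \<rho>" "\<rho> < r" "\<And>x b. x \<in> C \<union> D \<Longrightarrow> b \<in> Basis \<Longrightarrow> \<bar>(x - p) \<bullet> b\<bar> \<le> \<rho>"
    by (rule open_cube_shrink[OF compact_Un[OF C(1) D(1)] _ r]) (rule that)
  have cu: "cube r \<rho>" by unfold_locales (rule rh)+
  interpret cube p r \<rho> by (rule cu)
  have out: "x \<notin> C \<union> D" if "x \<notin> Cx" for x using that rh(3) by (auto simp: Cx_def co_def)
  have "cube_form (Suc k) (\<omega> c)"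
    unfolding cube_form_def cube_supp_def using C(3-5) w(3) out by (metis UnI1 zero_fun_apply)
  moreover have "cube_form (Suc k) (\<mu> c)"
    unfolding cube_form_def cube_supp_def using D(3-5) m(3) out by (metis UnI2 zero_fun_apply)
  ultimately show thesis by (rule that[OF B Ue cu])
qed

lemma cell_poincare:
  assumes U: "cell_in c U" and w: "\<omega> \<in> smooth_forms A (Suc k)" "supp_in U \<omega>" "ext_deriv A (Suc k) \<omega> = 0"
    and k: "Suc k < 2 * CARD('n)"
  obtains \<eta> where "\<eta> \<in> smooth_forms A k" "supp_in U \<eta>" "ext_deriv A k \<eta> = \<omega>"
proof -
  have c: "c \<in> A" by (rule cell_chart[OF U])
  obtain p r \<rho> where B: "open_cube p r \<subseteq> chart_img c" "U = {q \<in> fst c. snd c q \<in> open_cube p r}" "cube r \<rho>"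
    "cube.cube_form p \<rho> (Suc k) (\<omega> c)" by (rule cell_cube_form[OF U w w]) (rule that)
  interpret cube p r \<rho> by (rule B(3))
  have "Suc k < DIM(complex^'n)" using k by simp
  then obtain \<eta> where h: "local_form UNIV k \<eta>" "cube_supp \<eta>" "\<And>x v. \<omega> c x v = ld k \<eta> x v"
    using compact_poincare[OF B(4)] by metis
  note e = extend_cube[OF c B(1,2,3) h(1,2)]
  have "ext_deriv A k (extend c \<eta>) = \<omega>"
    using e h(3) supp_in_mono[OF _ cell_subset[OF U]] w c
    by (intro form_eq_in_chart[of _ "Suc k" _ c] ext_deriv_smooth supp_in_ext_deriv) (auto simp: fun_eq_iff)
  then show thesis using that e(1,2) by blast
qed

lemma top_form_closed:
  assumes "\<omega> \<in> smooth_forms A (2 * CARD('n))" shows "ext_deriv A (2 * CARD('n)) \<omega> = 0"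
proof (rule ext, rule ext, rule ext)
  fix c x v
  have "alternating_form (Suc (2 * CARD('n))) (ext_deriv A (2 * CARD('n)) \<omega> c x)"
  proof (cases "c \<in> A \<and> x \<in> chart_img c")
    case True
    then show ?thesis using local_formD1[OF smooth_formsD(1)[OF ext_deriv_smooth[OF assms]]] by blast
  next
    case False
    then have "ext_deriv A (2 * CARD('n)) \<omega> c x = (\<lambda>v. 0)" by (auto simp: ext_deriv_eq fun_eq_iff)
    then show ?thesis using alternating_0 by metis
  qed
  from alternating_above_dim[OF this] show "ext_deriv A (2 * CARD('n)) \<omega> c x v = 0 c x v" by simp
qed

text \<open>The form is compared with a bump form \<open>\<mu>\<close> of integral 1 in the same
  cell. On the cube \<open>b * \<omega> - a * \<mu>\<close> has a primitive; integrating it gives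
  \<open>a = 0\<close>, and division by \<open>b\<close> then solves for
  \<open>\<omega>\<close>.\<close>

lemma cell_poincare_top:
  assumes U: "cell_in c U" and w: "\<omega> \<in> smooth_forms A (2 * CARD('n))" "supp_in U \<omega>" "cint c \<omega> = 0"
  obtains \<eta> where "\<eta> \<in> smooth_forms A (2 * CARD('n) - 1)" "supp_in U \<eta>" "ext_deriv A (2 * CARD('n) - 1) \<eta> = \<omega>"
proof -
  have c: "c \<in> A" by (rule cell_chart[OF U])
  obtain k where k: "2 * CARD('n) = Suc k" by (metis One_nat_def Suc_pred zero_less_card_finite nat_0_less_mult_iff zero_less_numeral)
  note mono = supp_in_mono[OF _ cell_subset[OF U]]
  obtain q where q: "q \<in> U"
  proof -
    obtain p r where "r > 0" "open_cube p r \<subseteq> chart_img c" "U = {q \<in> fst c. snd c q \<in> open_cube p r}"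
      using U unfolding cell_in_def by blast
    moreover have "p \<in> open_cube p r" using \<open>r > 0\<close> by (simp add: open_cube_def)
    ultimately have "pt c p \<in> U" by auto
    then show thesis by (rule that)
  qed
  obtain \<mu> d where m: "\<mu> \<in> smooth_forms A (2 * CARD('n))" "supp_in U \<mu>" and d: "d \<in> A" "supp_in (fst d) \<mu>" "cint d \<mu> = 1"
    by (rule bump_form[OF cell_open[OF U] q]) (rule that)
  have "supp_in (fst c \<inter> fst d) \<mu>" using supp_in_Int[OF mono[OF m(2)] d(2)] .
  then have m1: "cint c \<mu> = 1" using cint_change_chart[OF m(1) c d(1)] d(3) by simp
  have cl: "ext_deriv A (Suc k) \<omega> = 0" "ext_deriv A (Suc k) \<mu> = 0"
    using top_form_closed[OF w(1)] top_form_closed[OF m(1)] unfolding k .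
  note w' = w(1)[unfolded k] and m' = m(1)[unfolded k]
  obtain p r \<rho> where B: "open_cube p r \<subseteq> chart_img c" "U = {q \<in> fst c. snd c q \<in> open_cube p r}" "cube r \<rho>"
    "cube.cube_form p \<rho> (Suc k) (\<omega> c)" "cube.cube_form p \<rho> (Suc k) (\<mu> c)"
    by (rule cell_cube_form[OF U w' w(2) cl(1) m' m(2) cl(2)]) (rule that)
  interpret cube p r \<rho> by (rule B(3))
  have dim: "Suc k = DIM(complex^'n)" using k by simp
  obtain a b \<eta> where h: "local_form UNIV k \<eta>" "cube_supp \<eta>" "\<And>x v. b * \<omega> c x v - a * \<mu> c x v = ld k \<eta> x v"
    and b0: "b = 0 \<Longrightarrow> \<exists>\<zeta>. local_form UNIV k \<zeta> \<and> cube_supp \<zeta> \<and> (\<forall>x v. \<mu> c x v = ld k \<zeta> x v)"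
    by (rule compact_poincare_top[OF B(4,5) dim]) blast
  \<comment> \<open>Otherwise \<open>\<mu>\<close> would have a primitive supported in the cell,
    against its integral 1 and Stokes' theorem.\<close>
  have "b \<noteq> 0"
  proof
    assume "b = 0"
    then obtain \<zeta> where z: "local_form UNIV k \<zeta>" "cube_supp \<zeta>" "\<forall>x v. \<mu> c x v = ld k \<zeta> x v" using b0 by blast
    note e = extend_cube[OF c B(1,2,3) z(1,2)]
    have "ext_deriv A k (extend c \<zeta>) = \<mu>"
      using e z(3) mono m m' c
      by (intro form_eq_in_chart[of _ "Suc k" _ c] ext_deriv_smooth supp_in_ext_deriv) (auto simp: fun_eq_iff)
    then show False using cint_ext_deriv[OF e(1) c mono[OF e(2)]] m1 by simp
  qed
  note e = extend_cube[OF c B(1,2,3) h(1,2)]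
  let ?\<eta> = "extend c \<eta>"
  have d\<eta>: "ext_deriv A k ?\<eta> = form_scale b \<omega> - form_scale a \<mu>"
    using e h(3) mono m(2) m' w(2) w' c
    by (intro form_eq_in_chart[of _ "Suc k" _ c] ext_deriv_smooth supp_in_ext_deriv diff_smooth form_scale_smooth
        supp_in_diff supp_in_scale) (auto simp: fun_eq_iff form_scale_def)
  have "cint c (form_scale b \<omega> - form_scale a \<mu>) = b * cint c \<omega> - a * cint c \<mu>"
    using cint_diff[OF form_scale_smooth[OF w(1)] form_scale_smooth[OF m(1)] c supp_in_scale[OF mono[OF w(2)]]
        supp_in_scale[OF mono[OF m(2)]]] by (simp add: cint_scale)
  then have "a = 0" using cint_ext_deriv[OF e(1) c mono[OF e(2)]] w(3) m1 by (simp add: d\<eta>)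
  then have "ext_deriv A k (form_scale (1 / b) ?\<eta>) = \<omega>"
    using ext_deriv_scale[OF e(1)] d\<eta> \<open>b \<noteq> 0\<close> by (simp only: form_scale_simps) (simp add: form_scale_simps)
  then show thesis
    using that[of "form_scale (1 / b) ?\<eta>"] form_scale_smooth[OF e(1)] supp_in_scale[OF e(2)] k by simp
qed

end


section \<open>The global integral and the top cohomology of a connected manifold\<close>

section \<open>Partitions of unity and the integral\<close>

context complex_atlas
begin

lemma exact_forms_Suc: "exact_forms A (Suc k) = ext_deriv A k ` smooth_forms A k"
  by (simp add: exact_forms_def)

lemma exact_0: "0 \<in> exact_forms A k"
proof (cases k)
  case (Suc j)
  then show ?thesis using ext_deriv_0[of j] zero_smooth[of j] unfolding exact_forms_Suc Suc by (metis image_eqI)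
qed (simp add: exact_forms_def)

lemma exact_add:
  assumes "\<alpha> \<in> exact_forms A k" "\<beta> \<in> exact_forms A k" shows "\<alpha> + \<beta> \<in> exact_forms A k"
proof (cases k)
  case (Suc j)
  from assms obtain a b where "a \<in> smooth_forms A j" "b \<in> smooth_forms A j" "\<alpha> = ext_deriv A j a" "\<beta> = ext_deriv A j b"
    unfolding Suc exact_forms_Suc by blast
  then show ?thesis unfolding Suc exact_forms_Suc using ext_deriv_add[of a j b] add_smooth[of a j b] by (metis image_eqI)
qed (use assms in \<open>simp add: exact_forms_def\<close>)

lemma exact_scale:
  assumes "\<alpha> \<in> exact_forms A k" shows "form_scale z \<alpha> \<in> exact_forms A k"
proof (cases k)
  case (Suc j)
  from assms obtain a where "a \<in> smooth_forms A j" "\<alpha> = ext_deriv A j a"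
    unfolding Suc exact_forms_Suc by blast
  then show ?thesis unfolding Suc exact_forms_Suc using ext_deriv_scale[of a j z] form_scale_smooth[of a j z] by (metis image_eqI)
qed (use assms in \<open>simp add: exact_forms_def form_scale_simps\<close>)

lemma exact_diff: "\<alpha> \<in> exact_forms A k \<Longrightarrow> \<beta> \<in> exact_forms A k \<Longrightarrow> \<alpha> - \<beta> \<in> exact_forms A k"
  using exact_add[of \<alpha> k "form_scale (- 1) \<beta>"] exact_scale[of \<beta> k "- 1"] by (simp add: form_scale_simps)

lemma exact_sum: "(\<And>i. i \<in> I \<Longrightarrow> \<omega> i \<in> exact_forms A k) \<Longrightarrow> (\<Sum>i\<in>I. \<omega> i) \<in> exact_forms A k"
  by (induction I rule: infinite_finite_induct) (auto intro: exact_add exact_0)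

end

context compact_atlas
begin

definition pou :: "'a set \<Rightarrow> ('a \<Rightarrow> ('a, 'n) chart) \<Rightarrow> ('a \<Rightarrow> 'a set) \<Rightarrow> ('a \<Rightarrow> 'a \<Rightarrow> complex) \<Rightarrow> bool"
  where "pou I ch Q \<rho> \<longleftrightarrow> finite I \<and>
    (\<forall>i\<in>I. cell_in (ch i) (Q i) \<and> smooth_fun (\<rho> i) \<and> fun_supp_in (Q i) (\<rho> i) \<and> (\<forall>p. \<exists>t\<ge>0. \<rho> i p = of_real t)) \<and>
    (\<forall>p\<in>topspace X. (\<Sum>i\<in>I. \<rho> i p) = 1)"

text \<open>The hereditary predicate \<open>P\<close> imposes a smallness condition on the cells; it
  is trivial for a first cover and is \<open>small\<close> when a cover is refined.\<close>

lemma pou_exists: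
  assumes P: "\<And>p. p \<in> topspace X \<Longrightarrow> \<exists>W. openin X W \<and> p \<in> W \<and> P W" "\<And>U W. P W \<Longrightarrow> U \<subseteq> W \<Longrightarrow> P U"
  obtains I ch Q \<rho> where "pou I ch Q \<rho>" "\<And>i. i \<in> I \<Longrightarrow> P (Q i)"
proof -
  have "\<exists>c U V g. cell_in c U \<and> P U \<and> openin X V \<and> p \<in> V \<and> smooth_fun g \<and> fun_supp_in U g \<and>
      (\<forall>q. \<exists>t\<ge>0. g q = complex_of_real t) \<and> (\<forall>q\<in>V. g q \<noteq> 0)" if p: "p \<in> topspace X" for p
  proof -
    obtain W where W: "openin X W" "p \<in> W" "P W" using P(1)[OF p] by blast
    obtain c U V g where "cell_in c U" "U \<subseteq> W" "openin X V" "p \<in> V" "smooth_fun g" "fun_supp_in U g"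
      "\<And>q. \<exists>t\<ge>0. g q = complex_of_real t" "\<And>q. q \<in> V \<Longrightarrow> g q \<noteq> 0"
      by (rule bump_function[OF W(1,2)]) (rule that)
    then show ?thesis using P(2)[OF W(3)] by blast
  qed
  then obtain ch Q V g where B: "\<And>p. p \<in> topspace X \<Longrightarrow> cell_in (ch p) (Q p) \<and> P (Q p) \<and> openin X (V p) \<and> p \<in> V p \<and>
      smooth_fun (g p) \<and> fun_supp_in (Q p) (g p) \<and> (\<forall>q. \<exists>t\<ge>0. g p q = complex_of_real t) \<and> (\<forall>q\<in>V p. g p q \<noteq> 0)"
    by metis
  have "compactin X (topspace X)" using compact compact_space_def by blast
  then have "\<exists>F. finite F \<and> F \<subseteq> V ` topspace X \<and> topspace X \<subseteq> \<Union>F"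
    by (rule compactinD) (use B in blast)+
  then obtain I where I: "finite I" "I \<subseteq> topspace X" "topspace X \<subseteq> \<Union>(V ` I)"
    by (metis finite_subset_image)
  have re: "g i p = of_real (Re (g i p)) \<and> Re (g i p) \<ge> 0" if "i \<in> I" for i p
  proof -
    have "\<exists>t\<ge>0. g i p = complex_of_real t" using B I(2) that by blast
    then show ?thesis by auto
  qed
  define s where "s p = (\<Sum>i\<in>I. g i p)" for p
  have s: "s p = of_real (\<Sum>i\<in>I. Re (g i p))" for p
    unfolding s_def using re by (simp add: of_real_sum)
  have s0: "s p \<noteq> 0" if p: "p \<in> topspace X" for p
  proof -
    obtain i where i: "i \<in> I" "p \<in> V i" using I(3) p by blast
    then have "g i p \<noteq> 0" using B I(2) by blast
    then have "Re (g i p) > 0" using re[OF i(1), of p] by (metis less_eq_real_def of_real_0)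
    then have "(\<Sum>i\<in>I. Re (g i p)) > 0" using re I(1) i(1) by (intro sum_pos2[of I i]) auto
    then show ?thesis unfolding s of_real_eq_0_iff by simp
  qed
  have sg: "smooth_fun (g i)" if "i \<in> I" for i using B I(2) that by blast
  have ss: "smooth_fun (\<lambda>p. inverse (s p))"
    unfolding smooth_fun_def
  proof
    fix c assume c: "c \<in> A"
    show "smooth_on (chart_img c) (\<lambda>x. inverse (s (pt c x)))"
    proof (rule smooth_on_inverse[OF chart(2)[OF c]])
      show "smooth_on (chart_img c) (\<lambda>x. s (pt c x))"
        unfolding s_def using smooth_fun_sum[of I g] sg smooth_funD[OF _ c] by blast
      show "s (pt c x) \<noteq> 0" if "x \<in> chart_img c" for x
        using s0 subsetD[OF chart_subset[OF c] pt_in[OF that]] .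
    qed
  qed
  define \<rho> where "\<rho> i p = g i p * inverse (s p)" for i p
  have "pou I ch Q \<rho>"
    unfolding pou_def
  proof (intro conjI ballI allI)
    show "finite I" by (rule I)
    show "cell_in (ch i) (Q i)" if "i \<in> I" for i using B I(2) that by blast
    show "smooth_fun (\<rho> i)" if "i \<in> I" for i
      unfolding \<rho>_def by (intro smooth_fun_mult sg[OF that] ss)
    show "fun_supp_in (Q i) (\<rho> i)" if i: "i \<in> I" for i
    proof -
      have "fun_supp_in (Q i) (g i)" using B I(2) i by blast
      then show ?thesis unfolding fun_supp_in_def \<rho>_def by auto
    qed
    show "\<exists>t\<ge>0. \<rho> i p = of_real t" if i: "i \<in> I" for i p
    proof (intro exI[of _ "Re (g i p) * inverse (\<Sum>i\<in>I. Re (g i p))"] conjI)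
      show "Re (g i p) * inverse (\<Sum>i\<in>I. Re (g i p)) \<ge> 0" using re i by (simp add: sum_nonneg)
      show "\<rho> i p = of_real (Re (g i p) * inverse (\<Sum>i\<in>I. Re (g i p)))"
        unfolding \<rho>_def s using re[OF i, of p] by simp
    qed
    show "(\<Sum>i\<in>I. \<rho> i p) = 1" if "p \<in> topspace X" for p
      using s0[OF that] by (simp add: \<rho>_def sum_distrib_right[symmetric] s_def[symmetric])
  qed
  then show thesis using that[of I ch Q \<rho>] B I(2) by blast
qed

lemma pouD:
  assumes "pou I ch Q \<rho>"
  shows "finite I" "i \<in> I \<Longrightarrow> cell_in (ch i) (Q i)" "i \<in> I \<Longrightarrow> smooth_fun (\<rho> i)" "i \<in> I \<Longrightarrow> fun_supp_in (Q i) (\<rho> i)"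
    "i \<in> I \<Longrightarrow> \<exists>t\<ge>0. \<rho> i p = of_real t" "p \<in> topspace X \<Longrightarrow> (\<Sum>i\<in>I. \<rho> i p) = 1"
  using assms unfolding pou_def by blast+

lemma pou_decompose:
  assumes "pou I ch Q \<rho>" "\<omega> \<in> smooth_forms A k"
  shows "(\<Sum>i\<in>I. fmult (\<rho> i) \<omega>) = \<omega>"
proof -
  have "fmult (\<lambda>p. \<Sum>i\<in>I. \<rho> i p) \<omega> = fmult (\<lambda>p. 1) \<omega>"
    by (rule form_vanishes_off_topspace[OF assms(2)]) (rule pouD(6)[OF assms(1)])
  also have "\<dots> = \<omega>" by (simp add: fmult_def)
  finally show ?thesis by (simp only: fmult_sum_fun)
qed

lemma cint_sum:
  assumes "\<And>i. i \<in> I \<Longrightarrow> \<omega> i \<in> smooth_forms A k" "\<And>i. i \<in> I \<Longrightarrow> supp_in (fst c) (\<omega> i)" "c \<in> A"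
  shows "cint c (\<Sum>i\<in>I. \<omega> i) = (\<Sum>i\<in>I. cint c (\<omega> i))"
  using assms(1,2)
proof (induction I rule: infinite_finite_induct)
  case (insert i I)
  have "cint c (\<omega> i + (\<Sum>i\<in>I. \<omega> i)) = cint c (\<omega> i) + cint c (\<Sum>i\<in>I. \<omega> i)"
    by (rule cint_add) (use insert.prems assms(3) in \<open>auto intro: sum_smooth supp_in_sum\<close>)
  moreover have "cint c (\<Sum>i\<in>I. \<omega> i) = (\<Sum>i\<in>I. cint c (\<omega> i))" using insert by blast
  ultimately show ?case by (simp only: sum.insert[OF insert(1,2)])
qed (simp_all add: cint_def vol_integral_def)

definition is_integral :: "(('a, 'n) form \<Rightarrow> complex) \<Rightarrow> bool"
  where "is_integral J \<longleftrightarrow>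
    (\<forall>\<omega>\<in>smooth_forms A (2 * CARD('n)). \<forall>c\<in>A. supp_in (fst c) \<omega> \<longrightarrow> J \<omega> = cint c \<omega>) \<and>
    (\<forall>\<alpha>\<in>smooth_forms A (2 * CARD('n)). \<forall>\<beta>\<in>smooth_forms A (2 * CARD('n)). J (\<alpha> + \<beta>) = J \<alpha> + J \<beta>) \<and>
    (\<forall>z \<alpha>. J (form_scale z \<alpha>) = z * J \<alpha>) \<and>
    (\<forall>\<alpha>\<in>exact_forms A (2 * CARD('n)). J \<alpha> = 0)"

lemma card_Suc: "2 * CARD('n) = Suc (2 * CARD('n) - 1)"
  by simp

lemma is_integral_exists: "\<exists>J. is_integral J"
proof -
  obtain I ch Q \<rho> where p: "pou I ch Q \<rho>"
    by (rule pou_exists[of "\<lambda>_. True"]) (auto intro: openin_topspace)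
  note pD = pouD[OF p]
  have ch: "ch i \<in> A" "Q i \<subseteq> fst (ch i)" if "i \<in> I" for i
    using pD(2)[OF that] cell_chart cell_subset by blast+
  define J where "J \<omega> = (\<Sum>i\<in>I. cint (ch i) (fmult (\<rho> i) \<omega>))" for \<omega>
  have si: "supp_in (fst (ch i)) (fmult (\<rho> i) \<omega>)" if "i \<in> I" for i \<omega>
    using supp_in_mono[OF supp_in_fmult_fun[OF pD(4)[OF that]] ch(2)[OF that]] .
  let ?M = "2 * CARD('n)"
  have 1: "J \<omega> = cint c \<omega>" if w: "\<omega> \<in> smooth_forms A ?M" "c \<in> A" "supp_in (fst c) \<omega>" for \<omega> c
  proof -
    \<comment> \<open>The piece \<open>fmult (\<rho> i) \<omega>\<close> is supported in both
      charts, \<open>ch i\<close> and \<open>c\<close>, and may be integrated in either.\<close>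
    have "J \<omega> = (\<Sum>i\<in>I. cint c (fmult (\<rho> i) \<omega>))"
      unfolding J_def
    proof (rule sum.cong[OF refl])
      fix i assume i: "i \<in> I"
      show "cint (ch i) (fmult (\<rho> i) \<omega>) = cint c (fmult (\<rho> i) \<omega>)"
        by (rule cint_change_chart[OF fmult_smooth[OF pD(3)[OF i] w(1)] ch(1)[OF i] w(2)])
          (rule supp_in_Int[OF si[OF i] supp_in_fmult[OF w(3)]])
    qed
    also have "\<dots> = cint c (\<Sum>i\<in>I. fmult (\<rho> i) \<omega>)"
      by (rule cint_sum[symmetric]) (use fmult_smooth[OF pD(3) w(1)] supp_in_fmult[OF w(3)] w(2) in auto)
    also have "\<dots> = cint c \<omega>" by (simp only: pou_decompose[OF p w(1)])
    finally show ?thesis .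
  qed
  have 2: "J (\<alpha> + \<beta>) = J \<alpha> + J \<beta>" if "\<alpha> \<in> smooth_forms A ?M" "\<beta> \<in> smooth_forms A ?M" for \<alpha> \<beta>
    unfolding J_def sum.distrib[symmetric]
  proof (rule sum.cong[OF refl])
    fix i assume i: "i \<in> I"
    show "cint (ch i) (fmult (\<rho> i) (\<alpha> + \<beta>)) = cint (ch i) (fmult (\<rho> i) \<alpha>) + cint (ch i) (fmult (\<rho> i) \<beta>)"
      unfolding fmult_add
      by (rule cint_add[OF fmult_smooth[OF pD(3)[OF i] that(1)] fmult_smooth[OF pD(3)[OF i] that(2)]
            ch(1)[OF i] si[OF i] si[OF i]])
  qed
  have 3: "J (form_scale z \<alpha>) = z * J \<alpha>" for z \<alpha>
  proof -
    have "fmult f (form_scale z \<alpha>) = form_scale z (fmult f \<alpha>)" for f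
      by (simp add: form_scale_fmult fmult_commute)
    then show ?thesis by (simp add: J_def cint_scale sum_distrib_left)
  qed
  have 4: "J (ext_deriv A (?M - 1) \<eta>) = 0" if e: "\<eta> \<in> smooth_forms A (?M - 1)" for \<eta>
  proof -
    let ?d = "ext_deriv A (?M - 1)"
    have sm: "?d \<beta> \<in> smooth_forms A ?M" if "\<beta> \<in> smooth_forms A (?M - 1)" for \<beta>
      using ext_deriv_smooth[OF that] by simp
    have z: "J (?d (fmult (\<rho> i) \<eta>)) = 0" if i: "i \<in> I" for i
    proof -
      have s: "fmult (\<rho> i) \<eta> \<in> smooth_forms A (?M - 1)" by (rule fmult_smooth[OF pD(3)[OF i] e])
      have "J (?d (fmult (\<rho> i) \<eta>)) = cint (ch i) (?d (fmult (\<rho> i) \<eta>))"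
        by (rule 1[OF sm[OF s] ch(1)[OF i] supp_in_ext_deriv[OF si[OF i]]])
      also have "\<dots> = 0" by (rule cint_ext_deriv[OF s ch(1)[OF i] si[OF i]])
      finally show ?thesis .
    qed
    have J0: "J 0 = 0" using 3[of 0 0] by (simp add: form_scale_simps)
    have "J (\<Sum>i\<in>K. ?d (fmult (\<rho> i) \<eta>)) = 0" if "finite K" "K \<subseteq> I" for K
      using that
    proof (induction rule: finite_induct)
      case (insert i K)
      have "J (?d (fmult (\<rho> i) \<eta>) + (\<Sum>i\<in>K. ?d (fmult (\<rho> i) \<eta>))) =
          J (?d (fmult (\<rho> i) \<eta>)) + J (\<Sum>i\<in>K. ?d (fmult (\<rho> i) \<eta>))"
        by (intro 2 sum_smooth sm fmult_smooth[OF pD(3) e]) (use insert in auto)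
      moreover have "J (\<Sum>i\<in>K. ?d (fmult (\<rho> i) \<eta>)) = 0" "J (?d (fmult (\<rho> i) \<eta>)) = 0" using insert z by auto
      ultimately show ?case by (simp only: sum.insert[OF insert(1,2)] add_0_left)
    qed (simp only: sum.empty J0)
    moreover have "?d \<eta> = (\<Sum>i\<in>I. ?d (fmult (\<rho> i) \<eta>))"
      using ext_deriv_sum[of I "\<lambda>i. fmult (\<rho> i) \<eta>" "?M - 1"] fmult_smooth[OF pD(3) e]
      by (simp only: pou_decompose[OF p e])
    ultimately show ?thesis using pD(1) by simp
  qed
  have "is_integral J"
    unfolding is_integral_def
  proof (intro conjI ballI allI impI)
    fix \<alpha> assume "\<alpha> \<in> exact_forms A ?M"
    then have "\<alpha> \<in> exact_forms A (Suc (?M - 1))" by (simp only: card_Suc[symmetric])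
    then show "J \<alpha> = 0" using 4 unfolding exact_forms_Suc by blast
  qed (use 1 2 3 in blast)+
  then show ?thesis by (intro exI[of is_integral J])
qed

definition gint :: "('a, 'n) form \<Rightarrow> complex"
  where "gint = (SOME J. is_integral J)"

lemma is_integral_gint: "is_integral gint"
  unfolding gint_def using is_integral_exists by (rule someI_ex)

lemma gint_chart: "\<omega> \<in> smooth_forms A (2 * CARD('n)) \<Longrightarrow> c \<in> A \<Longrightarrow> supp_in (fst c) \<omega> \<Longrightarrow> gint \<omega> = cint c \<omega>"
  and gint_add: "\<alpha> \<in> smooth_forms A (2 * CARD('n)) \<Longrightarrow> \<beta> \<in> smooth_forms A (2 * CARD('n)) \<Longrightarrow> gint (\<alpha> + \<beta>) = gint \<alpha> + gint \<beta>"
  and gint_scale: "gint (form_scale z \<alpha>) = z * gint \<alpha>"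
  and gint_exact: "\<alpha> \<in> exact_forms A (2 * CARD('n)) \<Longrightarrow> gint \<alpha> = 0"
  using is_integral_gint unfolding is_integral_def by blast+

lemma gint_diff:
  "\<alpha> \<in> smooth_forms A (2 * CARD('n)) \<Longrightarrow> \<beta> \<in> smooth_forms A (2 * CARD('n)) \<Longrightarrow> gint (\<alpha> - \<beta>) = gint \<alpha> - gint \<beta>"
  using gint_add[of \<alpha> "form_scale (- 1) \<beta>"] form_scale_smooth[of \<beta> _ "- 1"]
  by (simp only: gint_scale) (simp add: form_scale_simps)

lemma gint_0: "gint 0 = 0"
  using gint_scale[of 0 0] by (simp add: form_scale_simps)

lemma gint_sum:
  assumes "\<And>i. i \<in> I \<Longrightarrow> \<omega> i \<in> smooth_forms A (2 * CARD('n))"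
  shows "gint (\<Sum>i\<in>I. \<omega> i) = (\<Sum>i\<in>I. gint (\<omega> i))"
  using assms
proof (induction I rule: infinite_finite_induct)
  case (insert i I)
  have "gint (\<omega> i + (\<Sum>i\<in>I. \<omega> i)) = gint (\<omega> i) + gint (\<Sum>i\<in>I. \<omega> i)"
    using insert.prems by (intro gint_add sum_smooth) auto
  moreover have "gint (\<Sum>i\<in>I. \<omega> i) = (\<Sum>i\<in>I. gint (\<omega> i))" using insert by blast
  ultimately show ?case by (simp only: sum.insert[OF insert(1,2)])
qed (simp_all only: sum.infinite sum.empty gint_0 not_False_eq_True)

lemma bump_form_integral:
  assumes "openin X W" "q \<in> W"
  obtains \<mu> where "\<mu> \<in> smooth_forms A (2 * CARD('n))" "supp_in W \<mu>" "gint \<mu> = 1"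
proof -
  obtain \<mu> c where "c \<in> A" "\<mu> \<in> smooth_forms A (2 * CARD('n))" "supp_in W \<mu>" "supp_in (fst c) \<mu>" "cint c \<mu> = 1"
    by (rule bump_form[OF assms]) (rule that)
  then show thesis using that gint_chart by metis
qed

lemma cell_exact_top:
  assumes U: "cell_in c U" and w: "\<omega> \<in> smooth_forms A (2 * CARD('n))" "supp_in U \<omega>" "gint \<omega> = 0"
  obtains \<eta> where "\<eta> \<in> smooth_forms A (2 * CARD('n) - 1)" "supp_in U \<eta>" "ext_deriv A (2 * CARD('n) - 1) \<eta> = \<omega>"
proof (rule cell_poincare_top[OF U w(1,2)])
  show "cint c \<omega> = 0"
    using gint_chart[OF w(1) cell_chart[OF U] supp_in_mono[OF w(2) cell_subset[OF U]]] w(3) by simp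
qed (rule that)

lemma ext_deriv_exact_top: "\<eta> \<in> smooth_forms A (2 * CARD('n) - 1) \<Longrightarrow> ext_deriv A (2 * CARD('n) - 1) \<eta> \<in> exact_forms A (2 * CARD('n))"
  using exact_forms_Suc[of "2 * CARD('n) - 1"] by simp

text \<open>Fix a form \<open>\<mu>0\<close> of integral 1 in one cell. A cell is good if each form
  supported in it is, modulo exact forms, its integral times \<open>\<mu>0\<close>. Goodness passes
  between cells that meet, so the points in good cells form an open and closed set; connectedness
  makes all cells good, and a partition of unity adds up the pieces.\<close>

lemma exact_top_if_integral_0:
  assumes conn: "connected_space X" and w: "\<omega> \<in> smooth_forms A (2 * CARD('n))" "gint \<omega> = 0"
  shows "\<omega> \<in> exact_forms A (2 * CARD('n))"
proof (cases "topspace X = {}")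
  case True
  then have "\<omega> = 0" by (intro form_eqI[OF w(1) zero_smooth]) simp
  then show ?thesis by (simp only: exact_0)
next
  case False
  let ?M = "2 * CARD('n)"
  have cellx: "\<exists>c U. cell_in c U \<and> p \<in> U" if p: "p \<in> topspace X" for p
  proof -
    obtain c U q r where "c \<in> A" "r > 0" "open_cube q r \<subseteq> chart_img c" "U = {q' \<in> fst c. snd c q' \<in> open_cube q r}" "p \<in> U"
      by (rule cell_exists[OF openin_topspace p]) (rule that)
    then show ?thesis unfolding cell_in_def by blast
  qed
  obtain q0 where q0: "q0 \<in> topspace X" using False by blast
  obtain c0 U0 where U0: "cell_in c0 U0" "q0 \<in> U0" using cellx[OF q0] by blast
  obtain \<mu>0 where m0: "\<mu>0 \<in> smooth_forms A ?M" "supp_in U0 \<mu>0" "gint \<mu>0 = 1"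
    by (rule bump_form_integral[OF cell_open[OF U0(1)] U0(2)]) (rule that)
  define good where "good U \<longleftrightarrow> (\<forall>\<omega>\<in>smooth_forms A ?M. supp_in U \<omega> \<longrightarrow> \<omega> - form_scale (gint \<omega>) \<mu>0 \<in> exact_forms A ?M)" for U
  have ex: "\<omega> - form_scale (gint \<omega>) \<mu> \<in> exact_forms A ?M"
    if "cell_in c U" "\<omega> \<in> smooth_forms A ?M" "supp_in U \<omega>" "\<mu> \<in> smooth_forms A ?M" "supp_in U \<mu>" "gint \<mu> = 1" for c U \<omega> \<mu>
  proof -
    have s: "\<omega> - form_scale (gint \<omega>) \<mu> \<in> smooth_forms A ?M" "supp_in U (\<omega> - form_scale (gint \<omega>) \<mu>)"
      using that by (auto intro: diff_smooth form_scale_smooth supp_in_diff supp_in_scale)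
    have "gint (\<omega> - form_scale (gint \<omega>) \<mu>) = 0"
      using gint_diff[OF that(2) form_scale_smooth[OF that(4)]] that(6) by (simp add: gint_scale)
    from cell_exact_top[OF that(1) s this] show ?thesis using ext_deriv_exact_top by metis
  qed
  \<comment> \<open>A bump form of integral 1 in the intersection is comparable with
    \<open>\<omega>\<close> inside \<open>U\<close> and with \<open>\<mu>0\<close> through
    \<open>U'\<close>.\<close>
  have spread: "good U" if U: "cell_in c U" "cell_in c' U'" "good U'" "p \<in> U" "p \<in> U'" for c U c' U' p
    unfolding good_def
  proof (intro ballI impI)
    fix \<omega> assume w: "\<omega> \<in> smooth_forms A ?M" "supp_in U \<omega>"
    obtain \<mu> where m: "\<mu> \<in> smooth_forms A ?M" "supp_in (U \<inter> U') \<mu>" "gint \<mu> = 1"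
      by (rule bump_form_integral[OF openin_Int[OF cell_open[OF U(1)] cell_open[OF U(2)]] IntI[OF U(4,5)]]) (rule that)
    have m': "supp_in U \<mu>" "supp_in U' \<mu>" using supp_in_mono[OF m(2)] by auto
    have 1: "\<omega> - form_scale (gint \<omega>) \<mu> \<in> exact_forms A ?M" by (rule ex[OF U(1) w m(1) m'(1) m(3)])
    have "\<mu> - form_scale (gint \<mu>) \<mu>0 \<in> exact_forms A ?M" using U(3) m(1) m'(2) unfolding good_def by blast
    then have 2: "form_scale (gint \<omega>) (\<mu> - \<mu>0) \<in> exact_forms A ?M"
      using m(3) by (intro exact_scale) (simp add: form_scale_simps)
    have "\<omega> - form_scale (gint \<omega>) \<mu>0 = (\<omega> - form_scale (gint \<omega>) \<mu>) + form_scale (gint \<omega>) (\<mu> - \<mu>0)"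
      by (simp add: form_scale_simps)
    then show "\<omega> - form_scale (gint \<omega>) \<mu>0 \<in> exact_forms A ?M" using exact_add[OF 1 2] by (simp only:)
  qed
  define S where "S = {p \<in> topspace X. \<exists>c U. cell_in c U \<and> p \<in> U \<and> good U}"
  have "openin X S"
  proof (subst openin_subopen, intro ballI)
    fix p assume "p \<in> S"
    then obtain c U where U: "cell_in c U" "p \<in> U" "good U" unfolding S_def by blast
    then have "U \<subseteq> S" unfolding S_def using openin_subset[OF cell_open[OF U(1)]] by blast
    then show "\<exists>T. openin X T \<and> p \<in> T \<and> T \<subseteq> S" using U cell_open by blast
  qed
  moreover have "openin X (topspace X - S)"
  proof (subst openin_subopen, intro ballI)
    fix p assume p: "p \<in> topspace X - S"
    then obtain c U where U: "cell_in c U" "p \<in> U" using cellx by blast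
    have "U \<inter> S = {}"
    proof (rule ccontr)
      assume "U \<inter> S \<noteq> {}"
      then obtain q c' U' where "q \<in> U" "cell_in c' U'" "q \<in> U'" "good U'" unfolding S_def by blast
      then have "good U" using spread[OF U(1)] by blast
      then have "p \<in> S" using U p unfolding S_def by blast
      then show False using p by blast
    qed
    then have "U \<subseteq> topspace X - S" using openin_subset[OF cell_open[OF U(1)]] by blast
    then show "\<exists>T. openin X T \<and> p \<in> T \<and> T \<subseteq> topspace X - S" using U cell_open by blast
  qed
  then have "closedin X S" unfolding closedin_def S_def by blast
  moreover have "q0 \<in> S"
    unfolding S_def good_def using q0 U0 ex[OF U0(1) _ _ m0] by blast
  ultimately have S: "S = topspace X" using conn unfolding connected_space_clopen_in by blast
  have allgood: "good U" if U: "cell_in c U" for c U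
  proof (cases "U = {}")
    case True
    have "\<omega> = 0" if "\<omega> \<in> smooth_forms A ?M" "supp_in U \<omega>" for \<omega>
      using supp_in_empty that True by blast
    then show ?thesis unfolding good_def using gint_0 exact_0[of ?M] by (metis form_scale_simps(2) diff_0_right)
  next
    case False
    then obtain p where p: "p \<in> U" by blast
    then have "p \<in> S" using S openin_subset[OF cell_open[OF U]] by blast
    then show ?thesis using spread[OF U _ _ p] unfolding S_def by blast
  qed
  obtain I ch Q \<rho> where pu: "pou I ch Q \<rho>"
    by (rule pou_exists[of "\<lambda>_. True"]) (auto intro: openin_topspace)
  note pD = pouD[OF pu]
  have sm: "fmult (\<rho> i) \<omega> \<in> smooth_forms A ?M" if "i \<in> I" for i by (rule fmult_smooth[OF pD(3)[OF that] w(1)])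
  have "(\<Sum>i\<in>I. fmult (\<rho> i) \<omega> - form_scale (gint (fmult (\<rho> i) \<omega>)) \<mu>0) \<in> exact_forms A ?M"
  proof (rule exact_sum)
    fix i assume i: "i \<in> I"
    show "fmult (\<rho> i) \<omega> - form_scale (gint (fmult (\<rho> i) \<omega>)) \<mu>0 \<in> exact_forms A ?M"
      using allgood[OF pD(2)[OF i]] sm[OF i] supp_in_fmult_fun[OF pD(4)[OF i]] unfolding good_def by blast
  qed
  moreover have "(\<Sum>i\<in>I. form_scale (gint (fmult (\<rho> i) \<omega>)) \<mu>0) = form_scale (\<Sum>i\<in>I. gint (fmult (\<rho> i) \<omega>)) \<mu>0"
    unfolding form_scale_fmult by (rule fmult_sum_fun)
  moreover have "(\<Sum>i\<in>I. gint (fmult (\<rho> i) \<omega>)) = 0"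
    using gint_sum[of I "\<lambda>i. fmult (\<rho> i) \<omega>"] sm w(2) by (simp only: pou_decompose[OF pu w(1)])
  ultimately have "(\<Sum>i\<in>I. fmult (\<rho> i) \<omega>) - form_scale 0 \<mu>0 \<in> exact_forms A ?M"
    by (simp only: sum_subtractf)
  then show ?thesis by (simp only: pou_decompose[OF pu w(1)] form_scale_simps diff_0_right)
qed

end


section \<open>The nondegenerate pairing: linear algebra, Cech chains, nested covers,
  descent\<close>

section \<open>Duality\<close>

subsection \<open>Finite-dimensional linear algebra\<close>

text \<open>Induction on the spanning family. If the new vector \<open>b l\<close> depends on the
  others it is dropped; otherwise a functional \<open>c0\<close> kills the others but not
  \<open>b l\<close>, and it splits off the coefficient of \<open>b l\<close>.\<close>

lemma span_or_functional:
  fixes b :: "'l \<Rightarrow> 't \<Rightarrow> complex"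
  assumes L: "finite L" and T: "finite T"
  shows "(\<exists>u. \<forall>t\<in>T. a t = (\<Sum>l\<in>L. u l * b l t)) \<or>
    (\<exists>c. (\<forall>l\<in>L. (\<Sum>t\<in>T. c t * b l t) = 0) \<and> (\<Sum>t\<in>T. c t * a t) \<noteq> 0)"
  using L
proof (induction arbitrary: a rule: finite_induct)
  case empty
  show ?case
  proof (cases "\<forall>t\<in>T. a t = 0")
    case False
    then obtain t where t: "t \<in> T" "a t \<noteq> 0" by blast
    have "(\<Sum>s\<in>T. (if s = t then 1 else 0) * a s) = a t" using t(1) T by (simp add: if_distrib[of "\<lambda>x. x * _"] cong: if_cong)
    then show ?thesis using t(2) by (intro disjI2 exI[of _ "\<lambda>s. if s = t then 1 else 0"]) simp
  qed simp
next
  case (insert l L)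
  define dot where "dot c x = (\<Sum>t\<in>T. c t * x t)" for c x :: "'t \<Rightarrow> complex"
  have dot_minus: "dot c (\<lambda>t. x t - z * y t) = dot c x - z * dot c y"
    "dot (\<lambda>t. c t - z * c' t) x = dot c x - z * dot c' x" for c c' x y z
    by (simp_all add: dot_def algebra_simps sum_subtractf sum_distrib_left)
  have dot_sum: "dot c x = (\<Sum>l\<in>L. u l * dot c (b l))" if "\<forall>t\<in>T. x t = (\<Sum>l\<in>L. u l * b l t)" for c x u
  proof -
    have "dot c x = (\<Sum>t\<in>T. \<Sum>l\<in>L. u l * (c t * b l t))"
      using that by (simp add: dot_def sum_distrib_left mult.left_commute)
    also have "\<dots> = (\<Sum>l\<in>L. \<Sum>t\<in>T. u l * (c t * b l t))" by (rule sum.swap)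
    also have "\<dots> = (\<Sum>l\<in>L. u l * dot c (b l))" by (simp add: dot_def sum_distrib_left)
    finally show ?thesis .
  qed
  note IH = insert.IH[folded dot_def]
  from IH[of "b l"] show ?case
  proof (elim disjE exE conjE)
    fix u assume u: "\<forall>t\<in>T. b l t = (\<Sum>l\<in>L. u l * b l t)"
    from IH[of a] show ?thesis
    proof (elim disjE exE conjE)
      fix v assume v: "\<forall>t\<in>T. a t = (\<Sum>l\<in>L. v l * b l t)"
      have "(\<Sum>l'\<in>insert l L. (v(l := 0)) l' * b l' t) = (\<Sum>l\<in>L. v l * b l t)" for t
        using insert(1,2) by (auto intro!: sum.cong)
      then show ?thesis using v by (intro disjI1 exI[of _ "v(l := 0)"]) simp
    next
      fix c assume "\<forall>l\<in>L. dot c (b l) = 0" "dot c a \<noteq> 0"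
      then show ?thesis using dot_sum[OF u, of c] unfolding dot_def by (intro disjI2 exI[of _ c]) auto
    qed
  next
    fix c0 assume c0: "\<forall>l\<in>L. dot c0 (b l) = 0" "dot c0 (b l) \<noteq> 0"
    \<comment> \<open>The only possible coefficient of \<open>b l\<close> in \<open>a\<close>, as
      \<open>c0\<close> kills all the other vectors.\<close>
    define z where "z = dot c0 a / dot c0 (b l)"
    from IH[of "\<lambda>t. a t - z * b l t"] show ?thesis
    proof (elim disjE exE conjE)
      fix v assume v: "\<forall>t\<in>T. a t - z * b l t = (\<Sum>l\<in>L. v l * b l t)"
      have "(\<Sum>l'\<in>insert l L. (v(l := z)) l' * b l' t) = z * b l t + (\<Sum>l\<in>L. v l * b l t)" for t
        using insert(1,2) by (auto intro!: sum.cong)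
      then show ?thesis using v by (intro disjI1 exI[of _ "v(l := z)"]) (simp add: algebra_simps)
    next
      fix c1 assume c1: "\<forall>l\<in>L. dot c1 (b l) = 0" "dot c1 (\<lambda>t. a t - z * b l t) \<noteq> 0"
      \<comment> \<open>Subtracting this multiple of \<open>c0\<close> makes the functional vanish
        on \<open>b l\<close> too. Its value at \<open>a\<close> is then the value of
        \<open>c1\<close> at \<open>a - z * b l\<close>.\<close>
      define c where "c = (\<lambda>t. c1 t - (dot c1 (b l) / dot c0 (b l)) * c0 t)"
      have dc: "dot c x = dot c1 x - (dot c1 (b l) / dot c0 (b l)) * dot c0 x" for x
        unfolding c_def by (rule dot_minus(2))
      have "\<forall>l'\<in>insert l L. dot c (b l') = 0"
        using c0 c1(1) by (auto simp: dc)
      moreover have "dot c a = dot c1 (\<lambda>t. a t - z * b l t)"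
        unfolding dc dot_minus(1) by (simp add: z_def)
      ultimately show ?thesis using c1(2) unfolding dot_def by (intro disjI2 exI[of _ c]) auto
    qed
  qed
qed

subsection \<open>Cech cochains on all tuples\<close>

lemma sum_antisym: "(\<Sum>k\<in>I. \<Sum>l\<in>I. g k l - g l k) = (0 :: 'b::ab_group_add)"
  by (simp add: sum_subtractf sum.swap[of "\<lambda>k l. g l k"])

text \<open>The homological boundary maps of chains that are indexed by all tuples, without antisymmetry, so
  that no order on the index set is needed.\<close>

definition bd3 :: "'i set \<Rightarrow> ('i \<Rightarrow> 'i \<Rightarrow> 'i \<Rightarrow> 'b::ab_group_add) \<Rightarrow> 'i \<Rightarrow> 'i \<Rightarrow> 'b"
  where "bd3 I h i j = (\<Sum>k\<in>I. h k i j - h i k j + h i j k)"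

definition bd4 :: "'i set \<Rightarrow> ('i \<Rightarrow> 'i \<Rightarrow> 'i \<Rightarrow> 'i \<Rightarrow> 'b::ab_group_add) \<Rightarrow> 'i \<Rightarrow> 'i \<Rightarrow> 'i \<Rightarrow> 'b"
  where "bd4 I M i j k = (\<Sum>l\<in>I. M l i j k - M i l j k + M i j l k - M i j k l)"

text \<open>The boundary of a boundary: after expansion the positive and the negative terms are
  exchanged by swapping the two summation indices, so \<open>sum_antisym\<close> applies. The same
  pairing proves the next lemma.\<close>

lemma bd2_bd3: "(\<Sum>j\<in>I. bd3 I h j i - bd3 I h i j) = 0"
proof -
  have "(\<Sum>j\<in>I. bd3 I h j i - bd3 I h i j) =
      (\<Sum>j\<in>I. \<Sum>k\<in>I. (h k j i + h j i k + h i k j) - (h j k i + h k i j + h i j k))"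
    unfolding bd3_def sum_subtractf[symmetric] by (intro sum.cong refl) (simp add: algebra_simps)
  also have "\<dots> = 0" by (rule sum_antisym)
  finally show ?thesis .
qed

lemma bd3_bd4: "bd3 I (bd4 I M) i j = 0"
proof -
  have "bd3 I (bd4 I M) i j = (\<Sum>k\<in>I. \<Sum>l\<in>I.
      (M l k i j + M k i l j + M i l k j + M i k j l + M i j l k - M k i j l) -
      (M k l i j + M l i k j + M i k l j + M i l j k + M i j k l - M l i j k))"
    unfolding bd3_def bd4_def sum_subtractf[symmetric] sum.distrib[symmetric]
    by (intro sum.cong refl) (simp add: algebra_simps)
  also have "\<dots> = 0" by (rule sum_antisym)
  finally show ?thesis .
qed

text \<open>The bracket is the matrix entry of \<open>bd4\<close> at the tuples (x, y, z, w) and (i,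
  j, k). In this form \<open>bd4\<close> is a linear combination of column vectors, as
  \<open>span_or_functional\<close> expects.\<close>

lemma sum_delta_tuples:
  fixes lam :: "'i \<Rightarrow> 'i \<Rightarrow> 'i \<Rightarrow> 'i \<Rightarrow> complex"
  assumes I: "finite I" "i \<in> I" "j \<in> I" "k \<in> I"
  shows "(\<Sum>x\<in>I. \<Sum>y\<in>I. \<Sum>z\<in>I. \<Sum>w\<in>I. lam x y z w *
    (of_bool ((y, z, w) = (i, j, k)) - of_bool ((x, z, w) = (i, j, k)) +
     of_bool ((x, y, w) = (i, j, k)) - of_bool ((x, y, z) = (i, j, k)))) = bd4 I lam i j k"
proof -
  have d: "(\<Sum>y\<in>I. f y * of_bool (y = a)) = f a" if "a \<in> I" for f :: "'i \<Rightarrow> complex" and a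
    using that I(1) by (simp add: of_bool_def if_distrib[of "\<lambda>x. _ * x"] cong: if_cong)
  have p: "of_bool ((x, y, z) = (i, j, k)) = of_bool (x = i) * (of_bool (y = j) * of_bool (z = k) :: complex)" for x y z
    by auto
  have m: "(\<Sum>y\<in>I. f y * (c * g y)) = c * (\<Sum>y\<in>I. f y * g y)" for f g :: "'i \<Rightarrow> complex" and c
    by (simp add: sum_distrib_left mult.left_commute)
  have 1: "(\<Sum>x\<in>I. \<Sum>y\<in>I. \<Sum>z\<in>I. \<Sum>w\<in>I. lam x y z w * of_bool ((y, z, w) = (i, j, k))) = (\<Sum>x\<in>I. lam x i j k)"
  proof (rule sum.cong[OF refl])
    fix x
    have "(\<Sum>y\<in>I. \<Sum>z\<in>I. \<Sum>w\<in>I. lam x y z w * of_bool ((y, z, w) = (i, j, k))) =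
      (\<Sum>y\<in>I. (\<Sum>z\<in>I. (\<Sum>w\<in>I. lam x y z w * of_bool (w = k)) * of_bool (z = j)) * of_bool (y = i))"
      by (simp only: p sum_distrib_right sum_distrib_left mult_ac)
    then show "(\<Sum>y\<in>I. \<Sum>z\<in>I. \<Sum>w\<in>I. lam x y z w * of_bool ((y, z, w) = (i, j, k))) = lam x i j k"
      by (simp only: d I)
  qed
  have 2: "(\<Sum>x\<in>I. \<Sum>y\<in>I. \<Sum>z\<in>I. \<Sum>w\<in>I. lam x y z w * of_bool ((x, z, w) = (i, j, k))) = (\<Sum>y\<in>I. lam i y j k)"
  proof -
    have "(\<Sum>x\<in>I. \<Sum>y\<in>I. \<Sum>z\<in>I. \<Sum>w\<in>I. lam x y z w * of_bool ((x, z, w) = (i, j, k))) =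
      (\<Sum>x\<in>I. (\<Sum>y\<in>I. \<Sum>z\<in>I. (\<Sum>w\<in>I. lam x y z w * of_bool (w = k)) * of_bool (z = j)) * of_bool (x = i))"
      by (simp only: p sum_distrib_right sum_distrib_left mult_ac)
    then show ?thesis by (simp only: d I)
  qed
  have 3: "(\<Sum>x\<in>I. \<Sum>y\<in>I. \<Sum>z\<in>I. \<Sum>w\<in>I. lam x y z w * of_bool ((x, y, w) = (i, j, k))) = (\<Sum>z\<in>I. lam i j z k)"
  proof -
    have "(\<Sum>x\<in>I. \<Sum>y\<in>I. \<Sum>z\<in>I. \<Sum>w\<in>I. lam x y z w * of_bool ((x, y, w) = (i, j, k))) =
      (\<Sum>x\<in>I. (\<Sum>y\<in>I. (\<Sum>z\<in>I. \<Sum>w\<in>I. lam x y z w * of_bool (w = k)) * of_bool (y = j)) * of_bool (x = i))"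
      by (simp only: p sum_distrib_right sum_distrib_left mult_ac)
    then show ?thesis by (simp only: d I)
  qed
  have 4: "(\<Sum>x\<in>I. \<Sum>y\<in>I. \<Sum>z\<in>I. \<Sum>w\<in>I. lam x y z w * of_bool ((x, y, z) = (i, j, k))) = (\<Sum>w\<in>I. lam i j k w)"
  proof -
    have "(\<Sum>x\<in>I. \<Sum>y\<in>I. \<Sum>z\<in>I. \<Sum>w\<in>I. lam x y z w * of_bool ((x, y, z) = (i, j, k))) =
      (\<Sum>x\<in>I. (\<Sum>y\<in>I. (\<Sum>z\<in>I. (\<Sum>w\<in>I. lam x y z w) * of_bool (z = k)) * of_bool (y = j)) * of_bool (x = i))"
      by (simp only: p sum_distrib_right sum_distrib_left mult_ac)
    then show ?thesis by (simp only: d I)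
  qed
  show ?thesis
    unfolding bd4_def sum_subtractf sum.distrib 1[symmetric] 2[symmetric] 3[symmetric] 4[symmetric]
    by (simp only: sum_subtractf[symmetric] sum.distrib[symmetric] distrib_left right_diff_distrib)
qed

text \<open>In finite dimension, a vector outside the image of a map is detected by a functional in the kernel
  of its transpose; the transpose of \<open>bd4\<close> is the Cech coboundary.\<close>

lemma cech_dichotomy:
  fixes a :: "'i \<Rightarrow> 'i \<Rightarrow> 'i \<Rightarrow> complex"
  assumes I: "finite I"
  obtains lam where "\<And>x y z w. \<not> N x y z w \<Longrightarrow> lam x y z w = 0"
      "\<And>i j k. i \<in> I \<Longrightarrow> j \<in> I \<Longrightarrow> k \<in> I \<Longrightarrow> a i j k = bd4 I lam i j k"
  | c where "\<And>i j k l. i \<in> I \<Longrightarrow> j \<in> I \<Longrightarrow> k \<in> I \<Longrightarrow> l \<in> I \<Longrightarrow> N i j k l \<Longrightarrow> c j k l - c i k l + c i j l - c i j k = (0 :: complex)"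
      "(\<Sum>i\<in>I. \<Sum>j\<in>I. \<Sum>k\<in>I. c i j k * a i j k) \<noteq> 0"
proof -
  let ?T = "I \<times> I \<times> I"
  let ?A = "I \<times> I \<times> I \<times> I"
  let ?L = "{(i, j, k, l) \<in> ?A. N i j k l}"
  define b where "b = (\<lambda>(x, y, z, w) (t :: 'i \<times> 'i \<times> 'i). of_bool ((y, z, w) = t) - of_bool ((x, z, w) = t) +
      of_bool ((x, y, w) = t) - of_bool ((x, y, z) = t) :: complex)"
  have fL: "finite ?L" by (rule finite_subset[of _ ?A]) (use I in auto)
  have "(\<exists>u. \<forall>t\<in>?T. (\<lambda>(i, j, k). a i j k) t = (\<Sum>l\<in>?L. u l * b l t)) \<or>
    (\<exists>c. (\<forall>l\<in>?L. (\<Sum>t\<in>?T. c t * b l t) = 0) \<and> (\<Sum>t\<in>?T. c t * (\<lambda>(i, j, k). a i j k) t) \<noteq> 0)"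
    by (rule span_or_functional[OF fL]) (use I in auto)
  then show thesis
  proof (elim disjE exE conjE)
    fix u assume u: "\<forall>t\<in>?T. (\<lambda>(i, j, k). a i j k) t = (\<Sum>l\<in>?L. u l * b l t)"
    define lam where "lam x y z w = (if N x y z w then u (x, y, z, w) else 0)" for x y z w
    show thesis
    proof (rule that(1))
      show "lam x y z w = 0" if "\<not> N x y z w" for x y z w using that by (simp add: lam_def)
      fix i j k assume ijk: "i \<in> I" "j \<in> I" "k \<in> I"
      have "a i j k = (\<Sum>l\<in>?L. u l * b l (i, j, k))" using u ijk by auto
      also have "\<dots> = (\<Sum>(x, y, z, w)\<in>?L. lam x y z w * b (x, y, z, w) (i, j, k))"
        by (intro sum.cong refl) (auto simp: lam_def)
      also have "\<dots> = (\<Sum>(x, y, z, w)\<in>?A. lam x y z w * b (x, y, z, w) (i, j, k))"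
        by (rule sum.mono_neutral_left) (use I in \<open>auto simp: lam_def split: if_splits\<close>)
      also have "\<dots> = bd4 I lam i j k"
        unfolding sum_delta_tuples[OF I ijk, symmetric] b_def by (simp add: sum.cartesian_product)
      finally show "a i j k = bd4 I lam i j k" .
    qed
  next
    fix c assume c: "\<forall>l\<in>?L. (\<Sum>t\<in>?T. c t * b l t) = 0" "(\<Sum>t\<in>?T. c t * (\<lambda>(i, j, k). a i j k) t) \<noteq> 0"
    show thesis
    proof (rule that(2)[of "\<lambda>i j k. c (i, j, k)"])
      fix i j k l assume ij: "i \<in> I" "j \<in> I" "k \<in> I" "l \<in> I" "N i j k l"
      have d: "(\<Sum>t\<in>?T. c t * of_bool (s = t)) = c s" if "s \<in> ?T" for s
        using that I by (simp add: of_bool_def if_distrib[of "\<lambda>x. _ * x"] cong: if_cong)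
      have "(\<Sum>t\<in>?T. c t * b (i, j, k, l) t) = 0" using c(1) ij by auto
      moreover have "(\<Sum>t\<in>?T. c t * b (i, j, k, l) t) = c (j, k, l) - c (i, k, l) + c (i, j, l) - c (i, j, k)"
        unfolding b_def prod.case using ij d[of "(j, k, l)"] d[of "(i, k, l)"] d[of "(i, j, l)"] d[of "(i, j, k)"]
        by (simp only: distrib_left right_diff_distrib sum.distrib sum_subtractf mem_Sigma_iff simp_thms)
      ultimately show "c (j, k, l) - c (i, k, l) + c (i, j, l) - c (i, j, k) = 0" by simp
    next
      have "(\<Sum>t\<in>?T. c t * (\<lambda>(i, j, k). a i j k) t) = (\<Sum>i\<in>I. \<Sum>j\<in>I. \<Sum>k\<in>I. c (i, j, k) * a i j k)"
        by (simp add: sum.cartesian_product case_prod_unfold)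
      then show "(\<Sum>i\<in>I. \<Sum>j\<in>I. \<Sum>k\<in>I. c (i, j, k) * a i j k) \<noteq> 0" using c(2) by simp
    qed
  qed
qed

subsection \<open>Nested covers\<close>

context compact_atlas
begin

lemma cell_nonempty: assumes "cell_in c U" shows "U \<noteq> {}"
proof -
  obtain p r where "r > 0" "open_cube p r \<subseteq> chart_img c" "U = {q \<in> fst c. snd c q \<in> open_cube p r}"
    using assms unfolding cell_in_def by blast
  moreover have "p \<in> open_cube p r" using \<open>r > 0\<close> by (simp add: open_cube_def)
  ultimately have "pt c p \<in> U" by auto
  then show ?thesis by blast
qed

lemma smooth_fun_nbhd:
  assumes f: "smooth_fun f" and p: "p \<in> topspace X" and e: "e > 0"
  shows "\<exists>W. openin X W \<and> p \<in> W \<and> (\<forall>q\<in>W. cmod (f q - f p) < e)"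
proof -
  obtain c where c: "c \<in> A" "p \<in> fst c" using covers p by blast
  let ?S = "{x \<in> chart_img c. f (pt c x) \<in> ball (f p) e}"
  have "continuous_on (chart_img c) (\<lambda>x. f (pt c x))"
    by (rule smooth_on_continuous_on[OF smooth_funD[OF f c(1)]])
  then have "open (chart_img c \<inter> (\<lambda>x. f (pt c x)) -` ball (f p) e)"
    by (rule continuous_open_preimage[OF _ chart(2)[OF c(1)]]) simp
  moreover have "?S = chart_img c \<inter> (\<lambda>x. f (pt c x)) -` ball (f p) e" by auto
  ultimately have "open ?S" by (simp only:)
  then have "openin X {q \<in> fst c. snd c q \<in> ?S}" by (rule openin_chart_preimage[OF c(1)])
  moreover have "p \<in> {q \<in> fst c. snd c q \<in> ?S}" using c e by simp
  moreover have "cmod (f q - f p) < e" if "q \<in> {q \<in> fst c. snd c q \<in> ?S}" for q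
    using that pt_chart[OF c(1), of q] by (auto simp: dist_norm norm_minus_commute)
  ultimately show ?thesis by blast
qed

text \<open>The partition of unity serves instead of a metric: some \<open>\<rho> j\<close> is at least \<open>1 / card I\<close> at a given
  point, hence nonzero on the star of a family of small sets around it.\<close>

definition small :: "'a set \<Rightarrow> ('a \<Rightarrow> 'a \<Rightarrow> complex) \<Rightarrow> 'a set \<Rightarrow> bool"
  where "small I \<rho> U \<longleftrightarrow> (\<forall>j\<in>I. \<forall>p\<in>U. \<forall>q\<in>U. cmod (\<rho> j p - \<rho> j q) < 1 / (3 * card I))"

lemma pou_refine:
  assumes p: "pou I' ch' Q' \<rho>'"
  obtains I ch Q \<rho> where "pou I ch Q \<rho>" "\<And>i. i \<in> I \<Longrightarrow> small I' \<rho>' (Q i)"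
proof (rule pou_exists[of "small I' \<rho>'"])
  fix q assume q: "q \<in> topspace X"
  \<comment> \<open>Two points that are both this close to the value at \<open>q\<close> differ by
    less than 1 / (3 N), with N = \<open>card I'\<close>, as \<open>small\<close> demands.\<close>
  let ?e = "1 / (6 * real (card I'))"
  show "\<exists>W. openin X W \<and> q \<in> W \<and> small I' \<rho>' W"
  proof (cases "I' = {}")
    case True
    then show ?thesis using q by (intro exI[of _ "topspace X"]) (simp add: small_def)
  next
    case False
    then have e: "?e > 0" using pouD(1)[OF p] by (simp add: card_gt_0_iff)
    have "\<forall>j\<in>I'. \<exists>W. openin X W \<and> q \<in> W \<and> (\<forall>q'\<in>W. cmod (\<rho>' j q' - \<rho>' j q) < ?e)"
      using smooth_fun_nbhd[OF pouD(3)[OF p] q e] by blast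
    then obtain W where W: "\<And>j. j \<in> I' \<Longrightarrow> openin X (W j) \<and> q \<in> W j \<and> (\<forall>q'\<in>W j. cmod (\<rho>' j q' - \<rho>' j q) < ?e)"
      by metis
    have "openin X (\<Inter>j\<in>I'. W j)" by (rule openin_INT2) (use W pouD(1)[OF p] False in auto)
    moreover have "small I' \<rho>' (\<Inter>j\<in>I'. W j)"
      unfolding small_def
    proof (intro ballI)
      fix j a b assume j: "j \<in> I'" and ab: "a \<in> (\<Inter>j\<in>I'. W j)" "b \<in> (\<Inter>j\<in>I'. W j)"
      have "cmod (\<rho>' j a - \<rho>' j b) \<le> cmod (\<rho>' j a - \<rho>' j q) + cmod (\<rho>' j b - \<rho>' j q)"
        by (rule norm_diff_triangle_le[of _ "\<rho>' j q"]) (simp_all add: norm_minus_commute)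
      also have "\<dots> < ?e + ?e" using W[OF j] ab j by (intro add_strict_mono) auto
      finally show "cmod (\<rho>' j a - \<rho>' j b) < 1 / real (3 * card I')" by (simp add: field_simps)
    qed
    ultimately show ?thesis using W by blast
  qed
next
  show "small I' \<rho>' U" if "small I' \<rho>' W" "U \<subseteq> W" for U W using that unfolding small_def by blast
qed (rule that)

text \<open>Intersections are tested on the smallest sets \<open>Q0\<close>, while the conclusion
  concerns the enlarged sets \<open>W\<close>. This allows the lemma to be iterated along a tower in
  which one index set and one intersection pattern are kept.\<close>

lemma pou_star:
  assumes p: "pou I' ch' Q' \<rho>'" and Q0: "\<And>i. i \<in> I \<Longrightarrow> Q0 i \<noteq> {} \<and> Q0 i \<subseteq> W i \<and> W i \<subseteq> topspace X"
    and sm: "\<And>i. i \<in> I \<Longrightarrow> small I' \<rho>' (W i)"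
  obtains f where "\<And>i. i \<in> I \<Longrightarrow> f i \<in> I'" "\<And>i k. i \<in> I \<Longrightarrow> k \<in> I \<Longrightarrow> Q0 k \<inter> Q0 i \<noteq> {} \<Longrightarrow> W k \<subseteq> Q' (f i)"
proof -
  note pD = pouD[OF p]
  let ?N = "real (card I')"
  have "\<exists>j\<in>I'. \<forall>k\<in>I. Q0 k \<inter> Q0 i \<noteq> {} \<longrightarrow> W k \<subseteq> Q' j" if i: "i \<in> I" for i
  proof -
    obtain p0 where p0: "p0 \<in> Q0 i" using Q0[OF i] by blast
    have p0X: "p0 \<in> topspace X" "p0 \<in> W i" using p0 Q0[OF i] by auto
    have ne: "I' \<noteq> {}" using pD(6)[OF p0X(1)] by auto
    then have N: "?N > 0" using pD(1) by (simp add: card_gt_0_iff)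
    have "\<exists>j\<in>I'. cmod (\<rho>' j p0) \<ge> 1 / ?N"
    proof (rule ccontr)
      assume "\<not> ?thesis"
      then have "(\<Sum>j\<in>I'. cmod (\<rho>' j p0)) < (\<Sum>j\<in>I'. 1 / ?N)"
        by (intro sum_strict_mono pD(1) ne) auto
      also have "\<dots> = 1" using N by simp
      finally have "cmod (\<Sum>j\<in>I'. \<rho>' j p0) < 1" by (rule le_less_trans[OF norm_sum])
      then show False using pD(6)[OF p0X(1)] by simp
    qed
    then obtain j where j: "j \<in> I'" "cmod (\<rho>' j p0) \<ge> 1 / ?N" by blast
    have "W k \<subseteq> Q' j" if k: "k \<in> I" "Q0 k \<inter> Q0 i \<noteq> {}" for k
    proof
      fix a assume a: "a \<in> W k"
      obtain b where b: "b \<in> W k" "b \<in> W i" using k Q0[OF i] Q0[OF k(1)] by blast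
      \<comment> \<open>From \<open>p0\<close> any point of \<open>W k\<close> is reached through
        \<open>b\<close> in two steps, each changing \<open>\<rho>' j\<close> by less than 1 / (3
        N). The total of 2 / (3 N) cannot bring a value of modulus at least 1 / N down to 0.\<close>
      have "cmod (\<rho>' j a - \<rho>' j p0) \<le> cmod (\<rho>' j a - \<rho>' j b) + cmod (\<rho>' j b - \<rho>' j p0)"
        by (rule norm_diff_triangle_le[OF order_refl order_refl])
      also have "\<dots> < 1 / (3 * ?N) + 1 / (3 * ?N)"
        using sm[OF i] sm[OF k(1)] j(1) a b p0X(2) unfolding small_def by (intro add_strict_mono) auto
      also have "\<dots> < 1 / ?N" using N by (simp add: field_simps)
      finally have "\<rho>' j a \<noteq> 0" using j(2) by auto
      then show "a \<in> Q' j"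
        using pD(4)[OF j(1)] a Q0[OF k(1)] unfolding fun_supp_in_def by blast
    qed
    then show ?thesis using j(1) by blast
  qed
  then obtain f where "\<And>i. i \<in> I \<Longrightarrow> f i \<in> I' \<and> (\<forall>k\<in>I. Q0 k \<inter> Q0 i \<noteq> {} \<longrightarrow> W k \<subseteq> Q' (f i))" by metis
  then show thesis using that by blast
qed

text \<open>The covers are built from the coarsest to the finest, each refined until it is small for
  the partition of unity of the previous one. The maps \<open>f\<close>, \<open>g\<close>,
  \<open>h\<close> then assign to an index of the finest cover a cell of each coarser cover.\<close>

lemma tower:
  obtains I ch Q \<rho> Q1 c1 Q2 c2 Q3 c3 where "pou I ch Q \<rho>"
    "\<And>i. i \<in> I \<Longrightarrow> cell_in (c1 i) (Q1 i)" "\<And>i. i \<in> I \<Longrightarrow> cell_in (c2 i) (Q2 i)" "\<And>i. i \<in> I \<Longrightarrow> cell_in (c3 i) (Q3 i)"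
    "\<And>i k. i \<in> I \<Longrightarrow> k \<in> I \<Longrightarrow> Q k \<inter> Q i \<noteq> {} \<Longrightarrow> Q k \<subseteq> Q1 i"
    "\<And>i k. i \<in> I \<Longrightarrow> k \<in> I \<Longrightarrow> Q k \<inter> Q i \<noteq> {} \<Longrightarrow> Q1 k \<subseteq> Q2 i"
    "\<And>i k. i \<in> I \<Longrightarrow> k \<in> I \<Longrightarrow> Q k \<inter> Q i \<noteq> {} \<Longrightarrow> Q2 k \<subseteq> Q3 i"
    "\<And>i. i \<in> I \<Longrightarrow> Q i \<noteq> {}"
proof -
  obtain J3 ch3 R3 \<rho>3 where p3: "pou J3 ch3 R3 \<rho>3"
    by (rule pou_exists[of "\<lambda>_. True"]) (auto intro: openin_topspace)
  obtain J2 ch2 R2 \<rho>2 where p2: "pou J2 ch2 R2 \<rho>2" and s2: "\<And>i. i \<in> J2 \<Longrightarrow> small J3 \<rho>3 (R2 i)"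
    using pou_refine[OF p3] by blast
  obtain J1 ch1 R1 \<rho>1 where p1: "pou J1 ch1 R1 \<rho>1" and s1: "\<And>i. i \<in> J1 \<Longrightarrow> small J2 \<rho>2 (R1 i)"
    using pou_refine[OF p2] by blast
  obtain I ch Q \<rho> where p0: "pou I ch Q \<rho>" and s0: "\<And>i. i \<in> I \<Longrightarrow> small J1 \<rho>1 (Q i)"
    using pou_refine[OF p1] by blast
  have X: "U \<subseteq> topspace X" if "cell_in c U" for c U using openin_subset[OF cell_open[OF that]] .
  have ne: "Q i \<noteq> {}" if "i \<in> I" for i using cell_nonempty[OF pouD(2)[OF p0 that]] .
  have q0: "Q i \<noteq> {} \<and> Q i \<subseteq> Q i \<and> Q i \<subseteq> topspace X" if "i \<in> I" for i
    using ne[OF that] X[OF pouD(2)[OF p0 that]] by simp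
  obtain f where f: "\<And>i. i \<in> I \<Longrightarrow> f i \<in> J1" "\<And>i k. i \<in> I \<Longrightarrow> k \<in> I \<Longrightarrow> Q k \<inter> Q i \<noteq> {} \<Longrightarrow> Q k \<subseteq> R1 (f i)"
    by (rule pou_star[where I = I, OF p1 q0 s0]) (assumption+, rule that)
  have q1: "Q i \<noteq> {} \<and> Q i \<subseteq> R1 (f i) \<and> R1 (f i) \<subseteq> topspace X" if "i \<in> I" for i
    using ne[OF that] f(2)[OF that that] X[OF pouD(2)[OF p1 f(1)[OF that]]] by simp
  obtain g where g: "\<And>i. i \<in> I \<Longrightarrow> g i \<in> J2" "\<And>i k. i \<in> I \<Longrightarrow> k \<in> I \<Longrightarrow> Q k \<inter> Q i \<noteq> {} \<Longrightarrow> R1 (f k) \<subseteq> R2 (g i)"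
    by (rule pou_star[where I = I, OF p2 q1 s1[OF f(1)]]) (assumption+, rule that)
  have q2: "Q i \<noteq> {} \<and> Q i \<subseteq> R2 (g i) \<and> R2 (g i) \<subseteq> topspace X" if "i \<in> I" for i
    using q1[OF that] g(2)[OF that that] X[OF pouD(2)[OF p2 g(1)[OF that]]] by auto
  obtain h where h: "\<And>i. i \<in> I \<Longrightarrow> h i \<in> J3" "\<And>i k. i \<in> I \<Longrightarrow> k \<in> I \<Longrightarrow> Q k \<inter> Q i \<noteq> {} \<Longrightarrow> R2 (g k) \<subseteq> R3 (h i)"
    by (rule pou_star[where I = I, OF p3 q2 s2[OF g(1)]]) (assumption+, rule that)
  show thesis
    by (rule that[of I ch Q \<rho> "\<lambda>i. ch1 (f i)" "\<lambda>i. R1 (f i)" "\<lambda>i. ch2 (g i)" "\<lambda>i. R2 (g i)" "\<lambda>i. ch3 (h i)" "\<lambda>i. R3 (h i)"])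
      (use p0 pouD(2)[OF p1 f(1)] pouD(2)[OF p2 g(1)] pouD(2)[OF p3 h(1)] f(2) g(2) h(2) ne in auto)
qed

end


subsection \<open>Descent and the nondegenerate pairing\<close>

lemma ab_group_add_rearrange: "(a - b) - (c - d) + (e - f) = (a - c + e) - (b - d + (f :: 'b::ab_group_add))"
  by (simp add: algebra_simps)

lemma ab_group_add_rearrange2: "(a - b) - (c - d) = (a - c) - (b - (d :: 'b::ab_group_add))"
  by (simp add: algebra_simps)

context compact_atlas
begin

lemma fmult_form_sum: "fmult f (\<Sum>i\<in>I. \<omega> i) = (\<Sum>i\<in>I. fmult f (\<omega> i))"
proof (induction I rule: infinite_finite_induct)
  case (insert i I)
  then show ?case by (simp only: sum.insert[OF insert(1,2)] fmult_add)
qed (simp_all only: sum.infinite sum.empty fmult_0 not_False_eq_True)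

lemma dwedge_form_sum:
  assumes "\<And>i. i \<in> I \<Longrightarrow> \<omega> i \<in> smooth_forms A k" "smooth_fun f"
  shows "dwedge k f (\<Sum>i\<in>I. \<omega> i) = (\<Sum>i\<in>I. dwedge k f (\<omega> i))"
  unfolding dwedge_def fmult_form_sum
  using ext_deriv_sum[of I \<omega> k] ext_deriv_sum[of I "\<lambda>i. fmult f (\<omega> i)" k] assms
  by (simp only: sum_subtractf fmult_form_sum fmult_smooth)

lemma dwedge_0: "dwedge k f 0 = 0"
  by (simp only: dwedge_def fmult_0 ext_deriv_0 diff_self)

lemma pou_dwedge_sum:
  assumes p: "pou I ch Q \<rho>" and w: "\<omega> \<in> smooth_forms A k"
  shows "(\<Sum>i\<in>I. dwedge k (\<rho> i) \<omega>) = 0"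
proof -
  have "(\<Sum>i\<in>I. dwedge k (\<rho> i) \<omega>) = dwedge k (\<lambda>p. \<Sum>i\<in>I. \<rho> i p) \<omega>"
    by (rule dwedge_sum[OF pouD(3)[OF p] w])
  also have "\<dots> = dwedge k (\<lambda>p. 1) \<omega>" by (rule dwedge_cong[OF w pouD(6)[OF p]])
  finally show ?thesis by (simp only: dwedge_const[OF w])
qed

lemma fmult_dwedge_supp:
  assumes "fun_supp_in U f" "fun_supp_in V g"
  shows "supp_in (U \<inter> V) (fmult f (dwedge k g \<omega>))"
  by (rule supp_in_Int[OF supp_in_fmult_fun[OF assms(1)] supp_in_fmult[OF supp_in_dwedge_fun[OF assms(2)]]])

text \<open>Choosing the primitive 0 wherever \<open>N\<close> fails keeps the new chain supported
  on the tuples of sets that meet, so the next boundary involves only neighbouring cells.\<close>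

lemma choose_primitive:
  assumes "\<And>t. t \<in> T \<Longrightarrow> \<exists>\<eta>. \<eta> \<in> smooth_forms A k \<and> supp_in (U t) \<eta> \<and> ext_deriv A k \<eta> = \<omega> t"
    and "\<And>t. t \<in> T \<Longrightarrow> \<not> N t \<Longrightarrow> \<omega> t = 0"
  obtains \<eta> where "\<And>t. t \<in> T \<Longrightarrow> \<eta> t \<in> smooth_forms A k" "\<And>t. t \<in> T \<Longrightarrow> supp_in (U t) (\<eta> t)"
    "\<And>t. t \<in> T \<Longrightarrow> ext_deriv A k (\<eta> t) = \<omega> t" "\<And>t. t \<in> T \<Longrightarrow> \<not> N t \<Longrightarrow> \<eta> t = 0"
proof -
  have "\<exists>\<eta>. \<eta> \<in> smooth_forms A k \<and> supp_in (U t) \<eta> \<and> ext_deriv A k \<eta> = \<omega> t \<and> (\<not> N t \<longrightarrow> \<eta> = 0)" if "t \<in> T" for t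
  proof (cases "N t")
    case True
    then show ?thesis using assms(1)[OF that] by blast
  next
    case False
    then show ?thesis using assms(2)[OF that] zero_smooth supp_in_0 ext_deriv_0 by (intro exI[of _ 0]) auto
  qed
  then obtain \<eta> where "\<And>t. t \<in> T \<Longrightarrow> \<eta> t \<in> smooth_forms A k \<and> supp_in (U t) (\<eta> t) \<and> ext_deriv A k (\<eta> t) = \<omega> t \<and> (\<not> N t \<longrightarrow> \<eta> t = 0)"
    by metis
  then show thesis using that by blast
qed

lemma supp_in_0I: "\<omega> = 0 \<Longrightarrow> supp_in U \<omega>"
  using supp_in_0 by blast

end

text \<open>The chains \<open>th1\<close>, \<open>th2\<close>, \<open>th3\<close> have the values \<open>\<rho>\<^sub>i \<theta>\<close>, \<open>\<rho>\<^sub>i d\<rho>\<^sub>j \<and> \<theta>\<close> and \<open>\<rho>\<^sub>i d\<rho>\<^sub>j \<and> d\<rho>\<^sub>k \<and> \<theta>\<close>. The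
  boundary of each is the differential of the preceding one, and \<open>th3\<close> has top degree. The cells
  \<open>Q1\<close>, \<open>Q2\<close>, \<open>Q3\<close> contain the stars on which the successive primitives are supported.\<close>

locale cech_tower = compact_atlas X A for X :: "'a topology" and A :: "('a, 'n::finite) chart set" +
  fixes I :: "'a set" and ch Q \<rho> Q1 c1 Q2 c2 Q3 c3 and \<theta> :: "('a, 'n) form" and D :: nat
  assumes pu: "pou I ch Q \<rho>"
    and cells: "\<And>i. i \<in> I \<Longrightarrow> cell_in (c1 i) (Q1 i)" "\<And>i. i \<in> I \<Longrightarrow> cell_in (c2 i) (Q2 i)"
      "\<And>i. i \<in> I \<Longrightarrow> cell_in (c3 i) (Q3 i)"
    and star: "\<And>i k. i \<in> I \<Longrightarrow> k \<in> I \<Longrightarrow> Q k \<inter> Q i \<noteq> {} \<Longrightarrow> Q k \<subseteq> Q1 i"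
      "\<And>i k. i \<in> I \<Longrightarrow> k \<in> I \<Longrightarrow> Q k \<inter> Q i \<noteq> {} \<Longrightarrow> Q1 k \<subseteq> Q2 i"
      "\<And>i k. i \<in> I \<Longrightarrow> k \<in> I \<Longrightarrow> Q k \<inter> Q i \<noteq> {} \<Longrightarrow> Q2 k \<subseteq> Q3 i"
    and nonempty: "\<And>i. i \<in> I \<Longrightarrow> Q i \<noteq> {}"
    and dim: "2 * CARD('n) = Suc (Suc D)" "D > 0"
    and theta: "\<theta> \<in> smooth_forms A D" "ext_deriv A D \<theta> = 0"
begin

lemmas pD = pouD[OF pu]

definition th1 where "th1 i = fmult (\<rho> i) \<theta>"
definition th2 where "th2 i j = fmult (\<rho> i) (dwedge D (\<rho> j) \<theta>)"
definition th3 where "th3 i j k = fmult (\<rho> i) (dwedge (Suc D) (\<rho> j) (dwedge D (\<rho> k) \<theta>))"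

lemma dw_smooth: "j \<in> I \<Longrightarrow> \<omega> \<in> smooth_forms A k \<Longrightarrow> dwedge k (\<rho> j) \<omega> \<in> smooth_forms A (Suc k)"
  by (rule dwedge_smooth[OF pD(3)])

lemma th_smooth:
  "i \<in> I \<Longrightarrow> th1 i \<in> smooth_forms A D"
  "i \<in> I \<Longrightarrow> j \<in> I \<Longrightarrow> th2 i j \<in> smooth_forms A (Suc D)"
  "i \<in> I \<Longrightarrow> j \<in> I \<Longrightarrow> k \<in> I \<Longrightarrow> th3 i j k \<in> smooth_forms A (Suc (Suc D))"
  unfolding th1_def th2_def th3_def by (intro fmult_smooth pD(3) dw_smooth theta(1); assumption)+

lemma th_supp:
  "i \<in> I \<Longrightarrow> supp_in (Q i) (th1 i)"
  "i \<in> I \<Longrightarrow> j \<in> I \<Longrightarrow> supp_in (Q i \<inter> Q j) (th2 i j)"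
  "i \<in> I \<Longrightarrow> j \<in> I \<Longrightarrow> k \<in> I \<Longrightarrow> supp_in (Q i \<inter> (Q j \<inter> Q k)) (th3 i j k)"
  unfolding th1_def th2_def th3_def
  by (intro supp_in_fmult_fun pD(4), assumption, intro fmult_dwedge_supp pD(4), assumption, assumption,
      intro supp_in_Int[OF supp_in_fmult_fun supp_in_fmult[OF supp_in_Int[OF supp_in_dwedge_fun supp_in_dwedge[OF supp_in_dwedge_fun]]]] pD(4))

lemma d_th1: "i \<in> I \<Longrightarrow> ext_deriv A D (th1 i) = dwedge D (\<rho> i) \<theta>"
  unfolding th1_def ext_deriv_fmult theta(2) fmult_0 by simp

lemma d_th2:
  assumes "i \<in> I" "j \<in> I"
  shows "ext_deriv A (Suc D) (th2 i j) = dwedge (Suc D) (\<rho> i) (dwedge D (\<rho> j) \<theta>)"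
  unfolding th2_def ext_deriv_fmult ext_deriv_dwedge[OF pD(3)[OF assms(2)] theta] fmult_0 by simp

text \<open>The sum over the index of the undifferentiated factor uses that the
  \<open>\<rho> j\<close> add up to 1; the sum over a differentiated index vanishes since the
  differential of 1 is 0. \<open>sum_th3\<close> rests on the same two facts.\<close>

lemma sum_th2: "i \<in> I \<Longrightarrow> (\<Sum>j\<in>I. th2 j i - th2 i j) = ext_deriv A D (th1 i)"
proof -
  assume i: "i \<in> I"
  have "(\<Sum>j\<in>I. th2 j i) = dwedge D (\<rho> i) \<theta>"
    unfolding th2_def by (rule pou_decompose[OF pu dw_smooth[OF i theta(1)]])
  moreover have "(\<Sum>j\<in>I. th2 i j) = 0"
    unfolding th2_def by (simp only: fmult_form_sum[symmetric] pou_dwedge_sum[OF pu theta(1)] fmult_0)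
  ultimately show ?thesis by (simp only: sum_subtractf d_th1[OF i] diff_0_right)
qed

lemma sum_th3:
  assumes i: "i \<in> I" "j \<in> I"
  shows "bd3 I th3 i j = ext_deriv A (Suc D) (th2 i j)"
proof -
  note s = dw_smooth[OF _ theta(1)]
  have "(\<Sum>k\<in>I. th3 k i j) = dwedge (Suc D) (\<rho> i) (dwedge D (\<rho> j) \<theta>)"
    unfolding th3_def by (rule pou_decompose[OF pu dw_smooth[OF i(1) s[OF i(2)]]])
  moreover have "(\<Sum>k\<in>I. th3 i k j) = 0"
    unfolding th3_def by (simp only: fmult_form_sum[symmetric] pou_dwedge_sum[OF pu s[OF i(2)]] fmult_0)
  moreover have "(\<Sum>k\<in>I. th3 i j k) = 0"
    unfolding th3_def
    by (simp only: fmult_form_sum[symmetric] dwedge_form_sum[OF s pD(3)[OF i(2)], symmetric]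
        pou_dwedge_sum[OF pu theta(1)] dwedge_0 fmult_0)
  ultimately show ?thesis
    by (simp only: bd3_def sum.distrib sum_subtractf d_th2[OF i] diff_0_right add_0_right)
qed

lemma bd3_smooth:
  "(\<And>i j k. i \<in> I \<Longrightarrow> j \<in> I \<Longrightarrow> k \<in> I \<Longrightarrow> h i j k \<in> smooth_forms A d) \<Longrightarrow> i \<in> I \<Longrightarrow> j \<in> I \<Longrightarrow> bd3 I h i j \<in> smooth_forms A d"
  unfolding bd3_def by (intro sum_smooth add_smooth diff_smooth)

lemma bd4_smooth:
  "(\<And>i j k l. i \<in> I \<Longrightarrow> j \<in> I \<Longrightarrow> k \<in> I \<Longrightarrow> l \<in> I \<Longrightarrow> M i j k l \<in> smooth_forms A d) \<Longrightarrow>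
    i \<in> I \<Longrightarrow> j \<in> I \<Longrightarrow> k \<in> I \<Longrightarrow> bd4 I M i j k \<in> smooth_forms A d"
  unfolding bd4_def by (intro sum_smooth add_smooth diff_smooth)

lemma d_bd3:
  assumes h: "\<And>i j k. i \<in> I \<Longrightarrow> j \<in> I \<Longrightarrow> k \<in> I \<Longrightarrow> h i j k \<in> smooth_forms A d" and i: "i \<in> I" "j \<in> I"
  shows "ext_deriv A d (bd3 I h i j) = bd3 I (\<lambda>i j k. ext_deriv A d (h i j k)) i j"
proof -
  have "ext_deriv A d (h k i j - h i k j + h i j k) =
      ext_deriv A d (h k i j) - ext_deriv A d (h i k j) + ext_deriv A d (h i j k)" if "k \<in> I" for k
    using ext_deriv_add[OF diff_smooth[OF h[OF that i] h[OF i(1) that i(2)]] h[OF i that]]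
      ext_deriv_diff[OF h[OF that i] h[OF i(1) that i(2)]] by (simp only:)
  moreover have "ext_deriv A d (bd3 I h i j) = (\<Sum>k\<in>I. ext_deriv A d (h k i j - h i k j + h i j k))"
    unfolding bd3_def by (rule ext_deriv_sum) (intro add_smooth diff_smooth h i; assumption)
  ultimately show ?thesis by (simp only: bd3_def cong: sum.cong)
qed

text \<open>If the chain of integrals of \<open>th3\<close> is a boundary then \<open>\<theta>\<close> is exact: correct \<open>th3\<close> by bump forms
  and solve successively on the cells \<open>Q1\<close>, \<open>Q2\<close>, \<open>Q3\<close>.\<close>

lemma descent:
  assumes lam: "\<And>i j k l. Q i \<inter> Q j \<inter> Q k \<inter> Q l = {} \<Longrightarrow> lam i j k l = 0"
    and a: "\<And>i j k. i \<in> I \<Longrightarrow> j \<in> I \<Longrightarrow> k \<in> I \<Longrightarrow> gint (th3 i j k) = bd4 I lam i j k"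
  shows "\<theta> \<in> exact_forms A D"
proof -
  have op: "openin X (Q i)" if "i \<in> I" for i using cell_open[OF pD(2)[OF that]] .
  \<comment> \<open>The number \<open>lam i j k l\<close> is realised as the integral of a form
    supported in the fourfold intersection: a scaled bump, or 0 where the intersection is empty and
    \<open>lam\<close> vanishes.\<close>
  have "\<exists>\<mu>. \<mu> \<in> smooth_forms A (Suc (Suc D)) \<and> supp_in (Q i \<inter> Q j \<inter> Q k \<inter> Q l) \<mu> \<and> gint \<mu> = lam i j k l"
    if "i \<in> I" "j \<in> I" "k \<in> I" "l \<in> I" for i j k l
  proof (cases "Q i \<inter> Q j \<inter> Q k \<inter> Q l = {}")
    case True
    then show ?thesis using zero_smooth supp_in_0 gint_0 lam[OF True] by (intro exI[of _ 0]) auto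
  next
    case False
    then obtain q where q: "q \<in> Q i \<inter> Q j \<inter> Q k \<inter> Q l" by blast
    have "openin X (Q i \<inter> Q j \<inter> Q k \<inter> Q l)" by (intro openin_Int op that)
    then obtain \<mu> where m: "\<mu> \<in> smooth_forms A (2 * CARD('n))" "supp_in (Q i \<inter> Q j \<inter> Q k \<inter> Q l) \<mu>" "gint \<mu> = 1"
      by (rule bump_form_integral[OF _ q]) (rule that)
    show ?thesis
      using form_scale_smooth[OF m(1), of "lam i j k l"] supp_in_scale[OF m(2), of "lam i j k l"]
        gint_scale[of "lam i j k l" \<mu>] m(3) unfolding dim(1) by auto
  qed
  then obtain M where M: "\<And>i j k l. i \<in> I \<Longrightarrow> j \<in> I \<Longrightarrow> k \<in> I \<Longrightarrow> l \<in> I \<Longrightarrow>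
      M i j k l \<in> smooth_forms A (Suc (Suc D)) \<and> supp_in (Q i \<inter> Q j \<inter> Q k \<inter> Q l) (M i j k l) \<and> gint (M i j k l) = lam i j k l"
    by metis
  have Ms: "M i j k l \<in> smooth_forms A (Suc (Suc D))" if "i \<in> I" "j \<in> I" "k \<in> I" "l \<in> I" for i j k l using M that by blast
  let ?B = "bd4 I M"
  have Bs: "?B i j k \<in> smooth_forms A (Suc (Suc D))" if "i \<in> I" "j \<in> I" "k \<in> I" for i j k
    by (rule bd4_smooth[OF Ms that])
  have Bsupp: "supp_in (Q i \<inter> (Q j \<inter> Q k)) (?B i j k)" if ijk: "i \<in> I" "j \<in> I" "k \<in> I" for i j k
  proof -
    have "supp_in (Q i \<inter> (Q j \<inter> Q k)) (M i' j' k' l')"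
      if "i' \<in> I" "j' \<in> I" "k' \<in> I" "l' \<in> I" "{i, j, k} \<subseteq> {i', j', k', l'}" for i' j' k' l'
      using M[OF that(1-4)] by (rule supp_in_mono[OF conjunct1[OF conjunct2]]) (use that(5) in auto)
    then show ?thesis unfolding bd4_def using ijk by (intro supp_in_sum supp_in_add supp_in_diff) auto
  qed
  have Bint: "gint (?B i j k) = gint (th3 i j k)" if ijk: "i \<in> I" "j \<in> I" "k \<in> I" for i j k
  proof -
    have "gint (M l i j k - M i l j k + M i j l k - M i j k l) = lam l i j k - lam i l j k + lam i j l k - lam i j k l" if l: "l \<in> I" for l
    proof -
      note s = Ms[OF l ijk] Ms[OF ijk(1) l ijk(2,3)] Ms[OF ijk(1,2) l ijk(3)] Ms[OF ijk l]
      note s' = s[folded dim(1)]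
      have "gint (M l i j k - M i l j k + M i j l k - M i j k l) = gint (M l i j k) - gint (M i l j k) + gint (M i j l k) - gint (M i j k l)"
        using gint_diff[OF add_smooth[OF diff_smooth[OF s'(1,2)] s'(3)] s'(4)] gint_add[OF diff_smooth[OF s'(1,2)] s'(3)]
          gint_diff[OF s'(1,2)] by (simp only:)
      then show ?thesis using M ijk l by simp
    qed
    moreover have "gint (?B i j k) = (\<Sum>l\<in>I. gint (M l i j k - M i l j k + M i j l k - M i j k l))"
      unfolding bd4_def by (rule gint_sum) (unfold dim(1), intro add_smooth diff_smooth Ms ijk; assumption)
    ultimately have "gint (?B i j k) = bd4 I lam i j k" by (simp only: bd4_def cong: sum.cong)
    then show ?thesis using a[OF ijk] by simp
  qed
  \<comment> \<open>Every entry has integral 0 and is thus solvable on its cell, while subtracting a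
    boundary leaves \<open>bd3\<close> of the chain unchanged.\<close>
  define z3 where "z3 i j k = th3 i j k - ?B i j k" for i j k
  have z3s: "z3 i j k \<in> smooth_forms A (Suc (Suc D))" "supp_in (Q i \<inter> (Q j \<inter> Q k)) (z3 i j k)" "gint (z3 i j k) = 0"
    if "i \<in> I" "j \<in> I" "k \<in> I" for i j k
    unfolding z3_def using th_smooth(3)[OF that] Bs[OF that] th_supp(3)[OF that] Bsupp[OF that] Bint[OF that]
      gint_diff[OF th_smooth(3)[OF that, folded dim(1)] Bs[OF that, folded dim(1)]]
    by (auto intro: diff_smooth supp_in_diff)
  let ?T3 = "I \<times> I \<times> I"
  obtain \<eta>3' where e3':
    "\<And>t. t \<in> ?T3 \<Longrightarrow> \<eta>3' t \<in> smooth_forms A (Suc D)" "\<And>t. t \<in> ?T3 \<Longrightarrow> supp_in (Q1 (fst t)) (\<eta>3' t)"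
    "\<And>t. t \<in> ?T3 \<Longrightarrow> ext_deriv A (Suc D) (\<eta>3' t) = (case t of (i, j, k) \<Rightarrow> z3 i j k)"
    "\<And>t. t \<in> ?T3 \<Longrightarrow> \<not> (case t of (i, j, k) \<Rightarrow> Q i \<inter> (Q j \<inter> Q k) \<noteq> {}) \<Longrightarrow> \<eta>3' t = 0"
  proof (rule choose_primitive[where T = ?T3 and k = "Suc D" and U = "\<lambda>t. Q1 (fst t)"
        and \<omega> = "\<lambda>t. case t of (i, j, k) \<Rightarrow> z3 i j k" and N = "\<lambda>t. case t of (i, j, k) \<Rightarrow> Q i \<inter> (Q j \<inter> Q k) \<noteq> {}"])
    fix t assume "t \<in> ?T3"
    then obtain i j k where t: "t = (i, j, k)" and ijk: "i \<in> I" "j \<in> I" "k \<in> I" by auto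
    have "Q i \<subseteq> Q1 i" using star(1)[OF ijk(1,1)] nonempty[OF ijk(1)] by simp
    then have s1: "supp_in (Q1 i) (z3 i j k)" by (intro supp_in_mono[OF z3s(2)[OF ijk]]) auto
    obtain \<eta> where "\<eta> \<in> smooth_forms A (2 * CARD('n) - 1)" "supp_in (Q1 i) \<eta>" "ext_deriv A (2 * CARD('n) - 1) \<eta> = z3 i j k"
      by (rule cell_exact_top[OF cells(1)[OF ijk(1)] z3s(1)[OF ijk, folded dim(1)] s1 z3s(3)[OF ijk]]) (rule that)
    moreover have "2 * CARD('n) - 1 = Suc D" using dim(1) by simp
    ultimately show "\<exists>\<eta>. \<eta> \<in> smooth_forms A (Suc D) \<and> supp_in (Q1 (fst t)) \<eta> \<and> ext_deriv A (Suc D) \<eta> = (case t of (i, j, k) \<Rightarrow> z3 i j k)"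
      unfolding t prod.case fst_conv by metis
    show "(case t of (i, j, k) \<Rightarrow> z3 i j k) = 0" if "\<not> (case t of (i, j, k) \<Rightarrow> Q i \<inter> (Q j \<inter> Q k) \<noteq> {})"
      using supp_in_empty[OF z3s(1)[OF ijk]] z3s(2)[OF ijk] that unfolding t by simp
  qed (rule that)
  define \<eta>3 where "\<eta>3 i j k = \<eta>3' (i, j, k)" for i j k
  have e3: "\<eta>3 i j k \<in> smooth_forms A (Suc D)" "supp_in (Q1 i) (\<eta>3 i j k)" "ext_deriv A (Suc D) (\<eta>3 i j k) = z3 i j k"
    if "i \<in> I" "j \<in> I" "k \<in> I" for i j k
    using e3'(1-3)[of "(i, j, k)"] that by (auto simp: \<eta>3_def)
  have e30: "\<eta>3 i j k = 0" if "i \<in> I" "j \<in> I" "k \<in> I" "Q i \<inter> (Q j \<inter> Q k) = {}" for i j k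
    using e3'(4)[of "(i, j, k)"] that by (auto simp: \<eta>3_def)
  \<comment> \<open>Closed, since the differential of \<open>bd3 I \<eta>3\<close> is
    \<open>bd3 I z3\<close>, which equals \<open>bd3 I th3\<close>, that is, the differential of
    \<open>th2\<close>.\<close>
  define z2 where "z2 i j = th2 i j - bd3 I \<eta>3 i j" for i j
  have z2s: "z2 i j \<in> smooth_forms A (Suc D)" if "i \<in> I" "j \<in> I" for i j
    unfolding z2_def by (intro diff_smooth th_smooth(2) bd3_smooth e3(1) that)
  have z2d: "ext_deriv A (Suc D) (z2 i j) = 0" if ij: "i \<in> I" "j \<in> I" for i j
  proof -
    have "ext_deriv A (Suc D) (bd3 I \<eta>3 i j) = bd3 I (\<lambda>i j k. ext_deriv A (Suc D) (\<eta>3 i j k)) i j"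
      by (rule d_bd3[OF e3(1) ij])
    also have "\<dots> = bd3 I z3 i j" unfolding bd3_def by (intro sum.cong refl) (simp only: e3(3) ij)
    also have "\<dots> = bd3 I th3 i j - bd3 I ?B i j"
      unfolding bd3_def z3_def sum_subtractf[symmetric] by (intro sum.cong refl) (rule ab_group_add_rearrange)
    also have "\<dots> = ext_deriv A (Suc D) (th2 i j)" by (simp only: bd3_bd4 sum_th3[OF ij] diff_0_right)
    finally show ?thesis
      unfolding z2_def using ext_deriv_diff[OF th_smooth(2)[OF ij] bd3_smooth[OF e3(1) ij]] by (simp only: diff_self)
  qed
  \<comment> \<open>The boundary brings in primitives that live on \<open>Q1 i'\<close> for other
    first indices. Such an entry is 0 unless \<open>Q i'\<close> meets \<open>Q i\<close>, and then
    \<open>Q1 i'\<close> lies in \<open>Q2 i\<close>.\<close>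
  have z2supp: "supp_in (Q2 i) (z2 i j)" if ij: "i \<in> I" "j \<in> I" for i j
  proof -
    have 1: "Q i \<subseteq> Q1 i" "Q1 i \<subseteq> Q2 i" using star(1,2)[OF ij(1,1)] nonempty[OF ij(1)] by auto
    have "supp_in (Q2 i) (\<eta>3 i' j' k')" if "i' \<in> I" "j' \<in> I" "k' \<in> I" "i \<in> {i', j', k'}" for i' j' k'
    proof (cases "Q i' \<inter> (Q j' \<inter> Q k') = {}")
      case True
      then show ?thesis using e30 that by (intro supp_in_0I) blast
    next
      case False
      then have "Q i' \<inter> Q i \<noteq> {}" using that(4) by auto
      then show ?thesis using star(2)[OF ij(1) that(1)] supp_in_mono[OF e3(2)[OF that(1-3)]] by blast
    qed
    then have "supp_in (Q2 i) (bd3 I \<eta>3 i j)"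
      unfolding bd3_def using ij by (intro supp_in_sum supp_in_add supp_in_diff) auto
    moreover have "supp_in (Q2 i) (th2 i j)" by (rule supp_in_mono[OF th_supp(2)[OF ij]]) (use 1 in auto)
    ultimately show ?thesis unfolding z2_def by (intro supp_in_diff)
  qed
  have z20: "z2 i j = 0" if ij: "i \<in> I" "j \<in> I" "Q i \<inter> Q j = {}" for i j
  proof -
    have "bd3 I \<eta>3 i j = (\<Sum>k\<in>I. 0)"
      unfolding bd3_def
    proof (rule sum.cong[OF refl])
      fix k assume k: "k \<in> I"
      have "\<eta>3 k i j = 0" "\<eta>3 i k j = 0" "\<eta>3 i j k = 0"
        by (rule e30, use k ij in auto)+
      then show "\<eta>3 k i j - \<eta>3 i k j + \<eta>3 i j k = 0" by (simp only: diff_0_right add_0_right)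
    qed
    moreover have "th2 i j = 0"
      using supp_in_empty[OF th_smooth(2)[OF ij(1,2)]] th_supp(2)[OF ij(1,2)] ij(3) by simp
    ultimately show ?thesis unfolding z2_def by (simp only: sum.neutral_const diff_0_right)
  qed
  let ?T2 = "I \<times> I"
  obtain \<eta>2' where e2':
    "\<And>t. t \<in> ?T2 \<Longrightarrow> \<eta>2' t \<in> smooth_forms A D" "\<And>t. t \<in> ?T2 \<Longrightarrow> supp_in (Q2 (fst t)) (\<eta>2' t)"
    "\<And>t. t \<in> ?T2 \<Longrightarrow> ext_deriv A D (\<eta>2' t) = (case t of (i, j) \<Rightarrow> z2 i j)"
    "\<And>t. t \<in> ?T2 \<Longrightarrow> \<not> (case t of (i, j) \<Rightarrow> Q i \<inter> Q j \<noteq> {}) \<Longrightarrow> \<eta>2' t = 0"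
  proof (rule choose_primitive[where T = ?T2 and k = D and U = "\<lambda>t. Q2 (fst t)"
        and \<omega> = "\<lambda>t. case t of (i, j) \<Rightarrow> z2 i j" and N = "\<lambda>t. case t of (i, j) \<Rightarrow> Q i \<inter> Q j \<noteq> {}"])
    fix t assume "t \<in> ?T2"
    then obtain i j where t: "t = (i, j)" and ij: "i \<in> I" "j \<in> I" by auto
    obtain \<eta> where "\<eta> \<in> smooth_forms A D" "supp_in (Q2 i) \<eta>" "ext_deriv A D \<eta> = z2 i j"
      by (rule cell_poincare[OF cells(2)[OF ij(1)] z2s[OF ij] z2supp[OF ij] z2d[OF ij]]) (use dim in simp, rule that)
    then show "\<exists>\<eta>. \<eta> \<in> smooth_forms A D \<and> supp_in (Q2 (fst t)) \<eta> \<and> ext_deriv A D \<eta> = (case t of (i, j) \<Rightarrow> z2 i j)"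
      unfolding t prod.case fst_conv by metis
    show "(case t of (i, j) \<Rightarrow> z2 i j) = 0" if "\<not> (case t of (i, j) \<Rightarrow> Q i \<inter> Q j \<noteq> {})"
      using z20[OF ij] that unfolding t by simp
  qed (rule that)
  define \<eta>2 where "\<eta>2 i j = \<eta>2' (i, j)" for i j
  have e2: "\<eta>2 i j \<in> smooth_forms A D" "supp_in (Q2 i) (\<eta>2 i j)" "ext_deriv A D (\<eta>2 i j) = z2 i j"
    if "i \<in> I" "j \<in> I" for i j
    using e2'(1-3)[of "(i, j)"] that by (auto simp: \<eta>2_def)
  have e20: "\<eta>2 i j = 0" if "i \<in> I" "j \<in> I" "Q i \<inter> Q j = {}" for i j
    using e2'(4)[of "(i, j)"] that by (auto simp: \<eta>2_def)
  \<comment> \<open>Closed for the same reason one degree lower: the contribution of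
    \<open>\<eta>3\<close> drops out by \<open>bd2_bd3\<close>, and what remains is the differential
    of \<open>th1\<close>.\<close>
  define z1 where "z1 i = th1 i - (\<Sum>j\<in>I. \<eta>2 j i - \<eta>2 i j)" for i
  have ss: "(\<Sum>j\<in>I. \<eta>2 j i - \<eta>2 i j) \<in> smooth_forms A D" if "i \<in> I" for i
    by (intro sum_smooth diff_smooth e2(1) that)
  have z1s: "z1 i \<in> smooth_forms A D" if "i \<in> I" for i
    unfolding z1_def by (intro diff_smooth th_smooth(1) ss that)
  have z1d: "ext_deriv A D (z1 i) = 0" if i: "i \<in> I" for i
  proof -
    have "ext_deriv A D (\<Sum>j\<in>I. \<eta>2 j i - \<eta>2 i j) = (\<Sum>j\<in>I. ext_deriv A D (\<eta>2 j i - \<eta>2 i j))"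
      by (rule ext_deriv_sum) (intro diff_smooth e2(1) i; assumption)
    also have "\<dots> = (\<Sum>j\<in>I. (th2 j i - th2 i j) - (bd3 I \<eta>3 j i - bd3 I \<eta>3 i j))"
    proof (rule sum.cong[OF refl])
      fix j assume j: "j \<in> I"
      have "ext_deriv A D (\<eta>2 j i - \<eta>2 i j) = z2 j i - z2 i j"
        using ext_deriv_diff[OF e2(1)[OF j i] e2(1)[OF i j]] by (simp only: e2(3)[OF j i] e2(3)[OF i j])
      also have "\<dots> = (th2 j i - th2 i j) - (bd3 I \<eta>3 j i - bd3 I \<eta>3 i j)"
        unfolding z2_def by (rule ab_group_add_rearrange2)
      finally show "ext_deriv A D (\<eta>2 j i - \<eta>2 i j) = (th2 j i - th2 i j) - (bd3 I \<eta>3 j i - bd3 I \<eta>3 i j)" .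
    qed
    also have "\<dots> = (\<Sum>j\<in>I. th2 j i - th2 i j) - (\<Sum>j\<in>I. bd3 I \<eta>3 j i - bd3 I \<eta>3 i j)" by (rule sum_subtractf)
    also have "\<dots> = ext_deriv A D (th1 i)" by (simp only: bd2_bd3 sum_th2[OF i] diff_0_right)
    finally show ?thesis
      unfolding z1_def using ext_deriv_diff[OF th_smooth(1)[OF i] ss[OF i]] by (simp only: diff_self)
  qed
  have z1supp: "supp_in (Q3 i) (z1 i)" if i: "i \<in> I" for i
  proof -
    have 1: "Q i \<subseteq> Q1 i" "Q1 i \<subseteq> Q2 i" "Q2 i \<subseteq> Q3 i" using star[OF i i] nonempty[OF i] by auto
    have "supp_in (Q3 i) (\<eta>2 i' j')" if "i' \<in> I" "j' \<in> I" "i \<in> {i', j'}" for i' j'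
    proof (cases "Q i' \<inter> Q j' = {}")
      case True
      then show ?thesis using e20 that by (intro supp_in_0I) blast
    next
      case False
      then have "Q i' \<inter> Q i \<noteq> {}" using that(3) by auto
      then show ?thesis using star(3)[OF i that(1)] supp_in_mono[OF e2(2)[OF that(1,2)]] by blast
    qed
    then have "supp_in (Q3 i) (\<Sum>j\<in>I. \<eta>2 j i - \<eta>2 i j)"
      using i by (intro supp_in_sum supp_in_diff) auto
    moreover have "supp_in (Q3 i) (th1 i)" by (rule supp_in_mono[OF th_supp(1)[OF i]]) (use 1 in auto)
    ultimately show ?thesis unfolding z1_def by (intro supp_in_diff)
  qed
  obtain D' where D': "D = Suc D'" using dim(2) gr0_implies_Suc by blast
  have "z1 i \<in> exact_forms A D" if i: "i \<in> I" for i
  proof -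
    obtain \<eta> where "\<eta> \<in> smooth_forms A D'" "ext_deriv A D' \<eta> = z1 i"
      by (rule cell_poincare[OF cells(3)[OF i] z1s[OF i, unfolded D'] z1supp[OF i] z1d[OF i, unfolded D']])
        (use dim D' in simp, rule that)
    then have "z1 i \<in> ext_deriv A D' ` smooth_forms A D'" by (intro image_eqI[of _ _ \<eta>]) (rule sym)
    moreover have "exact_forms A D = ext_deriv A D' ` smooth_forms A D'" unfolding D' by (rule exact_forms_Suc)
    ultimately show ?thesis by (simp only:)
  qed
  then have "(\<Sum>i\<in>I. z1 i) \<in> exact_forms A D" by (rule exact_sum)
  \<comment> \<open>The primitives \<open>\<eta>2\<close> cancel in the sum over both indices and
    the \<open>th1 i\<close> add up to \<open>\<theta>\<close>, which is therefore a finite sum of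
    exact forms.\<close>
  moreover have "(\<Sum>i\<in>I. z1 i) = (\<Sum>i\<in>I. th1 i) - (\<Sum>i\<in>I. \<Sum>j\<in>I. \<eta>2 j i - \<eta>2 i j)"
    unfolding z1_def by (rule sum_subtractf)
  moreover have "(\<Sum>i\<in>I. \<Sum>j\<in>I. \<eta>2 j i - \<eta>2 i j) = 0" by (rule sum_antisym)
  moreover have "(\<Sum>i\<in>I. th1 i) = \<theta>" unfolding th1_def by (rule pou_decompose[OF pu theta(1)])
  ultimately show ?thesis by (simp only: diff_0_right)
qed

text \<open>The form \<open>d\<rho>\<^sub>j \<and> d\<rho>\<^sub>k\<close>, generated from the
  constant 1 by \<open>dwedge\<close>. In this form \<open>wedge_dwedge\<close> carries
  \<open>\<theta>\<close> inwards until it replaces the constant 1, which produces the entries of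
  \<open>th3\<close>.\<close>

definition be where "be j k = dwedge 1 (\<rho> j) (dwedge 0 (\<rho> k) (unit_form A))"

lemma be_smooth: "j \<in> I \<Longrightarrow> k \<in> I \<Longrightarrow> be j k \<in> smooth_forms A 2"
  unfolding be_def using dw_smooth[OF _ dw_smooth[OF _ unit_smooth]] by (simp add: numeral_2_eq_2)

lemma be_closed: "j \<in> I \<Longrightarrow> k \<in> I \<Longrightarrow> ext_deriv A 2 (be j k) = 0"
  unfolding be_def using ext_deriv_dwedge[OF pD(3) dw_smooth[OF _ unit_smooth] ext_deriv_dwedge[OF pD(3) unit_smooth ext_deriv_unit]]
  by (simp add: numeral_2_eq_2)

lemma wedge_be:
  assumes "even D" "j \<in> I" "k \<in> I"
  shows "wedge D 2 \<theta> (be j k) = dwedge (Suc D) (\<rho> j) (dwedge D (\<rho> k) \<theta>)"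
proof -
  have "wedge D (Suc 0) \<theta> (dwedge 0 (\<rho> k) (unit_form A)) = dwedge D (\<rho> k) \<theta>"
    using wedge_dwedge[OF theta assms(1) unit_smooth pD(3)[OF assms(3)]] by (simp add: wedge_unit[OF theta(1)])
  then show ?thesis
    using wedge_dwedge[OF theta assms(1) dw_smooth[OF assms(3) unit_smooth] pD(3)[OF assms(2)]]
    by (simp add: be_def numeral_2_eq_2)
qed

text \<open>A cocycle \<open>c\<close> gives the closed form \<open>\<Sum> c\<^sub>i\<^sub>j\<^sub>k \<rho>\<^sub>i d\<rho>\<^sub>j \<and> d\<rho>\<^sub>k\<close>.\<close>

lemma cocycle_form:
  assumes c: "\<And>i j k l. i \<in> I \<Longrightarrow> j \<in> I \<Longrightarrow> k \<in> I \<Longrightarrow> l \<in> I \<Longrightarrow> Q i \<inter> Q j \<inter> Q k \<inter> Q l \<noteq> {} \<Longrightarrow>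
      c j k l - c i k l + c i j l - c i j k = (0 :: complex)"
    and D: "even D"
  defines "\<alpha> \<equiv> (\<Sum>i\<in>I. \<Sum>j\<in>I. \<Sum>k\<in>I. form_scale (c i j k) (fmult (\<rho> i) (be j k)))"
  shows "\<alpha> \<in> closed_forms A 2"
    "gint (wedge D 2 \<theta> \<alpha>) = (\<Sum>i\<in>I. \<Sum>j\<in>I. \<Sum>k\<in>I. c i j k * gint (th3 i j k))"
proof -
  have ts: "form_scale (c i j k) (fmult (\<rho> i) (be j k)) \<in> smooth_forms A 2" if "i \<in> I" "j \<in> I" "k \<in> I" for i j k
    by (intro form_scale_smooth fmult_smooth pD(3) be_smooth that)
  have as: "\<alpha> \<in> smooth_forms A 2" unfolding \<alpha>_def by (intro sum_smooth ts)
  have "wedge D 2 \<theta> \<alpha> = (\<Sum>i\<in>I. \<Sum>j\<in>I. \<Sum>k\<in>I. form_scale (c i j k) (th3 i j k))"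
    unfolding \<alpha>_def wedge_sum
    by (intro sum.cong refl) (simp only: wedge_linear wedge_be[OF D] th3_def)
  moreover have "gint \<dots> = (\<Sum>i\<in>I. \<Sum>j\<in>I. \<Sum>k\<in>I. c i j k * gint (th3 i j k))"
  proof -
    have s: "form_scale (c i j k) (th3 i j k) \<in> smooth_forms A (2 * CARD('n))" if "i \<in> I" "j \<in> I" "k \<in> I" for i j k
      unfolding dim(1) by (intro form_scale_smooth th_smooth that)
    show ?thesis
      by (subst gint_sum, intro sum_smooth s, assumption+, intro sum.cong refl,
          subst gint_sum, intro sum_smooth s, assumption+, intro sum.cong refl,
          subst gint_sum, intro s, assumption+, simp only: gint_scale)
  qed
  ultimately show "gint (wedge D 2 \<theta> \<alpha>) = (\<Sum>i\<in>I. \<Sum>j\<in>I. \<Sum>k\<in>I. c i j k * gint (th3 i j k))" by (simp only:)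
  \<comment> \<open>The 3-forms \<open>d\<rho>\<^sub>i \<and> d\<rho>\<^sub>j \<and>
    d\<rho>\<^sub>k\<close>; their sum over any one of the indices is 0.\<close>
  define R where "R i j k = dwedge 2 (\<rho> i) (be j k)" for i j k
  have Rs: "R i j k \<in> smooth_forms A 3" if "i \<in> I" "j \<in> I" "k \<in> I" for i j k
    unfolding R_def using dw_smooth[OF that(1) be_smooth[OF that(2,3)]] by (simp add: numeral_3_eq_3)
  have R0: "(\<Sum>i\<in>I. R i j k) = 0" "(\<Sum>i\<in>I. R j i k) = 0" "(\<Sum>i\<in>I. R j k i) = 0" if jk: "j \<in> I" "k \<in> I" for j k
  proof -
    note u = dw_smooth[OF _ unit_smooth]
    show "(\<Sum>i\<in>I. R i j k) = 0" unfolding R_def by (rule pou_dwedge_sum[OF pu be_smooth[OF jk]])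
    have "(\<Sum>i\<in>I. be i k) = 0" unfolding be_def using pou_dwedge_sum[OF pu u[OF jk(2)]] by simp
    then show "(\<Sum>i\<in>I. R j i k) = 0"
      unfolding R_def using dwedge_form_sum[of I "\<lambda>i. be i k" 2 "\<rho> j"] be_smooth jk(2) pD(3)[OF jk(1)]
      by (simp only: dwedge_0)
    have "(\<Sum>i\<in>I. be k i) = 0"
      unfolding be_def
      using dwedge_form_sum[of I "\<lambda>i. dwedge 0 (\<rho> i) (unit_form A)" 1 "\<rho> k"] u pD(3)[OF jk(2)]
        pou_dwedge_sum[OF pu unit_smooth] by (simp add: dwedge_0)
    then show "(\<Sum>i\<in>I. R j k i) = 0"
      unfolding R_def using dwedge_form_sum[of I "\<lambda>i. be k i" 2 "\<rho> j"] be_smooth jk(2) pD(3)[OF jk(1)]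
      by (simp only: dwedge_0)
  qed
  have da: "ext_deriv A 2 \<alpha> = (\<Sum>i\<in>I. \<Sum>j\<in>I. \<Sum>k\<in>I. form_scale (c i j k) (R i j k))"
  proof -
    have d1: "ext_deriv A 2 (form_scale (c i j k) (fmult (\<rho> i) (be j k))) = form_scale (c i j k) (R i j k)"
      if "i \<in> I" "j \<in> I" "k \<in> I" for i j k
      unfolding ext_deriv_scale[OF fmult_smooth[OF pD(3)[OF that(1)] be_smooth[OF that(2,3)]]]
        ext_deriv_fmult be_closed[OF that(2,3)] fmult_0 R_def by simp
    show ?thesis
      unfolding \<alpha>_def
      by (subst ext_deriv_sum, intro sum_smooth ts, assumption+, intro sum.cong refl,
          subst ext_deriv_sum, intro sum_smooth ts, assumption+, intro sum.cong refl,
          subst ext_deriv_sum, intro ts, assumption+, intro sum.cong refl d1, assumption+)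
  qed
  \<comment> \<open>The factor \<open>\<rho> l\<close> supplies a fourth index. Either the four sets
    meet and the cocycle relation for (l, i, j, k) rewrites the coefficient, or the form is
    supported in the empty set.\<close>
  have key: "form_scale (c i j k) (fmult (\<rho> l) (R i j k)) = form_scale (c l j k) (fmult (\<rho> l) (R i j k)) -
      form_scale (c l i k) (fmult (\<rho> l) (R i j k)) + form_scale (c l i j) (fmult (\<rho> l) (R i j k))"
    if ijkl: "i \<in> I" "j \<in> I" "k \<in> I" "l \<in> I" for i j k l
  proof (cases "Q l \<inter> Q i \<inter> Q j \<inter> Q k = {}")
    case False
    then have c': "c i j k = c l j k - c l i k + c l i j" using c[OF ijkl(4,1,2,3)] by (simp add: algebra_simps)
    have "form_scale (x - y + z) \<gamma> = form_scale x \<gamma> - form_scale y \<gamma> + form_scale z \<gamma>"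
      for x y z :: complex and \<gamma> :: "('a, 'n) form"
      by (simp add: form_scale_def fun_eq_iff algebra_simps)
    then show ?thesis unfolding c' .
  next
    case True
    have "supp_in (Q l) (fmult (\<rho> l) (R i j k))" by (rule supp_in_fmult_fun[OF pD(4)[OF ijkl(4)]])
    moreover have "supp_in (Q i) (fmult (\<rho> l) (R i j k))"
      unfolding R_def by (intro supp_in_fmult supp_in_dwedge_fun pD(4) ijkl)
    moreover have "supp_in (Q j) (fmult (\<rho> l) (R i j k))"
      unfolding R_def be_def by (intro supp_in_fmult supp_in_dwedge[OF supp_in_dwedge_fun] pD(4) ijkl)
    moreover have "supp_in (Q k) (fmult (\<rho> l) (R i j k))"
      unfolding R_def be_def by (intro supp_in_fmult supp_in_dwedge[OF supp_in_dwedge[OF supp_in_dwedge_fun]] pD(4) ijkl)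
    ultimately have "supp_in (Q l \<inter> Q i \<inter> Q j \<inter> Q k) (fmult (\<rho> l) (R i j k))" by (intro supp_in_Int)
    then have "fmult (\<rho> l) (R i j k) = 0"
      using supp_in_empty[OF fmult_smooth[OF pD(3)[OF ijkl(4)] Rs[OF ijkl(1-3)]]] True by simp
    then show ?thesis by (simp add: form_scale_simps)
  qed
  have "ext_deriv A 2 \<alpha> = (\<Sum>l\<in>I. fmult (\<rho> l) (ext_deriv A 2 \<alpha>))"
    using pou_decompose[OF pu ext_deriv_smooth[OF as]] by simp
  also have "\<dots> = (\<Sum>l\<in>I. \<Sum>i\<in>I. \<Sum>j\<in>I. \<Sum>k\<in>I. form_scale (c i j k) (fmult (\<rho> l) (R i j k)))"
    unfolding da fmult_form_sum form_scale_fmult by (intro sum.cong refl) (rule fmult_commute)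
  also have "\<dots> = (\<Sum>l\<in>I. \<Sum>i\<in>I. \<Sum>j\<in>I. \<Sum>k\<in>I. form_scale (c l j k) (fmult (\<rho> l) (R i j k)) -
      form_scale (c l i k) (fmult (\<rho> l) (R i j k)) + form_scale (c l i j) (fmult (\<rho> l) (R i j k)))"
    by (intro sum.cong refl) (rule key)
  \<comment> \<open>Each of the three coefficients omits one of the indices i, j, k; summing
    \<open>R\<close> over the omitted index gives 0.\<close>
  also have "\<dots> = (\<Sum>l\<in>I. 0)"
  proof (rule sum.cong[OF refl])
    fix l assume "l \<in> I"
    have sc: "(\<Sum>i\<in>I. form_scale a (fmult (\<rho> l) (F i))) = 0" if "(\<Sum>i\<in>I. F i) = 0" for a F
      using that by (simp only: form_scale_fmult fmult_form_sum[symmetric] fmult_0)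
    have 1: "(\<Sum>i\<in>I. \<Sum>j\<in>I. \<Sum>k\<in>I. form_scale (c l j k) (fmult (\<rho> l) (R i j k))) = 0"
      by (subst sum.swap, rule sum.neutral, rule ballI, subst sum.swap, rule sum.neutral, rule ballI,
          rule sc, rule R0, assumption+)
    have 2: "(\<Sum>i\<in>I. \<Sum>j\<in>I. \<Sum>k\<in>I. form_scale (c l i k) (fmult (\<rho> l) (R i j k))) = 0"
      by (rule sum.neutral, rule ballI, subst sum.swap, rule sum.neutral, rule ballI, rule sc, rule R0, assumption+)
    have 3: "(\<Sum>i\<in>I. \<Sum>j\<in>I. \<Sum>k\<in>I. form_scale (c l i j) (fmult (\<rho> l) (R i j k))) = 0"
      by (rule sum.neutral, rule ballI, rule sum.neutral, rule ballI, rule sc, rule R0, assumption+)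
    show "(\<Sum>i\<in>I. \<Sum>j\<in>I. \<Sum>k\<in>I. form_scale (c l j k) (fmult (\<rho> l) (R i j k)) -
      form_scale (c l i k) (fmult (\<rho> l) (R i j k)) + form_scale (c l i j) (fmult (\<rho> l) (R i j k))) = 0"
      unfolding sum.distrib sum_subtractf 1 2 3 by simp
  qed
  finally have "ext_deriv A 2 \<alpha> = 0" by (simp only: sum.neutral_const)
  then show "\<alpha> \<in> closed_forms A 2" using as by (simp add: closed_forms_def)
qed

lemma duality_tower:
  assumes "even D" "\<theta> \<notin> exact_forms A D"
  shows "\<exists>\<alpha>\<in>closed_forms A 2. gint (wedge D 2 \<theta> \<alpha>) \<noteq> 0"
proof (rule cech_dichotomy[OF pD(1), where N = "\<lambda>i j k l. Q i \<inter> Q j \<inter> Q k \<inter> Q l \<noteq> {}" and a = "\<lambda>i j k. gint (th3 i j k)"])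
  fix lam
  assume "\<And>x y z w. \<not> Q x \<inter> Q y \<inter> Q z \<inter> Q w \<noteq> {} \<Longrightarrow> lam x y z w = 0"
    "\<And>i j k. i \<in> I \<Longrightarrow> j \<in> I \<Longrightarrow> k \<in> I \<Longrightarrow> gint (th3 i j k) = bd4 I lam i j k"
  then have "\<theta> \<in> exact_forms A D" by (intro descent[of lam]) auto
  then show ?thesis using assms(2) by blast
next
  fix c
  assume c: "\<And>i j k l. i \<in> I \<Longrightarrow> j \<in> I \<Longrightarrow> k \<in> I \<Longrightarrow> l \<in> I \<Longrightarrow> Q i \<inter> Q j \<inter> Q k \<inter> Q l \<noteq> {} \<Longrightarrow>
      c j k l - c i k l + c i j l - c i j k = (0 :: complex)"
    "(\<Sum>i\<in>I. \<Sum>j\<in>I. \<Sum>k\<in>I. c i j k * gint (th3 i j k)) \<noteq> 0"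
  show ?thesis
  proof (rule bexI)
    show "gint (wedge D 2 \<theta> (\<Sum>i\<in>I. \<Sum>j\<in>I. \<Sum>k\<in>I. form_scale (c i j k) (fmult (\<rho> i) (be j k)))) \<noteq> 0"
      by (subst cocycle_form(2)[OF _ assms(1)]) (rule c(1), assumption+, rule c(2))
  qed (rule cocycle_form(1)[OF _ assms(1)], rule c(1))
qed

end

context compact_atlas
begin

lemma duality:
  assumes "2 * CARD('n) = Suc (Suc D)" "D > 0" and t: "\<theta> \<in> smooth_forms A D" "ext_deriv A D \<theta> = 0" "\<theta> \<notin> exact_forms A D"
  shows "\<exists>\<alpha>\<in>closed_forms A 2. gint (wedge D 2 \<theta> \<alpha>) \<noteq> 0"
proof (rule tower)
  fix I ch Q \<rho> Q1 c1 Q2 c2 Q3 c3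
  assume "pou I ch Q \<rho>"
    "\<And>i. i \<in> I \<Longrightarrow> cell_in (c1 i) (Q1 i)" "\<And>i. i \<in> I \<Longrightarrow> cell_in (c2 i) (Q2 i)" "\<And>i. i \<in> I \<Longrightarrow> cell_in (c3 i) (Q3 i)"
    "\<And>i k. i \<in> I \<Longrightarrow> k \<in> I \<Longrightarrow> Q k \<inter> Q i \<noteq> {} \<Longrightarrow> Q k \<subseteq> Q1 i"
    "\<And>i k. i \<in> I \<Longrightarrow> k \<in> I \<Longrightarrow> Q k \<inter> Q i \<noteq> {} \<Longrightarrow> Q1 k \<subseteq> Q2 i"
    "\<And>i k. i \<in> I \<Longrightarrow> k \<in> I \<Longrightarrow> Q k \<inter> Q i \<noteq> {} \<Longrightarrow> Q2 k \<subseteq> Q3 i"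
    "\<And>i. i \<in> I \<Longrightarrow> Q i \<noteq> {}"
  then interpret cech_tower X A I ch Q \<rho> Q1 c1 Q2 c2 Q3 c3 \<theta> D
    by unfold_locales (use assms in auto)
  have "even (Suc (Suc D))" using assms(1) by (metis dvd_triv_left)
  then show ?thesis using duality_tower[OF _ t(3)] by simp
qed

end


section \<open>Passage from forms to cohomology classes, and the dichotomy\<close>

subsection \<open>De Rham classes\<close>

context complex_atlas
begin

lemma mem_derham_class: "\<xi> \<in> derham_class A k \<alpha> \<longleftrightarrow> \<xi> - \<alpha> \<in> exact_forms A k"
proof
  assume "\<xi> - \<alpha> \<in> exact_forms A k"
  then show "\<xi> \<in> derham_class A k \<alpha>"
    unfolding derham_class_def by (intro CollectI exI[of _ "\<xi> - \<alpha>"] conjI) (simp only: add_diff_cancel_left' add_diff_eq)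
next
  assume "\<xi> \<in> derham_class A k \<alpha>"
  then obtain \<gamma> where g: "\<xi> = \<alpha> + \<gamma>" "\<gamma> \<in> exact_forms A k" unfolding derham_class_def by auto
  show "\<xi> - \<alpha> \<in> exact_forms A k" unfolding g(1) add_diff_cancel_left' by (rule g(2))
qed

lemma derham_class_eq_iff: "derham_class A k \<alpha> = derham_class A k \<beta> \<longleftrightarrow> \<alpha> - \<beta> \<in> exact_forms A k"
proof
  assume "derham_class A k \<alpha> = derham_class A k \<beta>"
  moreover have "\<alpha> \<in> derham_class A k \<alpha>" unfolding mem_derham_class diff_self by (rule exact_0)
  ultimately show "\<alpha> - \<beta> \<in> exact_forms A k" using mem_derham_class by (simp only:)
next
  assume e: "\<alpha> - \<beta> \<in> exact_forms A k"
  have "\<xi> - \<alpha> \<in> exact_forms A k \<longleftrightarrow> \<xi> - \<beta> \<in> exact_forms A k" for \<xi>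
  proof
    assume "\<xi> - \<alpha> \<in> exact_forms A k"
    from exact_add[OF this e] show "\<xi> - \<beta> \<in> exact_forms A k" by (simp only: diff_add_cancel add_diff_eq)
  next
    assume "\<xi> - \<beta> \<in> exact_forms A k"
    from exact_diff[OF this e] show "\<xi> - \<alpha> \<in> exact_forms A k" by (simp only: diff_diff_eq2 diff_add_cancel)
  qed
  then show "derham_class A k \<alpha> = derham_class A k \<beta>" by (intro Set.set_eqI) (simp only: mem_derham_class)
qed

lemma derham_class_0_iff: "derham_class A k \<alpha> = \<zero>\<^bsub>derham A k\<^esub> \<longleftrightarrow> \<alpha> \<in> exact_forms A k"
  unfolding derham_def ring.simps derham_class_eq_iff diff_0_right ..

lemma derham_add: "derham_class A k \<alpha> \<oplus>\<^bsub>derham A k\<^esub> derham_class A k \<beta> = derham_class A k (\<alpha> + \<beta>)"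
proof -
  have "\<xi> \<in> {a + b | a b. a \<in> derham_class A k \<alpha> \<and> b \<in> derham_class A k \<beta>} \<longleftrightarrow> \<xi> \<in> derham_class A k (\<alpha> + \<beta>)" for \<xi>
  proof
    assume "\<xi> \<in> {a + b | a b. a \<in> derham_class A k \<alpha> \<and> b \<in> derham_class A k \<beta>}"
    then obtain a b where x: "\<xi> = a + b" and ab: "a - \<alpha> \<in> exact_forms A k" "b - \<beta> \<in> exact_forms A k"
      unfolding mem_derham_class by auto
    show "\<xi> \<in> derham_class A k (\<alpha> + \<beta>)"
      unfolding mem_derham_class x add_diff_add by (rule exact_add[OF ab])
  next
    assume "\<xi> \<in> derham_class A k (\<alpha> + \<beta>)"
    then have "(\<xi> - \<beta>) - \<alpha> \<in> exact_forms A k" unfolding mem_derham_class by (simp only: diff_diff_eq add.commute)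
    moreover have "\<beta> - \<beta> \<in> exact_forms A k" unfolding diff_self by (rule exact_0)
    ultimately show "\<xi> \<in> {a + b | a b. a \<in> derham_class A k \<alpha> \<and> b \<in> derham_class A k \<beta>}"
      by (intro CollectI exI[of _ "\<xi> - \<beta>"] exI[of _ \<beta>] conjI) (simp_all only: mem_derham_class diff_add_cancel)
  qed
  then show ?thesis unfolding derham_def ring.simps by (intro Set.set_eqI)
qed

lemma derham_smult: "a \<odot>\<^bsub>derham A k\<^esub> derham_class A k \<alpha> = derham_class A k (form_scale a \<alpha>)"
proof -
  have "derham_class A k (form_scale a \<xi>) = derham_class A k (form_scale a \<alpha>)" if "\<xi> \<in> derham_class A k \<alpha>" for \<xi>
    unfolding derham_class_eq_iff form_scale_simps(8)[symmetric] using that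
    by (intro exact_scale) (simp only: mem_derham_class)
  moreover have "\<alpha> \<in> derham_class A k \<alpha>" unfolding mem_derham_class diff_self by (rule exact_0)
  ultimately show ?thesis unfolding derham_def module.simps by blast
qed

lemma closed_formsI: "\<alpha> \<in> smooth_forms A k \<Longrightarrow> ext_deriv A k \<alpha> = 0 \<Longrightarrow> \<alpha> \<in> closed_forms A k"
  by (simp add: closed_forms_def)

lemma closed_formsD: "\<alpha> \<in> closed_forms A k \<Longrightarrow> \<alpha> \<in> smooth_forms A k" "\<alpha> \<in> closed_forms A k \<Longrightarrow> ext_deriv A k \<alpha> = 0"
  by (simp_all add: closed_forms_def)

lemma closed_0: "0 \<in> closed_forms A k"
  by (intro closed_formsI zero_smooth ext_deriv_0)

lemma closed_scale: "\<alpha> \<in> closed_forms A k \<Longrightarrow> form_scale a \<alpha> \<in> closed_forms A k"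
  by (intro closed_formsI form_scale_smooth) (simp_all only: closed_formsD ext_deriv_scale form_scale_simps)

lemma closed_add:
  assumes "\<alpha> \<in> closed_forms A k" "\<beta> \<in> closed_forms A k" shows "\<alpha> + \<beta> \<in> closed_forms A k"
  by (intro closed_formsI add_smooth) (simp_all only: closed_formsD[OF assms(1)] closed_formsD[OF assms(2)] ext_deriv_add add_0_right)

lemma closed_diff: "\<alpha> \<in> closed_forms A k \<Longrightarrow> \<beta> \<in> closed_forms A k \<Longrightarrow> \<alpha> - \<beta> \<in> closed_forms A k"
  using closed_add[of \<alpha> k "form_scale (- 1) \<beta>"] closed_scale[of \<beta> k "- 1"] 
  by (simp only: form_scale_simps(7) add_uminus_conv_diff)

lemma derham_carrier: "carrier (derham A k) = derham_class A k ` closed_forms A k"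
  by (simp add: derham_def)

text \<open>A submodule must be closed under \<open>m_inv\<close>, which is a definite description;
  it is resolved here directly, uniqueness coming from the fact that a class added to that of
  \<open>\<alpha>\<close> is zero only if the sum of representatives is exact.\<close>

lemma derham_inv:
  assumes a: "\<alpha> \<in> closed_forms A k"
  shows "m_inv (add_monoid (derham A k)) (derham_class A k \<alpha>) = derham_class A k (form_scale (- 1) \<alpha>)"
  unfolding m_inv_def monoid.simps partial_object.simps
proof (rule the_equality)
  have z: "\<zero>\<^bsub>derham A k\<^esub> = derham_class A k 0" by (simp add: derham_def)
  show "derham_class A k (form_scale (- 1) \<alpha>) \<in> carrier (derham A k) \<and>
      derham_class A k \<alpha> \<oplus>\<^bsub>derham A k\<^esub> derham_class A k (form_scale (- 1) \<alpha>) = \<zero>\<^bsub>derham A k\<^esub> \<and>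
      derham_class A k (form_scale (- 1) \<alpha>) \<oplus>\<^bsub>derham A k\<^esub> derham_class A k \<alpha> = \<zero>\<^bsub>derham A k\<^esub>"
    unfolding derham_add derham_carrier z
    by (intro conjI imageI closed_scale[OF a]) (simp_all only: form_scale_simps(7) right_minus left_minus)
  fix y
  assume y: "y \<in> carrier (derham A k) \<and> derham_class A k \<alpha> \<oplus>\<^bsub>derham A k\<^esub> y = \<zero>\<^bsub>derham A k\<^esub> \<and>
      y \<oplus>\<^bsub>derham A k\<^esub> derham_class A k \<alpha> = \<zero>\<^bsub>derham A k\<^esub>"
  then obtain \<beta> where b: "y = derham_class A k \<beta>" unfolding derham_carrier by auto
  from y have "\<beta> + \<alpha> \<in> exact_forms A k" unfolding b derham_add derham_class_0_iff by simp
  then show "y = derham_class A k (form_scale (- 1) \<alpha>)"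
    unfolding b derham_class_eq_iff form_scale_simps(7) by (simp only: diff_minus_eq_add)
qed

text \<open>Makes the wedge with a closed form of even degree independent of the representative of
  the second factor.\<close>

lemma exact_wedge_right:
  assumes t: "\<theta> \<in> smooth_forms A p" "ext_deriv A p \<theta> = 0" "even p" and b: "\<beta> \<in> exact_forms A (Suc q)"
  shows "wedge p (Suc q) \<theta> \<beta> \<in> exact_forms A (Suc (p + q))"
proof -
  obtain \<gamma> where g: "\<gamma> \<in> smooth_forms A q" "\<beta> = ext_deriv A q \<gamma>" using b unfolding exact_forms_Suc by (rule imageE)
  show ?thesis unfolding exact_forms_Suc g(2) closed_even_wedge[OF t g(1), symmetric]
    by (intro imageI wedge_smooth t g)
qed

text \<open>Makes the wedge class depend only on the class of the first factor, and makes it vanish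
  when that factor is exact: the source of the dependence on the balanced class alone and of the
  degenerate case.\<close>

lemma exact_wedge_left:
  assumes t: "\<theta> \<in> exact_forms A (Suc p)" and b: "\<beta> \<in> closed_forms A q"
  shows "wedge (Suc p) q \<theta> \<beta> \<in> exact_forms A (Suc (p + q))"
proof -
  obtain \<eta> where g: "\<eta> \<in> smooth_forms A p" "\<theta> = ext_deriv A p \<eta>" using t unfolding exact_forms_Suc by (rule imageE)
  have "ext_deriv A (p + q) (wedge p q \<eta> \<beta>) = wedge (Suc p) q \<theta> \<beta>"
    unfolding ext_deriv_wedge[OF g(1) closed_formsD(1)[OF b]] closed_formsD(2)[OF b] g(2)
      wedge_linear form_scale_simps add_0_right ..
  then show ?thesis unfolding exact_forms_Suc
    by (intro image_eqI[of _ _ "wedge p q \<eta> \<beta>"] wedge_smooth g closed_formsD(1)[OF b]) (rule sym)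
qed

end

subsection \<open>Primitive classes\<close>

context complex_atlas
begin

context
  fixes \<omega> :: "('a, 'n) form" and D \<theta>
  defines "D \<equiv> 2 * (CARD('n) - 1)" and "\<theta> \<equiv> divided_power A \<omega> (CARD('n) - 1)"
  assumes n2: "CARD('n) \<ge> 2" and bal: "balanced A \<omega>"
begin

lemma balanced_degree: "2 * CARD('n) = Suc (Suc D)" "D > 0" "even D"
  using n2 by (auto simp: D_def)

lemma balanced_form: "\<theta> \<in> smooth_forms A D" "ext_deriv A D \<theta> = 0"
proof -
  have "\<omega> \<in> smooth_forms A 2" using bal by (simp add: balanced_def hermitian_metric_def)
  from form_power_smooth[OF this] have s: "form_power A \<omega> (CARD('n) - 1) \<in> smooth_forms A D" unfolding D_def .
  then show "\<theta> \<in> smooth_forms A D" unfolding \<theta>_def divided_power_def by (rule form_scale_smooth)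
  show "ext_deriv A D \<theta> = 0"
    unfolding \<theta>_def divided_power_def ext_deriv_scale[OF s]
    using bal by (simp add: balanced_def D_def form_scale_simps)
qed

lemma balanced_degenerate_iff: "degenerate_balanced A \<omega> \<longleftrightarrow> \<theta> \<in> exact_forms A D"
proof
  assume "degenerate_balanced A \<omega>"
  then show "\<theta> \<in> exact_forms A D"
    unfolding \<theta>_def divided_power_def by (intro exact_scale) (simp add: degenerate_balanced_def D_def)
next
  assume "\<theta> \<in> exact_forms A D"
  from exact_scale[OF this, of "fact (CARD('n) - 1)"] have "form_power A \<omega> (CARD('n) - 1) \<in> exact_forms A D"
    unfolding \<theta>_def divided_power_def form_scale_simps(3) by (simp add: form_scale_simps(1))
  then show "degenerate_balanced A \<omega>"
    using bal by (simp add: degenerate_balanced_def balanced_def D_def)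
qed

lemma wedge_closed_smooth: "\<alpha> \<in> closed_forms A 2 \<Longrightarrow> wedge D 2 \<theta> \<alpha> \<in> smooth_forms A (2 * CARD('n))"
  using wedge_smooth[OF balanced_form(1) closed_formsD(1), of \<alpha> 2] unfolding balanced_degree(1)
  by (simp only: add_2_eq_Suc')

text \<open>All members of a class give the same class after wedging, so the union that defines the
  map collapses to a single coset.\<close>

lemma wedge_class_map_class:
  "wedge_class_map A \<omega> (derham_class A 2 \<alpha>) = derham_class A (2 * CARD('n)) (wedge D 2 \<theta> \<alpha>)"
proof -
  have "derham_class A (2 * CARD('n)) (wedge D 2 \<theta> \<xi>) = derham_class A (2 * CARD('n)) (wedge D 2 \<theta> \<alpha>)"
    if "\<xi> \<in> derham_class A 2 \<alpha>" for \<xi>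
  proof -
    have "\<xi> - \<alpha> \<in> exact_forms A (Suc 1)" using that unfolding mem_derham_class by (simp add: numeral_2_eq_2)
    from exact_wedge_right[OF balanced_form balanced_degree(3) this]
    have "wedge D 2 \<theta> (\<xi> - \<alpha>) \<in> exact_forms A (2 * CARD('n))"
      unfolding balanced_degree(1) by (simp add: numeral_2_eq_2)
    moreover have "wedge D 2 \<theta> (\<xi> - \<alpha>) = wedge D 2 \<theta> \<xi> - wedge D 2 \<theta> \<alpha>"
      using wedge_linear(1)[of D 2 \<theta> "\<xi> - \<alpha>" \<alpha>] by (simp only: diff_add_cancel add_diff_cancel_right')
    ultimately show ?thesis unfolding derham_class_eq_iff by (simp only:)
  qed
  moreover have "\<alpha> \<in> derham_class A 2 \<alpha>" unfolding mem_derham_class diff_self by (rule exact_0)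
  ultimately show ?thesis unfolding wedge_class_map_def D_def \<theta>_def by blast
qed

lemma primitive_classes_eq:
  "primitive_classes A \<omega> =
    derham_class A 2 ` {\<alpha> \<in> closed_forms A 2. wedge D 2 \<theta> \<alpha> \<in> exact_forms A (2 * CARD('n))}"
  unfolding primitive_classes_def a_kernel_def' derham_carrier Compr_image_eq wedge_class_map_class derham_class_0_iff ..

lemma primitive_iff:
  "\<alpha> \<in> closed_forms A 2 \<Longrightarrow>
    derham_class A 2 \<alpha> \<in> primitive_classes A \<omega> \<longleftrightarrow> wedge D 2 \<theta> \<alpha> \<in> exact_forms A (2 * CARD('n))"
  unfolding primitive_classes_def a_kernel_def' derham_carrier mem_Collect_eq wedge_class_map_class derham_class_0_iff
  by simp

lemma primitive_submodule: "submodule (primitive_classes A \<omega>) complex_scalars (derham A 2)"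
proof -
  let ?P = "{\<alpha> \<in> closed_forms A 2. wedge D 2 \<theta> \<alpha> \<in> exact_forms A (2 * CARD('n))}"
  have sc: "form_scale a \<alpha> \<in> ?P" if "\<alpha> \<in> ?P" for a \<alpha>
    using that closed_scale exact_scale by (auto simp only: wedge_linear mem_Collect_eq)
  have ad: "\<alpha> + \<beta> \<in> ?P" if "\<alpha> \<in> ?P" "\<beta> \<in> ?P" for \<alpha> \<beta>
    using that closed_add exact_add by (auto simp only: wedge_linear mem_Collect_eq)
  have z: "0 \<in> ?P"
    by (simp only: wedge_linear mem_Collect_eq exact_0 closed_0)
  have sub: "primitive_classes A \<omega> \<subseteq> carrier (derham A 2)"
    unfolding primitive_classes_def a_kernel_def' by blast
  have rep: "\<exists>\<alpha>\<in>?P. x = derham_class A 2 \<alpha>" if "x \<in> primitive_classes A \<omega>" for x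
    using that unfolding primitive_classes_eq by blast
  have smult: "c \<odot>\<^bsub>derham A 2\<^esub> x \<in> primitive_classes A \<omega>" if x: "x \<in> primitive_classes A \<omega>" for c x
  proof -
    obtain \<alpha> where a: "\<alpha> \<in> ?P" "x = derham_class A 2 \<alpha>" using rep[OF x] by (rule bexE)
    show ?thesis unfolding a(2) derham_smult primitive_classes_eq by (intro imageI sc a(1))
  qed
  have inv: "m_inv (add_monoid (derham A 2)) x \<in> primitive_classes A \<omega>" if x: "x \<in> primitive_classes A \<omega>" for x
  proof -
    obtain \<alpha> where a: "\<alpha> \<in> ?P" "x = derham_class A 2 \<alpha>" using rep[OF x] by (rule bexE)
    have a1: "\<alpha> \<in> closed_forms A 2" using a(1) by (simp only: mem_Collect_eq)
    show ?thesis unfolding a(2) derham_inv[OF a1] primitive_classes_eq by (intro imageI sc a(1))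
  qed
  have add: "x \<oplus>\<^bsub>derham A 2\<^esub> y \<in> primitive_classes A \<omega>"
    if x: "x \<in> primitive_classes A \<omega>" and y: "y \<in> primitive_classes A \<omega>" for x y
  proof -
    obtain \<alpha> where a: "\<alpha> \<in> ?P" "x = derham_class A 2 \<alpha>" using rep[OF x] by (rule bexE)
    obtain \<beta> where b: "\<beta> \<in> ?P" "y = derham_class A 2 \<beta>" using rep[OF y] by (rule bexE)
    show ?thesis unfolding a(2) b(2) derham_add primitive_classes_eq by (intro imageI ad a(1) b(1))
  qed
  have "\<zero>\<^bsub>derham A 2\<^esub> = derham_class A 2 0" by (simp add: derham_def)
  then have "\<zero>\<^bsub>derham A 2\<^esub> \<in> primitive_classes A \<omega>"
    using z unfolding primitive_classes_eq by (simp only: imageI)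
  then show ?thesis
    by (intro submodule.intro subgroup.intro submodule_axioms.intro) (simp_all only: partial_object.simps monoid.simps sub smult inv add)
qed

lemma wedge_exact_left:
  assumes "\<eta> \<in> exact_forms A D" "\<alpha> \<in> closed_forms A 2"
  shows "wedge D 2 \<eta> \<alpha> \<in> exact_forms A (2 * CARD('n))"
proof -
  obtain d where d: "D = Suc d" using balanced_degree(2) gr0_implies_Suc by blast
  show ?thesis unfolding balanced_degree(1) using exact_wedge_left[OF assms[unfolded d]] unfolding d by simp
qed

end

lemma primitive_classes_cong:
  fixes \<omega> \<omega>' :: "('a, 'n) form"
  assumes n2: "CARD('n) \<ge> 2" and b: "balanced A \<omega>" "balanced A \<omega>'" and e: "balanced_class A \<omega>' = balanced_class A \<omega>"
  shows "primitive_classes A \<omega>' = primitive_classes A \<omega>"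
proof -
  let ?D = "2 * (CARD('n) - 1)" and ?t = "divided_power A \<omega> (CARD('n) - 1)" and ?t' = "divided_power A \<omega>' (CARD('n) - 1)"
  have "wedge ?D 2 ?t' \<alpha> \<in> exact_forms A (2 * CARD('n)) \<longleftrightarrow> wedge ?D 2 ?t \<alpha> \<in> exact_forms A (2 * CARD('n))"
    if a: "\<alpha> \<in> closed_forms A 2" for \<alpha>
  proof -
    have "?t' - ?t \<in> exact_forms A ?D" using e unfolding balanced_class_def derham_class_eq_iff .
    from wedge_exact_left[OF n2 b(1) this a]
    have d: "wedge ?D 2 ?t' \<alpha> - wedge ?D 2 ?t \<alpha> \<in> exact_forms A (2 * CARD('n))"
      using wedge_linear(2)[of ?D 2 "?t' - ?t" ?t \<alpha>] by (simp only: diff_add_cancel add_diff_cancel_right')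
    show ?thesis
    proof
      assume "wedge ?D 2 ?t' \<alpha> \<in> exact_forms A (2 * CARD('n))"
      from exact_diff[OF this d] show "wedge ?D 2 ?t \<alpha> \<in> exact_forms A (2 * CARD('n))"
        by (simp only: diff_diff_eq2 add_diff_cancel_left')
    next
      assume "wedge ?D 2 ?t \<alpha> \<in> exact_forms A (2 * CARD('n))"
      from exact_add[OF d this] show "wedge ?D 2 ?t' \<alpha> \<in> exact_forms A (2 * CARD('n))"
        by (simp only: diff_add_cancel)
    qed
  qed
  then show ?thesis
    unfolding primitive_classes_eq[OF n2 b(1)] primitive_classes_eq[OF n2 b(2)]
    by (intro arg_cong[where f = "image _"] Collect_cong conj_cong refl)
qed

lemma primitive_classes_degenerate:
  fixes \<omega> :: "('a, 'n) form"
  assumes n2: "CARD('n) \<ge> 2" and b: "balanced A \<omega>" "degenerate_balanced A \<omega>"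
  shows "primitive_classes A \<omega> = carrier (derham A 2)"
  unfolding primitive_classes_eq[OF n2 b(1)] derham_carrier
  using wedge_exact_left[OF n2 b(1) balanced_degenerate_iff[OF n2 b(1), THEN iffD1, OF b(2)]]
  by (intro arg_cong[where f = "image _"]) blast

end

context compact_atlas
begin

lemma primitive_classes_hyperplane:
  fixes \<omega> :: "('a, 'n) form"
  assumes n2: "CARD('n) \<ge> 2" and conn: "connected_space X" and b: "balanced A \<omega>" "\<not> degenerate_balanced A \<omega>"
  shows "complex_hyperplane (primitive_classes A \<omega>) (derham A 2)"
proof -
  let ?D = "2 * (CARD('n) - 1)" and ?t = "divided_power A \<omega> (CARD('n) - 1)"
  note deg = balanced_degree[OF n2 b(1)] and sm = wedge_closed_smooth[OF n2 b(1)] and pr = primitive_iff[OF n2 b(1)]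
  have "?t \<notin> exact_forms A ?D" using b(2) balanced_degenerate_iff[OF n2 b(1)] by blast
  from duality[OF deg(1,2) balanced_form[OF n2 b(1)] this]
  obtain \<beta> where be: "\<beta> \<in> closed_forms A 2" "gint (wedge ?D 2 ?t \<beta>) \<noteq> 0" by (rule bexE)
  have u: "derham_class A 2 \<beta> \<in> carrier (derham A 2) - primitive_classes A \<omega>"
    using be pr[OF be(1)] gint_exact by (auto simp: derham_carrier)
  have "\<exists>w\<in>primitive_classes A \<omega>. \<exists>a. x = w \<oplus>\<^bsub>derham A 2\<^esub> a \<odot>\<^bsub>derham A 2\<^esub> derham_class A 2 \<beta>"
    if "x \<in> carrier (derham A 2)" for x
  proof -
    from that obtain \<alpha> where al: "x = derham_class A 2 \<alpha>" "\<alpha> \<in> closed_forms A 2" unfolding derham_carrier by (rule imageE)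
    \<comment> \<open>The coefficient for which \<open>\<alpha> - form_scale s \<beta>\<close> has
      integral 0 against \<open>?t\<close>; its wedge with \<open>?t\<close> is then exact because
      \<open>X\<close> is connected.\<close>
    define s where "s = gint (wedge ?D 2 ?t \<alpha>) / gint (wedge ?D 2 ?t \<beta>)"
    let ?g = "\<alpha> - form_scale s \<beta>"
    have g: "?g \<in> closed_forms A 2" by (intro closed_diff closed_scale al be)
    have w: "wedge ?D 2 ?t ?g = wedge ?D 2 ?t \<alpha> - form_scale s (wedge ?D 2 ?t \<beta>)"
      using wedge_linear(1)[of ?D 2 ?t ?g "form_scale s \<beta>"]
      by (simp only: diff_add_cancel add_diff_cancel_right' wedge_linear(3))
    have "gint (wedge ?D 2 ?t ?g) = 0"
      unfolding w gint_diff[OF sm[OF al(2)] form_scale_smooth[OF sm[OF be(1)]]] gint_scale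
      using be(2) by (simp add: s_def)
    then have "derham_class A 2 ?g \<in> primitive_classes A \<omega>"
      unfolding pr[OF g] by (rule exact_top_if_integral_0[OF conn sm[OF g]])
    moreover have "x = derham_class A 2 ?g \<oplus>\<^bsub>derham A 2\<^esub> s \<odot>\<^bsub>derham A 2\<^esub> derham_class A 2 \<beta>"
      unfolding derham_smult derham_add diff_add_cancel by (rule al(1))
    ultimately show ?thesis by (intro bexI exI)
  qed
  then show ?thesis
    unfolding complex_hyperplane_def using primitive_submodule[OF n2 b(1)] u by blast
qed

end

theorem corollary2p5:
  fixes X :: "'a topology"
    and A :: "('a, 'n::finite) chart set"
    and \<omega> :: "('a, 'n) form"
  assumes "complex_manifold X A"
    and "compact_space X"
    and "connected_space X"
    and "topspace X \<noteq> {}"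
    and "CARD('n) \<ge> 2"
    and "balanced A \<omega>"
  shows "(\<not> degenerate_balanced A \<omega> \<longrightarrow>
           complex_hyperplane (primitive_classes A \<omega>) (derham A 2) \<and>
           (\<forall>\<omega>'. balanced A \<omega>' \<and> balanced_class A \<omega>' = balanced_class A \<omega> \<longrightarrow>
                 primitive_classes A \<omega>' = primitive_classes A \<omega>)) \<and>
         (degenerate_balanced A \<omega> \<longrightarrow>
           primitive_classes A \<omega> = carrier (derham A 2))"
proof -
  interpret compact_atlas X A using assms(1,2) by unfold_locales
  show ?thesis
    using primitive_classes_hyperplane[OF assms(5,3,6)] primitive_classes_cong[OF assms(5,6)]
      primitive_classes_degenerate[OF assms(5,6)] by blast
qed


end
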